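(* Let $M$ be a second countable smooth manifold equipped with a (regular) foliation $\mathcal F$, and let $H$ be a group acting on the right on $(M,\mathcal F)$ by foliation automorphisms. For $h\in H$ write $R_h:M\to M$, $R_h(x)=x\cdot h$. Let $\pi:M\to M/\mathcal F$ be the quotient map to the leaf space, where $M/\mathcal F$ carries the quotient diffeology $\mathcal D'$ induced from the manifold diffeology of $M$. Then: (1) The action of $H$ on $M$ descends to an action on $M/\mathcal F$ (the map induced by $h\in H$ being the unique map $\overline{R_h}:M/\mathcal F\to M/\mathcal F$ with $\pi\circ R_h=\overline{R_h}\circ\pi$), and each $\overline{R_h}$ is a diffeological diffeomorphism of $(M/\mathcal F,\mathcal D')$. (2) Pullback by $\pi$ is an isomorphism of cochain complexes $$\pi^*:(\Omega^\bullet(M/\mathcal F,\mathcal D'),d)\xrightarrow{\;\cong\;}(\Omega^\bullet(M,\mathcal F),d)$$ onto the complex of basic forms, and it is $H$-equivariant, i.e. $R_h^*\,\pi^*\alpha=\pi^*\,(\overline{R_h})^*\alpha$ for all $h\in H$ and all $\alpha\in\Omega^\bullet(M/\mathcal F,\mathcal D')$. (3) In particular, $\pi^*$ induces an $H$-equivariant isomorphism $H^\bullet_{\mathrm{dR}}(M/\mathcal F,\mathcal D')\cong H^\bullet_{\mathrm{dR}}(M,\mathcal F)$, where the right-hand side is the basic cohomology of $(M,\mathcal F)$.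
   Context: **Diffeology.** A parametrization of a set $X$ is a map $\alpha:U\to X$ with $U$ an open subset of some $\mathbb R^n$, $n\ge 0$. A diffeology $\mathcal D$ on $X$ is a family of parametrizations (called plots) such that: (1) every constant parametrization is in $\mathcal D$; (2) if $\alpha:U\to X$ is in $\mathcal D$ and $h:V\to U$ is a smooth map between open subsets of Euclidean spaces, then $\alpha\circ h\in\mathcal D$; (3) a parametrization $\alpha:U\to X$ such that each point of $U$ has an open neighborhood $V$ with $\alpha|_V\in\mathcal D$ is itself in $\mathcal D$. A map between diffeological spaces is smooth if it sends plots to plots by composition; a diffeological diffeomorphism is a smooth bijection with smooth inverse. The manifold diffeology of a smooth manifold has as plots exactly the smooth maps from open subsets of Euclidean spaces. If $\sim$ is an equivalence relation on a diffeological space $X$ with quotient map $\pi:X\to X/\!\sim$, the quotient diffeology on $X/\!\sim$ consists of the parametrizations $\gamma:U\to X/\!\sim$ such that either $\gamma$ is constant or every $x\in U$ has an open neighborhood $V\subset U$ and a plot $\alpha:V\to X$ with $\gamma|_V=\pi\circ\alpha$. **Forms.** A differential $k$-form $\gamma$ on a diffeological space $(X,\mathcal D)$ assigns to each plot $\alpha:U\to X$ a differential $k$-form $\gamma_\alpha\in\Omega^k(U)$ such that $\gamma_{\alpha\circ f}=f^*\gamma_\alpha$ for every smooth map $f:V\to U$ between open subsets of Euclidean spaces. The differential is $d\{\gamma_\alpha\}=\{d\gamma_\alpha\}$; $\Omega^\bullet(X,\mathcal D)$ is the resulting complex and $H^\bullet_{\mathrm{dR}}(X,\mathcal D)$ its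 cohomology. For smooth $f:X\to Y$, $(f^*\gamma)_\alpha:=\gamma_{f\circ\alpha}$. On a manifold with its manifold diffeology this complex is identified with the usual de Rham complex. **Foliations.** A codimension $q$ foliation $\mathcal F$ on $M$ is given by a maximal family of submersions $f_i:U_i\to\mathbb R^q$, $\{U_i\}$ an open cover of $M$, such that for all $i,j$ and $x\in U_i\cap U_j$ there is a germ of diffeomorphism $\phi^x_{ji}$ of $\mathbb R^q$ at $f_i(x)$ with $f_j=\phi^x_{ji}\circ f_i$ near $x$, these germs satisfying $\phi^x_{ki}=\phi^x_{kj}\circ\phi^x_{ji}$ at every $x\in U_i\cap U_j\cap U_k$; equivalently, it is given by the integrable tangent distribution $T\mathcal F\subset TM$ (locally $T\mathcal F=\ker df_i$). Leaves are the maximal connected integral submanifolds of $T\mathcal F$, and $M/\mathcal F$ is the set of leaves. A foliation automorphism is a diffeomorphism of $M$ mapping leaves to leaves. A form $\omega\in\Omega^\bullet(M)$ is basic if $\iota_X\omega=0$ and $\mathcal L_X\omega=0$ for every vector field $X$ tangent to $\mathcal F$; the complex of basic forms is $\Omega^\bullet(M,\mathcal F)$ and its cohomology, the basic cohomology, is $H^\bullet_{\mathrm{dR}}(M,\mathcal F)$. The group $H$ acts on forms on $M$ and on $M/\mathcal F$ by the pullbacks $R_h^*$ and $(\overline{R_h})^*$. *)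

theory Defs
  imports "HOL-Analysis.Analysis" "HOL-Algebra.Group" "HOL-Library.Function_Algebras"
begin

section \<open>Smooth maps and differential forms on open subsets of Euclidean spaces\<close>

text \<open>
  Plots range over open subsets of all the spaces $R^n$, so the dimension has to be a
  number rather than a type. $R^n$ is the carrier of the library topology
  \<^const>\<open>Euclidean_space\<close>, i.e. the sequences vanishing from index $n$ on; a set is open in
  $R^n$ if it is open in \<^const>\<open>Euclidean_space\<close>. Vectors are added pointwise.
\<close>

abbreviation Rn :: "nat \<Rightarrow> (nat \<Rightarrow> real) set" where
  "Rn n \<equiv> topspace (Euclidean_space n)"

definition unit_vec :: "nat \<Rightarrow> nat \<Rightarrow> real" where
  "unit_vec i = (\<lambda>j. if j = i then 1 else 0)"

definition dir_deriv :: "((nat \<Rightarrow> real) \<Rightarrow> real) \<Rightarrow> (nat \<Rightarrow> real) \<Rightarrow> (nat \<Rightarrow> real) \<Rightarrow> real" where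
  "dir_deriv f x v = deriv (\<lambda>t. f (\<lambda>j. x j + t * v j)) 0"

text \<open>$C^k$ functions on an open $U \subseteq R^n$: the partial derivatives up to order $k$ exist
  and are continuous.\<close>

primrec Ck_on :: "nat \<Rightarrow> nat \<Rightarrow> (nat \<Rightarrow> real) set \<Rightarrow> ((nat \<Rightarrow> real) \<Rightarrow> real) \<Rightarrow> bool" where
  "Ck_on n 0 U f = continuous_on U f"
| "Ck_on n (Suc k) U f =
     (continuous_on U f \<and>
      (\<forall>i<n. (\<forall>x\<in>U. (\<lambda>t. f (\<lambda>j. x j + t * unit_vec i j)) field_differentiable at 0) \<and>
             Ck_on n k U (\<lambda>x. dir_deriv f x (unit_vec i))))"

definition smooth_fun :: "nat \<Rightarrow> (nat \<Rightarrow> real) set \<Rightarrow> ((nat \<Rightarrow> real) \<Rightarrow> real) \<Rightarrow> bool" where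
  "smooth_fun n U f \<longleftrightarrow> (\<forall>k. Ck_on n k U f)"

text \<open>Smooth maps from an open $U \subseteq R^n$ into a subset $V$ of $R^p$.\<close>

definition smooth_map ::
  "nat \<Rightarrow> (nat \<Rightarrow> real) set \<Rightarrow> nat \<Rightarrow> (nat \<Rightarrow> real) set \<Rightarrow> ((nat \<Rightarrow> real) \<Rightarrow> nat \<Rightarrow> real) \<Rightarrow> bool" where
  "smooth_map n U p V f \<longleftrightarrow> f \<in> U \<rightarrow> V \<and> (\<forall>j<p. smooth_fun n U (\<lambda>x. f x j))"

definition tangent_map ::
  "((nat \<Rightarrow> real) \<Rightarrow> nat \<Rightarrow> real) \<Rightarrow> (nat \<Rightarrow> real) \<Rightarrow> (nat \<Rightarrow> real) \<Rightarrow> nat \<Rightarrow> real" where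
  "tangent_map f x v = (\<lambda>j. dir_deriv (\<lambda>y. f y j) x v)"

text \<open>
  A $k$-form on $U$ maps a point and a list of $k$ tangent vectors to a number. It is extended
  by 0 to all other arguments, so that equality of forms is equality of functions and the
  linear structure is the pointwise one.
\<close>

type_synonym form = "(nat \<Rightarrow> real) \<Rightarrow> (nat \<Rightarrow> real) list \<Rightarrow> real"

definition tuples :: "nat \<Rightarrow> nat \<Rightarrow> (nat \<Rightarrow> real) list set" where
  "tuples n k = {v. length v = k \<and> set v \<subseteq> Rn n}"

definition alternating :: "nat \<Rightarrow> nat \<Rightarrow> ((nat \<Rightarrow> real) list \<Rightarrow> real) \<Rightarrow> bool" where
  "alternating n k w \<longleftrightarrow>
     (\<forall>v\<in>tuples n k. \<forall>i<k. \<forall>a\<in>Rn n. \<forall>b\<in>Rn n. \<forall>r s.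
        w (v[i := (\<lambda>j. r * a j + s * b j)]) = r * w (v[i := a]) + s * w (v[i := b])) \<and>
     (\<forall>v\<in>tuples n k. \<forall>i<k. \<forall>j<k. i \<noteq> j \<and> v ! i = v ! j \<longrightarrow> w v = 0)"

definition forms :: "nat \<Rightarrow> nat \<Rightarrow> (nat \<Rightarrow> real) set \<Rightarrow> form set" where
  "forms n k U = {\<omega>.
     (\<forall>x v. x \<notin> U \<or> v \<notin> tuples n k \<longrightarrow> \<omega> x v = 0) \<and>
     (\<forall>x\<in>U. alternating n k (\<omega> x)) \<and>
     (\<forall>v\<in>tuples n k. smooth_fun n U (\<lambda>x. \<omega> x v))}"

definition form_pullback ::
  "nat \<Rightarrow> (nat \<Rightarrow> real) set \<Rightarrow> ((nat \<Rightarrow> real) \<Rightarrow> nat \<Rightarrow> real) \<Rightarrow> form \<Rightarrow> form" where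
  "form_pullback n V f \<omega> = (\<lambda>x v.
     if x \<in> V \<and> set v \<subseteq> Rn n then \<omega> (f x) (map (tangent_map f x) v) else 0)"

text \<open>The exterior derivative:
  $(d\omega)_x(v_0,\dots,v_k) = \sum_i (-1)^i D_{v_i}\omega(v_0,\dots,\widehat{v_i},\dots,v_k)$
  for constant vector fields $v_i$.\<close>

definition ext_deriv :: "nat \<Rightarrow> (nat \<Rightarrow> real) set \<Rightarrow> form \<Rightarrow> form" where
  "ext_deriv n U \<omega> = (\<lambda>x v.
     if x \<in> U \<and> set v \<subseteq> Rn n
     then \<Sum>i<length v. (-1) ^ i * dir_deriv (\<lambda>y. \<omega> y (take i v @ drop (Suc i) v)) x (v ! i)
     else 0)"


section \<open>Cochain complexes of families of forms and their cohomology\<close>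

text \<open>
  Forms on diffeological spaces are families of forms indexed by plots, forms on manifolds are
  families indexed by charts. Both live in the following function type.
\<close>

type_synonym 'i form_family = "'i \<Rightarrow> form"

definition fscale :: "real \<Rightarrow> 'i form_family \<Rightarrow> 'i form_family" where
  "fscale r a = (\<lambda>i x v. r * a i x v)"

definition family_subspace :: "'i form_family set \<Rightarrow> bool" where
  "family_subspace A \<longleftrightarrow> 0 \<in> A \<and> (\<forall>a\<in>A. \<forall>b\<in>A. a + b \<in> A) \<and> (\<forall>r. \<forall>a\<in>A. fscale r a \<in> A)"

definition family_linear ::
  "'i form_family set \<Rightarrow> ('i form_family \<Rightarrow> 'j form_family) \<Rightarrow> bool" where
  "family_linear A f \<longleftrightarrow>
     (\<forall>a\<in>A. \<forall>b\<in>A. f (a + b) = f a + f b) \<and> (\<forall>r. \<forall>a\<in>A. f (fscale r a) = fscale r (f a))"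

definition cochain_complex ::
  "(nat \<Rightarrow> 'i form_family set) \<Rightarrow> ('i form_family \<Rightarrow> 'i form_family) \<Rightarrow> bool" where
  "cochain_complex C d \<longleftrightarrow>
     (\<forall>k. family_subspace (C k) \<and> family_linear (C k) d \<and> d ` C k \<subseteq> C (Suc k) \<and>
          (\<forall>a\<in>C k. d (d a) = 0))"

definition cochain_iso ::
  "(nat \<Rightarrow> 'i form_family set) \<Rightarrow> ('i form_family \<Rightarrow> 'i form_family) \<Rightarrow>
   (nat \<Rightarrow> 'j form_family set) \<Rightarrow> ('j form_family \<Rightarrow> 'j form_family) \<Rightarrow>
   ('i form_family \<Rightarrow> 'j form_family) \<Rightarrow> bool" where
  "cochain_iso C d C' d' f \<longleftrightarrow>
     cochain_complex C d \<and> cochain_complex C' d' \<and>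
     (\<forall>k. bij_betw f (C k) (C' k) \<and> family_linear (C k) f \<and> (\<forall>a\<in>C k. f (d a) = d' (f a)))"

definition cocycles ::
  "(nat \<Rightarrow> 'i form_family set) \<Rightarrow> ('i form_family \<Rightarrow> 'i form_family) \<Rightarrow> nat \<Rightarrow> 'i form_family set" where
  "cocycles C d k = {a \<in> C k. d a = 0}"

definition coboundaries ::
  "(nat \<Rightarrow> 'i form_family set) \<Rightarrow> ('i form_family \<Rightarrow> 'i form_family) \<Rightarrow> nat \<Rightarrow> 'i form_family set" where
  "coboundaries C d k = (case k of 0 \<Rightarrow> {0} | Suc j \<Rightarrow> d ` C j)"

definition cohomologous ::
  "(nat \<Rightarrow> 'i form_family set) \<Rightarrow> ('i form_family \<Rightarrow> 'i form_family) \<Rightarrow> nat \<Rightarrow>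
   ('i form_family \<times> 'i form_family) set" where
  "cohomologous C d k =
     {(a, b). a \<in> cocycles C d k \<and> b \<in> cocycles C d k \<and> a - b \<in> coboundaries C d k}"

definition cohomology ::
  "(nat \<Rightarrow> 'i form_family set) \<Rightarrow> ('i form_family \<Rightarrow> 'i form_family) \<Rightarrow> nat \<Rightarrow>
   'i form_family set set" where
  "cohomology C d k = cocycles C d k // cohomologous C d k"

definition class_add ::
  "(nat \<Rightarrow> 'i form_family set) \<Rightarrow> ('i form_family \<Rightarrow> 'i form_family) \<Rightarrow> nat \<Rightarrow>
   'i form_family set \<Rightarrow> 'i form_family set \<Rightarrow> 'i form_family set" where
  "class_add C d k A B = (\<Union>a\<in>A. \<Union>b\<in>B. cohomologous C d k `` {a + b})"

definition class_scale ::
  "(nat \<Rightarrow> 'i form_family set) \<Rightarrow> ('i form_family \<Rightarrow> 'i form_family) \<Rightarrow> nat \<Rightarrow>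
   real \<Rightarrow> 'i form_family set \<Rightarrow> 'i form_family set" where
  "class_scale C d k r A = (\<Union>a\<in>A. cohomologous C d k `` {fscale r a})"

text \<open>The map induced by \<open>f\<close> on cohomology, with target the degree-\<open>k\<close> cohomology
  of \<open>(C', d')\<close>.\<close>

definition induced ::
  "(nat \<Rightarrow> 'j form_family set) \<Rightarrow> ('j form_family \<Rightarrow> 'j form_family) \<Rightarrow> nat \<Rightarrow>
   ('i form_family \<Rightarrow> 'j form_family) \<Rightarrow> 'i form_family set \<Rightarrow> 'j form_family set" where
  "induced C' d' k f A = (\<Union>a\<in>A. cohomologous C' d' k `` {f a})"

definition cohomology_iso ::
  "(nat \<Rightarrow> 'i form_family set) \<Rightarrow> ('i form_family \<Rightarrow> 'i form_family) \<Rightarrow>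
   (nat \<Rightarrow> 'j form_family set) \<Rightarrow> ('j form_family \<Rightarrow> 'j form_family) \<Rightarrow> nat \<Rightarrow>
   ('i form_family set \<Rightarrow> 'j form_family set) \<Rightarrow> bool" where
  "cohomology_iso C d C' d' k F \<longleftrightarrow>
     bij_betw F (cohomology C d k) (cohomology C' d' k) \<and>
     (\<forall>A\<in>cohomology C d k. \<forall>B\<in>cohomology C d k.
        F (class_add C d k A B) = class_add C' d' k (F A) (F B)) \<and>
     (\<forall>r. \<forall>A\<in>cohomology C d k. F (class_scale C d k r A) = class_scale C' d' k r (F A))"


section \<open>Diffeological spaces\<close>

text \<open>
  A parametrization of \<open>X\<close> is a triple \<open>(n, U, \<alpha>)\<close> with \<open>U\<close> open in $R^n$ and
  \<open>\<alpha>\<close> a function from \<open>U\<close> to \<open>X\<close>, which is \<^const>\<open>undefined\<close> outside \<open>U\<close>. The dimension is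
  recorded because the empty set is open in every $R^n$.
\<close>

type_synonym 'x param = "nat \<times> (nat \<Rightarrow> real) set \<times> ((nat \<Rightarrow> real) \<Rightarrow> 'x)"

definition params :: "'x set \<Rightarrow> 'x param set" where
  "params X = {(n, U, \<alpha>). openin (Euclidean_space n) U \<and> \<alpha> \<in> U \<rightarrow>\<^sub>E X}"

definition diffeology :: "'x set \<Rightarrow> 'x param set \<Rightarrow> bool" where
  "diffeology X D \<longleftrightarrow>
     D \<subseteq> params X \<and>
     (\<forall>n U. \<forall>c\<in>X. openin (Euclidean_space n) U \<longrightarrow> (n, U, \<lambda>x\<in>U. c) \<in> D) \<and>
     (\<forall>(n, U, \<alpha>)\<in>D. \<forall>l V h. openin (Euclidean_space l) V \<and> smooth_map l V n U h \<longrightarrow>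
        (l, V, compose V \<alpha> h) \<in> D) \<and>
     (\<forall>(n, U, \<alpha>)\<in>params X.
        (\<forall>x\<in>U. \<exists>V. openin (Euclidean_space n) V \<and> x \<in> V \<and> V \<subseteq> U \<and> (n, V, restrict \<alpha> V) \<in> D) \<longrightarrow>
        (n, U, \<alpha>) \<in> D)"

definition dsmooth ::
  "'x set \<Rightarrow> 'x param set \<Rightarrow> 'y set \<Rightarrow> 'y param set \<Rightarrow> ('x \<Rightarrow> 'y) \<Rightarrow> bool" where
  "dsmooth X D Y E f \<longleftrightarrow>
     diffeology X D \<and> diffeology Y E \<and> f \<in> X \<rightarrow> Y \<and>
     (\<forall>(n, U, \<alpha>)\<in>D. (n, U, compose U f \<alpha>) \<in> E)"

definition ddiffeomorphism ::
  "'x set \<Rightarrow> 'x param set \<Rightarrow> 'y set \<Rightarrow> 'y param set \<Rightarrow> ('x \<Rightarrow> 'y) \<Rightarrow> bool" where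
  "ddiffeomorphism X D Y E f \<longleftrightarrow>
     bij_betw f X Y \<and> dsmooth X D Y E f \<and> dsmooth Y E X D (inv_into X f)"

text \<open>The quotient diffeology on \<open>Y\<close> along a quotient map \<open>p\<close> from \<open>(X, D)\<close> onto \<open>Y\<close>.\<close>

definition quotient_diffeology :: "'x param set \<Rightarrow> 'y set \<Rightarrow> ('x \<Rightarrow> 'y) \<Rightarrow> 'y param set" where
  "quotient_diffeology D Y p = {(n, U, \<gamma>). (n, U, \<gamma>) \<in> params Y \<and>
     ((\<exists>c. \<forall>x\<in>U. \<gamma> x = c) \<or>
      (\<forall>x\<in>U. \<exists>V \<alpha>. openin (Euclidean_space n) V \<and> x \<in> V \<and> V \<subseteq> U \<and> (n, V, \<alpha>) \<in> D \<and>
                 (\<forall>y\<in>V. \<gamma> y = p (\<alpha> y))))}"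

definition dforms :: "'x param set \<Rightarrow> nat \<Rightarrow> 'x param form_family set" where
  "dforms D k = {\<gamma>.
     (\<forall>P. P \<notin> D \<longrightarrow> \<gamma> P = 0) \<and>
     (\<forall>(n, U, \<alpha>)\<in>D. \<gamma> (n, U, \<alpha>) \<in> forms n k U \<and>
        (\<forall>l V f. openin (Euclidean_space l) V \<and> smooth_map l V n U f \<longrightarrow>
           \<gamma> (l, V, compose V \<alpha> f) = form_pullback l V f (\<gamma> (n, U, \<alpha>))))}"

definition dform_d :: "'x param form_family \<Rightarrow> 'x param form_family" where
  "dform_d \<gamma> = (\<lambda>(n, U, \<alpha>). ext_deriv n U (\<gamma> (n, U, \<alpha>)))"

text \<open>Pullback along a map \<open>f\<close> defined on the diffeological space with plots \<open>D\<close>.\<close>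

definition dform_pullback ::
  "'x param set \<Rightarrow> ('x \<Rightarrow> 'y) \<Rightarrow> 'y param form_family \<Rightarrow> 'x param form_family" where
  "dform_pullback D f \<gamma> = (\<lambda>(n, U, \<alpha>). if (n, U, \<alpha>) \<in> D then \<gamma> (n, U, compose U f \<alpha>) else 0)"


section \<open>Smooth manifolds\<close>

type_synonym 'a chart = "'a set \<times> ('a \<Rightarrow> nat \<Rightarrow> real)"

record 'a mfd =
  mtop :: "'a topology"
  mdim :: nat
  atlas :: "'a chart set"

abbreviation pts :: "'a mfd \<Rightarrow> 'a set" where
  "pts M \<equiv> topspace (mtop M)"

text \<open>The expression of a map \<open>f\<close> on \<open>M\<close> with values in some $R^p$ in the coordinates of a chart.\<close>

definition in_chart :: "'a chart \<Rightarrow> ('a \<Rightarrow> 'b) \<Rightarrow> (nat \<Rightarrow> real) \<Rightarrow> 'b" where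
  "in_chart c f = (\<lambda>x. f (inv_into (fst c) (snd c) x))"

definition smooth_manifold :: "'a mfd \<Rightarrow> bool" where
  "smooth_manifold M \<longleftrightarrow>
     Hausdorff_space (mtop M) \<and>
     (\<forall>(U, \<phi>)\<in>atlas M. openin (mtop M) U \<and> openin (Euclidean_space (mdim M)) (\<phi> ` U) \<and>
        homeomorphic_map (subtopology (mtop M) U) (subtopology (Euclidean_space (mdim M)) (\<phi> ` U)) \<phi>) \<and>
     (\<Union>(U, \<phi>)\<in>atlas M. U) = pts M \<and>
     (\<forall>(U, \<phi>)\<in>atlas M. \<forall>(V, \<psi>)\<in>atlas M.
        smooth_map (mdim M) (\<phi> ` (U \<inter> V)) (mdim M) (Rn (mdim M)) (in_chart (U, \<phi>) \<psi>))"

definition msmooth :: "'a mfd \<Rightarrow> 'b mfd \<Rightarrow> ('a \<Rightarrow> 'b) \<Rightarrow> bool" where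
  "msmooth M N f \<longleftrightarrow>
     continuous_map (mtop M) (mtop N) f \<and>
     (\<forall>(U, \<phi>)\<in>atlas M. \<forall>(V, \<psi>)\<in>atlas N.
        smooth_map (mdim M) (\<phi> ` (U \<inter> f -` V)) (mdim N) (Rn (mdim N)) (in_chart (U, \<phi>) (\<psi> \<circ> f)))"

definition mdiffeomorphism :: "'a mfd \<Rightarrow> 'b mfd \<Rightarrow> ('a \<Rightarrow> 'b) \<Rightarrow> bool" where
  "mdiffeomorphism M N f \<longleftrightarrow>
     bij_betw f (pts M) (pts N) \<and> msmooth M N f \<and> msmooth N M (inv_into (pts M) f)"

definition manifold_diffeology :: "'a mfd \<Rightarrow> 'a param set" where
  "manifold_diffeology M = {(n, U, \<alpha>). (n, U, \<alpha>) \<in> params (pts M) \<and>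
     continuous_map (subtopology (Euclidean_space n) U) (mtop M) \<alpha> \<and>
     (\<forall>(V, \<psi>)\<in>atlas M. smooth_map n (U \<inter> \<alpha> -` V) (mdim M) (Rn (mdim M)) (\<psi> \<circ> \<alpha>))}"

text \<open>Differential forms and vector fields are given by their coordinate expressions in the
  charts of the atlas, related by the transition maps.\<close>

definition mforms :: "'a mfd \<Rightarrow> nat \<Rightarrow> 'a chart form_family set" where
  "mforms M k = {\<omega>.
     (\<forall>c. c \<notin> atlas M \<longrightarrow> \<omega> c = 0) \<and>
     (\<forall>(U, \<phi>)\<in>atlas M. \<omega> (U, \<phi>) \<in> forms (mdim M) k (\<phi> ` U)) \<and>
     (\<forall>(U, \<phi>)\<in>atlas M. \<forall>(V, \<psi>)\<in>atlas M. \<forall>p\<in>U \<inter> V. \<forall>v\<in>tuples (mdim M) k.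
        \<omega> (U, \<phi>) (\<phi> p) v = \<omega> (V, \<psi>) (\<psi> p) (map (tangent_map (in_chart (U, \<phi>) \<psi>) (\<phi> p)) v))}"

definition mform_d :: "'a mfd \<Rightarrow> 'a chart form_family \<Rightarrow> 'a chart form_family" where
  "mform_d M \<omega> = (\<lambda>(U, \<phi>). ext_deriv (mdim M) (\<phi> ` U) (\<omega> (U, \<phi>)))"

text \<open>Pullback of a form on \<open>N\<close> along a smooth map from \<open>M\<close> to \<open>N\<close>; the value does not depend
  on the chart of \<open>N\<close> chosen around the image point.\<close>

definition mform_pullback ::
  "'a mfd \<Rightarrow> 'b mfd \<Rightarrow> ('a \<Rightarrow> 'b) \<Rightarrow> 'b chart form_family \<Rightarrow> 'a chart form_family" where
  "mform_pullback M N f \<omega> = (\<lambda>(U, \<phi>) x v.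
     if (U, \<phi>) \<in> atlas M \<and> x \<in> \<phi> ` U \<and> set v \<subseteq> Rn (mdim M)
     then let p = inv_into U \<phi> x; (V, \<psi>) = (SOME c. c \<in> atlas N \<and> f p \<in> fst c)
          in \<omega> (V, \<psi>) (\<psi> (f p)) (map (tangent_map (in_chart (U, \<phi>) (\<psi> \<circ> f)) x) v)
     else 0)"

text \<open>The identification of forms on the diffeological space underlying \<open>M\<close> with forms on the
  manifold \<open>M\<close>: the inverse of a chart is a plot, and the form attached to this plot is the
  expression in that chart.\<close>

definition mform_of_dform :: "'a mfd \<Rightarrow> 'a param form_family \<Rightarrow> 'a chart form_family" where
  "mform_of_dform M \<beta> = (\<lambda>(U, \<phi>).
     if (U, \<phi>) \<in> atlas M then \<beta> (mdim M, \<phi> ` U, restrict (inv_into U \<phi>) (\<phi> ` U)) else 0)"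

definition vector_fields :: "'a mfd \<Rightarrow> ('a chart \<Rightarrow> (nat \<Rightarrow> real) \<Rightarrow> nat \<Rightarrow> real) set" where
  "vector_fields M = {X.
     (\<forall>(U, \<phi>)\<in>atlas M. smooth_map (mdim M) (\<phi> ` U) (mdim M) (Rn (mdim M)) (X (U, \<phi>))) \<and>
     (\<forall>(U, \<phi>)\<in>atlas M. \<forall>(V, \<psi>)\<in>atlas M. \<forall>p\<in>U \<inter> V.
        X (V, \<psi>) (\<psi> p) = tangent_map (in_chart (U, \<phi>) \<psi>) (\<phi> p) (X (U, \<phi>) (\<phi> p)))}"

definition contraction ::
  "('a chart \<Rightarrow> (nat \<Rightarrow> real) \<Rightarrow> nat \<Rightarrow> real) \<Rightarrow> 'a chart form_family \<Rightarrow> 'a chart form_family" where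
  "contraction X \<omega> = (\<lambda>c x v. \<omega> c x (X c x # v))"

text \<open>The Lie derivative in coordinates:
  $(L_X\omega)(v_1,\dots,v_k) = X(\omega(v_1,\dots,v_k)) - \sum_i \omega(\dots,[X,v_i],\dots)$
  for constant coordinate fields $v_i$, where $[X,v_i] = - D_{v_i}X$.\<close>

definition lie_deriv ::
  "'a mfd \<Rightarrow> ('a chart \<Rightarrow> (nat \<Rightarrow> real) \<Rightarrow> nat \<Rightarrow> real) \<Rightarrow> 'a chart form_family \<Rightarrow> 'a chart form_family" where
  "lie_deriv M X \<omega> = (\<lambda>(U, \<phi>) x v.
     if (U, \<phi>) \<in> atlas M \<and> x \<in> \<phi> ` U \<and> set v \<subseteq> Rn (mdim M)
     then dir_deriv (\<lambda>y. \<omega> (U, \<phi>) y v) x (X (U, \<phi>) x) +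
          (\<Sum>i<length v. \<omega> (U, \<phi>) x (v[i := tangent_map (X (U, \<phi>)) x (v ! i)]))
     else 0)"


section \<open>Foliations\<close>

definition submersion_on :: "'a mfd \<Rightarrow> nat \<Rightarrow> 'a set \<Rightarrow> ('a \<Rightarrow> nat \<Rightarrow> real) \<Rightarrow> bool" where
  "submersion_on M q W f \<longleftrightarrow>
     openin (mtop M) W \<and>
     (\<forall>(U, \<phi>)\<in>atlas M.
        smooth_map (mdim M) (\<phi> ` (U \<inter> W)) q (Rn q) (in_chart (U, \<phi>) f) \<and>
        (\<forall>p\<in>U \<inter> W. tangent_map (in_chart (U, \<phi>) f) (\<phi> p) ` Rn (mdim M) = Rn q))"

text \<open>\<open>\<theta>\<close> represents a germ at \<open>y\<close> of a diffeomorphism of $R^q$.\<close>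

definition local_diffeo_at :: "nat \<Rightarrow> (nat \<Rightarrow> real) \<Rightarrow> ((nat \<Rightarrow> real) \<Rightarrow> nat \<Rightarrow> real) \<Rightarrow> bool" where
  "local_diffeo_at q y \<theta> \<longleftrightarrow>
     (\<exists>A B. openin (Euclidean_space q) A \<and> openin (Euclidean_space q) B \<and> y \<in> A \<and>
        bij_betw \<theta> A B \<and> smooth_map q A q B \<theta> \<and> smooth_map q B q A (inv_into A \<theta>))"

definition foliation_cocycle :: "'a mfd \<Rightarrow> nat \<Rightarrow> ('a set \<times> ('a \<Rightarrow> nat \<Rightarrow> real)) set \<Rightarrow> bool" where
  "foliation_cocycle M q F \<longleftrightarrow>
     (\<forall>(U, f)\<in>F. submersion_on M q U f) \<and>
     (\<Union>(U, f)\<in>F. U) = pts M \<and>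
     (\<exists>\<theta>. (\<forall>i\<in>F. \<forall>j\<in>F. \<forall>x\<in>fst i \<inter> fst j.
              local_diffeo_at q (snd i x) (\<theta> j i x) \<and>
              (\<exists>W. openin (mtop M) W \<and> x \<in> W \<and> W \<subseteq> fst i \<inter> fst j \<and>
                   (\<forall>y\<in>W. snd j y = \<theta> j i x (snd i y)))) \<and>
          (\<forall>i\<in>F. \<forall>j\<in>F. \<forall>k\<in>F. \<forall>x\<in>fst i \<inter> fst j \<inter> fst k.
              \<exists>A. openin (Euclidean_space q) A \<and> snd i x \<in> A \<and>
                  (\<forall>y\<in>A. \<theta> k i x y = \<theta> k j x (\<theta> j i x y))))"

definition foliation :: "'a mfd \<Rightarrow> nat \<Rightarrow> ('a set \<times> ('a \<Rightarrow> nat \<Rightarrow> real)) set \<Rightarrow> bool" where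
  "foliation M q F \<longleftrightarrow>
     foliation_cocycle M q F \<and> (\<forall>F'. foliation_cocycle M q F' \<and> F \<subseteq> F' \<longrightarrow> F' = F)"

text \<open>The tangent distribution at \<open>p\<close>, in the coordinates of a chart \<open>c\<close> around \<open>p\<close>.\<close>

definition foliation_tangent ::
  "'a mfd \<Rightarrow> ('a set \<times> ('a \<Rightarrow> nat \<Rightarrow> real)) set \<Rightarrow> 'a chart \<Rightarrow> 'a \<Rightarrow> (nat \<Rightarrow> real) set" where
  "foliation_tangent M F c p =
     {v \<in> Rn (mdim M). \<forall>(W, f)\<in>F. p \<in> W \<longrightarrow> tangent_map (in_chart c f) (snd c p) v = 0}"

text \<open>An integral submanifold is an injectively immersed submanifold, with its own topology and
  smooth structure, whose tangent spaces are those of the foliation. Its dimension is forced.\<close>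

definition integral_submanifold ::
  "'a mfd \<Rightarrow> ('a set \<times> ('a \<Rightarrow> nat \<Rightarrow> real)) set \<Rightarrow> 'a mfd \<Rightarrow> bool" where
  "integral_submanifold M F N \<longleftrightarrow>
     smooth_manifold N \<and> pts N \<subseteq> pts M \<and> msmooth N M (\<lambda>x. x) \<and>
     (\<forall>(V, \<psi>)\<in>atlas N. \<forall>(U, \<phi>)\<in>atlas M. \<forall>p\<in>V \<inter> U.
        inj_on (tangent_map (in_chart (V, \<psi>) \<phi>) (\<psi> p)) (Rn (mdim N)) \<and>
        tangent_map (in_chart (V, \<psi>) \<phi>) (\<psi> p) ` Rn (mdim N) = foliation_tangent M F (U, \<phi>) p)"

definition leaves :: "'a mfd \<Rightarrow> ('a set \<times> ('a \<Rightarrow> nat \<Rightarrow> real)) set \<Rightarrow> 'a set set" where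
  "leaves M F = {L. L \<noteq> {} \<and>
     (\<exists>N. integral_submanifold M F N \<and> connected_space (mtop N) \<and> pts N = L) \<and>
     (\<forall>N. integral_submanifold M F N \<and> connected_space (mtop N) \<and> L \<subseteq> pts N \<longrightarrow> pts N = L)}"

definition leaf_proj :: "'a mfd \<Rightarrow> ('a set \<times> ('a \<Rightarrow> nat \<Rightarrow> real)) set \<Rightarrow> 'a \<Rightarrow> 'a set" where
  "leaf_proj M F x = (THE L. L \<in> leaves M F \<and> x \<in> L)"

definition leaf_diffeology ::
  "'a mfd \<Rightarrow> ('a set \<times> ('a \<Rightarrow> nat \<Rightarrow> real)) set \<Rightarrow> 'a set param set" where
  "leaf_diffeology M F = quotient_diffeology (manifold_diffeology M) (leaves M F) (leaf_proj M F)"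

definition foliation_automorphism ::
  "'a mfd \<Rightarrow> ('a set \<times> ('a \<Rightarrow> nat \<Rightarrow> real)) set \<Rightarrow> ('a \<Rightarrow> 'a) \<Rightarrow> bool" where
  "foliation_automorphism M F g \<longleftrightarrow> mdiffeomorphism M M g \<and> (\<forall>L\<in>leaves M F. g ` L \<in> leaves M F)"

definition tangent_fields ::
  "'a mfd \<Rightarrow> ('a set \<times> ('a \<Rightarrow> nat \<Rightarrow> real)) set \<Rightarrow> ('a chart \<Rightarrow> (nat \<Rightarrow> real) \<Rightarrow> nat \<Rightarrow> real) set" where
  "tangent_fields M F = {X \<in> vector_fields M.
     \<forall>(U, \<phi>)\<in>atlas M. \<forall>p\<in>U. X (U, \<phi>) (\<phi> p) \<in> foliation_tangent M F (U, \<phi>) p}"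

definition basic_forms ::
  "'a mfd \<Rightarrow> ('a set \<times> ('a \<Rightarrow> nat \<Rightarrow> real)) set \<Rightarrow> nat \<Rightarrow> 'a chart form_family set" where
  "basic_forms M F k =
     {\<omega> \<in> mforms M k. \<forall>X\<in>tangent_fields M F. contraction X \<omega> = 0 \<and> lie_deriv M X \<omega> = 0}"

text \<open>Pullback along the projection to the leaf space, as a form on the manifold.\<close>

definition leaf_pullback ::
  "'a mfd \<Rightarrow> ('a set \<times> ('a \<Rightarrow> nat \<Rightarrow> real)) set \<Rightarrow> 'a set param form_family \<Rightarrow> 'a chart form_family" where
  "leaf_pullback M F \<gamma> = mform_of_dform M (dform_pullback (manifold_diffeology M) (leaf_proj M F) \<gamma>)"


section \<open>Group actions\<close>

definition right_action :: "('h, 'b) monoid_scheme \<Rightarrow> 'x set \<Rightarrow> ('h \<Rightarrow> 'x \<Rightarrow> 'x) \<Rightarrow> bool" where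
  "right_action H X R \<longleftrightarrow>
     (\<forall>h\<in>carrier H. R h \<in> X \<rightarrow> X) \<and> (\<forall>x\<in>X. R \<one>\<^bsub>H\<^esub> x = x) \<and>
     (\<forall>g\<in>carrier H. \<forall>h\<in>carrier H. \<forall>x\<in>X. R (g \<otimes>\<^bsub>H\<^esub> h) x = R h (R g x))"

definition descends_to ::
  "'a mfd \<Rightarrow> ('a set \<times> ('a \<Rightarrow> nat \<Rightarrow> real)) set \<Rightarrow> ('a \<Rightarrow> 'a) \<Rightarrow> ('a set \<Rightarrow> 'a set) \<Rightarrow> bool" where
  "descends_to M F g r \<longleftrightarrow>
     r \<in> leaves M F \<rightarrow>\<^sub>E leaves M F \<and> (\<forall>x\<in>pts M. leaf_proj M F (g x) = r (leaf_proj M F x))"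

definition leaf_map ::
  "'a mfd \<Rightarrow> ('a set \<times> ('a \<Rightarrow> nat \<Rightarrow> real)) set \<Rightarrow> ('a \<Rightarrow> 'a) \<Rightarrow> 'a set \<Rightarrow> 'a set" where
  "leaf_map M F g = (THE r. descends_to M F g r)"

end

theory Submission
  imports Defs
begin

text \<open>
  A form on the leaf space is the same as a form \<open>\<beta>\<close> on \<open>M\<close>, as a diffeological space, that takes
  equal values on plots with equal projections to the leaf space. In a foliated chart let the slide
  to \<open>z\<close> replace the coordinates along the leaves by those of \<open>z\<close>. By Cartan's formula, applied to
  tangent fields cut off by bump functions, a form is basic iff it is invariant under all slides.
  Slides move points within their leaf, so \<open>\<beta>\<close> is slide invariant if it comes from the leaf space.
  Conversely, let \<open>\<alpha>\<close> and \<open>\<alpha>'\<close> be plots with equal projections. At each point, \<open>\<alpha>'\<close> lies on the plaque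
  of the image of \<open>\<alpha>\<close> under finitely many slides, and countably many slides suffice because \<open>M\<close> is
  second countable. By Baire, on a dense open set this happens locally with a constant sequence of
  slides, so there a slide invariant \<open>\<beta>\<close> takes the same value on both plots, and by continuity
  everywhere. The leaves themselves are identified with the classes of points that are connected
  by chains of plaques.
\<close>

section \<open>Calculus on open subsets of Euclidean spaces\<close>

text \<open>Two plots with equal projections need not be joined by leafwise paths that depend
  continuously on the parameter: the plaques crossed, and their number, may jump from point to
  point. This is why a category argument takes the place of a homotopy. For a fixed word of slides
  the parameters at which it works are cut out of an open set by finitely many smooth equations, so
  they form a locally closed set, and countably many locally closed sets without interior cannot
  cover a nonempty open set. Words are countable because slides go to rational points only and
  because the foliated charts are taken from a Lindelof subcover.

  Slides are used instead of flows of tangent fields because they are explicit: a form is compared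
  with its slide by a mean value argument on a segment, and no differential equation has to be
  solved. In the same spirit foliated charts come from straightening a submersion one coordinate at
  a time, where the intermediate value theorem provides the inverse. Since dimensions are numbers,
  all calculus is done for functions of sequences by means of derivatives along lines.\<close>

lemma Rn_iff: "x \<in> Rn n \<longleftrightarrow> (\<forall>i\<ge>n. x i = 0)"
  by (simp add: topspace_Euclidean_space)

abbreviation open_Rn :: "nat \<Rightarrow> (nat \<Rightarrow> real) set \<Rightarrow> bool" where
  "open_Rn n U \<equiv> openin (Euclidean_space n) U"

text \<open>Open balls of the maximum norm. They are preferred to round balls because replacing some
  coordinates of a point of the cube by those of another point of the cube does not leave
  it.\<close>

definition cube :: "nat \<Rightarrow> (nat \<Rightarrow> real) \<Rightarrow> real \<Rightarrow> (nat \<Rightarrow> real) set" where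
  "cube n x e = {y \<in> Rn n. \<forall>i<n. \<bar>y i - x i\<bar> < e}"

lemma cube_subset_Rn: "cube n x e \<subseteq> Rn n"
  by (auto simp: cube_def)

lemma cube_mono: "d \<le> e \<Longrightarrow> cube n x d \<subseteq> cube n x e"
  unfolding cube_def using less_le_trans by blast

lemma center_in_cube: "x \<in> Rn n \<Longrightarrow> e > 0 \<Longrightarrow> x \<in> cube n x e"
  by (simp add: cube_def)

lemma open_Rn_cube: "open_Rn n (cube n x e)"
proof -
  have "open (\<Inter>i\<in>{..<n}. {y :: nat \<Rightarrow> real. \<bar>y i - x i\<bar> < e})"
    by (intro open_INT ballI open_Collect_less continuous_intros continuous_on_product_coordinates) auto
  then have "openin (powertop_real UNIV) (\<Inter>i\<in>{..<n}. {y. \<bar>y i - x i\<bar> < e})"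
    by (simp add: euclidean_product_topology)
  then show ?thesis
    unfolding Euclidean_space_def openin_subtopology
    by (intro exI[of _ "\<Inter>i\<in>{..<n}. {y. \<bar>y i - x i\<bar> < e}"])
       (auto simp: cube_def topspace_Euclidean_space)
qed

lemma open_Rn_subset: "open_Rn n U \<Longrightarrow> U \<subseteq> Rn n"
  by (rule openin_subset)

lemma open_Rn_contains_cube:
  assumes "open_Rn n U" "x \<in> U"
  obtains e where "e > 0" "cube n x e \<subseteq> U"
proof -
  obtain T where T: "openin (powertop_real UNIV) T" "U = T \<inter> {x. \<forall>i\<ge>n. x i = 0}"
    using assms(1) unfolding Euclidean_space_def openin_subtopology by blast
  have "x \<in> T" using assms(2) T(2) by simp
  then obtain X where X: "\<forall>i\<in>UNIV. openin euclideanreal (X i)" "x \<in> Pi\<^sub>E UNIV X" "Pi\<^sub>E UNIV X \<subseteq> T"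
    using T(1) unfolding openin_product_topology_alt by blast
  have "\<forall>i. \<exists>e>0. \<forall>y. \<bar>y - x i\<bar> < e \<longrightarrow> y \<in> X i"
  proof
    fix i
    have "x i \<in> X i" "open (X i)" using X(1,2) by auto
    then show "\<exists>e>0. \<forall>y. \<bar>y - x i\<bar> < e \<longrightarrow> y \<in> X i"
      unfolding open_dist dist_real_def by blast
  qed
  then obtain d where d: "\<forall>i. d i > 0 \<and> (\<forall>y. \<bar>y - x i\<bar> < d i \<longrightarrow> y \<in> X i)"
    using choice[of "\<lambda>i e. e > 0 \<and> (\<forall>y. \<bar>y - x i\<bar> < e \<longrightarrow> y \<in> X i)"] by blast
  \<comment> \<open>The \<open>1\<close> keeps the set nonempty when \<open>n = 0\<close>.\<close>
  define e where "e = Min (insert 1 (d ` {..<n}))"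
  have e: "e > 0" "\<And>i. i < n \<Longrightarrow> e \<le> d i"
    unfolding e_def using d by (simp_all add: Min_gr_iff)
  have "cube n x e \<subseteq> U"
  proof
    fix y assume y: "y \<in> cube n x e"
    have "y i \<in> X i" for i
    proof (cases "i < n")
      case True
      then have "\<bar>y i - x i\<bar> < d i"
        using y e(2)[OF True] less_le_trans[of "\<bar>y i - x i\<bar>" e "d i"] by (simp add: cube_def)
      then show ?thesis using d by blast
    next
      case False
      then have "y i = x i"
        using y assms(2) T(2) by (simp add: cube_def Rn_iff)
      then have "\<bar>y i - x i\<bar> < d i" using d by simp
      then show ?thesis using d by blast
    qed
    then have "y \<in> T" using X(3) by blast
    then show "y \<in> U" using y unfolding T(2) cube_def Rn_iff by blast
  qed
  with e(1) show ?thesis by (rule that)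
qed

lemma open_Rn_iff: "open_Rn n U \<longleftrightarrow> U \<subseteq> Rn n \<and> (\<forall>x\<in>U. \<exists>e>0. cube n x e \<subseteq> U)"
proof
  assume U: "open_Rn n U"
  have "\<exists>e>0. cube n x e \<subseteq> U" if "x \<in> U" for x
    using open_Rn_contains_cube[OF U that] by metis
  with open_Rn_subset[OF U] show "U \<subseteq> Rn n \<and> (\<forall>x\<in>U. \<exists>e>0. cube n x e \<subseteq> U)" by simp
next
  assume "U \<subseteq> Rn n \<and> (\<forall>x\<in>U. \<exists>e>0. cube n x e \<subseteq> U)"
  then have "\<forall>x\<in>U. \<exists>T. open_Rn n T \<and> x \<in> T \<and> T \<subseteq> U"
    by (meson center_in_cube open_Rn_cube subset_eq)
  then show "open_Rn n U" unfolding openin_subopen[of _ U] .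
qed

lemma open_Rn_iff_open: "open_Rn n U \<longleftrightarrow> (\<exists>T. open T \<and> U = T \<inter> Rn n)"
  unfolding topspace_Euclidean_space
  by (simp only: Euclidean_space_def openin_subtopology euclidean_product_topology open_openin)

lemma unit_vec_Rn: "i < n \<Longrightarrow> unit_vec i \<in> Rn n"
  by (auto simp: Rn_iff unit_vec_def)

lemma line_Rn: "x \<in> Rn n \<Longrightarrow> v \<in> Rn n \<Longrightarrow> (\<lambda>j. x j + t * v j) \<in> Rn n"
  by (simp add: Rn_iff)

lemma line_unit_vec: "(\<lambda>j. x j + t * unit_vec i j) = x(i := x i + t)"
  by (auto simp: unit_vec_def)

lemma eventually_curve_in:
  assumes "open_Rn n U" "p \<in> U"
    and "\<And>i. i < n \<Longrightarrow> ((\<lambda>t. c t i) \<longlongrightarrow> p i) F"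
    and "\<forall>\<^sub>F t in F. c t \<in> Rn n"
  shows "\<forall>\<^sub>F t in F. c t \<in> U"
proof -
  obtain e where e: "e > 0" "cube n p e \<subseteq> U"
    using assms(1,2) by (rule open_Rn_contains_cube)
  have "\<forall>\<^sub>F t in F. \<forall>i\<in>{..<n}. \<bar>c t i - p i\<bar> < e"
  proof (intro eventually_ball_finite ballI)
    fix i assume "i \<in> {..<n}"
    then show "\<forall>\<^sub>F t in F. \<bar>c t i - p i\<bar> < e"
      using tendstoD[OF assms(3) e(1)] by (simp add: dist_real_def)
  qed auto
  with assms(4) show ?thesis
    by eventually_elim (use e in \<open>auto simp: cube_def\<close>)
qed

lemma eventually_line_in:
  assumes "open_Rn n U" "x \<in> U" "v \<in> Rn n"
  shows "\<forall>\<^sub>F t in nhds 0. (\<lambda>j. x j + t * v j) \<in> U"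
proof (rule eventually_curve_in[OF assms(1,2)])
  have "((\<lambda>t. x i + t * v i) \<longlongrightarrow> x i + 0 * v i) (nhds 0)" for i
    by (intro tendsto_intros filterlim_ident)
  then show "((\<lambda>t. x i + t * v i) \<longlongrightarrow> x i) (nhds 0)" for i by simp
  show "\<forall>\<^sub>F t in nhds 0. (\<lambda>j. x j + t * v j) \<in> Rn n"
    using assms(2,3) open_Rn_subset[OF assms(1)] by (intro always_eventually allI line_Rn) blast+
qed

lemma dir_deriv_eqI:
  assumes "((\<lambda>t. f (\<lambda>j. x j + t * v j)) has_real_derivative D) (at 0)"
  shows "dir_deriv f x v = D"
  unfolding dir_deriv_def using assms by (rule DERIV_imp_deriv)

lemma line_derivative_cong:
  assumes "open_Rn n U" "x \<in> U" "v \<in> Rn n" "\<And>y. y \<in> U \<Longrightarrow> f y = g y"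
  shows "((\<lambda>t. f (\<lambda>j. x j + t * v j)) has_real_derivative D) (at 0) \<longleftrightarrow>
         ((\<lambda>t. g (\<lambda>j. x j + t * v j)) has_real_derivative D) (at 0)"
proof (rule DERIV_cong_ev)
  show "\<forall>\<^sub>F t in nhds 0. f (\<lambda>j. x j + t * v j) = g (\<lambda>j. x j + t * v j)"
    using eventually_line_in[OF assms(1-3)] by eventually_elim (rule assms(4))
qed auto

lemma dir_deriv_cong:
  assumes "open_Rn n U" "x \<in> U" "v \<in> Rn n" "\<And>y. y \<in> U \<Longrightarrow> f y = g y"
  shows "dir_deriv f x v = dir_deriv g x v"
  unfolding dir_deriv_def
  by (intro deriv_cong_ev eventually_mono[OF eventually_line_in[OF assms(1-3)]] assms(4)) auto

lemma dir_deriv_const [simp]: "dir_deriv (\<lambda>y. c) x v = 0"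
  by (rule dir_deriv_eqI) auto

section \<open>Partial derivatives and functions of class C^k\<close>

abbreviation pd :: "nat \<Rightarrow> ((nat \<Rightarrow> real) \<Rightarrow> real) \<Rightarrow> (nat \<Rightarrow> real) \<Rightarrow> real" where
  "pd i f \<equiv> \<lambda>x. dir_deriv f x (unit_vec i)"

lemma Ck_on_continuous: "Ck_on n k U f \<Longrightarrow> continuous_on U f"
  by (cases k) auto

lemma Ck_on_mono: "Ck_on n (Suc k) U f \<Longrightarrow> Ck_on n k U f"
proof (induction k arbitrary: f)
  case (Suc k)
  then have "Ck_on n k U (pd i f)" if "i < n" for i using that by auto
  then show ?case using Suc by simp
qed simp

lemma Ck_on_subset: "Ck_on n k U f \<Longrightarrow> V \<subseteq> U \<Longrightarrow> Ck_on n k V f"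
  by (induction k arbitrary: f) (auto intro: continuous_on_subset)

text \<open>Congruence of \<open>Ck_on\<close> is a premise because the rule already serves in the
  inductive step that proves congruence; \<open>Ck_on_SucI'\<close> is the version with the premise
  discharged.\<close>

lemma Ck_on_SucI:
  assumes "open_Rn n U" "continuous_on U f"
    and der: "\<And>i x. i < n \<Longrightarrow> x \<in> U \<Longrightarrow>
      ((\<lambda>t. f (\<lambda>j. x j + t * unit_vec i j)) has_real_derivative f' i x) (at 0)"
    and Ck: "\<And>i. i < n \<Longrightarrow> Ck_on n k U (f' i)"
    and cong: "\<And>f g. Ck_on n k U f \<Longrightarrow> (\<And>x. x \<in> U \<Longrightarrow> f x = g x) \<Longrightarrow> Ck_on n k U g"
  shows "Ck_on n (Suc k) U f"
proof -
  have "Ck_on n k U (pd i f)" if "i < n" for i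
    by (rule cong[OF Ck[OF that]]) (simp add: dir_deriv_eqI[OF der[OF that]])
  then show ?thesis
    using assms(2) der by (auto simp: field_differentiable_def)
qed

lemma Ck_on_cong:
  assumes "open_Rn n U" "Ck_on n k U f" "\<And>x. x \<in> U \<Longrightarrow> f x = g x"
  shows "Ck_on n k U g"
  using assms(2,3)
proof (induction k arbitrary: f g)
  case 0
  then show ?case using continuous_on_cong by fastforce
next
  case (Suc k)
  have c: "continuous_on U g" using Suc.prems continuous_on_cong by fastforce
  show ?case
  proof (rule Ck_on_SucI[OF assms(1) c])
    fix i x assume i: "i < n" and x: "x \<in> U"
    have "((\<lambda>t. f (\<lambda>j. x j + t * unit_vec i j)) has_real_derivative pd i f x) (at 0)"
      using Suc.prems(1) i x by (simp add: dir_deriv_def DERIV_deriv_iff_field_differentiable)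
    then show "((\<lambda>t. g (\<lambda>j. x j + t * unit_vec i j)) has_real_derivative pd i f x) (at 0)"
      using line_derivative_cong[OF assms(1) x unit_vec_Rn[OF i], of f g] Suc.prems(2) by simp
  next
    fix i assume "i < n"
    then show "Ck_on n k U (pd i f)" using Suc.prems(1) by simp
  qed (rule Suc.IH)
qed

lemma Ck_on_SucI':
  assumes "open_Rn n U" "continuous_on U f"
    and "\<And>i x. i < n \<Longrightarrow> x \<in> U \<Longrightarrow>
      ((\<lambda>t. f (\<lambda>j. x j + t * unit_vec i j)) has_real_derivative f' i x) (at 0)"
    and "\<And>i. i < n \<Longrightarrow> Ck_on n k U (f' i)"
  shows "Ck_on n (Suc k) U f"
  using assms(1-4) Ck_on_cong[OF assms(1)] by (rule Ck_on_SucI)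

lemma Ck_on_line_derivative:
  assumes "Ck_on n (Suc k) U f" "i < n" "x \<in> U"
  shows "((\<lambda>t. f (\<lambda>j. x j + t * unit_vec i j)) has_real_derivative pd i f x) (at 0)"
  using assms by (simp add: dir_deriv_def DERIV_deriv_iff_field_differentiable)

lemma Ck_on_pd: "Ck_on n (Suc k) U f \<Longrightarrow> i < n \<Longrightarrow> Ck_on n k U (pd i f)"
  by simp

declare Ck_on.simps(2) [simp del]

lemma Ck_on_local:
  assumes "open_Rn n U"
    and "\<And>x. x \<in> U \<Longrightarrow> \<exists>V. open_Rn n V \<and> x \<in> V \<and> V \<subseteq> U \<and> Ck_on n k V f"
  shows "Ck_on n k U f"
  using assms(2)
proof (induction k arbitrary: f)
  case 0
  have "continuous (at x within U) f" if x: "x \<in> U" for x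
  proof -
    obtain V where V: "open_Rn n V" "x \<in> V" "V \<subseteq> U" "continuous_on V f" using 0[OF x] by auto
    obtain T where T: "open T" "V = T \<inter> Rn n" using V(1) unfolding open_Rn_iff_open by blast
    have "at x within V = at x within U"
      by (rule at_within_nhd[of x T]) (use T V open_Rn_subset[OF assms(1)] in auto)
    then show ?thesis using V(2,4) by (metis continuous_on_eq_continuous_within)
  qed
  then show ?case by (simp add: continuous_on_eq_continuous_within)
next
  case (Suc k)
  have 1: "continuous_on U f"
  proof -
    have "\<exists>V. open_Rn n V \<and> x \<in> V \<and> V \<subseteq> U \<and> Ck_on n k V f" if "x \<in> U" for x
    proof -
      obtain V where V: "open_Rn n V" "x \<in> V" "V \<subseteq> U" "Ck_on n (Suc k) V f"
        using Suc.prems[OF \<open>x \<in> U\<close>] by blast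
      with Ck_on_mono[OF V(4)] show ?thesis by blast
    qed
    from Suc.IH[OF this] show ?thesis by (rule Ck_on_continuous)
  qed
  show ?case
  proof (rule Ck_on_SucI'[OF assms(1) 1])
    fix i x assume i: "i < n" and x: "x \<in> U"
    obtain V where "x \<in> V" "Ck_on n (Suc k) V f" using Suc.prems[OF x] by blast
    from Ck_on_line_derivative[OF this(2) i this(1)]
    show "((\<lambda>t. f (\<lambda>j. x j + t * unit_vec i j)) has_real_derivative pd i f x) (at 0)" .
  next
    fix i assume i: "i < n"
    have "\<exists>V. open_Rn n V \<and> x \<in> V \<and> V \<subseteq> U \<and> Ck_on n k V (pd i f)" if "x \<in> U" for x
    proof -
      obtain V where V: "open_Rn n V" "x \<in> V" "V \<subseteq> U" "Ck_on n (Suc k) V f"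
        using Suc.prems[OF \<open>x \<in> U\<close>] by blast
      with Ck_on_pd[OF V(4) i] show ?thesis by blast
    qed
    then show "Ck_on n k U (pd i f)" by (rule Suc.IH)
  qed
qed

lemma Ck_on_has_pd:
  assumes "Ck_on n (Suc k) U f" "i < n" "x \<in> U"
  shows "((\<lambda>t. f (x(i := t))) has_real_derivative pd i f x) (at (x i))"
proof -
  have "((\<lambda>t. f (x(i := x i + t))) has_real_derivative pd i f x) (at 0)"
    using Ck_on_line_derivative[OF assms] by (simp add: line_unit_vec)
  then show ?thesis
    using DERIV_shift[of "\<lambda>t. f (x(i := t))" "pd i f x" 0 "x i"] by (simp add: add.commute)
qed

section \<open>The C^1 estimate and the chain rule\<close>

lemma continuous_on_Rn_cube:
  fixes f :: "(nat \<Rightarrow> real) \<Rightarrow> real"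
  assumes "continuous_on U f" "open_Rn n U" "x \<in> U" "e > 0"
  obtains d where "d > 0" "cube n x d \<subseteq> U" "\<And>y. y \<in> cube n x d \<Longrightarrow> \<bar>f y - f x\<bar> < e"
proof -
  obtain T where T: "open T" "U = T \<inter> Rn n"
    using assms(2) open_Rn_iff_open by blast
  obtain A where A: "open A" "A \<inter> U = f -` ball (f x) e \<inter> U"
    using assms(1) unfolding continuous_on_open_invariant by blast
  have "open_Rn n (A \<inter> U)"
    unfolding open_Rn_iff_open using T A(1) by (intro exI[of _ "A \<inter> T"]) auto
  moreover have "x \<in> A \<inter> U" using A assms by auto
  ultimately obtain d where "d > 0" "cube n x d \<subseteq> A \<inter> U"
    by (rule open_Rn_contains_cube)
  then have "cube n x d \<subseteq> U" "\<bar>f y - f x\<bar> < e" if "y \<in> cube n x d" for y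
    using A(2) that by (auto simp: dist_real_def abs_minus_commute)
  with \<open>d > 0\<close> show ?thesis using center_in_cube[OF _ \<open>d > 0\<close>] assms(3) open_Rn_subset[OF assms(2)]
    by (intro that[of d]) blast+
qed

text \<open>The mean value inequality for \<open>g t - L * t\<close>, whose derivative has modulus
  at most \<open>e\<close>.\<close>

lemma real_derivative_bound:
  fixes g :: "real \<Rightarrow> real"
  assumes "\<And>t. t \<in> closed_segment a b \<Longrightarrow> (g has_real_derivative g' t) (at t)"
    and "\<And>t. t \<in> closed_segment a b \<Longrightarrow> \<bar>g' t - L\<bar> \<le> e"
  shows "\<bar>g b - g a - L * (b - a)\<bar> \<le> e * \<bar>b - a\<bar>"
proof -
  have "norm ((g b - L * b) - (g a - L * a)) \<le> e * norm (b - a)"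
  proof (rule field_differentiable_bound[of "closed_segment a b" _ "\<lambda>t. g' t - L"])
    fix t assume "t \<in> closed_segment a b"
    then show "((\<lambda>t. g t - L * t) has_real_derivative g' t - L) (at t within closed_segment a b)"
      by (auto intro!: derivative_eq_intros DERIV_subset[OF assms(1)])
  qed (use assms(2) in auto)
  then show ?thesis by (simp add: algebra_simps)
qed

text \<open>Continuity of the partial derivatives at \<open>x\<close> gives differentiability with a
  uniform error: pass from \<open>z\<close> to \<open>y\<close> by changing one coordinate at a time
  and apply the one-variable bound to each change.\<close>

lemma C1_estimate:
  assumes f: "Ck_on n (Suc 0) U f" and U: "open_Rn n U" and x: "x \<in> U" and e: "e > 0"
  obtains d where "d > 0" "cube n x d \<subseteq> U"
    "\<forall>y\<in>cube n x d. \<forall>z\<in>cube n x d.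
       \<bar>f y - f z - (\<Sum>i<n. pd i f x * (y i - z i))\<bar> \<le> e * (\<Sum>i<n. \<bar>y i - z i\<bar>)"
proof -
  have "\<exists>d>0. cube n x d \<subseteq> U \<and> (\<forall>y\<in>cube n x d. \<bar>pd i f y - pd i f x\<bar> < e)" if "i < n" for i
    using continuous_on_Rn_cube[OF _ U x e, of "pd i f"] f that by (metis Ck_on.simps(1) Ck_on_pd)
  then obtain D where D: "\<And>i. i < n \<Longrightarrow> D i > 0"
    "\<And>i y. i < n \<Longrightarrow> y \<in> cube n x (D i) \<Longrightarrow> \<bar>pd i f y - pd i f x\<bar> < e" by metis
  obtain d0 where d0: "d0 > 0" "cube n x d0 \<subseteq> U" using open_Rn_contains_cube[OF U x] .
  define d where "d = Min (insert d0 (D ` {..<n}))"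
  have d: "d > 0" "d \<le> d0" "\<And>i. i < n \<Longrightarrow> d \<le> D i"
    unfolding d_def using D(1) d0 by (auto simp: Min_gr_iff)
  have sub: "cube n x d \<subseteq> U" using cube_mono[OF d(2)] d0(2) by blast
  have "\<bar>f y - f z - (\<Sum>i<n. pd i f x * (y i - z i))\<bar> \<le> e * (\<Sum>i<n. \<bar>y i - z i\<bar>)"
    if y: "y \<in> cube n x d" and z: "z \<in> cube n x d" for y z
  proof -
    \<comment> \<open>The corners of the path: coordinates below \<open>k\<close> already come from
      \<open>y\<close>, the others still from \<open>z\<close>. The corners and the edges between
      them lie in the cube.\<close>
    define h where "h k = (\<lambda>j. if j < k then y j else z j)" for k
    have out: "y j = 0" "z j = 0" if "\<not> j < n" for j
      using y z that by (simp_all add: cube_def Rn_iff)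
    have hn: "h n = y" and h0: "h 0 = z"
      using out by (auto simp: h_def)
    have step: "\<bar>f (h (Suc k)) - f (h k) - pd k f x * (y k - z k)\<bar> \<le> e * \<bar>y k - z k\<bar>" if k: "k < n" for k
    proof -
      have hS: "h (Suc k) = (h k)(k := y k)" and hk: "h k = (h k)(k := z k)"
        by (auto simp: h_def fun_eq_iff)
      have inc: "(h k)(k := t) \<in> cube n x d" if "t \<in> closed_segment (z k) (y k)" for t
      proof -
        have "\<bar>z k - x k\<bar> < d" "\<bar>y k - x k\<bar> < d" using y z k by (auto simp: cube_def)
        then have "\<bar>t - x k\<bar> < d" using that unfolding closed_segment_eq_real_ivl by (auto split: if_splits)
        moreover have "\<bar>h k j - x j\<bar> < d" if "j < n" for j
          using y z that by (simp add: cube_def h_def)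
        moreover have "h k j = 0" if "n \<le> j" for j using out that by (simp add: h_def)
        ultimately show ?thesis using k by (simp add: cube_def Rn_iff)
      qed
      have "\<bar>f ((h k)(k := y k)) - f ((h k)(k := z k)) - pd k f x * (y k - z k)\<bar> \<le> e * \<bar>y k - z k\<bar>"
      proof (rule real_derivative_bound[where g = "\<lambda>t. f ((h k)(k := t))" and g' = "\<lambda>t. pd k f ((h k)(k := t))"])
        fix t assume t: "t \<in> closed_segment (z k) (y k)"
        have "(h k)(k := t) \<in> U" using inc[OF t] sub by auto
        from Ck_on_has_pd[OF f k this]
        show "((\<lambda>t. f ((h k)(k := t))) has_real_derivative pd k f ((h k)(k := t))) (at t)" by simp
        show "\<bar>pd k f ((h k)(k := t)) - pd k f x\<bar> \<le> e"
          using D(2)[OF k] inc[OF t] cube_mono[OF d(3)[OF k]] by (meson less_imp_le subsetD)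
      qed
      then show ?thesis using hS hk by simp
    qed
    have "f y - f z = (\<Sum>k<n. f (h (Suc k)) - f (h k))"
      by (simp add: sum_lessThan_telescope[of "\<lambda>k. f (h k)"] hn h0)
    then have "\<bar>f y - f z - (\<Sum>i<n. pd i f x * (y i - z i))\<bar> =
        \<bar>\<Sum>k<n. f (h (Suc k)) - f (h k) - pd k f x * (y k - z k)\<bar>"
      by (simp add: sum_subtractf)
    also have "\<dots> \<le> (\<Sum>k<n. \<bar>f (h (Suc k)) - f (h k) - pd k f x * (y k - z k)\<bar>)" by (rule sum_abs)
    also have "\<dots> \<le> (\<Sum>k<n. e * \<bar>y k - z k\<bar>)" by (intro sum_mono step) auto
    finally show ?thesis by (simp add: sum_distrib_left)
  qed
  then have "\<forall>y\<in>cube n x d. \<forall>z\<in>cube n x d.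
       \<bar>f y - f z - (\<Sum>i<n. pd i f x * (y i - z i))\<bar> \<le> e * (\<Sum>i<n. \<bar>y i - z i\<bar>)"
    by (intro ballI)
  with d(1) sub show ?thesis by (rule that)
qed

text \<open>Only the coordinates of the curve are known to be differentiable, so the proof works
  with their difference quotients \<open>q i\<close>: \<open>C1_estimate\<close> bounds the error by
  a small multiple of the sum of their moduli, which converges to \<open>K\<close>.\<close>

lemma chain_rule_curve:
  assumes f: "Ck_on n (Suc 0) U f" and U: "open_Rn n U" and c0: "c t0 \<in> U"
    and c: "\<And>i. i < n \<Longrightarrow> ((\<lambda>t. c t i) has_real_derivative c' i) (at t0)"
    and ev: "\<forall>\<^sub>F t in at t0. c t \<in> Rn n"
  shows "((\<lambda>t. f (c t)) has_real_derivative (\<Sum>i<n. pd i f (c t0) * c' i)) (at t0)"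
proof -
  define q where "q i t = (c t i - c t0 i) / (t - t0)" for i t
  define D where "D = (\<Sum>i<n. pd i f (c t0) * c' i)"
  have q: "(q i \<longlongrightarrow> c' i) (at t0)" if "i < n" for i
    using c[OF that] unfolding has_field_derivative_iff q_def .
  define K where "K = (\<Sum>i<n. \<bar>c' i\<bar>)"
  have K: "((\<lambda>t. \<Sum>i<n. \<bar>q i t\<bar>) \<longlongrightarrow> K) (at t0)"
    unfolding K_def by (intro tendsto_intros q) auto
  have K0: "K \<ge> 0" unfolding K_def by (intro sum_nonneg) auto
  have cc: "((\<lambda>t. c t i) \<longlongrightarrow> c t0 i) (at t0)" if "i < n" for i
    using DERIV_isCont[OF c[OF that]] by (simp add: isCont_def)
  have R: "((\<lambda>t. (f (c t) - f (c t0)) / (t - t0) - (\<Sum>i<n. pd i f (c t0) * q i t)) \<longlongrightarrow> 0) (at t0)"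
  proof (rule tendstoI)
    fix e :: real assume "e > 0"
    \<comment> \<open>\<open>K + 1\<close> eventually bounds the sum of the difference quotients, so
      the error stays below \<open>e' * (K + 1) = e\<close>.\<close>
    define e' where "e' = e / (K + 1)"
    have e': "e' > 0" using \<open>e > 0\<close> K0 by (simp add: e'_def)
    obtain d where d: "d > 0" "cube n (c t0) d \<subseteq> U"
      "\<forall>y\<in>cube n (c t0) d. \<forall>z\<in>cube n (c t0) d.
       \<bar>f y - f z - (\<Sum>i<n. pd i f (c t0) * (y i - z i))\<bar> \<le> e' * (\<Sum>i<n. \<bar>y i - z i\<bar>)"
      by (rule C1_estimate[OF f U c0 e'])
    have c0R: "c t0 \<in> Rn n" using c0 open_Rn_subset[OF U] by auto
    have 1: "\<forall>\<^sub>F t in at t0. c t \<in> cube n (c t0) d"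
      by (rule eventually_curve_in[OF open_Rn_cube center_in_cube[OF c0R d(1)] cc ev])
    have 2: "\<forall>\<^sub>F t in at t0. (\<Sum>i<n. \<bar>q i t\<bar>) < K + 1"
      by (rule order_tendstoD[OF K]) simp
    have 3: "\<forall>\<^sub>F t in at t0. t \<noteq> t0" by (simp add: eventually_at_filter)
    from 1 2 3 show "\<forall>\<^sub>F t in at t0. dist ((f (c t) - f (c t0)) / (t - t0) - (\<Sum>i<n. pd i f (c t0) * q i t)) 0 < e"
    proof eventually_elim
      case (elim t)
      have "(f (c t) - f (c t0)) / (t - t0) - (\<Sum>i<n. pd i f (c t0) * q i t)
          = (f (c t) - f (c t0) - (\<Sum>i<n. pd i f (c t0) * (c t i - c t0 i))) / (t - t0)"
        unfolding q_def times_divide_eq_right sum_divide_distrib[symmetric] diff_divide_distrib[symmetric] ..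
      moreover have "\<bar>\<dots>\<bar> \<le> e' * (\<Sum>i<n. \<bar>c t i - c t0 i\<bar>) / \<bar>t - t0\<bar>"
        using d(3) elim(1) center_in_cube[OF c0R d(1)] unfolding abs_divide
        by (intro divide_right_mono) auto
      moreover have "\<dots> = e' * (\<Sum>i<n. \<bar>q i t\<bar>)"
        unfolding q_def abs_divide sum_divide_distrib[symmetric] by simp
      moreover have "\<dots> < e' * (K + 1)" using elim(2) e' by simp
      moreover have "\<dots> = e" using K0 by (simp add: e'_def)
      ultimately show ?case by (simp add: dist_real_def)
    qed
  qed
  have "((\<lambda>t. \<Sum>i<n. pd i f (c t0) * q i t) \<longlongrightarrow> D) (at t0)"
    unfolding D_def by (intro tendsto_intros q) auto
  from tendsto_add[OF R this] have "((\<lambda>t. (f (c t) - f (c t0)) / (t - t0)) \<longlongrightarrow> D) (at t0)" by simp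
  then show ?thesis unfolding has_field_derivative_iff D_def .
qed

lemma C1_line_derivative:
  assumes "Ck_on n (Suc 0) U f" "open_Rn n U" "x \<in> U" "v \<in> Rn n"
  shows "((\<lambda>t. f (\<lambda>j. x j + t * v j)) has_real_derivative (\<Sum>i<n. pd i f x * v i)) (at 0)"
proof -
  have "x \<in> Rn n" using assms open_Rn_subset by blast
  have "((\<lambda>t. f (\<lambda>j. x j + t * v j)) has_real_derivative
      (\<Sum>i<n. pd i f (\<lambda>j. x j + 0 * v j) * v i)) (at 0)"
  proof (rule chain_rule_curve[where c = "\<lambda>t j. x j + t * v j", OF assms(1,2)])
    show "((\<lambda>t. x i + t * v i) has_real_derivative v i) (at 0)" for i
      by (auto intro!: derivative_eq_intros)
    show "\<forall>\<^sub>F t in at 0. (\<lambda>j. x j + t * v j) \<in> Rn n"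
      using line_Rn[OF \<open>x \<in> Rn n\<close> assms(4)] by simp
  qed (use assms(3) in simp)
  then show ?thesis by simp
qed

lemma dir_deriv_eq_sum:
  assumes "Ck_on n (Suc 0) U f" "open_Rn n U" "x \<in> U" "v \<in> Rn n"
  shows "dir_deriv f x v = (\<Sum>i<n. pd i f x * v i)"
  by (rule dir_deriv_eqI[OF C1_line_derivative[OF assms]])

section \<open>Closure properties of C^k functions\<close>

lemma Ck_on_const: "open_Rn n U \<Longrightarrow> Ck_on n k U (\<lambda>x. c)"
proof (induction k arbitrary: c)
  case (Suc k)
  show ?case
  proof (rule Ck_on_SucI'[OF Suc.prems, where f' = "\<lambda>_ _. 0"])
    show "Ck_on n k U (\<lambda>_. 0)" using Suc by blast
  qed simp_all
qed simp

lemma Ck_on_add: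
  assumes U: "open_Rn n U"
  shows "Ck_on n k U f \<Longrightarrow> Ck_on n k U g \<Longrightarrow> Ck_on n k U (\<lambda>x. f x + g x)"
proof (induction k arbitrary: f g)
  case (Suc k)
  then have c: "continuous_on U (\<lambda>x. f x + g x)"
    by (intro continuous_on_add Ck_on_continuous)
  show ?case
  proof (rule Ck_on_SucI'[OF U c, where f' = "\<lambda>i x. pd i f x + pd i g x"])
    fix i x assume "i < n" "x \<in> U"
    then show "((\<lambda>t. f (\<lambda>j. x j + t * unit_vec i j) + g (\<lambda>j. x j + t * unit_vec i j))
       has_real_derivative pd i f x + pd i g x) (at 0)"
      by (intro DERIV_add Ck_on_line_derivative[OF Suc.prems(1)] Ck_on_line_derivative[OF Suc.prems(2)])
  next
    fix i assume "i < n"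
    then show "Ck_on n k U (\<lambda>x. pd i f x + pd i g x)"
      by (intro Suc.IH Ck_on_pd[OF Suc.prems(1)] Ck_on_pd[OF Suc.prems(2)])
  qed
qed (simp add: continuous_on_add)

lemma Ck_on_mult:
  assumes U: "open_Rn n U"
  shows "Ck_on n k U f \<Longrightarrow> Ck_on n k U g \<Longrightarrow> Ck_on n k U (\<lambda>x. f x * g x)"
proof (induction k arbitrary: f g)
  case (Suc k)
  then have c: "continuous_on U (\<lambda>x. f x * g x)"
    by (intro continuous_on_mult Ck_on_continuous)
  show ?case
  proof (rule Ck_on_SucI'[OF U c, where f' = "\<lambda>i x. pd i f x * g x + f x * pd i g x"])
    fix i x assume "i < n" "x \<in> U"
    then show "((\<lambda>t. f (\<lambda>j. x j + t * unit_vec i j) * g (\<lambda>j. x j + t * unit_vec i j))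
       has_real_derivative pd i f x * g x + f x * pd i g x) (at 0)"
      using DERIV_mult[OF Ck_on_line_derivative[OF Suc.prems(1)] Ck_on_line_derivative[OF Suc.prems(2)]]
      by (simp add: algebra_simps)
  next
    fix i assume "i < n"
    then show "Ck_on n k U (\<lambda>x. pd i f x * g x + f x * pd i g x)"
      by (intro Ck_on_add[OF U] Suc.IH Ck_on_pd[OF Suc.prems(1)] Ck_on_pd[OF Suc.prems(2)]
          Ck_on_mono[OF Suc.prems(1)] Ck_on_mono[OF Suc.prems(2)])
  qed
qed (simp add: continuous_on_mult)

lemma Ck_on_sum:
  assumes "open_Rn n U"
  shows "(\<And>i. i \<in> I \<Longrightarrow> Ck_on n k U (f i)) \<Longrightarrow> Ck_on n k U (\<lambda>x. \<Sum>i\<in>I. f i x)"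
  by (induction I rule: infinite_finite_induct) (auto intro: Ck_on_add Ck_on_const assms)

lemma Ck_on_proj: "open_Rn n U \<Longrightarrow> Ck_on n k U (\<lambda>x. x j)"
proof (induction k)
  case (Suc k)
  have c: "continuous_on U (\<lambda>x. x j)"
    by (rule continuous_on_subset[OF continuous_on_product_coordinates subset_UNIV])
  show ?case
  proof (rule Ck_on_SucI'[OF Suc.prems c, where f' = "\<lambda>i x. unit_vec i j"])
    show "((\<lambda>t. x j + t * unit_vec i j) has_real_derivative unit_vec i j) (at 0)" for i and x :: "nat \<Rightarrow> real"
      by (auto intro!: derivative_eq_intros)
  qed (rule Ck_on_const[OF Suc.prems])
qed (simp add: continuous_on_subset[OF continuous_on_product_coordinates subset_UNIV])

lemma Ck_on_inverse:
  assumes U: "open_Rn n U"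
  shows "Ck_on n k U f \<Longrightarrow> (\<And>x. x \<in> U \<Longrightarrow> f x \<noteq> 0) \<Longrightarrow> Ck_on n k U (\<lambda>x. inverse (f x))"
proof (induction k arbitrary: f)
  case (Suc k)
  then have c: "continuous_on U (\<lambda>x. inverse (f x))"
    by (intro continuous_on_inverse Ck_on_continuous[of n "Suc k"]) auto
  show ?case
  proof (rule Ck_on_SucI'[OF U c, where f' = "\<lambda>i x. (-1 * pd i f x) * (inverse (f x) * inverse (f x))"])
    fix i x assume i: "i < n" and x: "x \<in> U"
    have nz: "f (\<lambda>j. x j + 0 * unit_vec i j) \<noteq> 0" using Suc.prems(2)[OF x] by simp
    show "((\<lambda>t. inverse (f (\<lambda>j. x j + t * unit_vec i j)))
       has_real_derivative (-1 * pd i f x) * (inverse (f x) * inverse (f x))) (at 0)"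
      using DERIV_inverse'[OF Ck_on_line_derivative[OF Suc.prems(1) i x] nz] by (simp add: mult_ac)
  next
    fix i assume "i < n"
    then show "Ck_on n k U (\<lambda>x. (-1 * pd i f x) * (inverse (f x) * inverse (f x)))"
      by (intro Ck_on_mult[OF U] Suc.IH Ck_on_pd[OF Suc.prems(1)] Ck_on_mono[OF Suc.prems(1)]
          Ck_on_const[OF U] Suc.prems(2))
  qed
qed (simp add: continuous_on_inverse)

lemma continuous_on_into_Rn:
  assumes "\<And>x. x \<in> U \<Longrightarrow> h x \<in> Rn p" "\<And>j. j < p \<Longrightarrow> continuous_on U (\<lambda>x. h x j)"
  shows "continuous_on U h"
proof (rule continuous_on_coordinatewise_then_product)
  fix j
  show "continuous_on U (\<lambda>x. h x j)"
  proof (cases "j < p")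
    case False
    then have "h x j = 0" if "x \<in> U" for x using assms(1)[OF that] by (simp add: Rn_iff)
    then show ?thesis by (simp cong: continuous_on_cong)
  qed (rule assms(2))
qed

lemma compose_line_derivative:
  assumes f: "Ck_on p (Suc k) V f" and V: "open_Rn p V" and U: "open_Rn n U"
    and h: "\<And>x. x \<in> U \<Longrightarrow> h x \<in> V" "\<And>j. j < p \<Longrightarrow> Ck_on n (Suc k') U (\<lambda>x. h x j)"
    and x: "x \<in> U" and v: "v \<in> Rn n"
  shows "((\<lambda>t. f (h (\<lambda>j. x j + t * v j))) has_real_derivative
           (\<Sum>j<p. pd j f (h x) * dir_deriv (\<lambda>y. h y j) x v)) (at 0)"
proof -
  have C1: "Ck_on m (Suc k) W g \<Longrightarrow> Ck_on m (Suc 0) W g" for m k W g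
    by (induction k) (use Ck_on_mono in blast)+
  have "\<forall>\<^sub>F t in at 0. (\<lambda>j. x j + t * v j) \<in> U"
    using eventually_line_in[OF U x v] by (simp add: eventually_at_filter eventually_mono)
  then have ev: "\<forall>\<^sub>F t in at 0. h (\<lambda>j. x j + t * v j) \<in> Rn p"
    by eventually_elim (use h(1) open_Rn_subset[OF V] in blast)
  have "((\<lambda>t. f (h (\<lambda>j. x j + t * v j))) has_real_derivative
      (\<Sum>j<p. pd j f (h (\<lambda>j. x j + 0 * v j)) * dir_deriv (\<lambda>y. h y j) x v)) (at 0)"
  proof (rule chain_rule_curve[OF C1[OF f] V _ _ ev])
    fix i assume "i < p"
    then show "((\<lambda>t. h (\<lambda>j. x j + t * v j) i) has_real_derivative dir_deriv (\<lambda>y. h y i) x v) (at 0)"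
      using C1_line_derivative[OF C1[OF h(2)] U x v] dir_deriv_eq_sum[OF C1[OF h(2)] U x v] by simp
  qed (use h(1) x in simp)
  then show ?thesis by simp
qed

text \<open>By the chain rule the partial derivatives of the composite are sums of products. The
  factor that evaluates \<open>pd j f\<close> along \<open>h\<close> is covered by the induction
  hypothesis, which is therefore general in \<open>f\<close>.\<close>

lemma Ck_on_compose:
  assumes V: "open_Rn p V" and U: "open_Rn n U"
    and h: "\<And>x. x \<in> U \<Longrightarrow> h x \<in> V"
  shows "Ck_on p k V f \<Longrightarrow> (\<And>j. j < p \<Longrightarrow> Ck_on n k U (\<lambda>x. h x j)) \<Longrightarrow> Ck_on n k U (\<lambda>x. f (h x))"
proof (induction k arbitrary: f)
  case 0
  have "continuous_on U h"
    using 0(2) h open_Rn_subset[OF V] by (intro continuous_on_into_Rn[of U h p]) auto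
  then have "continuous_on U (\<lambda>x. f (h x))"
    using 0(1) h by (intro continuous_on_compose2[of V f U h]) (auto simp: image_subset_iff)
  then show ?case by simp
next
  case (Suc k)
  have "continuous_on U h"
    using Ck_on_continuous[OF Suc.prems(2)] h open_Rn_subset[OF V]
    by (intro continuous_on_into_Rn[of U h p]) auto
  then have c: "continuous_on U (\<lambda>x. f (h x))"
    using Ck_on_continuous[OF Suc.prems(1)] h
    by (intro continuous_on_compose2[of V f U h]) (auto simp: image_subset_iff)
  show ?case
  proof (rule Ck_on_SucI'[OF U c, where f' = "\<lambda>i x. \<Sum>j<p. pd j f (h x) * pd i (\<lambda>y. h y j) x"])
    fix i x assume i: "i < n" and x: "x \<in> U"
    show "((\<lambda>t. f (h (\<lambda>j. x j + t * unit_vec i j))) has_real_derivative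
       (\<Sum>j<p. pd j f (h x) * pd i (\<lambda>y. h y j) x)) (at 0)"
      by (rule compose_line_derivative[OF Suc.prems(1) V U h Suc.prems(2) x unit_vec_Rn[OF i]])
  next
    fix i assume i: "i < n"
    show "Ck_on n k U (\<lambda>x. \<Sum>j<p. pd j f (h x) * pd i (\<lambda>y. h y j) x)"
    proof (intro Ck_on_sum[OF U] Ck_on_mult[OF U])
      fix j assume "j \<in> {..<p}"
      then have j: "j < p" by simp
      show "Ck_on n k U (pd i (\<lambda>y. h y j))" using Suc.prems(2)[OF j] i by (rule Ck_on_pd)
      show "Ck_on n k U (\<lambda>x. pd j f (h x))"
        by (rule Suc.IH[of "pd j f", OF Ck_on_pd[OF Suc.prems(1) j] Ck_on_mono[OF Suc.prems(2)]])
    qed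
  qed
qed

section \<open>Smooth functions and smooth maps\<close>

lemma smooth_fun_cong:
  "open_Rn n U \<Longrightarrow> smooth_fun n U f \<Longrightarrow> (\<And>x. x \<in> U \<Longrightarrow> f x = g x) \<Longrightarrow> smooth_fun n U g"
  unfolding smooth_fun_def using Ck_on_cong by blast

lemma smooth_fun_subset: "smooth_fun n U f \<Longrightarrow> V \<subseteq> U \<Longrightarrow> smooth_fun n V f"
  unfolding smooth_fun_def using Ck_on_subset by blast

lemma smooth_fun_local:
  assumes "open_Rn n U"
    and "\<And>x. x \<in> U \<Longrightarrow> \<exists>V. open_Rn n V \<and> x \<in> V \<and> V \<subseteq> U \<and> smooth_fun n V f"
  shows "smooth_fun n U f"
  unfolding smooth_fun_def
proof
  fix k
  show "Ck_on n k U f"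
  proof (rule Ck_on_local[OF assms(1)])
    fix x assume "x \<in> U"
    then show "\<exists>V. open_Rn n V \<and> x \<in> V \<and> V \<subseteq> U \<and> Ck_on n k V f"
      using assms(2)[of x] unfolding smooth_fun_def by blast
  qed
qed

lemma smooth_fun_continuous: "smooth_fun n U f \<Longrightarrow> continuous_on U f"
  unfolding smooth_fun_def using Ck_on_continuous by blast

lemma smooth_fun_const: "open_Rn n U \<Longrightarrow> smooth_fun n U (\<lambda>x. c)"
  and smooth_fun_proj: "open_Rn n U \<Longrightarrow> smooth_fun n U (\<lambda>x. x j)"
  by (simp_all add: smooth_fun_def Ck_on_const Ck_on_proj)

lemma smooth_fun_add:
  "open_Rn n U \<Longrightarrow> smooth_fun n U f \<Longrightarrow> smooth_fun n U g \<Longrightarrow> smooth_fun n U (\<lambda>x. f x + g x)"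
  and smooth_fun_mult:
  "open_Rn n U \<Longrightarrow> smooth_fun n U f \<Longrightarrow> smooth_fun n U g \<Longrightarrow> smooth_fun n U (\<lambda>x. f x * g x)"
  and smooth_fun_inverse:
  "open_Rn n U \<Longrightarrow> smooth_fun n U f \<Longrightarrow> (\<And>x. x \<in> U \<Longrightarrow> f x \<noteq> 0) \<Longrightarrow> smooth_fun n U (\<lambda>x. inverse (f x))"
  by (simp_all add: smooth_fun_def Ck_on_add Ck_on_mult Ck_on_inverse)

lemma smooth_fun_diff:
  assumes "open_Rn n U" "smooth_fun n U f" "smooth_fun n U g"
  shows "smooth_fun n U (\<lambda>x. f x - g x)"
  using smooth_fun_add[OF assms(1,2) smooth_fun_mult[OF assms(1) smooth_fun_const[OF assms(1), of "-1"] assms(3)]]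
  by simp

lemma smooth_fun_sum:
  "open_Rn n U \<Longrightarrow> (\<And>i. i \<in> I \<Longrightarrow> smooth_fun n U (f i)) \<Longrightarrow> smooth_fun n U (\<lambda>x. \<Sum>i\<in>I. f i x)"
  by (simp add: smooth_fun_def Ck_on_sum)

lemma smooth_fun_pd: "smooth_fun n U f \<Longrightarrow> i < n \<Longrightarrow> smooth_fun n U (pd i f)"
  unfolding smooth_fun_def using Ck_on_pd by blast

lemma smooth_fun_C1: "smooth_fun n U f \<Longrightarrow> Ck_on n (Suc 0) U f"
  by (simp add: smooth_fun_def)

lemmas dir_deriv_smooth_eq_sum = dir_deriv_eq_sum[OF smooth_fun_C1]

lemma smooth_fun_line_derivative:
  assumes "smooth_fun n U f" "open_Rn n U" "x \<in> U" "v \<in> Rn n"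
  shows "((\<lambda>t. f (\<lambda>j. x j + t * v j)) has_real_derivative dir_deriv f x v) (at 0)"
  using C1_line_derivative[OF smooth_fun_C1] dir_deriv_smooth_eq_sum assms by simp

lemma smooth_fun_line_derivative_at:
  assumes "smooth_fun n U f" "open_Rn n U" "(\<lambda>j. x j + s * v j) \<in> U" "v \<in> Rn n"
  shows "((\<lambda>t. f (\<lambda>j. x j + t * v j)) has_real_derivative dir_deriv f (\<lambda>j. x j + s * v j) v) (at s)"
proof -
  have "((\<lambda>t. f (\<lambda>j. (x j + s * v j) + t * v j)) has_real_derivative dir_deriv f (\<lambda>j. x j + s * v j) v) (at 0)"
    by (rule smooth_fun_line_derivative[OF assms])
  then have "((\<lambda>t. f (\<lambda>j. x j + (t + s) * v j)) has_real_derivative dir_deriv f (\<lambda>j. x j + s * v j) v) (at 0)"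
    by (simp add: algebra_simps)
  then show ?thesis
    using DERIV_shift[of "\<lambda>t. f (\<lambda>j. x j + t * v j)" _ 0 s] by simp
qed

lemma dir_deriv_linear:
  assumes "smooth_fun n U f" "open_Rn n U" "x \<in> U" "a \<in> Rn n" "b \<in> Rn n"
  shows "dir_deriv f x (\<lambda>j. r * a j + s * b j) = r * dir_deriv f x a + s * dir_deriv f x b"
proof -
  have "(\<lambda>j. r * a j + s * b j) \<in> Rn n" using assms(4,5) by (simp add: Rn_iff)
  then show ?thesis
    by (simp add: dir_deriv_smooth_eq_sum[OF assms(1-3)] assms(4,5) sum.distrib sum_distrib_left algebra_simps)
qed

lemma dir_deriv_zero [simp]: "dir_deriv f x (\<lambda>j. 0) = 0"
  by (rule dir_deriv_eqI) simp

lemma smooth_fun_dir_deriv: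
  assumes f: "smooth_fun n U f" and U: "open_Rn n U"
    and w: "\<And>x. x \<in> U \<Longrightarrow> w x \<in> Rn n" "\<And>j. j < n \<Longrightarrow> smooth_fun n U (\<lambda>x. w x j)"
  shows "smooth_fun n U (\<lambda>x. dir_deriv f x (w x))"
proof (rule smooth_fun_cong[OF U])
  show "smooth_fun n U (\<lambda>x. \<Sum>i<n. pd i f x * w x i)"
    using smooth_fun_sum[OF U, of "{..<n}" "\<lambda>i x. pd i f x * w x i"]
      smooth_fun_mult[OF U smooth_fun_pd[OF f] w(2)] by simp
qed (simp add: dir_deriv_smooth_eq_sum[OF f U] w(1))

lemma dir_deriv_add:
  assumes "smooth_fun n U f" "smooth_fun n U g" "open_Rn n U" "x \<in> U" "v \<in> Rn n"
  shows "dir_deriv (\<lambda>y. f y + g y) x v = dir_deriv f x v + dir_deriv g x v"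
  using assms by (intro dir_deriv_eqI DERIV_add smooth_fun_line_derivative)

lemma dir_deriv_cmult:
  assumes "smooth_fun n U f" "open_Rn n U" "x \<in> U" "v \<in> Rn n"
  shows "dir_deriv (\<lambda>y. c * f y) x v = c * dir_deriv f x v"
  using assms by (intro dir_deriv_eqI DERIV_cmult smooth_fun_line_derivative)

lemma dir_deriv_sum:
  assumes "\<And>i. i \<in> I \<Longrightarrow> smooth_fun n U (f i)" "open_Rn n U" "x \<in> U" "v \<in> Rn n"
  shows "dir_deriv (\<lambda>y. \<Sum>i\<in>I. f i y) x v = (\<Sum>i\<in>I. dir_deriv (f i) x v)"
  using assms by (intro dir_deriv_eqI DERIV_sum smooth_fun_line_derivative)

lemma dir_deriv_mult:
  assumes "smooth_fun n U f" "smooth_fun n U g" "open_Rn n U" "x \<in> U" "v \<in> Rn n"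
  shows "dir_deriv (\<lambda>y. f y * g y) x v = dir_deriv f x v * g x + f x * dir_deriv g x v"
  using DERIV_mult[OF smooth_fun_line_derivative[OF assms(1,3-5)] smooth_fun_line_derivative[OF assms(2-5)]]
  by (intro dir_deriv_eqI) (simp add: algebra_simps)

lemma dir_deriv_proj: "dir_deriv (\<lambda>y. y j) x v = v j"
  by (rule dir_deriv_eqI) (auto intro!: derivative_eq_intros)

lemma smooth_mapI:
  "(\<And>x. x \<in> U \<Longrightarrow> f x \<in> V) \<Longrightarrow> (\<And>j. j < p \<Longrightarrow> smooth_fun n U (\<lambda>x. f x j)) \<Longrightarrow> smooth_map n U p V f"
  by (simp add: smooth_map_def)

lemma smooth_map_in: "smooth_map n U p V f \<Longrightarrow> x \<in> U \<Longrightarrow> f x \<in> V"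
  by (auto simp: smooth_map_def)

lemma smooth_map_comp: "smooth_map n U p V f \<Longrightarrow> j < p \<Longrightarrow> smooth_fun n U (\<lambda>x. f x j)"
  by (simp add: smooth_map_def)

text \<open>\<open>smooth_map\<close> constrains only the coordinates below \<open>p\<close>; from
  \<open>p\<close> on the values vanish because \<open>V\<close> lies in
  \<open>Rn p\<close>.\<close>

lemma smooth_map_coord:
  assumes "smooth_map n U p V f" "V \<subseteq> Rn p" "open_Rn n U"
  shows "smooth_fun n U (\<lambda>x. f x j)"
proof (cases "j < p")
  case False
  then have "0 = f x j" if "x \<in> U" for x
    using smooth_map_in[OF assms(1) that] assms(2) by (auto simp: Rn_iff)
  then show ?thesis by (rule smooth_fun_cong[OF assms(3) smooth_fun_const[OF assms(3)]])
qed (rule smooth_map_comp[OF assms(1)])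

lemma smooth_map_subset: "smooth_map n U p V f \<Longrightarrow> U' \<subseteq> U \<Longrightarrow> V \<subseteq> V' \<Longrightarrow> smooth_map n U' p V' f"
  unfolding smooth_map_def using smooth_fun_subset by blast

lemma smooth_map_into: "smooth_map n U p V f \<Longrightarrow> (\<And>x. x \<in> U \<Longrightarrow> f x \<in> W) \<Longrightarrow> smooth_map n U p W f"
  by (simp add: smooth_map_def)

lemma smooth_map_cong:
  assumes "open_Rn n U" "smooth_map n U p V f" "\<And>x. x \<in> U \<Longrightarrow> f x = g x"
  shows "smooth_map n U p V g"
proof (rule smooth_mapI)
  show "g x \<in> V" if "x \<in> U" for x using smooth_map_in[OF assms(2) that] assms(3)[OF that] by simp
  show "smooth_fun n U (\<lambda>x. g x j)" if "j < p" for j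
    by (rule smooth_fun_cong[OF assms(1) smooth_map_comp[OF assms(2) that]]) (simp add: assms(3))
qed

lemma smooth_map_local:
  assumes "open_Rn n U"
    and "\<And>x. x \<in> U \<Longrightarrow> \<exists>V. open_Rn n V \<and> x \<in> V \<and> V \<subseteq> U \<and> smooth_map n V p W f"
  shows "smooth_map n U p W f"
proof (rule smooth_mapI)
  show "f x \<in> W" if "x \<in> U" for x using assms(2)[OF that] smooth_map_in by blast
  show "smooth_fun n U (\<lambda>x. f x j)" if "j < p" for j
  proof (rule smooth_fun_local[OF assms(1)])
    fix x assume "x \<in> U"
    then show "\<exists>V. open_Rn n V \<and> x \<in> V \<and> V \<subseteq> U \<and> smooth_fun n V (\<lambda>x. f x j)"
      using assms(2)[of x] smooth_map_comp[OF _ that] by blast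
  qed
qed

lemma smooth_map_id: "open_Rn n U \<Longrightarrow> smooth_map n U n U (\<lambda>x. x)"
  by (simp add: smooth_map_def smooth_fun_proj)

lemma smooth_map_const: "open_Rn n U \<Longrightarrow> c \<in> V \<Longrightarrow> smooth_map n U p V (\<lambda>x. c)"
  by (simp add: smooth_map_def smooth_fun_const)

lemma smooth_fun_compose:
  assumes "smooth_map n U p V h" "open_Rn n U" "open_Rn p V" "smooth_fun p V f"
  shows "smooth_fun n U (\<lambda>x. f (h x))"
  unfolding smooth_fun_def
proof
  fix k
  show "Ck_on n k U (\<lambda>x. f (h x))"
    using assms by (intro Ck_on_compose[of p V n U h k f]) (auto simp: smooth_map_def smooth_fun_def)
qed

lemma smooth_map_compose:
  assumes "smooth_map n U p V h" "open_Rn n U" "open_Rn p V" "smooth_map p V q W g"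
  shows "smooth_map n U q W (\<lambda>x. g (h x))"
proof (rule smooth_mapI)
  show "g (h x) \<in> W" if "x \<in> U" for x by (intro smooth_map_in[OF assms(4)] smooth_map_in[OF assms(1)] that)
  show "smooth_fun n U (\<lambda>x. g (h x) j)" if "j < q" for j
    by (rule smooth_fun_compose[OF assms(1-3) smooth_map_comp[OF assms(4) that]])
qed

lemma smooth_map_continuous_on:
  assumes "smooth_map n U p V h" "V \<subseteq> Rn p"
  shows "continuous_on U h"
  using assms smooth_map_in[OF assms(1)] smooth_fun_continuous[OF smooth_map_comp[OF assms(1)]]
  by (intro continuous_on_into_Rn[of U h p]) auto

lemma smooth_map_continuous_map:
  assumes "smooth_map n U p V h" "open_Rn n U" "V \<subseteq> Rn p"
  shows "continuous_map (subtopology (Euclidean_space n) U) (Euclidean_space p) h"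
proof -
  have "Rn n \<inter> U = U" using open_Rn_subset[OF assms(2)] by blast
  then show ?thesis
    using smooth_map_continuous_on[OF assms(1,3)] smooth_map_in[OF assms(1)] assms(3)
    unfolding cm_Euclidean_space_iff_continuous_on by auto
qed

lemma smooth_map_preimage_open:
  assumes "smooth_map n U p V h" "open_Rn n U" "V \<subseteq> Rn p" "open_Rn p W"
  shows "open_Rn n {x \<in> U. h x \<in> W}"
proof -
  have "openin (subtopology (Euclidean_space n) U) {x \<in> topspace (subtopology (Euclidean_space n) U). h x \<in> W}"
    by (rule openin_continuous_map_preimage[OF smooth_map_continuous_map[OF assms(1-3)] assms(4)])
  moreover have "topspace (subtopology (Euclidean_space n) U) = U"
    using open_Rn_subset[OF assms(2)] by auto
  ultimately show ?thesis using assms(2) openin_trans_full by fastforce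
qed

section \<open>Tangent maps\<close>

lemma tangent_map_Rn:
  assumes "smooth_map n U p V f" "open_Rn n U" "V \<subseteq> Rn p" "x \<in> U" "v \<in> Rn n"
  shows "tangent_map f x v \<in> Rn p"
  unfolding Rn_iff
proof (intro allI impI)
  fix j assume "p \<le> j"
  then have "f y j = 0" if "y \<in> U" for y
    using smooth_map_in[OF assms(1) that] assms(3) by (auto simp: Rn_iff)
  then show "tangent_map f x v j = 0"
    unfolding tangent_map_def using dir_deriv_cong[OF assms(2,4,5), of "\<lambda>y. f y j" "\<lambda>y. 0"] by simp
qed

lemma tangent_map_cong:
  assumes "open_Rn n U" "x \<in> U" "v \<in> Rn n" "\<And>y. y \<in> U \<Longrightarrow> f y = g y"
  shows "tangent_map f x v = tangent_map g x v"
  unfolding tangent_map_def using assms(4)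
  by (intro ext dir_deriv_cong[OF assms(1-3)]) simp

lemma tangent_map_id: "tangent_map (\<lambda>y. y) x v = v"
  by (simp add: tangent_map_def dir_deriv_proj)

lemma tangent_map_const: "tangent_map (\<lambda>y. c) x v = (\<lambda>j. 0)"
  by (simp add: tangent_map_def)

lemma tangent_map_zero: "tangent_map f x (\<lambda>j. 0) = (\<lambda>j. 0)"
  by (simp add: tangent_map_def)

lemma tangent_map_linear:
  assumes "smooth_map n U p V f" "open_Rn n U" "V \<subseteq> Rn p" "x \<in> U" "a \<in> Rn n" "b \<in> Rn n"
  shows "tangent_map f x (\<lambda>j. r * a j + s * b j) =
    (\<lambda>j. r * tangent_map f x a j + s * tangent_map f x b j)"
  unfolding tangent_map_def
  by (intro ext dir_deriv_linear[OF smooth_map_coord[OF assms(1,3,2)] assms(2,4-6)])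

lemma dir_deriv_compose:
  assumes "smooth_map n U p V h" "open_Rn n U" "open_Rn p V" "smooth_fun p V f" "x \<in> U" "v \<in> Rn n"
  shows "dir_deriv (\<lambda>y. f (h y)) x v = dir_deriv f (h x) (tangent_map h x v)"
proof -
  have "((\<lambda>t. f (h (\<lambda>j. x j + t * v j))) has_real_derivative
           (\<Sum>j<p. pd j f (h x) * dir_deriv (\<lambda>y. h y j) x v)) (at 0)"
  proof (rule compose_line_derivative[OF smooth_fun_C1[OF assms(4)] assms(3,2) _ _ assms(5,6)])
    show "Ck_on n (Suc 0) U (\<lambda>x. h x j)" if "j < p" for j
      by (rule smooth_fun_C1[OF smooth_map_comp[OF assms(1) that]])
  qed (rule smooth_map_in[OF assms(1)])
  then have "dir_deriv (\<lambda>y. f (h y)) x v = (\<Sum>j<p. pd j f (h x) * dir_deriv (\<lambda>y. h y j) x v)"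
    by (rule dir_deriv_eqI)
  also have "\<dots> = dir_deriv f (h x) (tangent_map h x v)"
    using dir_deriv_smooth_eq_sum[OF assms(4,3) smooth_map_in[OF assms(1,5)]
        tangent_map_Rn[OF assms(1,2) open_Rn_subset[OF assms(3)] assms(5,6)]]
    by (simp add: tangent_map_def)
  finally show ?thesis .
qed

lemma tangent_map_compose:
  assumes "smooth_map n U p V h" "open_Rn n U" "open_Rn p V" "smooth_map p V q W g" "W \<subseteq> Rn q"
    "x \<in> U" "v \<in> Rn n"
  shows "tangent_map (\<lambda>y. g (h y)) x v = tangent_map g (h x) (tangent_map h x v)"
  unfolding tangent_map_def[of g] tangent_map_def[of "\<lambda>y. g (h y)"]
  by (intro ext dir_deriv_compose[OF assms(1-3) smooth_map_coord[OF assms(4,5,3)] assms(6,7)])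

lemma smooth_map_tangent:
  assumes "smooth_map n U p V f" "open_Rn n U" "V \<subseteq> Rn p" "v \<in> Rn n"
  shows "smooth_map n U p (Rn p) (\<lambda>x. tangent_map f x v)"
proof (rule smooth_mapI)
  show "tangent_map f x v \<in> Rn p" if "x \<in> U" for x by (rule tangent_map_Rn[OF assms(1-3) that assms(4)])
  show "smooth_fun n U (\<lambda>x. tangent_map f x v j)" for j
    unfolding tangent_map_def
    using smooth_fun_dir_deriv[OF smooth_map_coord[OF assms(1,3,2)] assms(2), of "\<lambda>x. v" j] assms(4)
      smooth_fun_const[OF assms(2)] by simp
qed

section \<open>Symmetry of second derivatives\<close>

lemma second_difference:
  assumes f: "smooth_fun n U f" and U: "open_Rn n U" and u: "u \<in> Rn n" and v: "v \<in> Rn n" and "h > 0"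
    and P: "\<And>s t. 0 \<le> s \<Longrightarrow> s \<le> h \<Longrightarrow> 0 \<le> t \<Longrightarrow> t \<le> h \<Longrightarrow> (\<lambda>j. x j + s * u j + t * v j) \<in> U"
  obtains s t where "0 \<le> s" "s \<le> h" "0 \<le> t" "t \<le> h"
    "f (\<lambda>j. x j + h * u j + h * v j) - f (\<lambda>j. x j + h * u j) - f (\<lambda>j. x j + h * v j) + f x =
     h * h * dir_deriv (\<lambda>y. dir_deriv f y u) (\<lambda>j. x j + s * u j + t * v j) v"
proof -
  \<comment> \<open>The increment in direction \<open>v\<close> as a function of the position along
    \<open>u\<close>: \<open>\<phi> h - \<phi> 0\<close> is the second difference. The mean value
    theorem is applied first along \<open>u\<close> and then along \<open>v\<close>.\<close>
  define \<phi> where "\<phi> s = f (\<lambda>j. x j + s * u j + h * v j) - f (\<lambda>j. x j + s * u j)" for s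
  define \<phi>' where "\<phi>' s = dir_deriv f (\<lambda>j. x j + s * u j + h * v j) u - dir_deriv f (\<lambda>j. x j + s * u j) u" for s
  have "(\<phi> has_real_derivative \<phi>' s) (at s)" if "0 \<le> s" "s \<le> h" for s
  proof -
    have eq: "(\<lambda>j. x j + s * u j + h * v j) = (\<lambda>j. x j + h * v j + s * u j)" for s by (simp add: algebra_simps)
    have m: "(\<lambda>j. x j + h * v j + s * u j) \<in> U" "(\<lambda>j. x j + s * u j) \<in> U"
      using P[OF that, of h] P[OF that, of 0] \<open>h > 0\<close> by (simp_all add: eq)
    show ?thesis unfolding \<phi>_def \<phi>'_def eq
      using smooth_fun_line_derivative_at[OF f U m(1) u] smooth_fun_line_derivative_at[OF f U m(2) u]
      by (rule DERIV_diff)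
  qed
  then obtain s where s: "0 < s" "s < h" "\<phi> h - \<phi> 0 = (h - 0) * \<phi>' s"
    using MVT2[of 0 h \<phi> \<phi>'] \<open>h > 0\<close> by blast
  define \<psi> where "\<psi> t = dir_deriv f (\<lambda>j. x j + s * u j + t * v j) u" for t
  define \<psi>' where "\<psi>' t = dir_deriv (\<lambda>y. dir_deriv f y u) (\<lambda>j. x j + s * u j + t * v j) v" for t
  have g: "smooth_fun n U (\<lambda>y. dir_deriv f y u)"
    using smooth_fun_dir_deriv[OF f U, of "\<lambda>x. u"] u smooth_fun_const[OF U] by simp
  have "(\<psi> has_real_derivative \<psi>' t) (at t)" if "0 \<le> t" "t \<le> h" for t
    unfolding \<psi>_def \<psi>'_def
    by (rule smooth_fun_line_derivative_at[OF g U _ v, of "\<lambda>j. x j + s * u j"]) (use P s that in auto)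
  then obtain t where t: "0 < t" "t < h" "\<psi> h - \<psi> 0 = (h - 0) * \<psi>' t"
    using MVT2[of 0 h \<psi> \<psi>'] \<open>h > 0\<close> by blast
  have "\<phi>' s = \<psi> h - \<psi> 0" by (simp add: \<phi>'_def \<psi>_def)
  then have "\<phi> h - \<phi> 0 = h * h * \<psi>' t" using s(3) t(3) by simp
  then have "f (\<lambda>j. x j + h * u j + h * v j) - f (\<lambda>j. x j + h * u j) - f (\<lambda>j. x j + h * v j) + f x =
     h * h * dir_deriv (\<lambda>y. dir_deriv f y u) (\<lambda>j. x j + s * u j + t * v j) v"
    by (simp add: \<phi>_def \<psi>'_def)
  with s t show ?thesis by (intro that[of s t]) auto
qed

text \<open>Schwarz's theorem: the second difference is symmetric in \<open>u\<close> and
  \<open>v\<close>, so the two mixed derivatives agree when each is taken at a suitable point of a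
  small parallelogram; continuity carries the equality to \<open>x\<close>.\<close>

theorem dir_deriv_commute:
  assumes f: "smooth_fun n U f" and U: "open_Rn n U" and x: "x \<in> U" and u: "u \<in> Rn n" and v: "v \<in> Rn n"
  shows "dir_deriv (\<lambda>y. dir_deriv f y u) x v = dir_deriv (\<lambda>y. dir_deriv f y v) x u"
proof -
  define G where "G y = dir_deriv (\<lambda>y. dir_deriv f y u) y v" for y
  define H where "H y = dir_deriv (\<lambda>y. dir_deriv f y v) y u" for y
  have sm: "smooth_fun n U (\<lambda>y. dir_deriv g y w)" if "smooth_fun n U g" "w \<in> Rn n" for g w
    using smooth_fun_dir_deriv[OF that(1) U, of "\<lambda>x. w"] that(2) smooth_fun_const[OF U] by simp
  have GH: "continuous_on U G" "continuous_on U H"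
    unfolding G_def H_def
    using smooth_fun_continuous[OF sm[OF sm[OF f u] v]] smooth_fun_continuous[OF sm[OF sm[OF f v] u]] .
  have xR: "x \<in> Rn n" using x open_Rn_subset[OF U] by blast
  have "\<bar>G x - H x\<bar> < 2 * e" if e: "e > 0" for e
  proof -
    obtain d1 where d1: "d1 > 0" "cube n x d1 \<subseteq> U" "\<And>y. y \<in> cube n x d1 \<Longrightarrow> \<bar>G y - G x\<bar> < e"
      using continuous_on_Rn_cube[OF GH(1) U x e] by metis
    obtain d2 where d2: "d2 > 0" "cube n x d2 \<subseteq> U" "\<And>y. y \<in> cube n x d2 \<Longrightarrow> \<bar>H y - H x\<bar> < e"
      using continuous_on_Rn_cube[OF GH(2) U x e] by metis
    define d where "d = min d1 d2"
    define K where "K = (\<Sum>i<n. \<bar>u i\<bar> + \<bar>v i\<bar>)"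
    have K0: "K \<ge> 0" unfolding K_def by (intro sum_nonneg) auto
    \<comment> \<open>With this \<open>h\<close> the parallelogram with sides \<open>h * u\<close>
      and \<open>h * v\<close> fits into the cube of radius \<open>d\<close>; adding 1 to
      \<open>K\<close> avoids division by 0.\<close>
    define h where "h = d / (K + 1)"
    have d: "d > 0" using d1 d2 by (simp add: d_def)
    have h: "h > 0" using d K0 by (simp add: h_def)
    have in_cube: "(\<lambda>j. x j + s * u j + t * v j) \<in> cube n x d" if "0 \<le> s" "s \<le> h" "0 \<le> t" "t \<le> h" for s t
    proof -
      have "\<bar>s * u i + t * v i\<bar> < d" if i: "i < n" for i
      proof -
        have "\<bar>s * u i + t * v i\<bar> \<le> s * \<bar>u i\<bar> + t * \<bar>v i\<bar>"
          using \<open>0 \<le> s\<close> \<open>0 \<le> t\<close> abs_triangle_ineq[of "s * u i" "t * v i"] by (simp add: abs_mult)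
        also have "\<dots> \<le> h * \<bar>u i\<bar> + h * \<bar>v i\<bar>"
          using \<open>s \<le> h\<close> \<open>t \<le> h\<close> by (intro add_mono mult_right_mono) auto
        also have "\<dots> = h * (\<bar>u i\<bar> + \<bar>v i\<bar>)" by (simp add: algebra_simps)
        also have "\<dots> \<le> h * K"
          unfolding K_def using i h by (intro mult_left_mono member_le_sum) auto
        also have "\<dots> < h * (K + 1)" using h by simp
        also have "\<dots> = d" using K0 by (simp add: h_def)
        finally show ?thesis .
      qed
      then show ?thesis using xR u v by (auto simp: cube_def Rn_iff add.assoc)
    qed
    have sub: "cube n x d \<subseteq> U" "cube n x d \<subseteq> cube n x d1" "cube n x d \<subseteq> cube n x d2"
      using d1(2) cube_mono[of d d1] cube_mono[of d d2] by (auto simp: d_def)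
    obtain s t where st: "0 \<le> s" "s \<le> h" "0 \<le> t" "t \<le> h"
      "f (\<lambda>j. x j + h * u j + h * v j) - f (\<lambda>j. x j + h * u j) - f (\<lambda>j. x j + h * v j) + f x =
       h * h * G (\<lambda>j. x j + s * u j + t * v j)"
      by (rule second_difference[OF f U u v h subsetD[OF sub(1) in_cube], folded G_def])
    have in_cube': "(\<lambda>j. x j + s * v j + t * u j) \<in> cube n x d" if "0 \<le> s" "s \<le> h" "0 \<le> t" "t \<le> h" for s t
      using in_cube[of t s] that by (simp add: algebra_simps)
    obtain s' t' where st': "0 \<le> s'" "s' \<le> h" "0 \<le> t'" "t' \<le> h"
      "f (\<lambda>j. x j + h * v j + h * u j) - f (\<lambda>j. x j + h * v j) - f (\<lambda>j. x j + h * u j) + f x =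
       h * h * H (\<lambda>j. x j + s' * v j + t' * u j)"
      by (rule second_difference[OF f U v u h subsetD[OF sub(1) in_cube'], folded H_def])
    have "(\<lambda>j. x j + h * v j + h * u j) = (\<lambda>j. x j + h * u j + h * v j)" by (simp add: algebra_simps)
    with st(5) st'(5) have "h * h * G (\<lambda>j. x j + s * u j + t * v j) = h * h * H (\<lambda>j. x j + s' * v j + t' * u j)"
      by (simp only: algebra_simps)
    then have "G (\<lambda>j. x j + s * u j + t * v j) = H (\<lambda>j. x j + s' * v j + t' * u j)" using h by simp
    moreover have "\<bar>G (\<lambda>j. x j + s * u j + t * v j) - G x\<bar> < e"
      using d1(3) in_cube[OF st(1-4)] sub by blast
    moreover have "\<bar>H (\<lambda>j. x j + s' * v j + t' * u j) - H x\<bar> < e"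
      using d2(3) in_cube'[OF st'(1-4)] sub by blast
    ultimately show ?thesis by linarith
  qed
  from this[of "\<bar>G x - H x\<bar> / 2"] have "G x = H x" by fastforce
  then show ?thesis by (simp add: G_def H_def)
qed

section \<open>Differential forms on open subsets of Euclidean spaces\<close>

definition del :: "nat \<Rightarrow> 'b list \<Rightarrow> 'b list" where
  "del i v = take i v @ drop (Suc i) v"

text \<open>The coface map: the increasing enumeration of the numbers other than \<open>i\<close>.
  It translates positions in \<open>del i v\<close> to positions in \<open>v\<close>.\<close>

definition skip :: "nat \<Rightarrow> nat \<Rightarrow> nat" where
  "skip i a = (if a < i then a else Suc a)"

text \<open>The left inverse of \<open>skip i\<close>: for \<open>b \<noteq> i\<close> the position
  in \<open>del i v\<close> of the entry at position \<open>b\<close> of \<open>v\<close>.\<close>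

definition unskip :: "nat \<Rightarrow> nat \<Rightarrow> nat" where
  "unskip i b = (if b < i then b else b - 1)"

lemma skip_eq_iff: "i \<noteq> p \<Longrightarrow> skip i a = p \<longleftrightarrow> a = unskip i p"
  by (auto simp: skip_def unskip_def)

lemma unskip_less: "i < m \<Longrightarrow> b < m \<Longrightarrow> i \<noteq> b \<Longrightarrow> unskip i b < m - 1"
  by (auto simp: unskip_def)

text \<open>A simplicial identity: both sides enumerate the numbers other than \<open>i\<close> and
  \<open>b\<close> in increasing order.\<close>

lemma skip_unskip_commute: "i \<noteq> b \<Longrightarrow> skip i (skip (unskip i b) c) = skip b (skip (unskip b i) c)"
  by (cases "i < b"; cases "c < i"; cases "c < b"; cases "Suc c < b"; cases "Suc c < i"; simp add: skip_def unskip_def)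

lemma length_del [simp]: "i < length v \<Longrightarrow> length (del i v) = length v - 1"
  by (simp add: del_def)

lemma nth_del: "i < length v \<Longrightarrow> a < length v - 1 \<Longrightarrow> del i v ! a = v ! skip i a"
  by (simp add: del_def skip_def nth_append)

lemma skip_less: "a < m - 1 \<Longrightarrow> skip i a < m"
  by (auto simp: skip_def)

lemma del_in_tuples: "v \<in> tuples n (Suc k) \<Longrightarrow> i < Suc k \<Longrightarrow> del i v \<in> tuples n k"
  by (auto simp: del_def tuples_def dest: in_set_takeD in_set_dropD)

lemma del_update_neq:
  assumes "i < length v" "p < length v" "i \<noteq> p"
  shows "del i (v[p := a]) = (del i v)[unskip i p := a]"
proof (rule nth_equalityI)
  fix c assume "c < length (del i (v[p := a]))"
  then have c: "c < length v - 1" using assms by simp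
  have "del i (v[p := a]) ! c = v[p := a] ! skip i c" using nth_del[of i "v[p := a]" c] assms c by simp
  also have "\<dots> = (if c = unskip i p then a else v ! skip i c)"
    using skip_less[OF c] skip_eq_iff[OF assms(3), of c] assms(2) by (auto simp: nth_list_update)
  also have "\<dots> = (del i v)[unskip i p := a] ! c"
    using c assms(1) nth_del[OF assms(1) c] by (simp add: nth_list_update)
  finally show "del i (v[p := a]) ! c = (del i v)[unskip i p := a] ! c" .
qed (use assms in simp)

lemma nth_del_del:
  assumes "i < length v" "b < length v" "i \<noteq> b" "c < length v - 1 - 1"
  shows "del (unskip i b) (del i v) ! c = v ! skip i (skip (unskip i b) c)"
proof -
  have "del (unskip i b) (del i v) ! c = del i v ! skip (unskip i b) c"
    using assms unskip_less[OF assms(1-3)] by (intro nth_del) simp_all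
  also have "\<dots> = v ! skip i (skip (unskip i b) c)"
    using assms skip_less[OF assms(4)] by (intro nth_del) simp_all
  finally show ?thesis .
qed

lemma del_del:
  assumes "i < length v" "b < length v" "i \<noteq> b"
  shows "del (unskip i b) (del i v) = del (unskip b i) (del b v)"
proof (rule nth_equalityI)
  have len: "length (del (unskip i b) (del i v)) = length v - 1 - 1" if "i < length v" "b < length v" "i \<noteq> b" for i b
    using that unskip_less[OF that] by simp
  show "length (del (unskip i b) (del i v)) = length (del (unskip b i) (del b v))"
    using len[OF assms] len[OF assms(2,1)] assms(3) by simp
  fix c assume "c < length (del (unskip i b) (del i v))"
  then have c: "c < length v - 1 - 1" using len[OF assms] by simp
  show "del (unskip i b) (del i v) ! c = del (unskip b i) (del b v) ! c"
    using nth_del_del[OF assms c] nth_del_del[OF assms(2,1) _ c] skip_unskip_commute[OF assms(3), of c] assms(3)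
    by simp
qed

lemma sum_skip:
  assumes "i < Suc k"
  shows "(\<Sum>a<k. f a (skip i a)) = (\<Sum>b\<in>{..<Suc k} - {i}. f (unskip i b) b)"
  by (rule sum.reindex_bij_witness[where i = "unskip i" and j = "skip i"])
     (use assms in \<open>auto simp: skip_def unskip_def split: if_splits\<close>)

text \<open>The cancellation behind $d^2 = 0$ and behind $d f^* = f^* d$.\<close>

lemma alternating_sum_skip:
  fixes G :: "nat \<Rightarrow> nat \<Rightarrow> real"
  assumes sym: "\<And>i b. i < Suc k \<Longrightarrow> b < Suc k \<Longrightarrow> i \<noteq> b \<Longrightarrow> G i b = G b i"
  shows "(\<Sum>i<Suc k. (-1) ^ i * (\<Sum>a<k. (-1) ^ a * G i (skip i a))) = 0"
proof -
  \<comment> \<open>The signed summand of the pair \<open>i\<close>, \<open>b\<close>, with the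
    missing diagonal filled by 0. Exactly one of \<open>unskip i b\<close> and
    \<open>unskip b i\<close> is shifted by one, so \<open>T\<close> is antisymmetric when
    \<open>G\<close> is symmetric, and its double sum vanishes.\<close>
  define T where "T i b = (if b = i then 0 else (-1) ^ i * (-1) ^ unskip i b * G i b)" for i b
  have anti: "T b i = - T i b" if "i < Suc k" "b < Suc k" for i b
  proof (cases i b rule: linorder_cases)
    case less
    then obtain c where "b = Suc c" by (cases b) auto
    moreover have "G i b = G b i" using less by (intro sym that) simp
    ultimately show ?thesis using less by (simp add: T_def unskip_def)
  next
    case greater
    then obtain c where "i = Suc c" by (cases i) auto
    moreover have "G i b = G b i" using greater by (intro sym that) simp
    ultimately show ?thesis using greater by (simp add: T_def unskip_def)
  qed (simp add: T_def)
  have "(\<Sum>i<Suc k. (-1) ^ i * (\<Sum>a<k. (-1) ^ a * G i (skip i a))) = (\<Sum>i<Suc k. \<Sum>b<Suc k. T i b)"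
  proof (rule sum.cong)
    fix i assume "i \<in> {..<Suc k}"
    then have i: "i < Suc k" by simp
    have "(-1) ^ i * (\<Sum>a<k. (-1) ^ a * G i (skip i a)) = (-1) ^ i * (\<Sum>b\<in>{..<Suc k} - {i}. (-1) ^ unskip i b * G i b)"
      using sum_skip[OF i, of "\<lambda>a b. (-1) ^ a * G i b"] by simp
    also have "\<dots> = (\<Sum>b\<in>{..<Suc k} - {i}. T i b)"
      by (simp add: sum_distrib_left T_def mult.assoc)
    also have "\<dots> = (\<Sum>b<Suc k. T i b)"
      by (rule sum.mono_neutral_left) (auto simp: T_def)
    finally show "(-1) ^ i * (\<Sum>a<k. (-1) ^ a * G i (skip i a)) = (\<Sum>b<Suc k. T i b)" .
  qed simp
  moreover have "(\<Sum>i<Suc k. \<Sum>b<Suc k. T i b) = - (\<Sum>i<Suc k. \<Sum>b<Suc k. T i b)"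
  proof -
    have "(\<Sum>i<Suc k. \<Sum>b<Suc k. T i b) = (\<Sum>b<Suc k. \<Sum>i<Suc k. T i b)" by (rule sum.swap)
    also have "\<dots> = (\<Sum>b<Suc k. \<Sum>i<Suc k. - T b i)" by (intro sum.cong refl anti) simp_all
    finally show ?thesis unfolding sum_negf .
  qed
  ultimately show ?thesis by simp
qed

section \<open>Alternating multilinear functions\<close>

lemma tuples_update: "v \<in> tuples n k \<Longrightarrow> a \<in> Rn n \<Longrightarrow> v[i := a] \<in> tuples n k"
  using set_update_subset_insert[of v i a] by (auto simp: tuples_def)

lemma tuples_nth: "v \<in> tuples n k \<Longrightarrow> i < k \<Longrightarrow> v ! i \<in> Rn n"
  unfolding tuples_def by (auto simp: subset_iff)

lemma Rn_lin: "a \<in> Rn n \<Longrightarrow> b \<in> Rn n \<Longrightarrow> (\<lambda>j. r * a j + s * b j) \<in> Rn n"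
  by (simp add: Rn_iff)

lemma Rn_zero: "(\<lambda>j. 0) \<in> Rn n"
  by (simp add: Rn_iff)

context
  fixes n k :: nat and w :: "(nat \<Rightarrow> real) list \<Rightarrow> real"
  assumes w: "alternating n k w"
begin

lemma alternating_lin:
  assumes "v \<in> tuples n k" "i < k" "a \<in> Rn n" "b \<in> Rn n"
  shows "w (v[i := (\<lambda>j. r * a j + s * b j)]) = r * w (v[i := a]) + s * w (v[i := b])"
  using w assms unfolding alternating_def by blast

lemma alternating_eq_zero:
  assumes "v \<in> tuples n k" "i < k" "j < k" "i \<noteq> j" "v ! i = v ! j"
  shows "w v = 0"
  using w assms unfolding alternating_def by blast

lemma alternating_zero:
  assumes "v \<in> tuples n k" "i < k"
  shows "w (v[i := (\<lambda>j. 0)]) = 0"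
  using alternating_lin[OF assms Rn_zero Rn_zero, of 0 0] by simp

lemma alternating_linear_sum:
  assumes v: "v \<in> tuples n k" and i: "i < k" and "finite A"
  shows "(\<And>a. a \<in> A \<Longrightarrow> b a \<in> Rn n) \<Longrightarrow>
    w (v[i := (\<lambda>l. \<Sum>a\<in>A. c a * b a l)]) = (\<Sum>a\<in>A. c a * w (v[i := b a]))"
  using \<open>finite A\<close>
proof (induction A)
  case empty
  then show ?case using alternating_zero[OF v i] by simp
next
  case (insert a A)
  have "(\<lambda>l. \<Sum>a\<in>A. c a * b a l) \<in> Rn n"
    using insert.prems by (auto simp: Rn_iff intro!: sum.neutral)
  from alternating_lin[OF v i _ this, of "b a" "c a" 1] insert show ?case by simp
qed

lemma alternating_expand:
  assumes "v \<in> tuples n k" "i < k" "u \<in> Rn n"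
  shows "w (v[i := u]) = (\<Sum>j<n. u j * w (v[i := unit_vec j]))"
proof -
  have "u = (\<lambda>l. \<Sum>j<n. u j * unit_vec j l)"
  proof
    fix l
    have "(\<Sum>j<n. u j * unit_vec j l) = (\<Sum>j<n. if l = j then u j else 0)"
      by (intro sum.cong) (auto simp: unit_vec_def)
    also have "\<dots> = u l" using assms(3) by (auto simp: Rn_iff)
    finally show "u l = (\<Sum>j<n. u j * unit_vec j l)" by simp
  qed
  with alternating_linear_sum[OF assms(1,2), of "{..<n}" unit_vec u] show ?thesis
    by (simp add: unit_vec_Rn)
qed

text \<open>Polarization: put the sum of the two entries into both slots, where \<open>w\<close>
  vanishes.\<close>

lemma alternating_swap:
  assumes v: "v \<in> tuples n k" and ij: "i < k" "j < k" "i \<noteq> j"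
  shows "w (v[i := v ! j, j := v ! i]) = - w v"
proof -
  define a b where "a = v ! i" and "b = v ! j"
  have ab: "a \<in> Rn n" "b \<in> Rn n" using tuples_nth[OF v] ij by (simp_all add: a_def b_def)
  define s where "s = (\<lambda>l. 1 * a l + 1 * b l)"
  have s: "s \<in> Rn n" unfolding s_def by (rule Rn_lin[OF ab])
  have len: "length v = k" using v by (simp add: tuples_def)
  define W where "W x y = w (v[i := x, j := y])" for x y
  have T: "v[i := x] \<in> tuples n k" "v[j := x] \<in> tuples n k" if "x \<in> Rn n" for x
    using tuples_update[OF v that] by simp_all
  have z: "W x x = 0" if "x \<in> Rn n" for x
    unfolding W_def
    by (rule alternating_eq_zero[OF tuples_update[OF T(1)[OF that] that] ij]) (use ij len in simp)
  have 1: "W x s = W x a + W x b" if "x \<in> Rn n" for x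
    using alternating_lin[OF T(1)[OF that] ij(2) ab, of 1 1] by (simp add: s_def W_def)
  have sw: "v[i := x, j := y] = v[j := y, i := x]" for x y using ij(3) by (rule list_update_swap)
  have 2: "W s x = W a x + W b x" if "x \<in> Rn n" for x
    using alternating_lin[OF T(2)[OF that] ij(1) ab, of 1 1] by (simp add: s_def W_def sw)
  have "W b a = - W a b"
    using 1[OF s] 2[OF ab(1)] 2[OF ab(2)] z[OF s] z[OF ab(1)] z[OF ab(2)] by simp
  moreover have "v[i := a, j := b] = v" by (simp add: a_def b_def)
  ultimately show ?thesis by (simp add: W_def a_def b_def)
qed

text \<open>Each transposition of \<open>d\<close> with its left neighbour contributes one sign;
  \<open>ys\<close> is consumed from its right end.\<close>

lemma alternating_move:
  "ys @ d # zs \<in> tuples n k \<Longrightarrow> w (ys @ d # zs) = (-1) ^ length ys * w (d # ys @ zs)"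
proof (induction ys arbitrary: zs rule: rev_induct)
  case (snoc y ys)
  let ?v = "ys @ d # y # zs" and ?i = "length ys" and ?j = "Suc (length ys)"
  have v: "?v \<in> tuples n k" using snoc.prems by (auto simp: tuples_def)
  then have "length ys + 2 \<le> k" by (auto simp: tuples_def)
  then have "w (?v[?i := ?v ! ?j, ?j := ?v ! ?i]) = - w ?v"
    by (intro alternating_swap v) auto
  moreover have "?v[?i := ?v ! ?j, ?j := ?v ! ?i] = (ys @ [y]) @ d # zs"
    by (simp add: list_update_append nth_append)
  ultimately have "w ((ys @ [y]) @ d # zs) = - w ?v" by simp
  also have "w ?v = (-1) ^ length ys * w (d # ys @ y # zs)" by (rule snoc.IH[OF v])
  finally show ?case by simp
qed simp

end

lemma forms_alternating: "\<omega> \<in> forms n k U \<Longrightarrow> x \<in> U \<Longrightarrow> alternating n k (\<omega> x)"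
  by (simp add: forms_def)

lemma forms_smooth: "\<omega> \<in> forms n k U \<Longrightarrow> v \<in> tuples n k \<Longrightarrow> smooth_fun n U (\<lambda>x. \<omega> x v)"
  by (simp add: forms_def)

lemma forms_zero: "\<omega> \<in> forms n k U \<Longrightarrow> x \<notin> U \<or> v \<notin> tuples n k \<Longrightarrow> \<omega> x v = 0"
  unfolding forms_def by blast

section \<open>Forms evaluated on vector fields along a map\<close>

context
  fixes n k l :: nat and \<omega> :: form and U V :: "(nat \<Rightarrow> real) set"
    and h :: "(nat \<Rightarrow> real) \<Rightarrow> nat \<Rightarrow> real" and W :: "nat \<Rightarrow> (nat \<Rightarrow> real) \<Rightarrow> nat \<Rightarrow> real"
  assumes \<omega>: "\<omega> \<in> forms n k U" and U: "open_Rn n U" and V: "open_Rn l V"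
    and h: "smooth_map l V n U h" and W: "\<And>a. a < k \<Longrightarrow> smooth_map l V n (Rn n) (W a)"
begin

text \<open>The first \<open>i\<close> entries vary with the point, the others are those of \<open>c\<close>: this allows an
  induction on the number of varying entries.\<close>

private definition mix :: "nat \<Rightarrow> (nat \<Rightarrow> real) list \<Rightarrow> (nat \<Rightarrow> real) \<Rightarrow> (nat \<Rightarrow> real) list" where
  "mix i c y = map (\<lambda>a. if a < i then W a y else c ! a) [0..<k]"

private lemma mix_tuples: "c \<in> tuples n k \<Longrightarrow> y \<in> V \<Longrightarrow> mix i c y \<in> tuples n k"
  using smooth_map_in[OF W] tuples_nth[of c n k] by (auto simp: mix_def tuples_def)

private lemma mix_Suc: "i < k \<Longrightarrow> mix (Suc i) c y = (mix i c y)[i := W i y]"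
  by (rule nth_equalityI) (auto simp: mix_def nth_list_update)

private lemma mix_update: "c \<in> tuples n k \<Longrightarrow> i < k \<Longrightarrow> mix i (c[i := e]) y = (mix i c y)[i := e]"
  by (rule nth_equalityI) (auto simp: mix_def nth_list_update tuples_def)

private lemma mix_0: "c \<in> tuples n k \<Longrightarrow> mix 0 c y = c"
  by (rule nth_equalityI) (auto simp: mix_def tuples_def)

private lemma mix_k: "mix k c y = map (\<lambda>a. W a y) [0..<k]"
  by (rule nth_equalityI) (auto simp: mix_def)

private lemma alt: "y \<in> V \<Longrightarrow> alternating n k (\<omega> (h y))"
  by (intro forms_alternating[OF \<omega>] smooth_map_in[OF h])

private lemma mix_expand:
  assumes "c \<in> tuples n k" "y \<in> V" "i < k"
  shows "\<omega> (h y) (mix (Suc i) c y) = (\<Sum>j<n. W i y j * \<omega> (h y) (mix i (c[i := unit_vec j]) y))"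
  unfolding mix_Suc[OF assms(3)] mix_update[OF assms(1,3)]
  by (rule alternating_expand[OF alt[OF assms(2)] mix_tuples[OF assms(1,2)] assms(3)
        smooth_map_in[OF W[OF assms(3)] assms(2)]])

private lemma mix_smooth:
  "i \<le> k \<Longrightarrow> c \<in> tuples n k \<Longrightarrow> smooth_fun l V (\<lambda>y. \<omega> (h y) (mix i c y))"
proof (induction i arbitrary: c)
  case 0
  have "smooth_fun l V (\<lambda>y. \<omega> (h y) c)"
    by (rule smooth_fun_compose[OF h V U forms_smooth[OF \<omega> 0(2)]])
  then show ?case by (simp add: mix_0[OF 0(2)])
next
  case (Suc i)
  then have i: "i < k" by simp
  have "smooth_fun l V (\<lambda>y. \<Sum>j<n. W i y j * \<omega> (h y) (mix i (c[i := unit_vec j]) y))"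
  proof (intro smooth_fun_sum[OF V] smooth_fun_mult[OF V])
    fix j assume "j \<in> {..<n}"
    then have j: "j < n" by simp
    show "smooth_fun l V (\<lambda>y. W i y j)" by (rule smooth_map_comp[OF W[OF i] j])
    show "smooth_fun l V (\<lambda>y. \<omega> (h y) (mix i (c[i := unit_vec j]) y))"
      using Suc.IH[OF _ tuples_update[OF Suc.prems(2) unit_vec_Rn[OF j]]] i by simp
  qed
  then show ?case by (rule smooth_fun_cong[OF V]) (simp add: mix_expand[OF Suc.prems(2) _ i])
qed

lemma form_eval_smooth: "smooth_fun l V (\<lambda>y. \<omega> (h y) (map (\<lambda>a. W a y) [0..<k]))"
proof -
  \<comment> \<open>Once all \<open>k\<close> entries vary nothing is left of the constant tuple, so
    any member of \<open>tuples n k\<close> will do.\<close>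
  have "replicate k (\<lambda>j. 0) \<in> tuples n k" by (auto simp: tuples_def Rn_zero)
  from mix_smooth[OF order_refl this] show ?thesis by (simp add: mix_k)
qed

text \<open>The Leibniz rule, by induction on the number of varying entries: expand entry
  \<open>i\<close> in unit vectors, apply the product rule to coefficient and remaining factor, and
  recombine the sums by linearity.\<close>

private lemma mix_deriv:
  assumes x: "x \<in> V" and u: "u \<in> Rn l"
  shows "i \<le> k \<Longrightarrow> c \<in> tuples n k \<Longrightarrow>
    dir_deriv (\<lambda>y. \<omega> (h y) (mix i c y)) x u =
    dir_deriv (\<lambda>y. \<omega> (h y) (mix i c x)) x u +
    (\<Sum>a<i. \<omega> (h x) ((mix i c x)[a := tangent_map (W a) x u]))"
proof (induction i arbitrary: c)
  case 0
  then show ?case by (simp add: mix_0)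
next
  case (Suc i)
  then have i: "i < k" and c: "c \<in> tuples n k" by simp_all
  define c' where "c' j = c[i := unit_vec j]" for j
  have c': "c' j \<in> tuples n k" if "j < n" for j
    unfolding c'_def by (rule tuples_update[OF c unit_vec_Rn[OF that]])
  define F where "F j y = \<omega> (h y) (mix i (c' j) y)" for j y
  have Fs: "smooth_fun l V (F j)" if "j < n" for j
    unfolding F_def using mix_smooth[OF _ c'[OF that]] i by simp
  have Ws: "smooth_fun l V (\<lambda>y. W i y j)" if "j < n" for j
    by (rule smooth_map_comp[OF W[OF i] that])
  \<comment> \<open>The same factor with the varying entries frozen at \<open>x\<close>: only the
    dependence through \<open>h\<close> is left.\<close>
  define B where "B j = (\<lambda>y. \<omega> (h y) (mix i (c' j) x))" for j
  have Bs: "smooth_fun l V (B j)" if "j < n" for j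
    unfolding B_def
    by (rule smooth_fun_compose[OF h V U forms_smooth[OF \<omega> mix_tuples[OF c'[OF that] x]]])
  let ?TW = "\<lambda>a. tangent_map (W a) x u"
  have TW: "?TW a \<in> Rn n" if "a < k" for a
    by (rule tangent_map_Rn[OF W[OF that] V order_refl x u])
  have Wx: "W i x \<in> Rn n" by (rule smooth_map_in[OF W[OF i] x])
  have mt: "mix i c x \<in> tuples n k" by (rule mix_tuples[OF c x])
  have "dir_deriv (\<lambda>y. \<omega> (h y) (mix (Suc i) c y)) x u = dir_deriv (\<lambda>y. \<Sum>j<n. W i y j * F j y) x u"
    by (rule dir_deriv_cong[OF V x u]) (simp add: mix_expand[OF c _ i] F_def c'_def)
  also have "\<dots> = (\<Sum>j<n. dir_deriv (\<lambda>y. W i y j * F j y) x u)"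
    by (rule dir_deriv_sum[OF smooth_fun_mult[OF V Ws Fs] V x u]) auto
  also have "\<dots> = (\<Sum>j<n. dir_deriv (\<lambda>y. W i y j) x u * F j x + W i x j * dir_deriv (F j) x u)"
    by (intro sum.cong refl dir_deriv_mult[OF Ws Fs V x u]) auto
  also have "\<dots> = (\<Sum>j<n. ?TW i j * F j x) + (\<Sum>j<n. W i x j * dir_deriv (F j) x u)"
    by (simp add: sum.distrib tangent_map_def)
  also have "(\<Sum>j<n. ?TW i j * F j x) = \<omega> (h x) ((mix (Suc i) c x)[i := ?TW i])"
    using alternating_expand[OF alt[OF x] mt i TW[OF i]]
    by (simp add: F_def c'_def mix_update[OF c i] mix_Suc[OF i])
  also have "(\<Sum>j<n. W i x j * dir_deriv (F j) x u) =
      (\<Sum>j<n. W i x j * dir_deriv (B j) x u) +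
      (\<Sum>j<n. W i x j * (\<Sum>a<i. \<omega> (h x) ((mix i (c' j) x)[a := ?TW a])))"
  proof -
    have "dir_deriv (F j) x u = dir_deriv (B j) x u + (\<Sum>a<i. \<omega> (h x) ((mix i (c' j) x)[a := ?TW a]))" if "j < n" for j
      using Suc.IH[OF _ c'[OF that]] i unfolding F_def B_def by simp
    then show ?thesis by (simp add: sum.distrib distrib_left)
  qed
  also have "(\<Sum>j<n. W i x j * dir_deriv (B j) x u) = dir_deriv (\<lambda>y. \<omega> (h y) (mix (Suc i) c x)) x u"
  proof -
    have "dir_deriv (\<lambda>y. \<omega> (h y) (mix (Suc i) c x)) x u = dir_deriv (\<lambda>y. \<Sum>j<n. W i x j * B j y) x u"
    proof (rule dir_deriv_cong[OF V x u])
      fix y assume y: "y \<in> V"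
      show "\<omega> (h y) (mix (Suc i) c x) = (\<Sum>j<n. W i x j * B j y)"
        using alternating_expand[OF alt[OF y] mt i Wx]
        by (simp add: B_def c'_def mix_update[OF c i] mix_Suc[OF i])
    qed
    also have "\<dots> = (\<Sum>j<n. dir_deriv (\<lambda>y. W i x j * B j y) x u)"
      by (rule dir_deriv_sum[OF smooth_fun_mult[OF V smooth_fun_const[OF V] Bs] V x u]) auto
    also have "\<dots> = (\<Sum>j<n. W i x j * dir_deriv (B j) x u)"
      by (intro sum.cong refl dir_deriv_cmult[OF Bs V x u]) auto
    finally show ?thesis ..
  qed
  also have "(\<Sum>j<n. W i x j * (\<Sum>a<i. \<omega> (h x) ((mix i (c' j) x)[a := ?TW a]))) =
      (\<Sum>a<i. \<omega> (h x) ((mix (Suc i) c x)[a := ?TW a]))"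
  proof -
    have "\<omega> (h x) ((mix (Suc i) c x)[a := ?TW a]) = (\<Sum>j<n. W i x j * \<omega> (h x) ((mix i (c' j) x)[a := ?TW a]))"
      if a: "a < i" for a
    proof -
      have "a < k" using a i by simp
      have "(mix (Suc i) c x)[a := ?TW a] = (mix i c x)[a := ?TW a, i := W i x]"
        using a by (simp add: mix_Suc[OF i] list_update_swap)
      moreover have "(mix i (c' j) x)[a := ?TW a] = (mix i c x)[a := ?TW a, i := unit_vec j]" for j
        using a by (simp add: c'_def mix_update[OF c i] list_update_swap)
      ultimately show ?thesis
        using alternating_expand[OF alt[OF x] tuples_update[OF mt TW[OF \<open>a < k\<close>]] i Wx] by simp
    qed
    then have "(\<Sum>a<i. \<omega> (h x) ((mix (Suc i) c x)[a := ?TW a])) =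
        (\<Sum>a<i. \<Sum>j<n. W i x j * \<omega> (h x) ((mix i (c' j) x)[a := ?TW a]))" by simp
    also have "\<dots> = (\<Sum>j<n. \<Sum>a<i. W i x j * \<omega> (h x) ((mix i (c' j) x)[a := ?TW a]))" by (rule sum.swap)
    finally show ?thesis by (simp add: sum_distrib_left)
  qed
  finally show ?case by simp
qed

text \<open>Besides the derivative along \<open>h\<close> there is one term for each entry. These
  terms produce the second derivatives in \<open>ext_deriv_pullback\<close> and the derivative of
  the vector field in \<open>cartan_formula\<close>.\<close>

lemma form_eval_deriv:
  assumes "x \<in> V" "u \<in> Rn l"
  shows "dir_deriv (\<lambda>y. \<omega> (h y) (map (\<lambda>a. W a y) [0..<k])) x u =
    dir_deriv (\<lambda>y. \<omega> (h y) (map (\<lambda>a. W a x) [0..<k])) x u +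
    (\<Sum>a<k. \<omega> (h x) ((map (\<lambda>a. W a x) [0..<k])[a := tangent_map (W a) x u]))"
proof -
  have "replicate k (\<lambda>j. 0) \<in> tuples n k" by (auto simp: tuples_def Rn_zero)
  from mix_deriv[OF assms order_refl this] show ?thesis by (simp add: mix_k)
qed

end

lemma unskip_skip [simp]: "unskip i (skip i a) = a"
  by (auto simp: skip_def unskip_def)

lemma map_nth_upt: "map (\<lambda>a. F (v ! a)) [0..<length v] = map F v"
  by (rule nth_equalityI) auto

lemma del_map: "del i (map F v) = map F (del i v)"
  by (simp add: del_def take_map drop_map)

lemma update_as_move: "a < length v \<Longrightarrow> v[a := d] = take a v @ d # drop (Suc a) v"
  by (simp add: upd_conv_take_nth_drop)

lemma alternating_update_move:
  assumes "alternating n k w" "v \<in> tuples n k" "a < k" "d \<in> Rn n"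
  shows "w (v[a := d]) = (-1) ^ a * w (d # del a v)"
proof -
  have len: "length v = k" using assms(2) by (simp add: tuples_def)
  have "v[a := d] = take a v @ d # drop (Suc a) v" using assms(3) len by (simp add: update_as_move)
  moreover have "v[a := d] \<in> tuples n k" using assms by (intro tuples_update)
  ultimately show ?thesis
    using alternating_move[OF assms(1), of "take a v" d "drop (Suc a) v"] assms(3) len
    by (simp add: del_def)
qed

section \<open>Pullback of forms\<close>

lemma form_pullback_apply:
  "x \<in> V \<Longrightarrow> v \<in> tuples l k \<Longrightarrow> form_pullback l V f \<omega> x v = \<omega> (f x) (map (tangent_map f x) v)"
  by (simp add: form_pullback_def tuples_def)

lemma map_tangent_tuples:
  assumes "smooth_map l V n U f" "open_Rn l V" "U \<subseteq> Rn n" "x \<in> V" "v \<in> tuples l k"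
  shows "map (tangent_map f x) v \<in> tuples n k"
proof -
  have "tangent_map f x u \<in> Rn n" if "u \<in> set v" for u
    using tangent_map_Rn[OF assms(1-4)] assms(5) that by (auto simp: tuples_def)
  then show ?thesis using assms(5) by (auto simp: tuples_def)
qed

lemma form_pullback_zero:
  assumes "\<omega> \<in> forms n k U" "x \<notin> V \<or> v \<notin> tuples l k"
  shows "form_pullback l V f \<omega> x v = 0"
proof (cases "x \<in> V \<and> set v \<subseteq> Rn l")
  case True
  then have "map (tangent_map f x) v \<notin> tuples n k" using assms(2) by (auto simp: tuples_def)
  then show ?thesis using forms_zero[OF assms(1)] by (simp add: form_pullback_def)
qed (auto simp: form_pullback_def)

lemma form_pullback_forms:
  assumes \<omega>: "\<omega> \<in> forms n k U" and U: "open_Rn n U" and V: "open_Rn l V" and f: "smooth_map l V n U f"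
  shows "form_pullback l V f \<omega> \<in> forms l k V"
proof -
  note UR = open_Rn_subset[OF U]
  have 1: "alternating l k (form_pullback l V f \<omega> x)" if x: "x \<in> V" for x
  proof -
    have alt: "alternating n k (\<omega> (f x))" by (rule forms_alternating[OF \<omega> smooth_map_in[OF f x]])
    have mt: "map (tangent_map f x) v \<in> tuples n k" if "v \<in> tuples l k" for v
      by (rule map_tangent_tuples[OF f V UR x that])
    have lin: "form_pullback l V f \<omega> x (v[i := (\<lambda>j. r * a j + s * b j)]) =
        r * form_pullback l V f \<omega> x (v[i := a]) + s * form_pullback l V f \<omega> x (v[i := b])"
      if v: "v \<in> tuples l k" and i: "i < k" and ab: "a \<in> Rn l" "b \<in> Rn l" for v i a b r s
    proof -
      have T: "tangent_map f x a \<in> Rn n" "tangent_map f x b \<in> Rn n"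
        using tangent_map_Rn[OF f V UR x] ab by auto
      show ?thesis
        using alternating_lin[OF alt mt[OF v] i T, of r s]
        by (simp add: form_pullback_apply[OF x tuples_update[OF v]] Rn_lin ab map_update
            tangent_map_linear[OF f V UR x ab])
    qed
    have eq: "form_pullback l V f \<omega> x v = 0"
      if v: "v \<in> tuples l k" and ij: "i < k" "j < k" "i \<noteq> j" "v ! i = v ! j" for v i j
    proof -
      have "length v = k" using v by (simp add: tuples_def)
      then show ?thesis
        using alternating_eq_zero[OF alt mt[OF v] ij(1-3)] ij by (simp add: form_pullback_apply[OF x v])
    qed
    show ?thesis unfolding alternating_def using lin eq by blast
  qed
  have 2: "smooth_fun l V (\<lambda>x. form_pullback l V f \<omega> x v)" if v: "v \<in> tuples l k" for v
  proof -
    have len: "length v = k" using v by (simp add: tuples_def)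
    have "smooth_fun l V (\<lambda>y. \<omega> (f y) (map (\<lambda>a. tangent_map f y (v ! a)) [0..<k]))"
    proof (rule form_eval_smooth[OF \<omega> U V f])
      show "smooth_map l V n (Rn n) (\<lambda>y. tangent_map f y (v ! a))" if "a < k" for a
        by (rule smooth_map_tangent[OF f V UR tuples_nth[OF v that]])
    qed
    then show ?thesis
      by (rule smooth_fun_cong[OF V]) (simp add: form_pullback_apply[OF _ v] map_nth_upt len[symmetric])
  qed
  show ?thesis
    unfolding forms_def using 1 2 form_pullback_zero[OF \<omega>] by blast
qed

lemma form_pullback_compose:
  assumes \<omega>: "\<omega> \<in> forms n k U" and U: "open_Rn n U" and V: "open_Rn l V" and V': "open_Rn l' V'"
    and f: "smooth_map l V n U f" and g: "smooth_map l' V' l V g"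
  shows "form_pullback l' V' g (form_pullback l V f \<omega>) = form_pullback l' V' (\<lambda>x. f (g x)) \<omega>"
proof (intro ext)
  fix x v
  show "form_pullback l' V' g (form_pullback l V f \<omega>) x v = form_pullback l' V' (\<lambda>x. f (g x)) \<omega> x v"
  proof (cases "x \<in> V' \<and> v \<in> tuples l' k")
    case True
    then have x: "x \<in> V'" and v: "v \<in> tuples l' k" by auto
    have "tangent_map f (g x) (tangent_map g x u) = tangent_map (\<lambda>x. f (g x)) x u" if "u \<in> set v" for u
      using tangent_map_compose[OF g V' V f open_Rn_subset[OF U] x, of u] v that by (auto simp: tuples_def)
    then show ?thesis
      using form_pullback_apply[OF smooth_map_in[OF g x] map_tangent_tuples[OF g V' open_Rn_subset[OF V] x v]]
      by (simp add: form_pullback_apply[OF x v] comp_def cong: map_cong)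
  next
    case False
    then show ?thesis
      using form_pullback_zero[OF \<omega>, of x V' v l'] form_pullback_zero[OF form_pullback_forms[OF \<omega> U V f], of x V' v l']
      by simp
  qed
qed

lemma form_pullback_id_apply:
  assumes "\<omega> \<in> forms n k U" "x \<in> V"
  shows "form_pullback n V (\<lambda>x. x) \<omega> x v = \<omega> x v"
proof -
  have "map (tangent_map (\<lambda>x. x) x) v = v" by (simp add: tangent_map_id map_idI)
  then show ?thesis
    using assms forms_zero[OF assms(1), of x v] by (auto simp: form_pullback_def tuples_def)
qed

text \<open>Gluing: this is how families defined by local choices, of a lift or of a chart, are seen
  to be forms.\<close>

lemma forms_local:
  assumes U: "open_Rn n U"
    and out: "\<And>x v. x \<notin> U \<Longrightarrow> \<omega> x v = 0"
    and loc: "\<And>x. x \<in> U \<Longrightarrow> \<exists>V \<eta>. open_Rn n V \<and> x \<in> V \<and> V \<subseteq> U \<and> \<eta> \<in> forms n k V \<and> (\<forall>y\<in>V. \<omega> y = \<eta> y)"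
  shows "\<omega> \<in> forms n k U"
proof -
  have 1: "\<omega> x v = 0" if "x \<notin> U \<or> v \<notin> tuples n k" for x v
  proof (cases "x \<in> U")
    case True
    then obtain V \<eta> where "x \<in> V" "\<eta> \<in> forms n k V" "\<forall>y\<in>V. \<omega> y = \<eta> y" using loc[OF True] by blast
    then show ?thesis using forms_zero[of \<eta> n k V x v] that True by simp
  qed (rule out)
  have 2: "alternating n k (\<omega> x)" if "x \<in> U" for x
  proof -
    obtain V \<eta> where V: "x \<in> V" "\<eta> \<in> forms n k V" "\<forall>y\<in>V. \<omega> y = \<eta> y"
      using loc[OF \<open>x \<in> U\<close>] by blast
    show ?thesis unfolding bspec[OF V(3,1)] by (rule forms_alternating[OF V(2,1)])
  qed
  have 3: "smooth_fun n U (\<lambda>x. \<omega> x v)" if v: "v \<in> tuples n k" for v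
  proof (rule smooth_fun_local[OF U])
    fix x assume "x \<in> U"
    from loc[OF this]
    obtain V \<eta> where V: "open_Rn n V" "x \<in> V" "V \<subseteq> U" "\<eta> \<in> forms n k V" "\<forall>y\<in>V. \<omega> y = \<eta> y"
      by blast
    have "smooth_fun n V (\<lambda>x. \<omega> x v)"
      by (rule smooth_fun_cong[OF V(1) forms_smooth[OF V(4) v]]) (use V(5) in simp)
    with V(1-3) show "\<exists>V. open_Rn n V \<and> x \<in> V \<and> V \<subseteq> U \<and> smooth_fun n V (\<lambda>x. \<omega> x v)" by blast
  qed
  show ?thesis unfolding forms_def using 1 2 3 by blast
qed

section \<open>The exterior derivative\<close>

lemma ext_deriv_apply:
  assumes "x \<in> U" "v \<in> tuples n k"
  shows "ext_deriv n U \<omega> x v = (\<Sum>i<k. (-1) ^ i * dir_deriv (\<lambda>y. \<omega> y (del i v)) x (v ! i))"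
  using assms by (simp add: ext_deriv_def tuples_def del_def)

lemma ext_deriv_zero:
  assumes "\<omega> \<in> forms n k U" "x \<notin> U \<or> v \<notin> tuples n (Suc k)"
  shows "ext_deriv n U \<omega> x v = 0"
proof (cases "x \<in> U \<and> set v \<subseteq> Rn n")
  case True
  then have v: "v \<in> tuples n (length v)" by (simp add: tuples_def)
  have "length v \<noteq> Suc k" using assms(2) True by (auto simp: tuples_def)
  then have "del i v \<notin> tuples n k" if "i < length v" for i
    using that by (auto simp: tuples_def)
  then have "\<omega> y (del i v) = 0" if "i < length v" for i y
    using forms_zero[OF assms(1)] that by blast
  then show ?thesis using True by (simp add: ext_deriv_apply[OF _ v])
qed (auto simp: ext_deriv_def)

lemma ext_deriv_term_smooth:
  assumes "\<omega> \<in> forms n k U" "open_Rn n U" "v \<in> tuples n (Suc k)" "i < Suc k"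
  shows "smooth_fun n U (\<lambda>x. dir_deriv (\<lambda>y. \<omega> y (del i v)) x (v ! i))"
  using smooth_fun_dir_deriv[OF forms_smooth[OF assms(1) del_in_tuples[OF assms(3,4)]] assms(2), of "\<lambda>x. v ! i"]
    tuples_nth[OF assms(3,4)] smooth_fun_const[OF assms(2)] by simp

lemma ext_deriv_smooth:
  assumes "\<omega> \<in> forms n k U" "open_Rn n U" "v \<in> tuples n (Suc k)"
  shows "smooth_fun n U (\<lambda>x. ext_deriv n U \<omega> x v)"
proof (rule smooth_fun_cong[OF assms(2)])
  show "smooth_fun n U (\<lambda>x. \<Sum>i<Suc k. (-1) ^ i * dir_deriv (\<lambda>y. \<omega> y (del i v)) x (v ! i))"
    by (intro smooth_fun_sum[OF assms(2)] smooth_fun_mult[OF assms(2)] smooth_fun_const[OF assms(2)]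
        ext_deriv_term_smooth[OF assms]) simp
qed (rule ext_deriv_apply[OF _ assms(3), symmetric])

text \<open>Alternation: if entries \<open>p\<close> and \<open>q\<close> agree, every summand other
  than these two vanishes, because \<open>del i v\<close> keeps both entries. The two remaining
  summands cancel after the repeated entry is moved to the front.\<close>

lemma ext_deriv_forms:
  assumes \<omega>: "\<omega> \<in> forms n k U" and U: "open_Rn n U"
  shows "ext_deriv n U \<omega> \<in> forms n (Suc k) U"
proof -
  have alt: "alternating n (Suc k) (ext_deriv n U \<omega> x)" if x: "x \<in> U" for x
  proof -
    define t where "t i w = dir_deriv (\<lambda>y. \<omega> y (del i w)) x (w ! i)" for i w
    have app: "ext_deriv n U \<omega> x w = (\<Sum>i<Suc k. (-1) ^ i * t i w)" if "w \<in> tuples n (Suc k)" for w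
      unfolding t_def by (rule ext_deriv_apply[OF x that])
    have lin: "ext_deriv n U \<omega> x (v[p := (\<lambda>j. r * a j + s * b j)]) =
        r * ext_deriv n U \<omega> x (v[p := a]) + s * ext_deriv n U \<omega> x (v[p := b])"
      if v: "v \<in> tuples n (Suc k)" and p: "p < Suc k" and ab: "a \<in> Rn n" "b \<in> Rn n" for v p a b r s
    proof -
      define c where "c = (\<lambda>j. r * a j + s * b j)"
      have c: "c \<in> Rn n" unfolding c_def by (rule Rn_lin[OF ab])
      have len: "length v = Suc k" using v by (simp add: tuples_def)
      have "t i (v[p := c]) = r * t i (v[p := a]) + s * t i (v[p := b])" if i: "i < Suc k" for i
      proof (cases "i = p")
        case True
        have "del p (v[p := e]) = del p v" for e by (simp add: del_def)
        then show ?thesis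
          using dir_deriv_linear[OF forms_smooth[OF \<omega> del_in_tuples[OF v p]] U x ab, of r s] True len i
          by (simp add: t_def c_def)
      next
        case False
        have d: "del i (v[p := e]) = (del i v)[unskip i p := e]" for e
          using False len p i by (intro del_update_neq) auto
        have dt: "del i v \<in> tuples n k" by (rule del_in_tuples[OF v i])
        have u: "unskip i p < k" using unskip_less[OF i p False] by simp
        have sm: "smooth_fun n U (\<lambda>y. \<omega> y ((del i v)[unskip i p := e]))" if "e \<in> Rn n" for e
          by (rule forms_smooth[OF \<omega> tuples_update[OF dt that]])
        have vi: "v ! i \<in> Rn n" by (rule tuples_nth[OF v i])
        have "t i (v[p := c]) = dir_deriv (\<lambda>y. r * \<omega> y ((del i v)[unskip i p := a]) + s * \<omega> y ((del i v)[unskip i p := b])) x (v ! i)"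
          using False unfolding t_def d c_def
          by (simp, intro dir_deriv_cong[OF U x vi] alternating_lin[OF forms_alternating[OF \<omega>] dt u ab])
        also have "\<dots> = r * t i (v[p := a]) + s * t i (v[p := b])"
          using False dir_deriv_add[OF smooth_fun_mult[OF U smooth_fun_const[OF U] sm[OF ab(1)]]
              smooth_fun_mult[OF U smooth_fun_const[OF U] sm[OF ab(2)]] U x vi, of r s]
            dir_deriv_cmult[OF sm[OF ab(1)] U x vi] dir_deriv_cmult[OF sm[OF ab(2)] U x vi]
          unfolding t_def d by simp
        finally show ?thesis .
      qed
      then have "(\<Sum>i<Suc k. (-1) ^ i * t i (v[p := c])) =
          (\<Sum>i<Suc k. r * ((-1) ^ i * t i (v[p := a])) + s * ((-1) ^ i * t i (v[p := b])))"
        by (intro sum.cong refl) (simp add: algebra_simps)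
      also have "\<dots> = r * (\<Sum>i<Suc k. (-1) ^ i * t i (v[p := a])) + s * (\<Sum>i<Suc k. (-1) ^ i * t i (v[p := b]))"
        by (simp only: sum.distrib sum_distrib_left)
      finally show ?thesis
        unfolding app[OF tuples_update[OF v c]] app[OF tuples_update[OF v ab(1)]] app[OF tuples_update[OF v ab(2)]]
          c_def[symmetric] .
    qed
    have eq: "ext_deriv n U \<omega> x v = 0"
      if v: "v \<in> tuples n (Suc k)" and p: "p < Suc k" and q: "q < Suc k" and pq: "p < q" and e: "v ! p = v ! q" for v p q
    proof -
      have len: "length v = Suc k" using v by (simp add: tuples_def)
      have 0: "t i v = 0" if i: "i < Suc k" "i \<noteq> p" "i \<noteq> q" for i
      proof -
        have u: "unskip i p < k" "unskip i q < k" "unskip i p \<noteq> unskip i q"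
          using unskip_less[OF i(1) p i(2)] unskip_less[OF i(1) q i(3)] pq i by (auto simp: unskip_def)
        have s: "skip i (unskip i p) = p" "skip i (unskip i q) = q" using i skip_eq_iff by auto
        have "del i v ! unskip i p = del i v ! unskip i q"
          using nth_del[of i v] u i len s e by simp
        then have "\<omega> y (del i v) = 0" if "y \<in> U" for y
          by (rule alternating_eq_zero[OF forms_alternating[OF \<omega> that] del_in_tuples[OF v i(1)] u])
        then show ?thesis
          using dir_deriv_cong[OF U x tuples_nth[OF v i(1)], of "\<lambda>y. \<omega> y (del i v)" "\<lambda>y. 0"] by (simp add: t_def)
      qed
      \<comment> \<open>The common list to which both remaining summands are brought: the repeated
        vector first, then \<open>v\<close> without the positions \<open>p\<close> and
        \<open>q\<close>.\<close>
      define R where "R = v ! p # del (unskip p q) (del p v)"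
      have mv: "\<omega> y (del i v) = (-1) ^ unskip i b * \<omega> y (v ! b # del (unskip i b) (del i v))"
        if i: "i < Suc k" "b < Suc k" "i \<noteq> b" and y: "y \<in> U" for i b y
      proof -
        have u: "unskip i b < k" using unskip_less[OF i] by simp
        have "skip i (unskip i b) = b" using i skip_eq_iff by blast
        then have "del i v ! unskip i b = v ! b" using nth_del[of i v "unskip i b"] u i len by simp
        then have "del i v = (del i v)[unskip i b := v ! b]" by (metis list_update_id)
        then show ?thesis
          using alternating_update_move[OF forms_alternating[OF \<omega> y] del_in_tuples[OF v i(1)] u tuples_nth[OF v i(2)]]
          by simp
      qed
      have tR: "R \<in> tuples n k"
      proof -
        have u: "unskip p q < k" using unskip_less[OF p q] pq by simp
        then obtain k' where k': "k = Suc k'" by (cases k) auto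
        have "del (unskip p q) (del p v) \<in> tuples n k'"
          using del_in_tuples[OF del_in_tuples[OF v p, unfolded k']] u k' by simp
        then show ?thesis using tuples_nth[OF v p] k' by (auto simp: R_def tuples_def)
      qed
      have sR: "smooth_fun n U (\<lambda>y. \<omega> y R)" by (rule forms_smooth[OF \<omega> tR])
      define D where "D = dir_deriv (\<lambda>y. \<omega> y R) x (v ! p)"
      have tp: "t p v = (-1) ^ (q - 1) * D"
      proof -
        have "t p v = dir_deriv (\<lambda>y. (-1) ^ (q - 1) * \<omega> y R) x (v ! p)"
          unfolding t_def
        proof (rule dir_deriv_cong[OF U x tuples_nth[OF v p]])
          fix y assume y: "y \<in> U"
          show "\<omega> y (del p v) = (-1) ^ (q - 1) * \<omega> y R"
            using mv[OF p q _ y] pq e by (simp add: R_def unskip_def)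
        qed
        then show ?thesis unfolding D_def using dir_deriv_cmult[OF sR U x tuples_nth[OF v p]] by simp
      qed
      have tq: "t q v = (-1) ^ p * D"
      proof -
        have "t q v = dir_deriv (\<lambda>y. (-1) ^ p * \<omega> y R) x (v ! q)"
          unfolding t_def
        proof (rule dir_deriv_cong[OF U x tuples_nth[OF v q]])
          fix y assume y: "y \<in> U"
          have "del (unskip q p) (del q v) = del (unskip p q) (del p v)"
            using del_del[of q v p] p q pq len by simp
          then show "\<omega> y (del q v) = (-1) ^ p * \<omega> y R"
            using mv[OF q p _ y] pq by (simp add: R_def unskip_def)
        qed
        then show ?thesis unfolding D_def using dir_deriv_cmult[OF sR U x tuples_nth[OF v q]] e by simp
      qed
      obtain c where c: "q = Suc c" using pq by (cases q) auto
      have "ext_deriv n U \<omega> x v = (\<Sum>i\<in>{p, q}. (-1) ^ i * t i v)"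
        unfolding app[OF v] by (rule sum.mono_neutral_right) (use p q 0 in auto)
      also have "\<dots> = (-1) ^ p * t p v + (-1) ^ q * t q v" using pq by simp
      also have "\<dots> = (-1) ^ p * ((-1) ^ (q - 1) * D) + (-1) ^ q * ((-1) ^ p * D)" by (simp only: tp tq)
      also have "\<dots> = 0" by (simp add: c)
      finally show ?thesis .
    qed
    have eq': "ext_deriv n U \<omega> x v = 0"
      if "v \<in> tuples n (Suc k)" "p < Suc k" "q < Suc k" "p \<noteq> q" "v ! p = v ! q" for v p q
      using eq[OF that(1-3)] eq[OF that(1,3,2)] that(4,5) by (cases p q rule: linorder_cases) auto
    show ?thesis unfolding alternating_def using lin eq' by blast
  qed
  show ?thesis
    unfolding forms_def using alt ext_deriv_smooth[OF \<omega> U] ext_deriv_zero[OF \<omega>] by blast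
qed

text \<open>Differentiating twice produces second derivatives \<open>G i b\<close> of coefficients,
  symmetric by \<open>dir_deriv_commute\<close>; their signed sum is the one of
  \<open>alternating_sum_skip\<close>.\<close>

theorem ext_deriv_ext_deriv:
  assumes \<omega>: "\<omega> \<in> forms n k U" and U: "open_Rn n U"
  shows "ext_deriv n U (ext_deriv n U \<omega>) = (\<lambda>x v. 0)"
proof (intro ext)
  fix x v
  show "ext_deriv n U (ext_deriv n U \<omega>) x v = 0"
  proof (cases "x \<in> U \<and> v \<in> tuples n (Suc (Suc k))")
    case False
    then show ?thesis using ext_deriv_zero[OF ext_deriv_forms[OF \<omega> U]] by blast
  next
    case True
    then have x: "x \<in> U" and v: "v \<in> tuples n (Suc (Suc k))" by auto
    have len: "length v = Suc (Suc k)" using v by (simp add: tuples_def)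
    define G where "G i b = dir_deriv (\<lambda>y. dir_deriv (\<lambda>z. \<omega> z (del (unskip i b) (del i v))) y (v ! b)) x (v ! i)" for i b
    have dd: "del a (del i v) \<in> tuples n k" if "a < Suc k" "i < Suc (Suc k)" for a i
      using del_in_tuples[OF del_in_tuples[OF v that(2)] that(1)] .
    have Gsym: "G i b = G b i" if ib: "i < Suc (Suc k)" "b < Suc (Suc k)" "i \<noteq> b" for i b
    proof -
      have "unskip i b < Suc k" using unskip_less[OF ib] by simp
      from dir_deriv_commute[OF forms_smooth[OF \<omega> dd[OF this ib(1)]] U x tuples_nth[OF v ib(2)] tuples_nth[OF v ib(1)]]
      show ?thesis using del_del[of i v b] ib len by (simp add: G_def)
    qed
    have "dir_deriv (\<lambda>y. ext_deriv n U \<omega> y (del i v)) x (v ! i) = (\<Sum>a<Suc k. (-1) ^ a * G i (skip i a))"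
      if i: "i < Suc (Suc k)" for i
    proof -
      have vi: "v ! i \<in> Rn n" by (rule tuples_nth[OF v i])
      have nth: "del i v ! a = v ! skip i a" if "a < Suc k" for a
        using nth_del[of i v a] that i len by simp
      have sm: "smooth_fun n U (\<lambda>y. dir_deriv (\<lambda>z. \<omega> z (del a (del i v))) y (del i v ! a))" if "a < Suc k" for a
        by (rule ext_deriv_term_smooth[OF \<omega> U del_in_tuples[OF v i] that])
      have "dir_deriv (\<lambda>y. ext_deriv n U \<omega> y (del i v)) x (v ! i) =
        dir_deriv (\<lambda>y. \<Sum>a<Suc k. (-1) ^ a * dir_deriv (\<lambda>z. \<omega> z (del a (del i v))) y (del i v ! a)) x (v ! i)"
        by (rule dir_deriv_cong[OF U x vi]) (rule ext_deriv_apply[OF _ del_in_tuples[OF v i]])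
      also have "\<dots> = (\<Sum>a<Suc k. dir_deriv (\<lambda>y. (-1) ^ a * dir_deriv (\<lambda>z. \<omega> z (del a (del i v))) y (del i v ! a)) x (v ! i))"
        by (rule dir_deriv_sum[OF smooth_fun_mult[OF U smooth_fun_const[OF U] sm] U x vi]) simp
      also have "\<dots> = (\<Sum>a<Suc k. (-1) ^ a * G i (skip i a))"
      proof (intro sum.cong refl)
        fix a assume "a \<in> {..<Suc k}"
        then have a: "a < Suc k" by simp
        show "dir_deriv (\<lambda>y. (-1) ^ a * dir_deriv (\<lambda>z. \<omega> z (del a (del i v))) y (del i v ! a)) x (v ! i) =
            (-1) ^ a * G i (skip i a)"
          using dir_deriv_cmult[OF sm[OF a] U x vi] by (simp add: G_def nth[OF a])
      qed
      finally show ?thesis .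
    qed
    then have "ext_deriv n U (ext_deriv n U \<omega>) x v =
        (\<Sum>i<Suc (Suc k). (-1) ^ i * (\<Sum>a<Suc k. (-1) ^ a * G i (skip i a)))"
      unfolding ext_deriv_apply[OF x v] by (intro sum.cong refl) simp
    also have "\<dots> = 0" by (rule alternating_sum_skip[OF Gsym])
    finally show ?thesis .
  qed
qed

text \<open>The Leibniz rule for the coefficients of the pullback yields the pullback of the
  derivative and further terms with the second derivatives \<open>D b i\<close> of \<open>f\<close>;
  the latter are symmetric and cancel in the alternating sum.\<close>

theorem ext_deriv_pullback:
  assumes \<omega>: "\<omega> \<in> forms n k U" and U: "open_Rn n U" and V: "open_Rn l V" and f: "smooth_map l V n U f"
  shows "ext_deriv l V (form_pullback l V f \<omega>) = form_pullback l V f (ext_deriv n U \<omega>)"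
proof (intro ext)
  fix x v
  note UR = open_Rn_subset[OF U]
  show "ext_deriv l V (form_pullback l V f \<omega>) x v = form_pullback l V f (ext_deriv n U \<omega>) x v"
  proof (cases "x \<in> V \<and> v \<in> tuples l (Suc k)")
    case False
    then show ?thesis
      using ext_deriv_zero[OF form_pullback_forms[OF \<omega> U V f], of x v]
        form_pullback_zero[OF ext_deriv_forms[OF \<omega> U], of x V v l f] by simp
  next
    case True
    then have x: "x \<in> V" and v: "v \<in> tuples l (Suc k)" by auto
    have len: "length v = Suc k" using v by (simp add: tuples_def)
    let ?T = "tangent_map f x"
    have fx: "f x \<in> U" by (rule smooth_map_in[OF f x])
    define D where "D b i = tangent_map (\<lambda>y. tangent_map f y (v ! b)) x (v ! i)" for b i
    define G where "G i b = \<omega> (f x) (D b i # map ?T (del (unskip i b) (del i v)))" for i b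
    have DR: "D b i \<in> Rn n" if "b < Suc k" "i < Suc k" for b i
      unfolding D_def
      by (rule tangent_map_Rn[OF smooth_map_tangent[OF f V UR tuples_nth[OF v that(1)]] V order_refl x tuples_nth[OF v that(2)]])
    have Dsym: "D b i = D i b" if "b < Suc k" "i < Suc k" for b i
    proof
      fix j
      show "D b i j = D i b j"
        using dir_deriv_commute[OF smooth_map_coord[OF f UR V] V x tuples_nth[OF v that(1)] tuples_nth[OF v that(2)], of j]
        by (simp add: D_def tangent_map_def)
    qed
    have Gsym: "G i b = G b i" if "i < Suc k" "b < Suc k" "i \<noteq> b" for i b
      using del_del[of i v b] Dsym[OF that(2,1)] that len by (simp add: G_def)
    have dterm: "dir_deriv (\<lambda>y. form_pullback l V f \<omega> y (del i v)) x (v ! i) =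
        dir_deriv (\<lambda>p. \<omega> p (del i (map ?T v))) (f x) (map ?T v ! i) + (\<Sum>a<k. (-1) ^ a * G i (skip i a))"
      if i: "i < Suc k" for i
    proof -
      have dv: "del i v \<in> tuples l k" by (rule del_in_tuples[OF v i])
      have ld: "length (del i v) = k" using i len by simp
      have vi: "v ! i \<in> Rn l" by (rule tuples_nth[OF v i])
      have nth: "del i v ! a = v ! skip i a" if "a < k" for a
        using nth_del[of i v a] that i len by simp
      define W where "W a y = tangent_map f y (del i v ! a)" for a y
      have Ws: "smooth_map l V n (Rn n) (W a)" if "a < k" for a
        unfolding W_def by (rule smooth_map_tangent[OF f V UR tuples_nth[OF dv that]])
      have mW: "map (\<lambda>a. W a y) [0..<k] = map (tangent_map f y) (del i v)" for y
        unfolding W_def ld[symmetric] by (rule map_nth_upt)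
      have mt: "map ?T (del i v) \<in> tuples n k" by (rule map_tangent_tuples[OF f V UR x dv])
      have "dir_deriv (\<lambda>y. form_pullback l V f \<omega> y (del i v)) x (v ! i) =
          dir_deriv (\<lambda>y. \<omega> (f y) (map (\<lambda>a. W a y) [0..<k])) x (v ! i)"
        by (rule dir_deriv_cong[OF V x vi]) (simp add: form_pullback_apply[OF _ dv] mW)
      also have "\<dots> = dir_deriv (\<lambda>y. \<omega> (f y) (map (\<lambda>a. W a x) [0..<k])) x (v ! i) +
          (\<Sum>a<k. \<omega> (f x) ((map (\<lambda>a. W a x) [0..<k])[a := tangent_map (W a) x (v ! i)]))"
        by (rule form_eval_deriv[OF \<omega> U V f Ws x vi])
      also have "dir_deriv (\<lambda>y. \<omega> (f y) (map (\<lambda>a. W a x) [0..<k])) x (v ! i) =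
          dir_deriv (\<lambda>p. \<omega> p (del i (map ?T v))) (f x) (map ?T v ! i)"
        using dir_deriv_compose[OF f V U forms_smooth[OF \<omega> mt] x vi] i len by (simp add: mW del_map)
      also have "(\<Sum>a<k. \<omega> (f x) ((map (\<lambda>a. W a x) [0..<k])[a := tangent_map (W a) x (v ! i)])) =
          (\<Sum>a<k. (-1) ^ a * G i (skip i a))"
      proof (intro sum.cong refl)
        fix a assume "a \<in> {..<k}"
        then have a: "a < k" by simp
        have TW: "tangent_map (W a) x (v ! i) = D (skip i a) i" unfolding W_def D_def nth[OF a] ..
        have s: "skip i a < Suc k" using a by (simp add: skip_def)
        show "\<omega> (f x) ((map (\<lambda>a. W a x) [0..<k])[a := tangent_map (W a) x (v ! i)]) = (-1) ^ a * G i (skip i a)"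
          unfolding mW TW alternating_update_move[OF forms_alternating[OF \<omega> fx] mt a DR[OF s i]]
          by (simp add: G_def del_map)
      qed
      finally show ?thesis .
    qed
    have "ext_deriv l V (form_pullback l V f \<omega>) x v =
        (\<Sum>i<Suc k. (-1) ^ i * dir_deriv (\<lambda>p. \<omega> p (del i (map ?T v))) (f x) (map ?T v ! i)) +
        (\<Sum>i<Suc k. (-1) ^ i * (\<Sum>a<k. (-1) ^ a * G i (skip i a)))"
      unfolding ext_deriv_apply[OF x v] sum.distrib[symmetric]
      by (intro sum.cong refl) (simp add: dterm distrib_left)
    also have "(\<Sum>i<Suc k. (-1) ^ i * (\<Sum>a<k. (-1) ^ a * G i (skip i a))) = 0"
      by (rule alternating_sum_skip[OF Gsym])
    finally show ?thesis
      by (simp add: form_pullback_apply[OF x v] ext_deriv_apply[OF fx map_tangent_tuples[OF f V UR x v]])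
  qed
qed

text \<open>The left side is the coordinate expression used in \<open>lie_deriv\<close>. On the
  right the derivatives of \<open>\<omega>\<close> with \<open>X x\<close> frozen cancel between the
  two terms, and what remains of the second term differentiates \<open>X\<close>.\<close>

theorem cartan_formula:
  assumes \<omega>: "\<omega> \<in> forms n k U" and U: "open_Rn n U" and X: "smooth_map n U n (Rn n) X"
    and x: "x \<in> U" and v: "v \<in> tuples n k"
  shows "dir_deriv (\<lambda>y. \<omega> y v) x (X x) + (\<Sum>i<k. \<omega> x (v[i := tangent_map X x (v ! i)])) =
    ext_deriv n U \<omega> x (X x # v) + ext_deriv n U (\<lambda>y w. \<omega> y (X y # w)) x v"
proof -
  have len: "length v = k" using v by (simp add: tuples_def)
  have XR: "X y \<in> Rn n" if "y \<in> U" for y by (rule smooth_map_in[OF X that])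
  have Xv: "X x # v \<in> tuples n (Suc k)" using v XR[OF x] by (auto simp: tuples_def)
  have 1: "ext_deriv n U \<omega> x (X x # v) = dir_deriv (\<lambda>y. \<omega> y v) x (X x) -
      (\<Sum>i<k. (-1) ^ i * dir_deriv (\<lambda>y. \<omega> y (X x # del i v)) x (v ! i))"
    unfolding ext_deriv_apply[OF x Xv] sum.lessThan_Suc_shift by (simp add: del_def sum_negf)
  have "dir_deriv (\<lambda>y. \<omega> y (X y # del i v)) x (v ! i) =
      dir_deriv (\<lambda>y. \<omega> y (X x # del i v)) x (v ! i) + (-1) ^ i * \<omega> x (v[i := tangent_map X x (v ! i)])"
    if i: "i < k" for i
  proof -
    obtain k' where k': "k = Suc k'" using i by (cases k) auto
    have vi: "v ! i \<in> Rn n" by (rule tuples_nth[OF v i])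
    have dv: "del i v \<in> tuples n k'" using del_in_tuples v i unfolding k' by blast
    \<comment> \<open>The vectors fed to \<open>form_eval_deriv\<close>: only slot 0 varies with the
      point, so a single Leibniz term survives.\<close>
    define W where "W a y = (case a of 0 \<Rightarrow> X y | Suc b \<Rightarrow> del i v ! b)" for a y
    have Ws: "smooth_map n U n (Rn n) (W a)" if "a < k" for a
      using that X k' tuples_nth[OF dv] unfolding W_def
      by (cases a) (auto intro!: smooth_map_const[OF U])
    have W0: "W 0 = X" and WS: "W (Suc b) = (\<lambda>y. del i v ! b)" for b
      by (simp_all add: W_def fun_eq_iff)
    have mW: "map (\<lambda>a. W a y) [0..<k] = X y # del i v" for y
      using dv unfolding k' tuples_def
      by (intro nth_equalityI) (auto simp: W_def nth_Cons simp del: upt_Suc split: nat.split)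
    have TX: "tangent_map X x (v ! i) \<in> Rn n" by (rule tangent_map_Rn[OF X U order_refl x vi])
    have tup: "X x # del i v \<in> tuples n k" using dv XR[OF x] by (auto simp: tuples_def k')
    have "dir_deriv (\<lambda>y. \<omega> y (X y # del i v)) x (v ! i) =
        dir_deriv (\<lambda>y. \<omega> y (X x # del i v)) x (v ! i) +
        (\<Sum>a<k. \<omega> x ((X x # del i v)[a := tangent_map (W a) x (v ! i)]))"
      using form_eval_deriv[where W = W, OF \<omega> U U smooth_map_id[OF U] Ws x vi] unfolding mW by blast
    also have "(\<Sum>a<k. \<omega> x ((X x # del i v)[a := tangent_map (W a) x (v ! i)])) =
        \<omega> x (tangent_map X x (v ! i) # del i v)"
    proof -
      have "\<omega> x ((X x # del i v)[Suc a := tangent_map (W (Suc a)) x (v ! i)]) = 0" if "a < k'" for a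
        using alternating_zero[OF forms_alternating[OF \<omega> x] tup, of "Suc a"] that k'
        by (simp add: WS tangent_map_const)
      then show ?thesis unfolding k' sum.lessThan_Suc_shift by (simp add: W0)
    qed
    also have "\<omega> x (tangent_map X x (v ! i) # del i v) = (-1) ^ i * \<omega> x (v[i := tangent_map X x (v ! i)])"
      using alternating_update_move[OF forms_alternating[OF \<omega> x] v i TX] by simp
    finally show ?thesis .
  qed
  then have "ext_deriv n U (\<lambda>y w. \<omega> y (X y # w)) x v =
      (\<Sum>i<k. (-1) ^ i * dir_deriv (\<lambda>y. \<omega> y (X x # del i v)) x (v ! i) + \<omega> x (v[i := tangent_map X x (v ! i)]))"
    unfolding ext_deriv_apply[OF x v] by (intro sum.cong refl) (simp add: distrib_left)
  then show ?thesis unfolding 1 by (simp add: sum.distrib)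
qed

section \<open>Cohomology of isomorphic complexes\<close>

lemma fscale_zero [simp]: "fscale r 0 = 0"
  by (simp add: fscale_def fun_eq_iff)

lemma fscale_minus_one: "fscale (-1) a = - a"
  by (simp add: fscale_def fun_eq_iff)

lemma family_subspaceD:
  assumes "family_subspace A"
  shows "0 \<in> A" "a \<in> A \<Longrightarrow> b \<in> A \<Longrightarrow> a + b \<in> A" "a \<in> A \<Longrightarrow> fscale r a \<in> A"
    "a \<in> A \<Longrightarrow> - a \<in> A" "a \<in> A \<Longrightarrow> b \<in> A \<Longrightarrow> a - b \<in> A"
proof -
  show 1: "0 \<in> A" "a \<in> A \<Longrightarrow> b \<in> A \<Longrightarrow> a + b \<in> A" "a \<in> A \<Longrightarrow> fscale r a \<in> A" for a b r
    using assms by (auto simp: family_subspace_def)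
  show 2: "a \<in> A \<Longrightarrow> - a \<in> A" for a using 1(3)[of a "-1"] by (simp add: fscale_minus_one)
  show "a \<in> A \<Longrightarrow> b \<in> A \<Longrightarrow> a - b \<in> A" using 1(2)[of a "- b"] 2[of b] by simp
qed

lemma family_linearD:
  assumes "family_linear A f"
  shows "a \<in> A \<Longrightarrow> b \<in> A \<Longrightarrow> f (a + b) = f a + f b" "a \<in> A \<Longrightarrow> f (fscale r a) = fscale r (f a)"
  using assms by (auto simp: family_linear_def)

lemma family_linear_zero:
  assumes "family_linear A f" "family_subspace A"
  shows "f 0 = 0"
proof -
  have "f 0 + f 0 = f 0 + 0"
    using family_linearD(1)[OF assms(1), of 0 0] family_subspaceD(1)[OF assms(2)] by simp
  then show ?thesis by (simp only: add_left_cancel)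
qed

lemma family_linear_diff:
  assumes "family_linear A f" "family_subspace A" "a \<in> A" "b \<in> A"
  shows "f (a - b) = f a - f b"
  using family_linearD(1)[OF assms(1,3), of "- b"] family_linearD(2)[OF assms(1,4), of "-1"]
    family_subspaceD(4)[OF assms(2,4)]
  by (simp add: fscale_minus_one)

lemma cochain_complexD:
  assumes "cochain_complex C d"
  shows "family_subspace (C k)" "family_linear (C k) d" "a \<in> C k \<Longrightarrow> d a \<in> C (Suc k)"
    "a \<in> C k \<Longrightarrow> d (d a) = 0"
  using assms by (auto simp: cochain_complex_def)

lemma cocycles_subspace: "cochain_complex C d \<Longrightarrow> family_subspace (cocycles C d k)"
  using cochain_complexD(1,2)[of C d k] family_linear_zero[of "C k" d]
  by (simp add: family_subspace_def cocycles_def family_linear_def)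

lemma coboundaries_subspace:
  assumes "cochain_complex C d"
  shows "family_subspace (coboundaries C d k)"
proof (cases k)
  case (Suc j)
  note lin = family_linearD[OF cochain_complexD(2)[OF assms, of j]]
  note sub = family_subspaceD[OF cochain_complexD(1)[OF assms, of j]]
  have "0 \<in> d ` C j"
    using family_linear_zero[OF cochain_complexD(2,1)[OF assms, of j]] sub(1) by (metis image_eqI)
  moreover have "d a + d b \<in> d ` C j" if "a \<in> C j" "b \<in> C j" for a b
    using lin(1)[OF that] sub(2)[OF that] by (metis image_eqI)
  moreover have "fscale r (d a) \<in> d ` C j" if "a \<in> C j" for a r
    using lin(2)[OF that] sub(3)[OF that] by (metis image_eqI)
  ultimately show ?thesis by (auto simp: coboundaries_def Suc family_subspace_def)
qed (simp add: coboundaries_def family_subspace_def fscale_def fun_eq_iff)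

section \<open>Cohomology classes and induced maps\<close>

lemma equiv_cohomologous:
  assumes "cochain_complex C d"
  shows "equiv (cocycles C d k) (cohomologous C d k)"
proof (rule equivI)
  note sub = family_subspaceD[OF coboundaries_subspace[OF assms, of k]]
  show "refl_on (cocycles C d k) (cohomologous C d k)"
    using sub(1) by (auto simp: refl_on_def cohomologous_def)
  show "sym (cohomologous C d k)"
  proof (rule symI)
    fix a b assume "(a, b) \<in> cohomologous C d k"
    then show "(b, a) \<in> cohomologous C d k"
      using sub(4)[of "a - b"] by (simp add: cohomologous_def)
  qed
  show "trans (cohomologous C d k)"
  proof (rule transI)
    fix a b c assume "(a, b) \<in> cohomologous C d k" "(b, c) \<in> cohomologous C d k"
    then show "(a, c) \<in> cohomologous C d k"
      using sub(2)[of "a - b" "b - c"] by (simp add: cohomologous_def)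
  qed
  show "cohomologous C d k \<subseteq> cocycles C d k \<times> cocycles C d k" by (auto simp: cohomologous_def)
qed

text \<open>The common frame for an isomorphism of complexes and for the pullbacks along the maps
  that group elements induce on the leaf space.\<close>

definition cochain_map ::
  "(nat \<Rightarrow> 'i form_family set) \<Rightarrow> ('i form_family \<Rightarrow> 'i form_family) \<Rightarrow>
   (nat \<Rightarrow> 'j form_family set) \<Rightarrow> ('j form_family \<Rightarrow> 'j form_family) \<Rightarrow>
   ('i form_family \<Rightarrow> 'j form_family) \<Rightarrow> bool" where
  "cochain_map C d C' d' f \<longleftrightarrow>
     cochain_complex C d \<and> cochain_complex C' d' \<and>
     (\<forall>k. f ` C k \<subseteq> C' k \<and> family_linear (C k) f \<and> (\<forall>a\<in>C k. f (d a) = d' (f a)))"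

lemma cochain_mapD:
  assumes "cochain_map C d C' d' f"
  shows "cochain_complex C d" "cochain_complex C' d'" "a \<in> C k \<Longrightarrow> f a \<in> C' k"
    "family_linear (C k) f" "a \<in> C k \<Longrightarrow> f (d a) = d' (f a)"
  using assms unfolding cochain_map_def by (blast, blast, blast, blast, blast)

lemma cochain_iso_map: "cochain_iso C d C' d' f \<Longrightarrow> cochain_map C d C' d' f"
  by (simp add: cochain_iso_def cochain_map_def bij_betw_def)

lemma cochain_map_cocycles:
  assumes "cochain_map C d C' d' f" "a \<in> cocycles C d k"
  shows "f a \<in> cocycles C' d' k"
proof -
  note m = cochain_mapD[OF assms(1)]
  have a: "a \<in> C k" "d a = 0" using assms(2) by (simp_all add: cocycles_def)
  have "d' (f a) = f 0" using m(5)[OF a(1)] a(2) by simp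
  also have "\<dots> = 0" by (rule family_linear_zero[OF m(4)[of k] cochain_complexD(1)[OF m(1)]])
  finally show ?thesis using m(3)[OF a(1)] by (simp add: cocycles_def)
qed

lemma cochain_map_coboundaries:
  assumes "cochain_map C d C' d' f" "a \<in> coboundaries C d k"
  shows "f a \<in> coboundaries C' d' k"
proof (cases k)
  case 0
  note m = cochain_mapD[OF assms(1)]
  show ?thesis
    using assms(2) 0 family_linear_zero[OF m(4)[of k] cochain_complexD(1)[OF m(1)]]
    by (simp add: coboundaries_def)
next
  case (Suc j)
  then obtain c where "c \<in> C j" "a = d c" using assms(2) by (auto simp: coboundaries_def)
  then show ?thesis using cochain_mapD(3,5)[OF assms(1), of c j] Suc by (simp add: coboundaries_def)
qed

lemma cochain_map_cohomologous:
  assumes "cochain_map C d C' d' f" "(a, b) \<in> cohomologous C d k"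
  shows "(f a, f b) \<in> cohomologous C' d' k"
proof -
  note m = cochain_mapD[OF assms(1)]
  have ab: "a \<in> cocycles C d k" "b \<in> cocycles C d k" "a - b \<in> coboundaries C d k"
    using assms(2) by (simp_all add: cohomologous_def)
  then have "f (a - b) = f a - f b"
    by (intro family_linear_diff[OF m(4)[of k] cochain_complexD(1)[OF m(1)]]) (auto simp: cocycles_def)
  then show ?thesis
    using cochain_map_coboundaries[OF assms(1) ab(3)] cochain_map_cocycles[OF assms(1)] ab(1,2)
    by (simp add: cohomologous_def)
qed

text \<open>Sums, multiples and images of classes are defined as unions over all representatives;
  this collapses such a union to a single class once the choice of representative does not
  matter.\<close>

lemma UN_class_eq:
  assumes "equiv A r" "equiv B s" "a \<in> A" "\<And>a'. (a, a') \<in> r \<Longrightarrow> (g a, g a') \<in> s"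
  shows "(\<Union>a'\<in>r `` {a}. s `` {g a'}) = s `` {g a}"
proof -
  have "s `` {g a'} = s `` {g a}" if "a' \<in> r `` {a}" for a'
    using equiv_class_eq[OF assms(2) assms(4)] that by simp
  moreover have "r `` {a} \<noteq> {}" using equiv_class_self[OF assms(1,3)] by blast
  ultimately show ?thesis by simp
qed

lemma induced_class:
  assumes "cochain_map C d C' d' f" "a \<in> cocycles C d k"
  shows "induced C' d' k f (cohomologous C d k `` {a}) = cohomologous C' d' k `` {f a}"
  unfolding induced_def
  by (rule UN_class_eq[OF equiv_cohomologous[OF cochain_mapD(1)[OF assms(1)]]
        equiv_cohomologous[OF cochain_mapD(2)[OF assms(1)]] assms(2) cochain_map_cohomologous[OF assms(1)]])

lemma cohomologous_add:
  assumes "cochain_complex C d" "(a, a') \<in> cohomologous C d k" "(b, b') \<in> cohomologous C d k"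
  shows "(a + b, a' + b') \<in> cohomologous C d k"
proof -
  have "(a - a') + (b - b') \<in> coboundaries C d k"
    using family_subspaceD(2)[OF coboundaries_subspace[OF assms(1)]] assms(2,3) by (simp add: cohomologous_def)
  moreover have "(a - a') + (b - b') = (a + b) - (a' + b')" by (rule add_diff_add[symmetric])
  ultimately show ?thesis
    using family_subspaceD(2)[OF cocycles_subspace[OF assms(1)]] assms(2,3) by (simp add: cohomologous_def)
qed

lemma cohomologous_scale:
  assumes "cochain_complex C d" "(a, a') \<in> cohomologous C d k"
  shows "(fscale r a, fscale r a') \<in> cohomologous C d k"
proof -
  have "fscale r (a - a') = fscale r a - fscale r a'" by (simp add: fscale_def fun_eq_iff algebra_simps)
  then show ?thesis
    using family_subspaceD(3)[OF coboundaries_subspace[OF assms(1)], of "a - a'" k r]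
      family_subspaceD(3)[OF cocycles_subspace[OF assms(1)]] assms(2)
    by (simp add: cohomologous_def)
qed

lemma class_add_class:
  assumes "cochain_complex C d" "a \<in> cocycles C d k" "b \<in> cocycles C d k"
  shows "class_add C d k (cohomologous C d k `` {a}) (cohomologous C d k `` {b}) = cohomologous C d k `` {a + b}"
proof -
  note eq = equiv_cohomologous[OF assms(1), of k]
  have "(b, b) \<in> cohomologous C d k" using eq assms(3) by (simp add: equiv_def refl_on_def)
  have "(\<Union>b'\<in>cohomologous C d k `` {b}. cohomologous C d k `` {a' + b'}) = cohomologous C d k `` {a' + b}"
    if "a' \<in> cohomologous C d k `` {a}" for a'
  proof (rule UN_class_eq[OF eq eq assms(3)])
    have "(a', a') \<in> cohomologous C d k" using that eq by (auto simp: equiv_def refl_on_def)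
    then show "(a' + b, a' + b') \<in> cohomologous C d k" if "(b, b') \<in> cohomologous C d k" for b'
      using cohomologous_add[OF assms(1)] that by blast
  qed
  then have "class_add C d k (cohomologous C d k `` {a}) (cohomologous C d k `` {b}) =
     (\<Union>a'\<in>cohomologous C d k `` {a}. cohomologous C d k `` {a' + b})"
    unfolding class_add_def by (intro SUP_cong refl) 
  also have "\<dots> = cohomologous C d k `` {a + b}"
    using cohomologous_add[OF assms(1) _ \<open>(b, b) \<in> cohomologous C d k\<close>]
    by (rule UN_class_eq[OF eq eq assms(2)])
  finally show ?thesis .
qed

lemma class_scale_class:
  assumes "cochain_complex C d" "a \<in> cocycles C d k"
  shows "class_scale C d k r (cohomologous C d k `` {a}) = cohomologous C d k `` {fscale r a}"
  unfolding class_scale_def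
  by (rule UN_class_eq[OF equiv_cohomologous[OF assms(1)] equiv_cohomologous[OF assms(1)] assms(2)
        cohomologous_scale[OF assms(1)]])

lemma cohomology_cases:
  assumes "A \<in> cohomology C d k"
  obtains a where "a \<in> cocycles C d k" "A = cohomologous C d k `` {a}"
  using assms unfolding cohomology_def by (rule quotientE)

context
  fixes C :: "nat \<Rightarrow> 'i form_family set" and d C' d' and f :: "'i form_family \<Rightarrow> 'j form_family"
  assumes iso: "cochain_iso C d C' d' f"
begin

private lemma map: "cochain_map C d C' d' f"
  by (rule cochain_iso_map[OF iso])

private lemma bij: "bij_betw f (C k) (C' k)"
  using iso by (simp add: cochain_iso_def)

private lemma iso_zero: "f 0 = 0"
  by (rule family_linear_zero[OF cochain_mapD(4)[OF map] cochain_complexD(1)[OF cochain_mapD(1)[OF map]]])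

text \<open>The preimage of a cocycle is closed because \<open>f\<close> is injective one degree
  higher.\<close>

lemma cochain_iso_cocycles_lift:
  assumes "c \<in> cocycles C' d' k"
  obtains a where "a \<in> cocycles C d k" "f a = c"
proof -
  have "c \<in> f ` C k" using assms bij_betw_imp_surj_on[OF bij[of k]] by (simp add: cocycles_def)
  then obtain a where a: "a \<in> C k" "f a = c" by blast
  have "f (d a) = f 0" using cochain_mapD(5)[OF map a(1)] a(2) assms iso_zero by (simp add: cocycles_def)
  then have "d a = 0"
    by (rule inj_onD[OF bij_betw_imp_inj_on[OF bij[of "Suc k"]] _
          cochain_complexD(3)[OF cochain_mapD(1)[OF map] a(1)]
          family_subspaceD(1)[OF cochain_complexD(1)[OF cochain_mapD(1)[OF map]]]])
  with a that show ?thesis by (simp add: cocycles_def)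
qed

text \<open>Coboundaries are reflected by surjectivity one degree lower and injectivity in degree
  \<open>k\<close>; in degree 0 the only coboundary is 0.\<close>

lemma cochain_iso_cohomologous_reflect:
  assumes ab: "a \<in> cocycles C d k" "b \<in> cocycles C d k" and "(f a, f b) \<in> cohomologous C' d' k"
  shows "(a, b) \<in> cohomologous C d k"
proof -
  note cc = cochain_mapD(1)[OF map]
  have "a \<in> C k" "b \<in> C k" using ab by (simp_all add: cocycles_def)
  then have abC: "a - b \<in> C k" and fab: "f (a - b) = f a - f b"
    using family_subspaceD(5)[OF cochain_complexD(1)[OF cc]]
      family_linear_diff[OF cochain_mapD(4)[OF map] cochain_complexD(1)[OF cc]] by blast+
  have inj: "x = y" if "x \<in> C k" "y \<in> C k" "f x = f y" for x y
    using bij[of k] that inj_onD[OF bij_betw_imp_inj_on] by metis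
  have fc: "f (a - b) \<in> coboundaries C' d' k" using assms(3) fab by (simp add: cohomologous_def)
  have "a - b \<in> coboundaries C d k"
  proof (cases k)
    case 0
    then have "f (a - b) = f 0" using fc iso_zero by (simp add: coboundaries_def)
    then have "a - b = 0"
      by (rule inj[OF abC family_subspaceD(1)[OF cochain_complexD(1)[OF cc]]])
    then show ?thesis using 0 by (simp add: coboundaries_def)
  next
    case (Suc j)
    then obtain c' where "c' \<in> C' j" "f (a - b) = d' c'" using fc by (auto simp: coboundaries_def)
    moreover have "c' \<in> f ` C j" using \<open>c' \<in> C' j\<close> bij_betw_imp_surj_on[OF bij[of j]] by simp
    ultimately obtain c where c: "c \<in> C j" "f (a - b) = d' (f c)" by blast
    then have "f (a - b) = f (d c)" using cochain_mapD(5)[OF map c(1)] by simp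
    then have "a - b = d c" using inj[OF abC] cochain_complexD(3)[OF cc c(1)] Suc by simp
    then show ?thesis using c(1) Suc by (simp add: coboundaries_def)
  qed
  then show ?thesis using ab by (simp add: cohomologous_def)
qed

theorem cochain_iso_cohomology: "cohomology_iso C d C' d' k (induced C' d' k f)"
proof -
  note cc = cochain_mapD(1)[OF map] and cc' = cochain_mapD(2)[OF map]
  note ic = induced_class[OF map, where k = k]
  have "inj_on (induced C' d' k f) (cohomology C d k)"
  proof (rule inj_onI)
    fix A B assume "A \<in> cohomology C d k" "B \<in> cohomology C d k" and e: "induced C' d' k f A = induced C' d' k f B"
    then obtain a b where ab: "a \<in> cocycles C d k" "A = cohomologous C d k `` {a}"
      "b \<in> cocycles C d k" "B = cohomologous C d k `` {b}" by (metis cohomology_cases)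
    have "(f a, f b) \<in> cohomologous C' d' k"
      using e ab ic cochain_map_cocycles[OF map] eq_equiv_class_iff[OF equiv_cohomologous[OF cc', of k]] by simp
    then show "A = B"
      using cochain_iso_cohomologous_reflect[OF ab(1,3)] equiv_class_eq[OF equiv_cohomologous[OF cc]] ab by simp
  qed
  moreover have "induced C' d' k f ` cohomology C d k = cohomology C' d' k"
  proof
    show "induced C' d' k f ` cohomology C d k \<subseteq> cohomology C' d' k"
    proof (rule image_subsetI)
      fix A assume "A \<in> cohomology C d k"
      then show "induced C' d' k f A \<in> cohomology C' d' k"
      proof (rule cohomology_cases)
        fix a assume "a \<in> cocycles C d k" "A = cohomologous C d k `` {a}"
        then show ?thesis using ic cochain_map_cocycles[OF map] by (simp add: cohomology_def quotientI)
      qed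
    qed
    show "cohomology C' d' k \<subseteq> induced C' d' k f ` cohomology C d k"
    proof
      fix B assume "B \<in> cohomology C' d' k"
      then show "B \<in> induced C' d' k f ` cohomology C d k"
      proof (rule cohomology_cases)
        fix b assume b: "b \<in> cocycles C' d' k" "B = cohomologous C' d' k `` {b}"
        obtain a where a: "a \<in> cocycles C d k" "f a = b" by (rule cochain_iso_cocycles_lift[OF b(1)])
        then have "induced C' d' k f (cohomologous C d k `` {a}) = B" using ic b by simp
        moreover have "cohomologous C d k `` {a} \<in> cohomology C d k" using a by (simp add: cohomology_def quotientI)
        ultimately show ?thesis by blast
      qed
    qed
  qed
  moreover have "induced C' d' k f (class_add C d k A B) = class_add C' d' k (induced C' d' k f A) (induced C' d' k f B)"
    if AB: "A \<in> cohomology C d k" "B \<in> cohomology C d k" for A B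
  proof -
    obtain a b where ab: "a \<in> cocycles C d k" "A = cohomologous C d k `` {a}"
      "b \<in> cocycles C d k" "B = cohomologous C d k `` {b}" using AB by (metis cohomology_cases)
    have "f (a + b) = f a + f b"
      using family_linearD(1)[OF cochain_mapD(4)[OF map, of k]] ab(1,3) by (simp add: cocycles_def)
    then show ?thesis
      using ab ic class_add_class[OF cc] class_add_class[OF cc'] cochain_map_cocycles[OF map]
        family_subspaceD(2)[OF cocycles_subspace[OF cc]] by simp
  qed
  moreover have "induced C' d' k f (class_scale C d k r A) = class_scale C' d' k r (induced C' d' k f A)"
    if "A \<in> cohomology C d k" for A r
  proof -
    obtain a where a: "a \<in> cocycles C d k" "A = cohomologous C d k `` {a}" using \<open>A \<in> cohomology C d k\<close> by (rule cohomology_cases)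
    have "f (fscale r a) = fscale r (f a)"
      using family_linearD(2)[OF cochain_mapD(4)[OF map, of k]] a(1) by (simp add: cocycles_def)
    then show ?thesis
      using a ic class_scale_class[OF cc] class_scale_class[OF cc'] cochain_map_cocycles[OF map]
        family_subspaceD(3)[OF cocycles_subspace[OF cc]] by simp
  qed
  ultimately show ?thesis unfolding cohomology_iso_def bij_betw_def by simp
qed

text \<open>\<open>g'\<close> is known only through the equation \<open>g' (f a) = f (g a)\<close>.
  That it respects classes is checked on preimages under \<open>f\<close>, where \<open>g\<close> is
  a cochain map.\<close>

theorem cochain_iso_cohomology_equivariant:
  assumes g: "cochain_map C d C d g" and gg': "\<And>a. a \<in> C k \<Longrightarrow> g' (f a) = f (g a)"
    and A: "A \<in> cohomology C d k"
  shows "induced C' d' k g' (induced C' d' k f A) = induced C' d' k f (induced C d k g A)"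
proof -
  note cc' = cochain_mapD(2)[OF map]
  obtain a where a: "a \<in> cocycles C d k" "A = cohomologous C d k `` {a}" using A by (rule cohomology_cases)
  have fa: "f a \<in> cocycles C' d' k" by (rule cochain_map_cocycles[OF map a(1)])
  have "induced C' d' k g' (cohomologous C' d' k `` {f a}) = cohomologous C' d' k `` {g' (f a)}"
    unfolding induced_def
  proof (rule UN_class_eq[OF equiv_cohomologous[OF cc'] equiv_cohomologous[OF cc'] fa])
    fix b assume b: "(f a, b) \<in> cohomologous C' d' k"
    then have "b \<in> cocycles C' d' k" by (simp add: cohomologous_def)
    then obtain a' where a': "a' \<in> cocycles C d k" "f a' = b" by (rule cochain_iso_cocycles_lift)
    then have "(a, a') \<in> cohomologous C d k"
      using cochain_iso_cohomologous_reflect[OF a(1) a'(1)] b by simp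
    from cochain_map_cohomologous[OF map cochain_map_cohomologous[OF g this]]
    show "(g' (f a), g' b) \<in> cohomologous C' d' k"
      using gg'[of a] gg'[of a'] a(1) a' by (simp add: cocycles_def)
  qed
  then show ?thesis
    using induced_class[OF map a(1)] induced_class[OF g a(1)]
      induced_class[OF map cochain_map_cocycles[OF g a(1)]] gg'[of a] a by (simp add: cocycles_def)
qed

end

section \<open>Forms on diffeological spaces and descent along quotients\<close>

lemma forms_subspace:
  assumes "open_Rn n U"
  shows "0 \<in> forms n k U"
    and "\<omega> \<in> forms n k U \<Longrightarrow> \<eta> \<in> forms n k U \<Longrightarrow> \<omega> + \<eta> \<in> forms n k U"
    and "\<omega> \<in> forms n k U \<Longrightarrow> (\<lambda>x v. r * \<omega> x v) \<in> forms n k U"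
proof -
  show "0 \<in> forms n k U"
    by (simp add: forms_def alternating_def smooth_fun_const[OF assms])
  show "\<omega> + \<eta> \<in> forms n k U" if "\<omega> \<in> forms n k U" "\<eta> \<in> forms n k U"
    using that smooth_fun_add[OF assms] unfolding forms_def alternating_def
    by (simp add: algebra_simps)
  show "(\<lambda>x v. r * \<omega> x v) \<in> forms n k U" if "\<omega> \<in> forms n k U"
    using that smooth_fun_mult[OF assms smooth_fun_const[OF assms]] unfolding forms_def alternating_def
    by (simp add: algebra_simps)
qed

lemma ext_deriv_linear:
  assumes U: "open_Rn n U" and \<omega>: "\<omega> \<in> forms n k U"
  shows "\<eta> \<in> forms n k U \<Longrightarrow> ext_deriv n U (\<omega> + \<eta>) = ext_deriv n U \<omega> + ext_deriv n U \<eta>"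
    and "ext_deriv n U (\<lambda>x v. r * \<omega> x v) = (\<lambda>x v. r * ext_deriv n U \<omega> x v)"
proof -
  show "ext_deriv n U (\<omega> + \<eta>) = ext_deriv n U \<omega> + ext_deriv n U \<eta>" if \<eta>: "\<eta> \<in> forms n k U"
  proof (intro ext)
    fix x v
    show "ext_deriv n U (\<omega> + \<eta>) x v = (ext_deriv n U \<omega> + ext_deriv n U \<eta>) x v"
    proof (cases "x \<in> U \<and> v \<in> tuples n (Suc k)")
      case True
      then have x: "x \<in> U" and v: "v \<in> tuples n (Suc k)" by auto
      have "dir_deriv (\<lambda>y. (\<omega> + \<eta>) y (del i v)) x (v ! i) =
          dir_deriv (\<lambda>y. \<omega> y (del i v)) x (v ! i) + dir_deriv (\<lambda>y. \<eta> y (del i v)) x (v ! i)" if "i < Suc k" for i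
        using dir_deriv_add[OF forms_smooth[OF \<omega> del_in_tuples[OF v that]]
            forms_smooth[OF \<eta> del_in_tuples[OF v that]] U x tuples_nth[OF v that]] by simp
      then have "(\<Sum>i<Suc k. (-1) ^ i * dir_deriv (\<lambda>y. (\<omega> + \<eta>) y (del i v)) x (v ! i)) =
          (\<Sum>i<Suc k. (-1) ^ i * dir_deriv (\<lambda>y. \<omega> y (del i v)) x (v ! i) +
            (-1) ^ i * dir_deriv (\<lambda>y. \<eta> y (del i v)) x (v ! i))"
        by (intro sum.cong refl) (simp add: distrib_left)
      then show ?thesis unfolding plus_fun_apply ext_deriv_apply[OF x v] by (simp only: sum.distrib)
    next
      case False
      then show ?thesis
        using ext_deriv_zero[OF \<omega>, of x v] ext_deriv_zero[OF \<eta>, of x v]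
          ext_deriv_zero[OF forms_subspace(2)[OF U \<omega> \<eta>], of x v] by simp
    qed
  qed
  show "ext_deriv n U (\<lambda>x v. r * \<omega> x v) = (\<lambda>x v. r * ext_deriv n U \<omega> x v)"
  proof (intro ext)
    fix x v
    show "ext_deriv n U (\<lambda>x v. r * \<omega> x v) x v = r * ext_deriv n U \<omega> x v"
    proof (cases "x \<in> U \<and> v \<in> tuples n (Suc k)")
      case True
      then have x: "x \<in> U" and v: "v \<in> tuples n (Suc k)" by auto
      have "dir_deriv (\<lambda>y. r * \<omega> y (del i v)) x (v ! i) = r * dir_deriv (\<lambda>y. \<omega> y (del i v)) x (v ! i)"
        if "i < Suc k" for i
        by (rule dir_deriv_cmult[OF forms_smooth[OF \<omega> del_in_tuples[OF v that]] U x tuples_nth[OF v that]])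
      then have "(\<Sum>i<Suc k. (-1) ^ i * dir_deriv (\<lambda>y. r * \<omega> y (del i v)) x (v ! i)) =
          (\<Sum>i<Suc k. r * ((-1) ^ i * dir_deriv (\<lambda>y. \<omega> y (del i v)) x (v ! i)))"
        by (intro sum.cong refl) (simp add: mult_ac)
      then show ?thesis unfolding ext_deriv_apply[OF x v] by (simp only: sum_distrib_left)
    next
      case False
      then show ?thesis
        using ext_deriv_zero[OF \<omega>, of x v] ext_deriv_zero[OF forms_subspace(3)[OF U \<omega>], of x v r] by simp
    qed
  qed
qed

lemma ext_deriv_0 [simp]: "ext_deriv n U 0 = 0"
  by (simp add: ext_deriv_def fun_eq_iff)

lemma form_pullback_add: "form_pullback l V f (\<omega> + \<eta>) = form_pullback l V f \<omega> + form_pullback l V f \<eta>"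
  by (simp add: form_pullback_def fun_eq_iff)

lemma form_pullback_scale: "form_pullback l V f (\<lambda>x v. r * \<omega> x v) = (\<lambda>x v. r * form_pullback l V f \<omega> x v)"
  by (simp add: form_pullback_def fun_eq_iff)

lemma form_pullback_0: "form_pullback l V f 0 = 0"
  by (simp add: form_pullback_def fun_eq_iff)

section \<open>The complex of forms on a diffeological space\<close>

lemma dforms_in: "\<gamma> \<in> dforms D k \<Longrightarrow> (n, U, \<alpha>) \<in> D \<Longrightarrow> \<gamma> (n, U, \<alpha>) \<in> forms n k U"
  unfolding dforms_def by blast

lemma dforms_natural:
  "\<gamma> \<in> dforms D k \<Longrightarrow> (n, U, \<alpha>) \<in> D \<Longrightarrow> open_Rn l V \<Longrightarrow> smooth_map l V n U f \<Longrightarrow>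
   \<gamma> (l, V, compose V \<alpha> f) = form_pullback l V f (\<gamma> (n, U, \<alpha>))"
  unfolding dforms_def by blast

lemma dforms_zero: "\<gamma> \<in> dforms D k \<Longrightarrow> P \<notin> D \<Longrightarrow> \<gamma> P = 0"
  unfolding dforms_def by blast

lemma dformsI:
  assumes "\<And>P. P \<notin> D \<Longrightarrow> \<gamma> P = 0"
    and "\<And>n U \<alpha>. (n, U, \<alpha>) \<in> D \<Longrightarrow> \<gamma> (n, U, \<alpha>) \<in> forms n k U"
    and "\<And>n U \<alpha> l V f. (n, U, \<alpha>) \<in> D \<Longrightarrow> open_Rn l V \<Longrightarrow> smooth_map l V n U f \<Longrightarrow>
      \<gamma> (l, V, compose V \<alpha> f) = form_pullback l V f (\<gamma> (n, U, \<alpha>))"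
  shows "\<gamma> \<in> dforms D k"
  unfolding dforms_def using assms by blast

lemma paramsD: "(n, U, \<alpha>) \<in> params X \<Longrightarrow> open_Rn n U \<and> \<alpha> \<in> U \<rightarrow>\<^sub>E X"
  by (simp add: params_def)

lemma dform_d_apply: "dform_d \<gamma> (n, U, \<alpha>) = ext_deriv n U (\<gamma> (n, U, \<alpha>))"
  by (simp add: dform_d_def)

lemma dforms_family_subspace:
  assumes D: "D \<subseteq> params X"
  shows "family_subspace (dforms D k)"
  unfolding family_subspace_def
proof (intro conjI ballI allI)
  have op: "open_Rn n U" if "(n, U, \<alpha>) \<in> D" for n U and \<alpha> :: "(nat \<Rightarrow> real) \<Rightarrow> 'a"
    using that D paramsD by blast
  show "0 \<in> dforms D k"
    by (rule dformsI) (simp_all add: form_pullback_0 forms_subspace(1)[OF op])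
  show "a + b \<in> dforms D k" if "a \<in> dforms D k" "b \<in> dforms D k" for a b
    by (rule dformsI) (simp_all add: dforms_zero[OF that(1)] dforms_zero[OF that(2)] form_pullback_add
        forms_subspace(2)[OF op dforms_in[OF that(1)] dforms_in[OF that(2)]]
        dforms_natural[OF that(1)] dforms_natural[OF that(2)])
  show "fscale r a \<in> dforms D k" if "a \<in> dforms D k" for a r
    by (rule dformsI) (simp_all add: fscale_def dforms_zero[OF that] form_pullback_scale fun_eq_iff
        forms_subspace(3)[OF op dforms_in[OF that]] dforms_natural[OF that])
qed

lemma dform_d_dforms:
  assumes D: "D \<subseteq> params X" and \<gamma>: "\<gamma> \<in> dforms D k"
  shows "dform_d \<gamma> \<in> dforms D (Suc k)"
proof (rule dformsI)
  fix P assume "P \<notin> D"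
  then show "dform_d \<gamma> P = 0" using dforms_zero[OF \<gamma>] by (cases P) (simp add: dform_d_apply)
next
  fix n U \<alpha> assume P: "(n, U, \<alpha>) \<in> D"
  then have U: "open_Rn n U" using D paramsD by blast
  show "dform_d \<gamma> (n, U, \<alpha>) \<in> forms n (Suc k) U"
    unfolding dform_d_apply by (rule ext_deriv_forms[OF dforms_in[OF \<gamma> P] U])
  fix l V f assume V: "open_Rn l V" and f: "smooth_map l V n U f"
  show "dform_d \<gamma> (l, V, compose V \<alpha> f) = form_pullback l V f (dform_d \<gamma> (n, U, \<alpha>))"
    unfolding dform_d_apply dforms_natural[OF \<gamma> P V f]
    by (rule ext_deriv_pullback[OF dforms_in[OF \<gamma> P] U V f])
qed

lemma dforms_cochain_complex:
  assumes D: "D \<subseteq> params X"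
  shows "cochain_complex (dforms D) dform_d"
  unfolding cochain_complex_def
proof (intro allI conjI ballI)
  fix k
  show "family_subspace (dforms D k)" by (rule dforms_family_subspace[OF D])
  show "dform_d ` dforms D k \<subseteq> dforms D (Suc k)" using dform_d_dforms[OF D] by blast
  have op: "open_Rn n U" if "(n, U, \<alpha>) \<in> D" for n U \<alpha> using that D paramsD by blast
  show "family_linear (dforms D k) dform_d"
    unfolding family_linear_def
  proof (intro conjI ballI allI)
    fix a b r assume a: "a \<in> dforms D k"
    show "dform_d (fscale r a) = fscale r (dform_d a)"
    proof
      fix P :: "'a param" obtain n U \<alpha> where P: "P = (n, U, \<alpha>)" by (cases P)
      show "dform_d (fscale r a) P = fscale r (dform_d a) P"
      proof (cases "P \<in> D")
        case True
        then show ?thesis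
          using ext_deriv_linear(2)[OF op dforms_in[OF a], where r = r] by (simp add: P dform_d_apply fscale_def)
      next
        case False
        then have a0: "a (n, U, \<alpha>) = 0" using dforms_zero[OF a False] by (simp add: P)
        have f0: "fscale r a (n, U, \<alpha>) = 0" unfolding fscale_def a0 by (simp add: fun_eq_iff)
        show ?thesis
          unfolding P fscale_def[of r "dform_d a"] dform_d_apply a0 f0 ext_deriv_0 by (simp add: fun_eq_iff)
      qed
    qed
    assume b: "b \<in> dforms D k"
    show "dform_d (a + b) = dform_d a + dform_d b"
    proof
      fix P :: "'a param" obtain n U \<alpha> where P: "P = (n, U, \<alpha>)" by (cases P)
      show "dform_d (a + b) P = (dform_d a + dform_d b) P"
      proof (cases "P \<in> D")
        case True
        then show ?thesis
          using ext_deriv_linear(1)[OF op dforms_in[OF a] dforms_in[OF b]] by (simp add: P dform_d_apply)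
      next
        case False
        then show ?thesis using dforms_zero[OF a False] dforms_zero[OF b False] by (simp add: P dform_d_apply)
      qed
    qed
  qed
  fix a assume a: "a \<in> dforms D k"
  show "dform_d (dform_d a) = 0"
  proof
    fix P :: "'a param" obtain n U \<alpha> where P: "P = (n, U, \<alpha>)" by (cases P)
    show "dform_d (dform_d a) P = 0 P"
    proof (cases "P \<in> D")
      case True
      then show ?thesis
        using ext_deriv_ext_deriv[OF dforms_in[OF a] op] by (simp add: P dform_d_apply fun_eq_iff)
    next
      case False
      then show ?thesis using dforms_zero[OF a False] by (simp add: P dform_d_apply)
    qed
  qed
qed

lemma dform_d_pullback: "dform_d (dform_pullback D f \<gamma>) = dform_pullback D f (dform_d \<gamma>)"
  by (auto simp: dform_d_def dform_pullback_def fun_eq_iff ext_deriv_def)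

lemma family_linear_dform_pullback: "family_linear A (dform_pullback D f)"
  by (auto simp: family_linear_def dform_pullback_def fscale_def fun_eq_iff)

lemma dform_pullback_apply: "(n, U, \<alpha>) \<in> D \<Longrightarrow> dform_pullback D f \<gamma> (n, U, \<alpha>) = \<gamma> (n, U, compose U f \<alpha>)"
  by (simp add: dform_pullback_def)

lemma diffeology_compose:
  "diffeology X D \<Longrightarrow> (n, U, \<alpha>) \<in> D \<Longrightarrow> open_Rn l V \<Longrightarrow> smooth_map l V n U h \<Longrightarrow> (l, V, compose V \<alpha> h) \<in> D"
  unfolding diffeology_def by blast

lemma diffeology_params: "diffeology X D \<Longrightarrow> D \<subseteq> params X"
  by (simp add: diffeology_def)

lemma diffeology_open: "diffeology X D \<Longrightarrow> (n, U, \<alpha>) \<in> D \<Longrightarrow> open_Rn n U"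
  using diffeology_params paramsD by blast

lemma diffeology_in: "diffeology X D \<Longrightarrow> (n, U, \<alpha>) \<in> D \<Longrightarrow> x \<in> U \<Longrightarrow> \<alpha> x \<in> X"
  using diffeology_params[of X D] paramsD[of n U \<alpha> X] by (auto simp: PiE_iff)

lemma compose_compose_restrict:
  "h \<in> V \<rightarrow> U \<Longrightarrow> compose V (compose U f \<alpha>) h = compose V f (compose V \<alpha> h)"
  by (auto simp: compose_def fun_eq_iff)

lemma dform_pullback_dforms:
  assumes f: "dsmooth X D Y E f" and \<gamma>: "\<gamma> \<in> dforms E k"
  shows "dform_pullback D f \<gamma> \<in> dforms D k"
proof (rule dformsI)
  have D: "diffeology X D" and fE: "(n, U, compose U f \<alpha>) \<in> E" if "(n, U, \<alpha>) \<in> D" for n U \<alpha>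
    using f that by (auto simp: dsmooth_def)
  show "dform_pullback D f \<gamma> P = 0" if "P \<notin> D" for P
    using that by (cases P) (simp add: dform_pullback_def)
  fix n U \<alpha> assume P: "(n, U, \<alpha>) \<in> D"
  show "dform_pullback D f \<gamma> (n, U, \<alpha>) \<in> forms n k U"
    using dforms_in[OF \<gamma> fE[OF P]] P by (simp add: dform_pullback_apply)
  fix l V h assume V: "open_Rn l V" and h: "smooth_map l V n U h"
  have "h \<in> V \<rightarrow> U" using h by (simp add: smooth_map_def)
  then show "dform_pullback D f \<gamma> (l, V, compose V \<alpha> h) = form_pullback l V h (dform_pullback D f \<gamma> (n, U, \<alpha>))"
    using dforms_natural[OF \<gamma> fE[OF P] V h] diffeology_compose[OF D[OF P] P V h] P
    by (simp add: dform_pullback_apply compose_compose_restrict)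
qed

lemma restrict_eq_compose: "restrict \<alpha> V = compose V \<alpha> (\<lambda>x. x)"
  by (auto simp: compose_def)

lemma smooth_inclusion: "open_Rn n V \<Longrightarrow> V \<subseteq> U \<Longrightarrow> smooth_map n V n U (\<lambda>x. x)"
  by (rule smooth_map_subset[OF smooth_map_id order_refl])

lemma diffeology_restrict:
  "diffeology X D \<Longrightarrow> (n, U, \<alpha>) \<in> D \<Longrightarrow> open_Rn n V \<Longrightarrow> V \<subseteq> U \<Longrightarrow> (n, V, restrict \<alpha> V) \<in> D"
  unfolding restrict_eq_compose by (rule diffeology_compose[OF _ _ _ smooth_inclusion])

text \<open>Naturality along the inclusion of \<open>V\<close>, whose tangent map is the
  identity.\<close>

lemma dform_restrict:
  assumes "\<gamma> \<in> dforms D k" "(n, U, \<alpha>) \<in> D" "open_Rn n V" "V \<subseteq> U" "x \<in> V"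
  shows "\<gamma> (n, V, restrict \<alpha> V) x = \<gamma> (n, U, \<alpha>) x"
  unfolding restrict_eq_compose dforms_natural[OF assms(1-3) smooth_inclusion[OF assms(3,4)]]
  by (intro ext form_pullback_id_apply[OF dforms_in[OF assms(1,2)] assms(5)])

lemma dforms_eqI:
  assumes "\<gamma> \<in> dforms D k" "\<gamma>' \<in> dforms D k"
    and "\<And>n U \<alpha> x. (n, U, \<alpha>) \<in> D \<Longrightarrow> x \<in> U \<Longrightarrow> \<gamma> (n, U, \<alpha>) x = \<gamma>' (n, U, \<alpha>) x"
  shows "\<gamma> = \<gamma>'"
proof
  fix P :: "'a param" obtain n U \<alpha> where P: "P = (n, U, \<alpha>)" by (cases P)
  show "\<gamma> P = \<gamma>' P"
  proof (cases "P \<in> D")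
    case True
    show ?thesis
    proof (intro ext)
      fix x v
      show "\<gamma> P x v = \<gamma>' P x v"
        using assms(3)[of n U \<alpha> x] forms_zero[OF dforms_in[OF assms(1)], of n U \<alpha> x v]
          forms_zero[OF dforms_in[OF assms(2)], of n U \<alpha> x v] True unfolding P by (cases "x \<in> U") auto
    qed
  qed (simp add: dforms_zero[OF assms(1)] dforms_zero[OF assms(2)])
qed

section \<open>Quotient diffeologies and descent of forms\<close>

locale diffeological_quotient =
  fixes X :: "'x set" and D :: "'x param set" and Y :: "'y set" and p :: "'x \<Rightarrow> 'y"
  assumes D: "diffeology X D" and surj: "p ` X = Y"
begin

abbreviation Q where "Q \<equiv> quotient_diffeology D Y p"

text \<open>Stated for pairs so that a lift can be selected by \<open>SOME\<close> in
  \<open>descending_form\<close>.\<close>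

definition lift_at :: "nat \<Rightarrow> (nat \<Rightarrow> real) set \<Rightarrow> ((nat \<Rightarrow> real) \<Rightarrow> 'y) \<Rightarrow> (nat \<Rightarrow> real) \<Rightarrow>
    (nat \<Rightarrow> real) set \<times> ((nat \<Rightarrow> real) \<Rightarrow> 'x) \<Rightarrow> bool" where
  "lift_at n U \<sigma> x = (\<lambda>(V, \<alpha>). open_Rn n V \<and> x \<in> V \<and> V \<subseteq> U \<and> (n, V, \<alpha>) \<in> D \<and> (\<forall>y\<in>V. \<sigma> y = p (\<alpha> y)))"

text \<open>A constant parametrization lifts to a constant one because \<open>p\<close> is onto, so
  the separate clause for constants is absorbed by the lifting condition.\<close>

lemma quotient_plot_iff:
  "(n, U, \<sigma>) \<in> Q \<longleftrightarrow> (n, U, \<sigma>) \<in> params Y \<and> (\<forall>x\<in>U. \<exists>L. lift_at n U \<sigma> x L)"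
proof -
  have "\<exists>L. lift_at n U \<sigma> x L" if P: "(n, U, \<sigma>) \<in> params Y" and c: "\<forall>x\<in>U. \<sigma> x = c" and x: "x \<in> U" for c x
  proof -
    have U: "open_Rn n U" using paramsD[OF P] by simp
    have "c \<in> Y" using paramsD[OF P] c x by (metis PiE_mem)
    then obtain c' where c': "c' \<in> X" "p c' = c" using surj by auto
    have "(n, U, \<lambda>x\<in>U. c') \<in> D" using D U c'(1) unfolding diffeology_def by blast
    then have "lift_at n U \<sigma> x (U, \<lambda>x\<in>U. c')" using U x c c'(2) by (simp add: lift_at_def)
    then show ?thesis by blast
  qed
  then show ?thesis
    unfolding quotient_diffeology_def by (auto simp: lift_at_def)
qed

lemma lift_compose:
  assumes L: "lift_at n U \<sigma> (h x) (W, \<alpha>)" and U: "open_Rn n U" and V: "open_Rn l V" and h: "smooth_map l V n U h"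
    and x: "x \<in> V"
  defines "W' \<equiv> {z \<in> V. h z \<in> W}"
  shows "lift_at l V (compose V \<sigma> h) x (W', compose W' \<alpha> h)" and "smooth_map l W' n W h" and "open_Rn l W'"
proof -
  have W: "open_Rn n W" using L by (simp add: lift_at_def)
  show W': "open_Rn l W'"
    unfolding W'_def by (rule smooth_map_preimage_open[OF h V open_Rn_subset[OF U] W])
  have "smooth_map l W' n U h" by (rule smooth_map_subset[OF h]) (auto simp: W'_def)
  then show hW: "smooth_map l W' n W h" by (rule smooth_map_into) (simp add: W'_def)
  have "(l, W', compose W' \<alpha> h) \<in> D"
    by (rule diffeology_compose[OF D _ W' hW]) (use L in \<open>simp add: lift_at_def\<close>)
  then show "lift_at l V (compose V \<sigma> h) x (W', compose W' \<alpha> h)"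
    using L x W' by (auto simp: lift_at_def W'_def compose_def)
qed

lemma diffeology_quotient: "diffeology Y Q"
  unfolding diffeology_def
proof (intro conjI)
  show "Q \<subseteq> params Y" by (auto simp: quotient_diffeology_def)
  show "\<forall>n U. \<forall>c\<in>Y. open_Rn n U \<longrightarrow> (n, U, \<lambda>x\<in>U. c) \<in> Q"
    by (auto simp: quotient_diffeology_def params_def)
  show "\<forall>(n, U, \<alpha>)\<in>Q. \<forall>l V h. open_Rn l V \<and> smooth_map l V n U h \<longrightarrow> (l, V, compose V \<alpha> h) \<in> Q"
  proof (clarify)
    fix n U \<sigma> l V h assume Q: "(n, U, \<sigma>) \<in> Q" and V: "open_Rn l V" and h: "smooth_map l V n U h"
    have P: "(n, U, \<sigma>) \<in> params Y" and L: "\<exists>L. lift_at n U \<sigma> y L" if "y \<in> U" for y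
      using Q that unfolding quotient_plot_iff by auto
    have P: "(n, U, \<sigma>) \<in> params Y" using Q unfolding quotient_plot_iff by blast
    have "compose V \<sigma> h \<in> V \<rightarrow>\<^sub>E Y"
      using smooth_map_in[OF h] paramsD[OF P] by (auto simp: compose_def PiE_iff)
    then have "(l, V, compose V \<sigma> h) \<in> params Y" using V by (simp add: params_def)
    moreover have "\<exists>L. lift_at l V (compose V \<sigma> h) x L" if x: "x \<in> V" for x
    proof -
      obtain W \<alpha> where "lift_at n U \<sigma> (h x) (W, \<alpha>)" using L[OF smooth_map_in[OF h x]] by auto
      from lift_compose(1)[OF this _ V h x] paramsD[OF P] show ?thesis by blast
    qed
    ultimately show "(l, V, compose V \<sigma> h) \<in> Q" unfolding quotient_plot_iff by blast
  qed
  show "\<forall>(n, U, \<alpha>)\<in>params Y. (\<forall>x\<in>U. \<exists>V. open_Rn n V \<and> x \<in> V \<and> V \<subseteq> U \<and> (n, V, restrict \<alpha> V) \<in> Q) \<longrightarrow> (n, U, \<alpha>) \<in> Q"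
  proof (clarify)
    fix n U \<sigma> assume P: "(n, U, \<sigma>) \<in> params Y"
      and loc: "\<forall>x\<in>U. \<exists>V. open_Rn n V \<and> x \<in> V \<and> V \<subseteq> U \<and> (n, V, restrict \<sigma> V) \<in> Q"
    have "\<exists>L. lift_at n U \<sigma> x L" if x: "x \<in> U" for x
    proof -
      obtain V where V: "x \<in> V" "V \<subseteq> U" "(n, V, restrict \<sigma> V) \<in> Q" using loc x by blast
      then obtain W \<alpha> where "lift_at n V (restrict \<sigma> V) x (W, \<alpha>)" unfolding quotient_plot_iff by auto
      moreover have "restrict \<sigma> V y = \<sigma> y" if "y \<in> W" "W \<subseteq> V" for y using that by auto
      ultimately have "lift_at n U \<sigma> x (W, \<alpha>)" using V(2) by (simp add: lift_at_def) blast
      then show ?thesis by blast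
    qed
    with P show "(n, U, \<sigma>) \<in> Q" unfolding quotient_plot_iff by blast
  qed
qed

lemma quotient_plot:
  assumes "(n, U, \<alpha>) \<in> D"
  shows "(n, U, compose U p \<alpha>) \<in> Q"
proof -
  have U: "open_Rn n U" and \<alpha>: "\<alpha> x \<in> X" if "x \<in> U" for x
    using diffeology_open[OF D assms] diffeology_in[OF D assms that] by auto
  have "compose U p \<alpha> \<in> U \<rightarrow>\<^sub>E Y" using \<alpha> surj by (auto simp: compose_def)
  then have "(n, U, compose U p \<alpha>) \<in> params Y"
    using diffeology_open[OF D assms] by (simp add: params_def)
  moreover have "lift_at n U (compose U p \<alpha>) x (U, \<alpha>)" if "x \<in> U" for x
    using assms U that by (simp add: lift_at_def compose_def)
  ultimately show ?thesis unfolding quotient_plot_iff by blast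
qed

lemma dsmooth_quotient: "dsmooth X D Y Q p"
  using D diffeology_quotient quotient_plot surj by (auto simp: dsmooth_def)

text \<open>A local lift followed by \<open>g\<close> is a local lift of the plot followed by
  \<open>r\<close>.\<close>

lemma dsmooth_induced:
  assumes g: "dsmooth X D X D g" and r: "r \<in> Y \<rightarrow> Y" and rp: "\<And>x. x \<in> X \<Longrightarrow> p (g x) = r (p x)"
  shows "dsmooth Y Q Y Q r"
proof -
  have "(n, U, compose U r \<sigma>) \<in> Q" if Q: "(n, U, \<sigma>) \<in> Q" for n U \<sigma>
  proof -
    have P: "(n, U, \<sigma>) \<in> params Y" using Q unfolding quotient_plot_iff by blast
    have "compose U r \<sigma> \<in> U \<rightarrow>\<^sub>E Y" using paramsD[OF P] r by (auto simp: compose_def PiE_iff)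
    then have "(n, U, compose U r \<sigma>) \<in> params Y" using paramsD[OF P] by (simp add: params_def)
    moreover have "\<exists>L. lift_at n U (compose U r \<sigma>) x L" if x: "x \<in> U" for x
    proof -
      obtain V \<alpha> where L: "lift_at n U \<sigma> x (V, \<alpha>)" using Q x unfolding quotient_plot_iff by auto
      then have V: "(n, V, \<alpha>) \<in> D" by (simp add: lift_at_def)
      have "(n, V, compose V g \<alpha>) \<in> D" using g V by (auto simp: dsmooth_def)
      moreover have "compose U r \<sigma> y = p (compose V g \<alpha> y)" if "y \<in> V" for y
        using L that rp[OF diffeology_in[OF D V that]] by (auto simp: lift_at_def compose_def)
      ultimately have "lift_at n U (compose U r \<sigma>) x (V, compose V g \<alpha>)" using L by (simp add: lift_at_def)
      then show ?thesis by blast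
    qed
    ultimately show ?thesis unfolding quotient_plot_iff by blast
  qed
  then show ?thesis using diffeology_quotient r by (auto simp: dsmooth_def)
qed

text \<open>Identified in \<open>bij_betw_quotient_pullback\<close> with the image of the pullback
  along \<open>p\<close>; this turns forms on the quotient into a condition on forms on
  \<open>X\<close>.\<close>

definition descending :: "nat \<Rightarrow> 'x param form_family set" where
  "descending k = {\<beta> \<in> dforms D k. \<forall>n V \<alpha> \<alpha>'. (n, V, \<alpha>) \<in> D \<and> (n, V, \<alpha>') \<in> D \<and>
     (\<forall>y\<in>V. p (\<alpha> y) = p (\<alpha>' y)) \<longrightarrow> \<beta> (n, V, \<alpha>) = \<beta> (n, V, \<alpha>')}"

lemma pullback_descending:
  assumes "\<gamma> \<in> dforms Q k"
  shows "dform_pullback D p \<gamma> \<in> descending k"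
proof -
  have "dform_pullback D p \<gamma> (n, V, \<alpha>) = dform_pullback D p \<gamma> (n, V, \<alpha>')"
    if "(n, V, \<alpha>) \<in> D" "(n, V, \<alpha>') \<in> D" "\<forall>y\<in>V. p (\<alpha> y) = p (\<alpha>' y)" for n V \<alpha> \<alpha>'
  proof -
    have "compose V p \<alpha> = compose V p \<alpha>'" using that(3) by (auto simp: compose_def)
    then show ?thesis using that(1,2) by (simp add: dform_pullback_apply)
  qed
  with dform_pullback_dforms[OF dsmooth_quotient assms] show ?thesis
    unfolding descending_def by blast
qed

lemma quotient_form_at_lift:
  assumes \<gamma>: "\<gamma> \<in> dforms Q k" and Q: "(n, U, \<sigma>) \<in> Q" and L: "lift_at n U \<sigma> x (V, \<alpha>)"
  shows "\<gamma> (n, U, \<sigma>) x = dform_pullback D p \<gamma> (n, V, \<alpha>) x"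
proof -
  have V: "open_Rn n V" "V \<subseteq> U" "x \<in> V" "(n, V, \<alpha>) \<in> D" "\<forall>y\<in>V. \<sigma> y = p (\<alpha> y)"
    using L by (auto simp: lift_at_def)
  have "restrict \<sigma> V = compose V p \<alpha>" using V(5) by (auto simp: compose_def)
  then show ?thesis using dform_restrict[OF \<gamma> Q V(1-3)] V(4) by (simp add: dform_pullback_apply)
qed

lemma inj_on_quotient_pullback: "inj_on (dform_pullback D p) (dforms Q k)"
proof (rule inj_onI)
  fix \<gamma> \<gamma>' assume g: "\<gamma> \<in> dforms Q k" "\<gamma>' \<in> dforms Q k" and e: "dform_pullback D p \<gamma> = dform_pullback D p \<gamma>'"
  show "\<gamma> = \<gamma>'"
  proof (rule dforms_eqI[OF g])
    fix n U \<sigma> x assume Q: "(n, U, \<sigma>) \<in> Q" and "x \<in> U"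
    then obtain V \<alpha> where L: "lift_at n U \<sigma> x (V, \<alpha>)" unfolding quotient_plot_iff by auto
    show "\<gamma> (n, U, \<sigma>) x = \<gamma>' (n, U, \<sigma>) x"
      unfolding quotient_form_at_lift[OF g(1) Q L] quotient_form_at_lift[OF g(2) Q L] e ..
  qed
qed

text \<open>The form is read off from local lifts. Two lifts near \<open>x\<close> have equal
  projections on the intersection of their domains, so \<open>\<beta>\<close> agrees on their
  restrictions and the choice of lift is immaterial.\<close>

lemma descending_form:
  assumes \<beta>: "\<beta> \<in> descending k"
  obtains \<gamma> where "\<gamma> \<in> dforms Q k" "dform_pullback D p \<gamma> = \<beta>"
proof -
  have \<beta>D: "\<beta> \<in> dforms D k" using \<beta> by (simp add: descending_def)
  have well: "\<beta> (n, V, \<alpha>) x = \<beta> (n, V', \<alpha>') x"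
    if L: "lift_at n U \<sigma> x (V, \<alpha>)" "lift_at n U' \<sigma>' x (V', \<alpha>')" "\<forall>y\<in>V \<inter> V'. \<sigma> y = \<sigma>' y" for n U U' \<sigma> \<sigma>' x V V' \<alpha> \<alpha>'
  proof -
    have V: "open_Rn n V" "x \<in> V" "(n, V, \<alpha>) \<in> D" "\<forall>y\<in>V. \<sigma> y = p (\<alpha> y)"
      "open_Rn n V'" "x \<in> V'" "(n, V', \<alpha>') \<in> D" "\<forall>y\<in>V'. \<sigma>' y = p (\<alpha>' y)"
      using L(1,2) by (simp_all add: lift_at_def)
    have W: "open_Rn n (V \<inter> V')" using V by (intro openin_Int)
    have r: "(n, V \<inter> V', restrict \<alpha> (V \<inter> V')) \<in> D" "(n, V \<inter> V', restrict \<alpha>' (V \<inter> V')) \<in> D"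
      using diffeology_restrict[OF D V(3) W] diffeology_restrict[OF D V(7) W] by auto
    have "\<forall>y\<in>V \<inter> V'. p (restrict \<alpha> (V \<inter> V') y) = p (restrict \<alpha>' (V \<inter> V') y)"
      using V(4,8) L(3) by simp
    with r have "\<beta> (n, V \<inter> V', restrict \<alpha> (V \<inter> V')) = \<beta> (n, V \<inter> V', restrict \<alpha>' (V \<inter> V'))"
      using \<beta> unfolding descending_def by blast
    then show ?thesis
      using dform_restrict[OF \<beta>D V(3) W, of x] dform_restrict[OF \<beta>D V(7) W, of x] V by simp
  qed
  \<comment> \<open>A lift is chosen anew at every point. Smoothness is recovered afterwards: by
    \<open>well\<close> one lift serves for all points of its domain.\<close>
  define \<gamma> :: "'y param form_family" where "\<gamma> = (\<lambda>(n, U, \<sigma>). if (n, U, \<sigma>) \<in> Q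
     then (\<lambda>x v. if x \<in> U then (case SOME L. lift_at n U \<sigma> x L of (V, \<alpha>) \<Rightarrow> \<beta> (n, V, \<alpha>) x v) else 0) else 0)"
  have \<gamma>_at: "\<gamma> (n, U, \<sigma>) x = \<beta> (n, V, \<alpha>) x" if Q: "(n, U, \<sigma>) \<in> Q" and L: "lift_at n U \<sigma> x (V, \<alpha>)" for n U \<sigma> x V \<alpha>
  proof -
    have x: "x \<in> U" using L by (auto simp: lift_at_def)
    obtain V' \<alpha>' where c: "(SOME L. lift_at n U \<sigma> x L) = (V', \<alpha>')" by (cases "SOME L. lift_at n U \<sigma> x L")
    have "lift_at n U \<sigma> x (SOME L. lift_at n U \<sigma> x L)" using L by (rule someI)
    then have L': "lift_at n U \<sigma> x (V', \<alpha>')" unfolding c .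
    show ?thesis using Q x well[OF L' L] by (simp add: \<gamma>_def c)
  qed
  have lift_move: "lift_at n U \<sigma> y (V, \<alpha>)" if "lift_at n U \<sigma> x (V, \<alpha>)" "y \<in> V" for n U \<sigma> x y V \<alpha>
    using that by (simp add: lift_at_def)
  have \<gamma>_out: "\<gamma> (n, U, \<sigma>) x v = 0" if "x \<notin> U" for n U \<sigma> x v
    using that by (simp add: \<gamma>_def)
  have \<gamma>_forms: "\<gamma> (n, U, \<sigma>) \<in> forms n k U" if Q: "(n, U, \<sigma>) \<in> Q" for n U \<sigma>
  proof (rule forms_local[OF _ \<gamma>_out])
    show "open_Rn n U" by (rule diffeology_open[OF diffeology_quotient Q])
    fix x assume "x \<in> U"
    then obtain V \<alpha> where L: "lift_at n U \<sigma> x (V, \<alpha>)" using Q unfolding quotient_plot_iff by auto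
    then have "open_Rn n V" "x \<in> V" "V \<subseteq> U" "\<beta> (n, V, \<alpha>) \<in> forms n k V"
      using dforms_in[OF \<beta>D] by (auto simp: lift_at_def)
    moreover have "\<forall>y\<in>V. \<gamma> (n, U, \<sigma>) y = \<beta> (n, V, \<alpha>) y" using \<gamma>_at[OF Q lift_move[OF L]] by blast
    ultimately show "\<exists>V \<eta>. open_Rn n V \<and> x \<in> V \<and> V \<subseteq> U \<and> \<eta> \<in> forms n k V \<and> (\<forall>y\<in>V. \<gamma> (n, U, \<sigma>) y = \<eta> y)"
      by blast
  qed
  have \<gamma>: "\<gamma> \<in> dforms Q k"
  proof (rule dformsI)
    show "\<gamma> P = 0" if "P \<notin> Q" for P using that by (cases P) (simp add: \<gamma>_def)
    fix n U \<sigma> assume Q: "(n, U, \<sigma>) \<in> Q"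
    show "\<gamma> (n, U, \<sigma>) \<in> forms n k U" by (rule \<gamma>_forms[OF Q])
    fix l V h assume V: "open_Rn l V" and h: "smooth_map l V n U h"
    have U: "open_Rn n U" by (rule diffeology_open[OF diffeology_quotient Q])
    have Qh: "(l, V, compose V \<sigma> h) \<in> Q" by (rule diffeology_compose[OF diffeology_quotient Q V h])
    show "\<gamma> (l, V, compose V \<sigma> h) = form_pullback l V h (\<gamma> (n, U, \<sigma>))"
    proof (intro ext)
      fix x v
      show "\<gamma> (l, V, compose V \<sigma> h) x v = form_pullback l V h (\<gamma> (n, U, \<sigma>)) x v"
      proof (cases "x \<in> V")
        case True
        obtain W \<alpha> where L: "lift_at n U \<sigma> (h x) (W, \<alpha>)"
          using Q smooth_map_in[OF h True] unfolding quotient_plot_iff by auto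
        note lc = lift_compose[OF L U V h True]
        have WD: "(n, W, \<alpha>) \<in> D" and xW: "x \<in> {z \<in> V. h z \<in> W}" using L True by (simp_all add: lift_at_def)
        have "\<gamma> (l, V, compose V \<sigma> h) x v = form_pullback l {z \<in> V. h z \<in> W} h (\<beta> (n, W, \<alpha>)) x v"
          unfolding \<gamma>_at[OF Qh lc(1)] dforms_natural[OF \<beta>D WD lc(3,2)] ..
        also have "\<dots> = form_pullback l V h (\<gamma> (n, U, \<sigma>)) x v"
          using xW \<gamma>_at[OF Q L] by (simp add: form_pullback_def)
        finally show ?thesis .
      next
        case False
        then show ?thesis using \<gamma>_out by (simp add: form_pullback_def)
      qed
    qed
  qed
  moreover have "dform_pullback D p \<gamma> = \<beta>"
  proof (rule dforms_eqI[OF dform_pullback_dforms[OF dsmooth_quotient \<gamma>] \<beta>D])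
    fix n U \<alpha> x assume P: "(n, U, \<alpha>) \<in> D" and x: "x \<in> U"
    have "lift_at n U (compose U p \<alpha>) x (U, \<alpha>)"
      using diffeology_open[OF D P] P x by (simp add: lift_at_def compose_def)
    from \<gamma>_at[OF quotient_plot[OF P] this]
    show "dform_pullback D p \<gamma> (n, U, \<alpha>) x = \<beta> (n, U, \<alpha>) x" using P by (simp add: dform_pullback_apply)
  qed
  ultimately show ?thesis by (rule that)
qed

theorem bij_betw_quotient_pullback: "bij_betw (dform_pullback D p) (dforms Q k) (descending k)"
proof -
  have "descending k \<subseteq> dform_pullback D p ` dforms Q k"
  proof
    fix \<beta> assume "\<beta> \<in> descending k"
    then obtain \<gamma> where "\<gamma> \<in> dforms Q k" "dform_pullback D p \<gamma> = \<beta>" by (rule descending_form)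
    then show "\<beta> \<in> dform_pullback D p ` dforms Q k" by blast
  qed
  then show ?thesis
    unfolding bij_betw_def using inj_on_quotient_pullback pullback_descending by blast
qed

end

section \<open>Manifolds as diffeological spaces\<close>

lemma diffeology_local:
  assumes "diffeology X D" "(n, U, \<alpha>) \<in> params X"
    and "\<And>x. x \<in> U \<Longrightarrow> \<exists>V. open_Rn n V \<and> x \<in> V \<and> V \<subseteq> U \<and> (n, V, restrict \<alpha> V) \<in> D"
  shows "(n, U, \<alpha>) \<in> D"
proof -
  have "\<forall>(n, U, \<alpha>)\<in>params X. (\<forall>x\<in>U. \<exists>V. open_Rn n V \<and> x \<in> V \<and> V \<subseteq> U \<and> (n, V, restrict \<alpha> V) \<in> D) \<longrightarrow>
      (n, U, \<alpha>) \<in> D"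
    using assms(1) unfolding diffeology_def by (elim conjE)
  from bspec[OF this assms(2)] show ?thesis using assms(3) by simp
qed

locale mfd =
  fixes M :: "'a mfd"
  assumes M: "smooth_manifold M"
begin

abbreviation m where "m \<equiv> mdim M"
abbreviation MD where "MD \<equiv> manifold_diffeology M"

lemma Hausdorff: "Hausdorff_space (mtop M)"
  using M by (simp add: smooth_manifold_def)

lemma chart:
  assumes "(U, \<phi>) \<in> atlas M"
  shows "openin (mtop M) U" "open_Rn m (\<phi> ` U)"
    "homeomorphic_map (subtopology (mtop M) U) (subtopology (Euclidean_space m) (\<phi> ` U)) \<phi>"
proof -
  have "\<forall>(U, \<phi>)\<in>atlas M. openin (mtop M) U \<and> open_Rn m (\<phi> ` U) \<and>
        homeomorphic_map (subtopology (mtop M) U) (subtopology (Euclidean_space m) (\<phi> ` U)) \<phi>"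
    using M unfolding smooth_manifold_def by (elim conjE)
  from bspec[OF this assms]
  show "openin (mtop M) U" "open_Rn m (\<phi> ` U)"
    "homeomorphic_map (subtopology (mtop M) U) (subtopology (Euclidean_space m) (\<phi> ` U)) \<phi>" by simp_all
qed

lemma chart_at: "x \<in> pts M \<Longrightarrow> \<exists>U \<phi>. (U, \<phi>) \<in> atlas M \<and> x \<in> U"
  using M unfolding smooth_manifold_def by blast

lemma transition:
  "(U, \<phi>) \<in> atlas M \<Longrightarrow> (V, \<psi>) \<in> atlas M \<Longrightarrow>
   smooth_map m (\<phi> ` (U \<inter> V)) m (Rn m) (in_chart (U, \<phi>) \<psi>)"
proof -
  assume c: "(U, \<phi>) \<in> atlas M" "(V, \<psi>) \<in> atlas M"
  have "\<forall>(U, \<phi>)\<in>atlas M. \<forall>(V, \<psi>)\<in>atlas M.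
        smooth_map m (\<phi> ` (U \<inter> V)) m (Rn m) (in_chart (U, \<phi>) \<psi>)"
    using M unfolding smooth_manifold_def by (elim conjE)
  from bspec[OF this c(1)] have "\<forall>(V, \<psi>)\<in>atlas M.
        smooth_map m (\<phi> ` (U \<inter> V)) m (Rn m) (in_chart (U, \<phi>) \<psi>)" by simp
  from bspec[OF this c(2)] show ?thesis by simp
qed

lemma chart_subset: "(U, \<phi>) \<in> atlas M \<Longrightarrow> U \<subseteq> pts M"
  using chart(1) openin_subset by blast

lemma chart_topspace:
  assumes "(U, \<phi>) \<in> atlas M"
  shows "topspace (subtopology (mtop M) U) = U" "topspace (subtopology (Euclidean_space m) (\<phi> ` U)) = \<phi> ` U"
  using chart_subset[OF assms] open_Rn_subset[OF chart(2)[OF assms]] by auto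

lemma chart_inj:
  assumes "(U, \<phi>) \<in> atlas M"
  shows "inj_on \<phi> U"
  using homeomorphic_imp_injective_map[OF chart(3)[OF assms]] chart_topspace(1)[OF assms] by simp

lemma chart_inv [simp]: "(U, \<phi>) \<in> atlas M \<Longrightarrow> p \<in> U \<Longrightarrow> inv_into U \<phi> (\<phi> p) = p"
  by (rule inv_into_f_f[OF chart_inj])

lemma chart_inv_in: "x \<in> \<phi> ` U \<Longrightarrow> inv_into U \<phi> x \<in> U"
  by (rule inv_into_into)

lemma chart_f_inv: "x \<in> \<phi> ` U \<Longrightarrow> \<phi> (inv_into U \<phi> x) = x"
  by (rule f_inv_into_f)

lemma chart_Rn: "(U, \<phi>) \<in> atlas M \<Longrightarrow> p \<in> U \<Longrightarrow> \<phi> p \<in> Rn m"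
  using open_Rn_subset[OF chart(2)] by blast

lemma chart_image_open:
  assumes c: "(U, \<phi>) \<in> atlas M" and W: "openin (mtop M) W" "W \<subseteq> U"
  shows "open_Rn m (\<phi> ` W)"
proof -
  have "openin (subtopology (mtop M) U) W"
    using W by (auto simp: openin_subtopology)
  then have "openin (subtopology (Euclidean_space m) (\<phi> ` U)) (\<phi> ` W)"
    using homeomorphic_map_openness[OF chart(3)[OF c], of W] W(2) chart_subset[OF c]
    by auto
  then show ?thesis by (rule openin_trans_full[OF _ chart(2)[OF c]])
qed

lemma chart_image_Int_open:
  "(U, \<phi>) \<in> atlas M \<Longrightarrow> openin (mtop M) W \<Longrightarrow> open_Rn m (\<phi> ` (U \<inter> W))"
  by (rule chart_image_open) (auto intro: openin_Int chart(1))

lemma chart_preimage_open: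
  assumes c: "(U, \<phi>) \<in> atlas M" and B: "open_Rn m B"
  shows "openin (mtop M) {p \<in> U. \<phi> p \<in> B}"
proof -
  have "continuous_map (subtopology (mtop M) U) (subtopology (Euclidean_space m) (\<phi> ` U)) \<phi>"
    using chart(3)[OF c] by (simp add: homeomorphic_eq_everything_map)
  then have "continuous_map (subtopology (mtop M) U) (Euclidean_space m) \<phi>"
    by (simp add: continuous_map_in_subtopology)
  from openin_continuous_map_preimage[OF this B]
  have "openin (subtopology (mtop M) U) {p \<in> U. \<phi> p \<in> B}" by (simp only: chart_topspace(1)[OF c])
  then show ?thesis by (rule openin_trans_full[OF _ chart(1)[OF c]])
qed

lemma continuous_map_open_iff:
  assumes "open_Rn n U"
  shows "continuous_map (subtopology (Euclidean_space n) U) (mtop N) \<alpha> \<longleftrightarrow>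
    (\<forall>x\<in>U. \<alpha> x \<in> pts N) \<and> (\<forall>S. openin (mtop N) S \<longrightarrow> open_Rn n {x \<in> U. \<alpha> x \<in> S})"
proof -
  have top: "topspace (subtopology (Euclidean_space n) U) = U" using open_Rn_subset[OF assms] by auto
  have "openin (subtopology (Euclidean_space n) U) {x \<in> U. \<alpha> x \<in> S} \<longleftrightarrow> open_Rn n {x \<in> U. \<alpha> x \<in> S}" for S
    using openin_open_subtopology[OF assms] by auto
  then show ?thesis unfolding continuous_map_def top by auto
qed

lemma plot_iff:
  "(n, U, \<alpha>) \<in> MD \<longleftrightarrow> open_Rn n U \<and> \<alpha> \<in> U \<rightarrow>\<^sub>E pts M \<and>
     (\<forall>S. openin (mtop M) S \<longrightarrow> open_Rn n {x \<in> U. \<alpha> x \<in> S}) \<and>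
     (\<forall>V \<psi>. (V, \<psi>) \<in> atlas M \<longrightarrow> smooth_map n {x \<in> U. \<alpha> x \<in> V} m (Rn m) (\<lambda>x. \<psi> (\<alpha> x)))"
proof -
  have e: "U \<inter> \<alpha> -` V = {x \<in> U. \<alpha> x \<in> V}" for V by auto
  show ?thesis
  proof (cases "open_Rn n U \<and> \<alpha> \<in> U \<rightarrow>\<^sub>E pts M")
    case True
    then have "\<forall>x\<in>U. \<alpha> x \<in> pts M" by auto
    then show ?thesis
      using True continuous_map_open_iff[of n U M \<alpha>]
      by (simp add: manifold_diffeology_def params_def e comp_def) blast
  qed (auto simp: manifold_diffeology_def params_def)
qed

lemma plot_open: "(n, U, \<alpha>) \<in> MD \<Longrightarrow> open_Rn n U"
  and plot_preimage_open: "(n, U, \<alpha>) \<in> MD \<Longrightarrow> openin (mtop M) S \<Longrightarrow> open_Rn n {x \<in> U. \<alpha> x \<in> S}"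
  and plot_smooth: "(n, U, \<alpha>) \<in> MD \<Longrightarrow> (V, \<psi>) \<in> atlas M \<Longrightarrow>
    smooth_map n {x \<in> U. \<alpha> x \<in> V} m (Rn m) (\<lambda>x. \<psi> (\<alpha> x))"
  and plot_in: "(n, U, \<alpha>) \<in> MD \<Longrightarrow> x \<in> U \<Longrightarrow> \<alpha> x \<in> pts M"
  and plot_ext: "(n, U, \<alpha>) \<in> MD \<Longrightarrow> \<alpha> \<in> U \<rightarrow>\<^sub>E pts M"
  unfolding plot_iff by (blast, blast, blast, blast, blast)

lemma diffeology_MD: "diffeology (pts M) MD"
  unfolding diffeology_def
proof (intro conjI)
  show "MD \<subseteq> params (pts M)" by (auto simp: manifold_diffeology_def)
  show "\<forall>n U. \<forall>c\<in>pts M. open_Rn n U \<longrightarrow> (n, U, \<lambda>x\<in>U. c) \<in> MD"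
  proof (intro allI ballI impI)
    fix n U c assume c: "c \<in> pts M" and U: "open_Rn n U"
    have set: "{x \<in> U. (\<lambda>x\<in>U. c) x \<in> S} = (if c \<in> S then U else {})" for S by auto
    show "(n, U, \<lambda>x\<in>U. c) \<in> MD"
      unfolding plot_iff
    proof (intro conjI allI impI)
      show "open_Rn n {x \<in> U. (\<lambda>x\<in>U. c) x \<in> S}" for S unfolding set using U by simp
      fix V \<psi> assume V: "(V, \<psi>) \<in> atlas M"
      show "smooth_map n {x \<in> U. (\<lambda>x\<in>U. c) x \<in> V} m (Rn m) (\<lambda>x. \<psi> ((\<lambda>x\<in>U. c) x))"
      proof (cases "c \<in> V")
        case True
        then have "smooth_map n U m (Rn m) (\<lambda>x. \<psi> c)" by (intro smooth_map_const[OF U] chart_Rn[OF V])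
        then have "smooth_map n U m (Rn m) (\<lambda>x. \<psi> ((\<lambda>x\<in>U. c) x))"
          by (rule smooth_map_cong[OF U]) simp
        then show ?thesis unfolding set using True by simp
      next
        case False
        \<comment> \<open>The chart misses the constant value, so the domain is empty and there is
          nothing to check locally.\<close>
        have "smooth_fun n {} f" for f by (rule smooth_fun_local) auto
        then show ?thesis unfolding set using False by (simp add: smooth_map_def)
      qed
    qed (use U c in auto)
  qed
  show "\<forall>(n, U, \<alpha>)\<in>MD. \<forall>l V h. open_Rn l V \<and> smooth_map l V n U h \<longrightarrow> (l, V, compose V \<alpha> h) \<in> MD"
  proof (clarify)
    fix n U \<alpha> l V h assume P: "(n, U, \<alpha>) \<in> MD" and V: "open_Rn l V" and h: "smooth_map l V n U h"
    note U = plot_open[OF P]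
    have set: "{x \<in> V. compose V \<alpha> h x \<in> S} = {x \<in> V. h x \<in> {y \<in> U. \<alpha> y \<in> S}}" for S
      using smooth_map_in[OF h] by (auto simp: compose_def)
    have op: "open_Rn l {x \<in> V. compose V \<alpha> h x \<in> S}" if "openin (mtop M) S" for S
      unfolding set by (rule smooth_map_preimage_open[OF h V open_Rn_subset[OF U] plot_preimage_open[OF P that]])
    show "(l, V, compose V \<alpha> h) \<in> MD"
      unfolding plot_iff
    proof (intro conjI allI impI)
      show "compose V \<alpha> h \<in> V \<rightarrow>\<^sub>E pts M"
        using smooth_map_in[OF h] plot_in[OF P] by (auto simp: compose_def)
      fix W \<psi> assume W: "(W, \<psi>) \<in> atlas M"
      let ?S = "{x \<in> V. compose V \<alpha> h x \<in> W}"
      have "smooth_map l ?S n {y \<in> U. \<alpha> y \<in> W} h"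
        using smooth_map_into[OF smooth_map_subset[OF h _ order_refl], of ?S] unfolding set by simp
      from smooth_map_compose[OF this op[OF chart(1)[OF W]] plot_preimage_open[OF P chart(1)[OF W]] plot_smooth[OF P W]]
      show "smooth_map l ?S m (Rn m) (\<lambda>x. \<psi> (compose V \<alpha> h x))"
        by (rule smooth_map_cong[OF op[OF chart(1)[OF W]]]) (simp add: compose_def)
    qed (use V op in auto)
  qed
  show "\<forall>(n, U, \<alpha>)\<in>params (pts M). (\<forall>x\<in>U. \<exists>V. open_Rn n V \<and> x \<in> V \<and> V \<subseteq> U \<and> (n, V, restrict \<alpha> V) \<in> MD) \<longrightarrow> (n, U, \<alpha>) \<in> MD"
  proof (clarify)
    fix n U \<alpha> assume P: "(n, U, \<alpha>) \<in> params (pts M)"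
      and loc: "\<forall>x\<in>U. \<exists>V. open_Rn n V \<and> x \<in> V \<and> V \<subseteq> U \<and> (n, V, restrict \<alpha> V) \<in> MD"
    have set: "{x \<in> V. restrict \<alpha> V x \<in> S} = {x \<in> V. \<alpha> x \<in> S}" for V S by auto
    have op: "open_Rn n {x \<in> U. \<alpha> x \<in> S}" if S: "openin (mtop M) S" for S
    proof (subst openin_subopen, rule ballI)
      fix x assume x: "x \<in> {x \<in> U. \<alpha> x \<in> S}"
      then obtain V where V: "x \<in> V" "V \<subseteq> U" "(n, V, restrict \<alpha> V) \<in> MD" using loc by blast
      have "open_Rn n {x \<in> V. \<alpha> x \<in> S}" using plot_preimage_open[OF V(3) S] unfolding set .
      moreover have "x \<in> {x \<in> V. \<alpha> x \<in> S}" "{x \<in> V. \<alpha> x \<in> S} \<subseteq> {x \<in> U. \<alpha> x \<in> S}" using V x by auto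
      ultimately show "\<exists>T. open_Rn n T \<and> x \<in> T \<and> T \<subseteq> {x \<in> U. \<alpha> x \<in> S}" by blast
    qed
    show "(n, U, \<alpha>) \<in> MD"
      unfolding plot_iff
    proof (intro conjI allI impI)
      fix W \<psi> assume W: "(W, \<psi>) \<in> atlas M"
      show "smooth_map n {x \<in> U. \<alpha> x \<in> W} m (Rn m) (\<lambda>x. \<psi> (\<alpha> x))"
      proof (rule smooth_map_local[OF op[OF chart(1)[OF W]]])
        fix x assume x: "x \<in> {x \<in> U. \<alpha> x \<in> W}"
        then obtain V where V: "x \<in> V" "V \<subseteq> U" "(n, V, restrict \<alpha> V) \<in> MD" using loc by blast
        have o: "open_Rn n {x \<in> V. \<alpha> x \<in> W}" using plot_preimage_open[OF V(3) chart(1)[OF W]] unfolding set .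
        have "smooth_map n {x \<in> V. \<alpha> x \<in> W} m (Rn m) (\<lambda>x. \<psi> (restrict \<alpha> V x))"
          using plot_smooth[OF V(3) W] unfolding set .
        then have "smooth_map n {x \<in> V. \<alpha> x \<in> W} m (Rn m) (\<lambda>x. \<psi> (\<alpha> x))"
          by (rule smooth_map_cong[OF o]) simp
        moreover have "x \<in> {x \<in> V. \<alpha> x \<in> W}" "{x \<in> V. \<alpha> x \<in> W} \<subseteq> {x \<in> U. \<alpha> x \<in> W}" using V x by auto
        ultimately show "\<exists>T. open_Rn n T \<and> x \<in> T \<and> T \<subseteq> {x \<in> U. \<alpha> x \<in> W} \<and> smooth_map n T m (Rn m) (\<lambda>x. \<psi> (\<alpha> x))"
          using o by blast
      qed
    qed (use paramsD[OF P] op in auto)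
  qed
qed

definition chart_plot :: "'a chart \<Rightarrow> 'a param" where
  "chart_plot = (\<lambda>(U, \<phi>). (m, \<phi> ` U, restrict (inv_into U \<phi>) (\<phi> ` U)))"

lemma chart_plot_MD:
  assumes c: "(U, \<phi>) \<in> atlas M"
  shows "(m, \<phi> ` U, restrict (inv_into U \<phi>) (\<phi> ` U)) \<in> MD"
  unfolding plot_iff
proof (intro conjI allI impI)
  have set: "{x \<in> \<phi> ` U. restrict (inv_into U \<phi>) (\<phi> ` U) x \<in> S} = \<phi> ` (U \<inter> S)" for S
  proof (rule subset_antisym; rule subsetI)
    show "x \<in> \<phi> ` (U \<inter> S)" if "x \<in> {x \<in> \<phi> ` U. restrict (inv_into U \<phi>) (\<phi> ` U) x \<in> S}" for x
    proof -
      have "x \<in> \<phi> ` U" "inv_into U \<phi> x \<in> S" using that by auto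
      then show ?thesis using chart_inv_in[of x \<phi> U] chart_f_inv[of x \<phi> U]
        by (intro image_eqI[of x \<phi> "inv_into U \<phi> x"]) simp_all
    qed
    show "x \<in> {x \<in> \<phi> ` U. restrict (inv_into U \<phi>) (\<phi> ` U) x \<in> S}" if x: "x \<in> \<phi> ` (U \<inter> S)" for x
    proof -
      obtain p where "x = \<phi> p" "p \<in> U" "p \<in> S" using x by blast
      then show ?thesis using chart_inv[OF c, of p] by simp
    qed
  qed
  show "open_Rn m (\<phi> ` U)" by (rule chart(2)[OF c])
  show "restrict (inv_into U \<phi>) (\<phi> ` U) \<in> \<phi> ` U \<rightarrow>\<^sub>E pts M"
    using c chart_subset[OF c] by auto
  show "open_Rn m {x \<in> \<phi> ` U. restrict (inv_into U \<phi>) (\<phi> ` U) x \<in> S}" if "openin (mtop M) S" for S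
    unfolding set by (rule chart_image_Int_open[OF c that])
  fix V \<psi> assume V: "(V, \<psi>) \<in> atlas M"
  show "smooth_map m {x \<in> \<phi> ` U. restrict (inv_into U \<phi>) (\<phi> ` U) x \<in> V} m (Rn m)
      (\<lambda>x. \<psi> (restrict (inv_into U \<phi>) (\<phi> ` U) x))"
    unfolding set
    by (rule smooth_map_cong[OF chart_image_Int_open[OF c chart(1)[OF V]] transition[OF c V]])
      (use c in \<open>auto simp: in_chart_def\<close>)
qed

lemma chart_inverse_plot:
  assumes c: "(V, \<psi>) \<in> atlas M" and W: "open_Rn n W" and h: "smooth_map n W m (Rn m) h"
    and "\<And>x. x \<in> W \<Longrightarrow> h x \<in> \<psi> ` V"
  shows "(n, W, \<lambda>x\<in>W. inv_into V \<psi> (h x)) \<in> MD"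
proof -
  have "(n, W, compose W (restrict (inv_into V \<psi>) (\<psi> ` V)) h) \<in> MD"
    by (rule diffeology_compose[OF diffeology_MD chart_plot_MD[OF c] W smooth_map_into[OF h assms(4)]])
  moreover have "compose W (restrict (inv_into V \<psi>) (\<psi> ` V)) h = (\<lambda>x\<in>W. inv_into V \<psi> (h x))"
    using assms(4) by (auto simp: compose_def fun_eq_iff)
  ultimately show ?thesis by simp
qed

lemma plot_local_chart:
  assumes U: "open_Rn n U" and \<alpha>: "\<alpha> \<in> U \<rightarrow>\<^sub>E pts M"
    and loc: "\<And>x. x \<in> U \<Longrightarrow> \<exists>W V \<psi>. open_Rn n W \<and> x \<in> W \<and> W \<subseteq> U \<and> (V, \<psi>) \<in> atlas M \<and> \<alpha> ` W \<subseteq> V \<and>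
      smooth_map n W m (Rn m) (\<lambda>x. \<psi> (\<alpha> x))"
  shows "(n, U, \<alpha>) \<in> MD"
proof -
  have "\<exists>W. open_Rn n W \<and> x \<in> W \<and> W \<subseteq> U \<and> (n, W, restrict \<alpha> W) \<in> MD" if "x \<in> U" for x
  proof -
    from loc[OF that] obtain W V \<psi> where W: "open_Rn n W" "x \<in> W" "W \<subseteq> U" "(V, \<psi>) \<in> atlas M" "\<alpha> ` W \<subseteq> V"
      "smooth_map n W m (Rn m) (\<lambda>x. \<psi> (\<alpha> x))" by blast
    have "(n, W, \<lambda>x\<in>W. inv_into V \<psi> (\<psi> (\<alpha> x))) \<in> MD"
      by (rule chart_inverse_plot[OF W(4,1,6)]) (use W(5) in auto)
    moreover have "(\<lambda>x\<in>W. inv_into V \<psi> (\<psi> (\<alpha> x))) = restrict \<alpha> W"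
    proof
      fix y show "(\<lambda>x\<in>W. inv_into V \<psi> (\<psi> (\<alpha> x))) y = restrict \<alpha> W y"
      proof (cases "y \<in> W")
        case True
        then have "\<alpha> y \<in> V" using W(5) by blast
        with True show ?thesis using chart_inv[OF W(4)] by simp
      qed simp
    qed
    ultimately have "(n, W, restrict \<alpha> W) \<in> MD" by simp
    with W(1-3) show ?thesis by blast
  qed
  moreover have "(n, U, \<alpha>) \<in> params (pts M)" using U \<alpha> by (simp add: params_def)
  ultimately show ?thesis using diffeology_local[OF diffeology_MD] by blast
qed

text \<open>Where \<open>\<alpha>\<close> meets the chart it is the inverse chart after the
  coordinate map \<open>\<psi> \<circ> \<alpha>\<close>; naturality of \<open>\<beta>\<close> along
  this map gives the value.\<close>

lemma plot_form_in_chart: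
  assumes \<beta>: "\<beta> \<in> dforms MD k" and P: "(n, A, \<alpha>) \<in> MD" and c: "(V, \<psi>) \<in> atlas M"
    and x: "x \<in> A" "\<alpha> x \<in> V" and v: "v \<in> tuples n k"
  shows "\<beta> (n, A, \<alpha>) x v = \<beta> (chart_plot (V, \<psi>)) (\<psi> (\<alpha> x)) (map (tangent_map (\<lambda>y. \<psi> (\<alpha> y)) x) v)"
proof -
  let ?W = "{x \<in> A. \<alpha> x \<in> V}"
  have W: "open_Rn n ?W" by (rule plot_preimage_open[OF P chart(1)[OF c]])
  have h: "smooth_map n ?W m (\<psi> ` V) (\<lambda>x. \<psi> (\<alpha> x))"
    by (rule smooth_map_into[OF plot_smooth[OF P c]]) simp
  have "compose ?W (restrict (inv_into V \<psi>) (\<psi> ` V)) (\<lambda>x. \<psi> (\<alpha> x)) = restrict \<alpha> ?W"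
    using c by (auto simp: compose_def fun_eq_iff)
  then have "\<beta> (n, ?W, restrict \<alpha> ?W) = form_pullback n ?W (\<lambda>x. \<psi> (\<alpha> x)) (\<beta> (chart_plot (V, \<psi>)))"
    using dforms_natural[OF \<beta> chart_plot_MD[OF c] W h] by (simp add: chart_plot_def)
  moreover have "\<beta> (n, ?W, restrict \<alpha> ?W) x = \<beta> (n, A, \<alpha>) x"
    by (rule dform_restrict[OF \<beta> P W]) (use x in auto)
  ultimately have "\<beta> (n, A, \<alpha>) x v = form_pullback n ?W (\<lambda>x. \<psi> (\<alpha> x)) (\<beta> (chart_plot (V, \<psi>))) x v" by simp
  also have "\<dots> = \<beta> (chart_plot (V, \<psi>)) (\<psi> (\<alpha> x)) (map (tangent_map (\<lambda>y. \<psi> (\<alpha> y)) x) v)"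
    by (rule form_pullback_apply[OF _ v]) (use x in simp)
  finally show ?thesis .
qed

section \<open>Forms given on charts and forms given on plots\<close>

lemma mform_of_dform_chart:
  "(U, \<phi>) \<in> atlas M \<Longrightarrow> mform_of_dform M \<beta> (U, \<phi>) = \<beta> (chart_plot (U, \<phi>))"
  by (simp add: mform_of_dform_def chart_plot_def)

lemma mform_of_dform_mforms:
  assumes \<beta>: "\<beta> \<in> dforms MD k"
  shows "mform_of_dform M \<beta> \<in> mforms M k"
proof -
  have "mform_of_dform M \<beta> (U, \<phi>) (\<phi> p) v =
      mform_of_dform M \<beta> (V, \<psi>) (\<psi> p) (map (tangent_map (in_chart (U, \<phi>) \<psi>) (\<phi> p)) v)"
    if c: "(U, \<phi>) \<in> atlas M" "(V, \<psi>) \<in> atlas M" and p: "p \<in> U \<inter> V" and v: "v \<in> tuples m k" for U \<phi> V \<psi> p v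
  proof -
    have "tangent_map (\<lambda>y. \<psi> (restrict (inv_into U \<phi>) (\<phi> ` U) y)) (\<phi> p) u = tangent_map (in_chart (U, \<phi>) \<psi>) (\<phi> p) u"
      if "u \<in> set v" for u
      by (rule tangent_map_cong[OF chart(2)[OF c(1)]]) (use p v that in \<open>auto simp: in_chart_def tuples_def\<close>)
    then have e: "map (tangent_map (\<lambda>y. \<psi> (restrict (inv_into U \<phi>) (\<phi> ` U) y)) (\<phi> p)) v =
        map (tangent_map (in_chart (U, \<phi>) \<psi>) (\<phi> p)) v" by (rule map_cong[OF refl])
    have q: "restrict (inv_into U \<phi>) (\<phi> ` U) (\<phi> p) = p" using c p by simp
    have V: "restrict (inv_into U \<phi>) (\<phi> ` U) (\<phi> p) \<in> V" unfolding q using p by simp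
    have "\<phi> p \<in> \<phi> ` U" using p by simp
    from plot_form_in_chart[OF \<beta> chart_plot_MD[OF c(1)] c(2) this V v]
    show ?thesis unfolding e q mform_of_dform_chart[OF c(1)] mform_of_dform_chart[OF c(2)]
      by (simp add: chart_plot_def restrict_def)
  qed
  moreover have "mform_of_dform M \<beta> (U, \<phi>) \<in> forms m k (\<phi> ` U)" if "(U, \<phi>) \<in> atlas M" for U \<phi>
    using dforms_in[OF \<beta> chart_plot_MD[OF that]] that by (simp add: mform_of_dform_def)
  moreover have "mform_of_dform M \<beta> c = 0" if "c \<notin> atlas M" for c
    using that by (cases c) (simp add: mform_of_dform_def)
  ultimately show ?thesis unfolding mforms_def by blast
qed

lemma mformsD:
  assumes "\<omega> \<in> mforms M k"
  shows "c \<notin> atlas M \<Longrightarrow> \<omega> c = 0"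
    "(U, \<phi>) \<in> atlas M \<Longrightarrow> \<omega> (U, \<phi>) \<in> forms m k (\<phi> ` U)"
    "(U, \<phi>) \<in> atlas M \<Longrightarrow> (V, \<psi>) \<in> atlas M \<Longrightarrow> p \<in> U \<Longrightarrow> p \<in> V \<Longrightarrow> v \<in> tuples m k \<Longrightarrow>
      \<omega> (U, \<phi>) (\<phi> p) v = \<omega> (V, \<psi>) (\<psi> p) (map (tangent_map (in_chart (U, \<phi>) \<psi>) (\<phi> p)) v)"
  using assms unfolding mforms_def by (blast, blast, blast)

lemma tangent_plot_transition:
  assumes P: "(n, A, \<alpha>) \<in> MD" and c: "(U, \<phi>) \<in> atlas M" "(V, \<psi>) \<in> atlas M"
    and x: "x \<in> A" "\<alpha> x \<in> U" "\<alpha> x \<in> V" and u: "u \<in> Rn n"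
  shows "tangent_map (in_chart (U, \<phi>) \<psi>) (\<phi> (\<alpha> x)) (tangent_map (\<lambda>y. \<phi> (\<alpha> y)) x u) =
    tangent_map (\<lambda>y. \<psi> (\<alpha> y)) x u"
proof -
  let ?W = "{x \<in> A. \<alpha> x \<in> U \<inter> V}"
  have W: "open_Rn n ?W" by (rule plot_preimage_open[OF P openin_Int[OF chart(1)[OF c(1)] chart(1)[OF c(2)]]])
  have h: "smooth_map n ?W m (\<phi> ` (U \<inter> V)) (\<lambda>x. \<phi> (\<alpha> x))"
    by (rule smooth_map_into[OF smooth_map_subset[OF plot_smooth[OF P c(1)] _ order_refl]]) auto
  have xW: "x \<in> ?W" using x by simp
  have "tangent_map (\<lambda>y. in_chart (U, \<phi>) \<psi> (\<phi> (\<alpha> y))) x u =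
      tangent_map (in_chart (U, \<phi>) \<psi>) (\<phi> (\<alpha> x)) (tangent_map (\<lambda>y. \<phi> (\<alpha> y)) x u)"
    by (rule tangent_map_compose[OF h W chart_image_Int_open[OF c(1) chart(1)[OF c(2)]] transition[OF c] order_refl xW u])
  moreover have "tangent_map (\<lambda>y. in_chart (U, \<phi>) \<psi> (\<phi> (\<alpha> y))) x u = tangent_map (\<lambda>y. \<psi> (\<alpha> y)) x u"
    by (rule tangent_map_cong[OF W xW u]) (use c in \<open>simp add: in_chart_def\<close>)
  ultimately show ?thesis by simp
qed

text \<open>Formulated like the choice inside \<open>mform_pullback\<close>, so that
  \<open>plot_chart (g p)\<close> is the very chart chosen there.\<close>

definition plot_chart :: "'a \<Rightarrow> 'a chart" where
  "plot_chart p = (SOME c. c \<in> atlas M \<and> p \<in> fst c)"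

lemma plot_chart:
  assumes "p \<in> pts M"
  obtains V \<psi> where "plot_chart p = (V, \<psi>)" "(V, \<psi>) \<in> atlas M" "p \<in> V"
proof -
  have "\<exists>c. c \<in> atlas M \<and> p \<in> fst c" using chart_at[OF assms] by force
  then have "plot_chart p \<in> atlas M \<and> p \<in> fst (plot_chart p)" unfolding plot_chart_def by (rule someI_ex)
  then show ?thesis by (cases "plot_chart p") (auto intro: that)
qed

text \<open>The inverse of \<open>mform_of_dform\<close> in degree \<open>k\<close>. The chart is
  chosen point by point; compatibility of the coordinate forms with transition maps makes the choice
  irrelevant, see \<open>dform_of_mform_apply\<close>.\<close>

definition dform_of_mform :: "nat \<Rightarrow> 'a chart form_family \<Rightarrow> 'a param form_family" where
  "dform_of_mform k \<omega> = (\<lambda>(n, A, \<alpha>) x v. if (n, A, \<alpha>) \<in> MD \<and> x \<in> A \<and> v \<in> tuples n k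
     then (case plot_chart (\<alpha> x) of (V, \<psi>) \<Rightarrow> \<omega> (V, \<psi>) (\<psi> (\<alpha> x)) (map (tangent_map (\<lambda>y. \<psi> (\<alpha> y)) x) v)) else 0)"

lemma dform_of_mform_apply:
  assumes \<omega>: "\<omega> \<in> mforms M k" and P: "(n, A, \<alpha>) \<in> MD" and x: "x \<in> A" and v: "v \<in> tuples n k"
    and c: "(V, \<psi>) \<in> atlas M" "\<alpha> x \<in> V"
  shows "dform_of_mform k \<omega> (n, A, \<alpha>) x v = \<omega> (V, \<psi>) (\<psi> (\<alpha> x)) (map (tangent_map (\<lambda>y. \<psi> (\<alpha> y)) x) v)"
proof -
  obtain U \<phi> where c': "plot_chart (\<alpha> x) = (U, \<phi>)" "(U, \<phi>) \<in> atlas M" "\<alpha> x \<in> U"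
    using plot_chart[OF plot_in[OF P x]] .
  let ?W = "{x \<in> A. \<alpha> x \<in> U}"
  have t: "map (tangent_map (\<lambda>y. \<phi> (\<alpha> y)) x) v \<in> tuples m k"
    by (rule map_tangent_tuples[OF plot_smooth[OF P c'(2)] plot_preimage_open[OF P chart(1)[OF c'(2)]] order_refl _ v])
      (use x c'(3) in simp)
  have e: "map (tangent_map (in_chart (U, \<phi>) \<psi>) (\<phi> (\<alpha> x))) (map (tangent_map (\<lambda>y. \<phi> (\<alpha> y)) x) v) =
     map (tangent_map (\<lambda>y. \<psi> (\<alpha> y)) x) v"
    using tangent_plot_transition[OF P c'(2) c(1) x c'(3) c(2)] v by (auto simp: tuples_def)
  show ?thesis
    using mformsD(3)[OF \<omega> c'(2) c(1) c'(3) c(2) t] P x v unfolding e by (simp add: dform_of_mform_def c'(1))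
qed

text \<open>Over the part of a plot inside one chart the family is the pullback of a single
  coordinate form; smoothness and naturality are checked there.\<close>

lemma dform_of_mform_dforms:
  assumes \<omega>: "\<omega> \<in> mforms M k"
  shows "dform_of_mform k \<omega> \<in> dforms MD k"
proof (rule dformsI)
  show "dform_of_mform k \<omega> P = 0" if "P \<notin> MD" for P
    using that by (cases P) (auto simp: dform_of_mform_def fun_eq_iff)
  fix n A \<alpha> assume P: "(n, A, \<alpha>) \<in> MD"
  note A = plot_open[OF P]
  have zero: "dform_of_mform k \<omega> (n, A, \<alpha>) x v = 0" if "x \<notin> A \<or> v \<notin> tuples n k" for n A \<alpha> x v
    using that by (auto simp: dform_of_mform_def)
  have local: "\<exists>W. open_Rn n W \<and> x \<in> W \<and> W \<subseteq> A \<and> (\<exists>V \<psi>. (V, \<psi>) \<in> atlas M \<and> \<alpha> x \<in> V \<and>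
      smooth_map n W m (\<psi> ` V) (\<lambda>x. \<psi> (\<alpha> x)) \<and>
      (\<forall>y\<in>W. dform_of_mform k \<omega> (n, A, \<alpha>) y = form_pullback n W (\<lambda>x. \<psi> (\<alpha> x)) (\<omega> (V, \<psi>)) y))"
    if x: "x \<in> A" for x
  proof -
    obtain V \<psi> where c: "(V, \<psi>) \<in> atlas M" "\<alpha> x \<in> V" using chart_at[OF plot_in[OF P x]] by blast
    let ?W = "{x \<in> A. \<alpha> x \<in> V}"
    have "dform_of_mform k \<omega> (n, A, \<alpha>) y v = form_pullback n ?W (\<lambda>x. \<psi> (\<alpha> x)) (\<omega> (V, \<psi>)) y v" if y: "y \<in> ?W" for y v
    proof (cases "v \<in> tuples n k")
      case True
      then show ?thesis
        using dform_of_mform_apply[OF \<omega> P _ True c(1)] y form_pullback_apply[OF y True] by simp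
    next
      case False
      then show ?thesis using zero form_pullback_zero[OF mformsD(2)[OF \<omega> c(1)]] by simp
    qed
    moreover have "smooth_map n ?W m (\<psi> ` V) (\<lambda>x. \<psi> (\<alpha> x))"
      by (rule smooth_map_into[OF plot_smooth[OF P c(1)]]) simp
    moreover have "open_Rn n ?W" by (rule plot_preimage_open[OF P chart(1)[OF c(1)]])
    moreover have "x \<in> ?W" "?W \<subseteq> A" using x c by auto
    ultimately show ?thesis using c by (intro exI[of _ ?W] conjI exI[of _ V] exI[of _ \<psi>]) (auto simp: fun_eq_iff)
  qed
  show "dform_of_mform k \<omega> (n, A, \<alpha>) \<in> forms n k A"
  proof (rule forms_local[OF A])
    show "dform_of_mform k \<omega> (n, A, \<alpha>) x v = 0" if "x \<notin> A" for x v using zero that by blast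
    fix x assume "x \<in> A"
    from local[OF this] obtain W V \<psi> where W: "open_Rn n W" "x \<in> W" "W \<subseteq> A" "(V, \<psi>) \<in> atlas M"
      "smooth_map n W m (\<psi> ` V) (\<lambda>x. \<psi> (\<alpha> x))"
      "\<forall>y\<in>W. dform_of_mform k \<omega> (n, A, \<alpha>) y = form_pullback n W (\<lambda>x. \<psi> (\<alpha> x)) (\<omega> (V, \<psi>)) y" by blast
    have "form_pullback n W (\<lambda>x. \<psi> (\<alpha> x)) (\<omega> (V, \<psi>)) \<in> forms n k W"
      by (rule form_pullback_forms[OF mformsD(2)[OF \<omega> W(4)] chart(2)[OF W(4)] W(1,5)])
    with W show "\<exists>V \<eta>. open_Rn n V \<and> x \<in> V \<and> V \<subseteq> A \<and> \<eta> \<in> forms n k V \<and> (\<forall>y\<in>V. dform_of_mform k \<omega> (n, A, \<alpha>) y = \<eta> y)"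
      by blast
  qed
  fix l B f assume B: "open_Rn l B" and f: "smooth_map l B n A f"
  have PB: "(l, B, compose B \<alpha> f) \<in> MD" by (rule diffeology_compose[OF diffeology_MD P B f])
  show "dform_of_mform k \<omega> (l, B, compose B \<alpha> f) = form_pullback l B f (dform_of_mform k \<omega> (n, A, \<alpha>))"
  proof (intro ext)
    fix x v
    show "dform_of_mform k \<omega> (l, B, compose B \<alpha> f) x v = form_pullback l B f (dform_of_mform k \<omega> (n, A, \<alpha>)) x v"
    proof (cases "x \<in> B \<and> v \<in> tuples l k")
      case True
      then have x: "x \<in> B" and v: "v \<in> tuples l k" by auto
      have fx: "f x \<in> A" by (rule smooth_map_in[OF f x])
      obtain V \<psi> where c: "(V, \<psi>) \<in> atlas M" "\<alpha> (f x) \<in> V" using chart_at[OF plot_in[OF P fx]] by blast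
      let ?W = "{y \<in> A. \<alpha> y \<in> V}" and ?W' = "{z \<in> B. f z \<in> {y \<in> A. \<alpha> y \<in> V}}"
      have W: "open_Rn n ?W" by (rule plot_preimage_open[OF P chart(1)[OF c(1)]])
      have W': "open_Rn l ?W'" by (rule smooth_map_preimage_open[OF f B open_Rn_subset[OF A] W])
      have f': "smooth_map l ?W' n ?W f" by (rule smooth_map_into[OF smooth_map_subset[OF f _ order_refl]]) auto
      have xW: "x \<in> ?W'" using x fx c by simp
      have "tangent_map (\<lambda>y. \<psi> (compose B \<alpha> f y)) x u = tangent_map (\<lambda>y. \<psi> (\<alpha> y)) (f x) (tangent_map f x u)"
        if "u \<in> set v" for u
      proof -
        have u: "u \<in> Rn l" using that v by (auto simp: tuples_def)
        have "tangent_map (\<lambda>y. \<psi> (compose B \<alpha> f y)) x u = tangent_map (\<lambda>y. \<psi> (\<alpha> (f y))) x u"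
          by (rule tangent_map_cong[OF W' xW u]) (simp add: compose_def)
        also have "\<dots> = tangent_map (\<lambda>y. \<psi> (\<alpha> y)) (f x) (tangent_map f x u)"
          by (rule tangent_map_compose[OF f' W' W plot_smooth[OF P c(1)] order_refl xW u])
        finally show ?thesis .
      qed
      then have e: "map (tangent_map (\<lambda>y. \<psi> (compose B \<alpha> f y)) x) v =
          map (tangent_map (\<lambda>y. \<psi> (\<alpha> y)) (f x)) (map (tangent_map f x) v)" by simp
      have cx: "compose B \<alpha> f x = \<alpha> (f x)" using x by (simp add: compose_def)
      have "compose B \<alpha> f x \<in> V" unfolding cx by (rule c(2))
      from dform_of_mform_apply[OF \<omega> PB x v c(1) this]
      show ?thesis
        unfolding e cx form_pullback_apply[OF x v]
          dform_of_mform_apply[OF \<omega> P fx map_tangent_tuples[OF f B open_Rn_subset[OF A] x v] c] .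
    next
      case False
      then have "x \<in> B \<Longrightarrow> set v \<subseteq> Rn l \<Longrightarrow> map (tangent_map f x) v \<notin> tuples n k" by (auto simp: tuples_def)
      then show ?thesis using zero False by (auto simp: form_pullback_def)
    qed
  qed
qed

lemma mform_of_dform_of_mform:
  assumes \<omega>: "\<omega> \<in> mforms M k"
  shows "mform_of_dform M (dform_of_mform k \<omega>) = \<omega>"
proof
  fix c :: "'a chart" obtain U \<phi> where c: "c = (U, \<phi>)" by (cases c)
  show "mform_of_dform M (dform_of_mform k \<omega>) c = \<omega> c"
  proof (cases "c \<in> atlas M")
    case False
    then show ?thesis using mformsD(1)[OF \<omega> False] by (simp add: c mform_of_dform_def)
  next
    case True
    then have a: "(U, \<phi>) \<in> atlas M" by (simp add: c)
    have "dform_of_mform k \<omega> (chart_plot (U, \<phi>)) x v = \<omega> (U, \<phi>) x v" for x v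
    proof (cases "x \<in> \<phi> ` U \<and> v \<in> tuples m k")
      case True
      then have x: "x \<in> \<phi> ` U" and v: "v \<in> tuples m k" by auto
      let ?\<alpha> = "restrict (inv_into U \<phi>) (\<phi> ` U)"
      have xU: "?\<alpha> x \<in> U" using x chart_inv_in[OF x] by simp
      have "tangent_map (\<lambda>y. \<phi> (?\<alpha> y)) x u = u" if "u \<in> set v" for u
      proof -
        have "tangent_map (\<lambda>y. \<phi> (?\<alpha> y)) x u = tangent_map (\<lambda>y. y) x u"
          by (rule tangent_map_cong[OF chart(2)[OF a] x]) (use v that in \<open>auto simp: chart_f_inv tuples_def\<close>)
        then show ?thesis by (simp add: tangent_map_id)
      qed
      then have "map (tangent_map (\<lambda>y. \<phi> (?\<alpha> y)) x) v = v" by (rule map_idI)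
      then show ?thesis
        using dform_of_mform_apply[OF \<omega> chart_plot_MD[OF a] x v a xU] x
        by (simp add: chart_plot_def chart_f_inv restrict_def)
    next
      case False
      then show ?thesis using forms_zero[OF mformsD(2)[OF \<omega> a], of x v] by (auto simp: chart_plot_def dform_of_mform_def)
    qed
    then show ?thesis using mform_of_dform_chart[OF a] by (simp add: c fun_eq_iff)
  qed
qed

lemma inj_on_mform_of_dform: "inj_on (mform_of_dform M) (dforms MD k)"
proof (rule inj_onI)
  fix \<beta> \<beta>' assume b: "\<beta> \<in> dforms MD k" "\<beta>' \<in> dforms MD k" and e: "mform_of_dform M \<beta> = mform_of_dform M \<beta>'"
  show "\<beta> = \<beta>'"
  proof (rule dforms_eqI[OF b])
    fix n A \<alpha> x assume P: "(n, A, \<alpha>) \<in> MD" and x: "x \<in> A"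
    obtain V \<psi> where c: "(V, \<psi>) \<in> atlas M" "\<alpha> x \<in> V" using chart_at[OF plot_in[OF P x]] by blast
    have e': "\<beta> (chart_plot (V, \<psi>)) = \<beta>' (chart_plot (V, \<psi>))"
      using e mform_of_dform_chart[OF c(1)] by metis
    show "\<beta> (n, A, \<alpha>) x = \<beta>' (n, A, \<alpha>) x"
    proof
      fix v
      show "\<beta> (n, A, \<alpha>) x v = \<beta>' (n, A, \<alpha>) x v"
      proof (cases "v \<in> tuples n k")
        case True
        show ?thesis
          unfolding plot_form_in_chart[OF b(1) P c(1) x c(2) True] plot_form_in_chart[OF b(2) P c(1) x c(2) True] e' ..
      next
        case False
        then show ?thesis using forms_zero[OF dforms_in[OF b(1) P]] forms_zero[OF dforms_in[OF b(2) P]] by simp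
      qed
    qed
  qed
qed

lemma bij_betw_mform_of_dform: "bij_betw (mform_of_dform M) (dforms MD k) (mforms M k)"
  unfolding bij_betw_def
proof
  show "inj_on (mform_of_dform M) (dforms MD k)" by (rule inj_on_mform_of_dform)
  show "mform_of_dform M ` dforms MD k = mforms M k"
    using mform_of_dform_mforms mform_of_dform_of_mform dform_of_mform_dforms by (metis image_eqI image_subsetI subsetI subset_antisym)
qed

lemma mform_d_of_dform: "mform_d M (mform_of_dform M \<beta>) = mform_of_dform M (dform_d \<beta>)"
  by (auto simp: mform_d_def mform_of_dform_def dform_d_def fun_eq_iff ext_deriv_def)

lemma family_linear_mform_of_dform: "family_linear A (mform_of_dform M)"
  by (auto simp: family_linear_def mform_of_dform_def fscale_def fun_eq_iff)

end

lemma msmooth_dsmooth: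
  assumes M: "smooth_manifold M" and N: "smooth_manifold N" and g: "msmooth M N g"
  shows "dsmooth (pts M) (manifold_diffeology M) (pts N) (manifold_diffeology N) g"
proof -
  interpret M: mfd M by unfold_locales (rule M)
  interpret N: mfd N by unfold_locales (rule N)
  have gc: "continuous_map (mtop M) (mtop N) g" using g by (simp add: msmooth_def)
  have gin: "g p \<in> pts N" if "p \<in> pts M" for p
    using continuous_map_image_subset_topspace[OF gc] that by blast
  have "(n, A, compose A g \<alpha>) \<in> N.MD" if P: "(n, A, \<alpha>) \<in> M.MD" for n A \<alpha>
  proof (rule N.plot_local_chart[OF M.plot_open[OF P]])
    show "compose A g \<alpha> \<in> A \<rightarrow>\<^sub>E pts N" using M.plot_in[OF P] gin by (auto simp: compose_def)
    fix x assume x: "x \<in> A"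
    obtain U \<phi> where c: "(U, \<phi>) \<in> atlas M" "\<alpha> x \<in> U" using M.chart_at[OF M.plot_in[OF P x]] by blast
    obtain V \<psi> where c': "(V, \<psi>) \<in> atlas N" "g (\<alpha> x) \<in> V" using N.chart_at[OF gin[OF M.plot_in[OF P x]]] by blast
    \<comment> \<open>The part of the preimage of \<open>V\<close> inside \<open>M\<close>. It is
      open, and on chart domains it coincides with the preimage over the whole type that occurs in
      \<open>msmooth\<close>.\<close>
    define S where "S = {p \<in> pts M. g p \<in> V}"
    have S: "openin (mtop M) S"
      unfolding S_def by (rule openin_continuous_map_preimage[OF gc N.chart(1)[OF c'(1)]])
    have US: "U \<inter> g -` V = U \<inter> S" using M.chart_subset[OF c(1)] by (auto simp: S_def)
    let ?W = "{x \<in> A. \<alpha> x \<in> U \<inter> S}"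
    have W: "open_Rn n ?W" by (rule M.plot_preimage_open[OF P openin_Int[OF M.chart(1)[OF c(1)] S]])
    have h: "smooth_map n ?W M.m (\<phi> ` (U \<inter> S)) (\<lambda>x. \<phi> (\<alpha> x))"
      by (rule smooth_map_into[OF smooth_map_subset[OF M.plot_smooth[OF P c(1)] _ order_refl]]) auto
    have sg: "smooth_map M.m (\<phi> ` (U \<inter> S)) N.m (Rn N.m) (in_chart (U, \<phi>) (\<psi> \<circ> g))"
    proof -
      have "\<forall>(U, \<phi>)\<in>atlas M. \<forall>(V, \<psi>)\<in>atlas N.
          smooth_map M.m (\<phi> ` (U \<inter> g -` V)) N.m (Rn N.m) (in_chart (U, \<phi>) (\<psi> \<circ> g))"
        using g unfolding msmooth_def by (elim conjE)
      from bspec[OF this c(1)] have "\<forall>(V, \<psi>)\<in>atlas N.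
          smooth_map M.m (\<phi> ` (U \<inter> g -` V)) N.m (Rn N.m) (in_chart (U, \<phi>) (\<psi> \<circ> g))" by simp
      from bspec[OF this c'(1)] show ?thesis by (simp add: US)
    qed
    have "smooth_map n ?W N.m (Rn N.m) (\<lambda>x. in_chart (U, \<phi>) (\<psi> \<circ> g) (\<phi> (\<alpha> x)))"
      by (rule smooth_map_compose[OF h W M.chart_image_Int_open[OF c(1) S] sg])
    then have "smooth_map n ?W N.m (Rn N.m) (\<lambda>x. \<psi> (compose A g \<alpha> x))"
      by (rule smooth_map_cong[OF W]) (use c(1) in \<open>simp add: in_chart_def compose_def\<close>)
    moreover have "x \<in> ?W" "?W \<subseteq> A" "compose A g \<alpha> ` ?W \<subseteq> V"
      using x c(2) c'(2) M.plot_in[OF P x] by (auto simp: S_def compose_def)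
    ultimately show "\<exists>W V \<psi>. open_Rn n W \<and> x \<in> W \<and> W \<subseteq> A \<and> (V, \<psi>) \<in> atlas N \<and> compose A g \<alpha> ` W \<subseteq> V \<and>
      smooth_map n W N.m (Rn N.m) (\<lambda>x. \<psi> (compose A g \<alpha> x))"
      using W c'(1) by blast
  qed
  then show ?thesis using M.diffeology_MD N.diffeology_MD gin by (auto simp: dsmooth_def)
qed

context mfd
begin

lemma mform_pullback_of_dform:
  assumes g: "msmooth M M g" and \<beta>: "\<beta> \<in> dforms MD k"
  shows "mform_pullback M M g (mform_of_dform M \<beta>) = mform_of_dform M (dform_pullback MD g \<beta>)"
proof (intro ext)
  note gs = msmooth_dsmooth[OF M M g]
  note g\<beta> = dform_pullback_dforms[OF gs \<beta>]
  have gin: "g p \<in> pts M" if "p \<in> pts M" for p using gs that by (auto simp: dsmooth_def)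
  fix c :: "'a chart" and x v obtain U \<phi> where c: "c = (U, \<phi>)" by (cases c)
  show "mform_pullback M M g (mform_of_dform M \<beta>) c x v = mform_of_dform M (dform_pullback MD g \<beta>) c x v"
  proof (cases "(U, \<phi>) \<in> atlas M \<and> x \<in> \<phi> ` U \<and> set v \<subseteq> Rn m")
    case False
    then have "mform_pullback M M g (mform_of_dform M \<beta>) c x v = 0"
      by (simp only: c mform_pullback_def prod.case False if_False)
    moreover have "mform_of_dform M (dform_pullback MD g \<beta>) c x v = 0"
    proof (cases "(U, \<phi>) \<in> atlas M")
      case True
      then have "x \<notin> \<phi> ` U \<or> v \<notin> tuples m k" using False by (auto simp: tuples_def)
      then show ?thesis
        unfolding c by (rule forms_zero[OF mformsD(2)[OF mform_of_dform_mforms[OF g\<beta>] True]])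
    qed (simp add: c mform_of_dform_def)
    ultimately show ?thesis by simp
  next
    case True
    then have a: "(U, \<phi>) \<in> atlas M" and x: "x \<in> \<phi> ` U" and v: "set v \<subseteq> Rn m" by auto
    let ?p = "inv_into U \<phi> x" and ?\<alpha> = "restrict (inv_into U \<phi>) (\<phi> ` U)"
    have p: "?p \<in> U" by (rule chart_inv_in[OF x])
    have pM: "?p \<in> pts M" using p chart_subset[OF a] by blast
    obtain V \<psi> where c': "plot_chart (g ?p) = (V, \<psi>)" "(V, \<psi>) \<in> atlas M" "g ?p \<in> V"
      using plot_chart[OF gin[OF pM]] .
    have L: "mform_pullback M M g (mform_of_dform M \<beta>) c x v =
      \<beta> (chart_plot (V, \<psi>)) (\<psi> (g ?p)) (map (tangent_map (in_chart (U, \<phi>) (\<psi> \<circ> g)) x) v)"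
      using True c'(1)[unfolded plot_chart_def] mform_of_dform_chart[OF c'(2)]
      by (simp add: c mform_pullback_def)
    have R: "mform_of_dform M (dform_pullback MD g \<beta>) c x v = \<beta> (m, \<phi> ` U, compose (\<phi> ` U) g ?\<alpha>) x v"
      using chart_plot_MD[OF a] a by (simp add: c mform_of_dform_def dform_pullback_apply)
    have Pg: "(m, \<phi> ` U, compose (\<phi> ` U) g ?\<alpha>) \<in> MD" using gs chart_plot_MD[OF a] by (auto simp: dsmooth_def)
    show ?thesis
    proof (cases "length v = k")
      case True
      then have vt: "v \<in> tuples m k" using v by (simp add: tuples_def)
      have gx: "compose (\<phi> ` U) g ?\<alpha> x = g ?p" using x by (simp add: compose_def)
      have gV: "compose (\<phi> ` U) g ?\<alpha> x \<in> V" unfolding gx by (rule c'(3))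
      have "tangent_map (\<lambda>y. \<psi> (compose (\<phi> ` U) g ?\<alpha> y)) x u = tangent_map (in_chart (U, \<phi>) (\<psi> \<circ> g)) x u"
        if "u \<in> set v" for u
        by (rule tangent_map_cong[OF chart(2)[OF a] x]) (use that v in \<open>auto simp: compose_def in_chart_def\<close>)
      then have e: "map (tangent_map (\<lambda>y. \<psi> (compose (\<phi> ` U) g ?\<alpha> y)) x) v = map (tangent_map (in_chart (U, \<phi>) (\<psi> \<circ> g)) x) v"
        by (rule map_cong[OF refl])
      show ?thesis unfolding L R using plot_form_in_chart[OF \<beta> Pg c'(2) x gV vt] unfolding e gx
        by (simp add: restrict_def)
    next
      case False
      then have "v \<notin> tuples m k" "map (tangent_map (in_chart (U, \<phi>) (\<psi> \<circ> g)) x) v \<notin> tuples m k"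
        by (simp_all add: tuples_def)
      then show ?thesis unfolding L R
        using forms_zero[OF dforms_in[OF \<beta> Pg]] forms_zero[OF dforms_in[OF \<beta> chart_plot_MD[OF c'(2)]]]
        by (simp add: chart_plot_def)
    qed
  qed
qed

end

section \<open>Submersions are locally projections\<close>

text \<open>The inverse is an explicit argument, so that composites and restrictions come with their
  inverses and \<open>inv_into\<close> is avoided.\<close>

definition diffeo_on ::
  "nat \<Rightarrow> (nat \<Rightarrow> real) set \<Rightarrow> (nat \<Rightarrow> real) set \<Rightarrow> ((nat \<Rightarrow> real) \<Rightarrow> nat \<Rightarrow> real) \<Rightarrow> ((nat \<Rightarrow> real) \<Rightarrow> nat \<Rightarrow> real) \<Rightarrow> bool" where
  "diffeo_on n A B f g \<longleftrightarrow> open_Rn n A \<and> open_Rn n B \<and> smooth_map n A n B f \<and> smooth_map n B n A g \<and>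
     (\<forall>x\<in>A. g (f x) = x) \<and> (\<forall>y\<in>B. f (g y) = y)"

lemma diffeo_onD:
  assumes "diffeo_on n A B f g"
  shows "open_Rn n A" "open_Rn n B" "smooth_map n A n B f" "smooth_map n B n A g"
    "x \<in> A \<Longrightarrow> g (f x) = x" "y \<in> B \<Longrightarrow> f (g y) = y"
  using assms by (simp_all add: diffeo_on_def)

lemma diffeo_on_restrict:
  assumes d: "diffeo_on n A B f g" and B': "open_Rn n B'" "B' \<subseteq> B"
  shows "diffeo_on n {x \<in> A. f x \<in> B'} B' f g"
proof -
  note d' = diffeo_onD[OF d]
  have A': "open_Rn n {x \<in> A. f x \<in> B'}"
    by (rule smooth_map_preimage_open[OF d'(3,1) open_Rn_subset[OF d'(2)] B'(1)])
  have f: "smooth_map n {x \<in> A. f x \<in> B'} n B' f"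
    by (rule smooth_map_into[OF smooth_map_subset[OF d'(3) _ order_refl]]) auto
  have "g y \<in> {x \<in> A. f x \<in> B'}" if "y \<in> B'" for y
    using that B'(2) smooth_map_in[OF d'(4)] d'(6) by auto
  then have g: "smooth_map n B' n {x \<in> A. f x \<in> B'} g"
    by (intro smooth_map_into[OF smooth_map_subset[OF d'(4) B'(2) order_refl]])
  show ?thesis unfolding diffeo_on_def using A' B' f g d'(5,6) by auto
qed

lemma diffeo_on_compose:
  assumes d: "diffeo_on n A B f g" and d': "diffeo_on n B C f' g'"
  shows "diffeo_on n A C (\<lambda>x. f' (f x)) (\<lambda>y. g (g' y))"
  unfolding diffeo_on_def
proof (intro conjI ballI)
  note e = diffeo_onD[OF d] and e' = diffeo_onD[OF d']
  show "open_Rn n A" "open_Rn n C" by (fact e(1), fact e'(2))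
  show "smooth_map n A n C (\<lambda>x. f' (f x))" by (rule smooth_map_compose[OF e(3,1,2) e'(3)])
  show "smooth_map n C n A (\<lambda>y. g (g' y))" by (rule smooth_map_compose[OF e'(4,2,1) e(4)])
  show "g (g' (f' (f x))) = x" if "x \<in> A" for x
    using e(5)[OF that] e'(5)[OF smooth_map_in[OF e(3) that]] by simp
  show "f' (f (g (g' y))) = y" if "y \<in> C" for y
    using e'(6)[OF that] e(6)[OF smooth_map_in[OF e'(4) that]] by simp
qed

text \<open>Implicit differentiation: the increment \<open>\<Delta>\<close> is known only through a
  linear relation whose error involves \<open>\<Delta>\<close> itself. Taking \<open>e\<close> as
  half the modulus of \<open>a\<close> first yields a Lipschitz bound for \<open>\<Delta>\<close>;
  after that the error is small relative to \<open>t\<close>.\<close>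

lemma difference_quotient_limit:
  fixes \<Delta> :: "real \<Rightarrow> real"
  assumes a: "a \<noteq> 0"
    and est: "\<And>e. e > 0 \<Longrightarrow> \<forall>\<^sub>F t in at 0. \<bar>a * \<Delta> t - r * t\<bar> \<le> e * (\<bar>t\<bar> + \<bar>\<Delta> t\<bar>)"
  shows "((\<lambda>t. \<Delta> t / t) \<longlongrightarrow> r / a) (at 0)"
proof (rule tendstoI)
  fix \<epsilon> :: real assume \<epsilon>: "\<epsilon> > 0"
  \<comment> \<open>The Lipschitz constant obtained from the estimate with
    \<open>e = \<bar>a\<bar> / 2\<close>.\<close>
  define K where "K = 2 * (\<bar>r\<bar> + \<bar>a\<bar> / 2) / \<bar>a\<bar>"
  have K: "K \<ge> 0" using a by (simp add: K_def)
  \<comment> \<open>Chosen so that \<open>e * (1 + K)\<close> is half of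
    \<open>\<epsilon> * \<bar>a\<bar>\<close>.\<close>
  define e where "e = \<epsilon> * \<bar>a\<bar> / (2 * (1 + K))"
  have e: "e > 0" using \<epsilon> a K by (simp add: e_def)
  have a2: "\<bar>a\<bar> / 2 > 0" using a by simp
  have "\<forall>\<^sub>F t in at 0. t \<noteq> (0 :: real)" by (simp add: eventually_at_filter)
  with est[OF a2] est[OF e] show "\<forall>\<^sub>F t in at 0. dist (\<Delta> t / t) (r / a) < \<epsilon>"
  proof eventually_elim
    case (elim t)
    have "\<bar>a\<bar> * \<bar>\<Delta> t\<bar> \<le> \<bar>a * \<Delta> t - r * t\<bar> + \<bar>r\<bar> * \<bar>t\<bar>"
      using abs_triangle_ineq[of "a * \<Delta> t - r * t" "r * t"] by (simp add: abs_mult)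
    then have "\<bar>a\<bar> * \<bar>\<Delta> t\<bar> \<le> \<bar>a\<bar> / 2 * (\<bar>t\<bar> + \<bar>\<Delta> t\<bar>) + \<bar>r\<bar> * \<bar>t\<bar>" using elim(1) by linarith
    moreover have "\<bar>a\<bar> / 2 * (\<bar>t\<bar> + \<bar>\<Delta> t\<bar>) = \<bar>a\<bar> / 2 * \<bar>t\<bar> + \<bar>a\<bar> / 2 * \<bar>\<Delta> t\<bar>"
      "\<bar>a\<bar> * \<bar>\<Delta> t\<bar> = \<bar>a\<bar> / 2 * \<bar>\<Delta> t\<bar> + \<bar>a\<bar> / 2 * \<bar>\<Delta> t\<bar>"
      "(\<bar>r\<bar> + \<bar>a\<bar> / 2) * \<bar>t\<bar> = \<bar>r\<bar> * \<bar>t\<bar> + \<bar>a\<bar> / 2 * \<bar>t\<bar>"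
      by (simp_all add: distrib_left distrib_right)
    ultimately have "\<bar>a\<bar> / 2 * \<bar>\<Delta> t\<bar> \<le> (\<bar>r\<bar> + \<bar>a\<bar> / 2) * \<bar>t\<bar>" by linarith
    then have 1: "\<bar>\<Delta> t\<bar> \<le> K * \<bar>t\<bar>" using a by (simp add: K_def field_simps)
    have "\<bar>a * \<Delta> t - r * t\<bar> \<le> e * ((1 + K) * \<bar>t\<bar>)"
      using elim(2) mult_left_mono[OF _ less_imp_le[OF e], of "\<bar>t\<bar> + \<bar>\<Delta> t\<bar>" "(1 + K) * \<bar>t\<bar>"] 1
      by (simp add: algebra_simps)
    also have "\<dots> = \<epsilon> * \<bar>a\<bar> / 2 * \<bar>t\<bar>" using K by (simp add: e_def field_simps)
    also have "\<dots> < \<epsilon> * \<bar>a\<bar> * \<bar>t\<bar>" using \<epsilon> a elim(3) by simp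
    finally have 2: "\<bar>a * \<Delta> t - r * t\<bar> < \<epsilon> * \<bar>a\<bar> * \<bar>t\<bar>" .
    have "\<Delta> t / t - r / a = (a * \<Delta> t - r * t) / (a * t)" using a elim(3) by (simp add: field_simps)
    then have "\<bar>\<Delta> t / t - r / a\<bar> = \<bar>a * \<Delta> t - r * t\<bar> / (\<bar>a\<bar> * \<bar>t\<bar>)" by (simp add: abs_mult)
    also have "\<dots> < \<epsilon>" using 2 a elim(3) by (simp add: pos_divide_less_eq mult.assoc)
    finally show ?case by (simp add: dist_real_def)
  qed
qed

lemma Rn_upd: "x \<in> Rn n \<Longrightarrow> i < n \<Longrightarrow> x(i := t) \<in> Rn n"
  by (simp add: Rn_iff)

lemma cube_upd: "x \<in> cube n p d \<Longrightarrow> i < n \<Longrightarrow> \<bar>t - p i\<bar> < d \<Longrightarrow> x(i := t) \<in> cube n p d"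
  by (simp add: cube_def Rn_upd)

lemma cube_component_convex:
  assumes "x \<in> cube n p d" "y \<in> cube n p d" "i < n" "x i \<le> t" "t \<le> y i"
  shows "\<bar>t - p i\<bar> < d"
proof -
  have "\<bar>x i - p i\<bar> < d" "\<bar>y i - p i\<bar> < d" using assms by (simp_all add: cube_def)
  then show ?thesis using assms(4,5) by linarith
qed

text \<open>The special case of the inverse function theorem for maps that change one coordinate only.
  The inverse is constructed with the intermediate value theorem.\<close>

context
  fixes n i :: nat and U :: "(nat \<Rightarrow> real) set" and g :: "(nat \<Rightarrow> real) \<Rightarrow> real" and p :: "nat \<Rightarrow> real" and d :: real
  assumes g: "smooth_fun n U g" and U: "open_Rn n U" and i: "i < n" and d: "d > 0"
    and sub: "cube n p d \<subseteq> U" and p: "p \<in> Rn n"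
    and sg: "\<And>x. x \<in> cube n p d \<Longrightarrow> sgn (pd i g p) * pd i g x > 0"
begin

private abbreviation "A \<equiv> cube n p d"
private definition "s = sgn (pd i g p)"
private definition "\<Phi> x = x(i := g x)"
private definition "h y = (SOME t. y(i := t) \<in> A \<and> g (y(i := t)) = y i)"

text \<open>The sign \<open>s\<close> makes the partial derivative positive on the whole cube, so
  that increasing and decreasing \<open>g\<close> are treated alike.\<close>

private lemma g_mono:
  assumes x: "x \<in> A" and t: "x i < t" "\<bar>t - p i\<bar> < d"
  shows "s * g x < s * g (x(i := t))"
proof -
  have xt: "x(i := t) \<in> A" by (rule cube_upd[OF x i t(2)])
  have "((\<lambda>u. s * g (x(i := u))) has_real_derivative s * pd i g (x(i := u))) (at u)" if "x i \<le> u" "u \<le> t" for u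
  proof -
    have "x(i := u) \<in> A"
      using cube_component_convex[OF x xt i, of u] that by (intro cube_upd[OF x i]) simp
    then have "x(i := u) \<in> U" using sub by blast
    from Ck_on_has_pd[OF smooth_fun_C1[OF g] i this]
    show ?thesis by (intro DERIV_cmult) simp
  qed
  then obtain z where z: "x i < z" "z < t" "s * g (x(i := t)) - s * g (x(i := x i)) = (t - x i) * (s * pd i g (x(i := z)))"
    using MVT2[OF t(1), of "\<lambda>u. s * g (x(i := u))" "\<lambda>u. s * pd i g (x(i := u))"] by blast
  have "x(i := z) \<in> A"
    using cube_component_convex[OF x xt i, of z] z by (intro cube_upd[OF x i]) simp
  then have "s * pd i g (x(i := z)) > 0" using sg by (simp add: s_def)
  then have "(t - x i) * (s * pd i g (x(i := z))) > 0" using t by simp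
  with z(3) show ?thesis by simp
qed

private lemma g_inj:
  assumes "y(i := t) \<in> A" "y(i := t') \<in> A" "g (y(i := t)) = g (y(i := t'))"
  shows "t = t'"
proof (rule ccontr)
  have b: "\<bar>t - p i\<bar> < d" "\<bar>t' - p i\<bar> < d" using assms(1,2) i by (auto simp: cube_def)
  assume "t \<noteq> t'"
  then consider "t < t'" | "t' < t" by linarith
  then show False
  proof cases
    case 1 with g_mono[OF assms(1), of t'] b assms(3) show False by simp
  next
    case 2 with g_mono[OF assms(2), of t] b assms(3) show False by simp
  qed
qed

private lemma h_eq: "y(i := t) \<in> A \<Longrightarrow> g (y(i := t)) = y i \<Longrightarrow> h y = t"
  unfolding h_def by (rule some_equality) (auto intro: g_inj)

private lemma h_\<Phi>:
  assumes x: "x \<in> A"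
  shows "h (\<Phi> x) = x i" "(\<Phi> x)(i := h (\<Phi> x)) = x"
proof -
  show 1: "h (\<Phi> x) = x i" by (rule h_eq) (use x in \<open>simp_all add: \<Phi>_def\<close>)
  show "(\<Phi> x)(i := h (\<Phi> x)) = x" unfolding 1 by (simp add: \<Phi>_def)
qed

text \<open>Openness of the image and continuity of \<open>h\<close> at once: for every
  \<open>y\<close> close to \<open>\<Phi> x\<close> the function \<open>g (y(i := t)) - y i\<close>
  of \<open>t\<close> changes sign between \<open>a\<close> and \<open>b\<close>, so it has a root
  within \<open>\<epsilon>\<close> of \<open>x i\<close>.\<close>

private lemma near:
  assumes x: "x \<in> A" and e: "e > 0"
  obtains \<delta> where "\<delta> > 0" "\<And>y. y \<in> cube n (\<Phi> x) \<delta> \<Longrightarrow> y \<in> \<Phi> ` A \<and> \<bar>h y - x i\<bar> < e"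
proof -
  have xp: "\<bar>x i - p i\<bar> < d" using x i by (simp add: cube_def)
  define \<epsilon> where "\<epsilon> = min e (d - \<bar>x i - p i\<bar>) / 2"
  have \<epsilon>: "\<epsilon> > 0" "\<epsilon> < e" "\<bar>x i - p i\<bar> + \<epsilon> < d" using e xp by (auto simp: \<epsilon>_def min_def field_simps)
  define a b where "a = x i - \<epsilon>" and "b = x i + \<epsilon>"
  have ab: "\<bar>a - p i\<bar> < d" "\<bar>b - p i\<bar> < d" using \<epsilon> by (auto simp: a_def b_def)
  have xa: "x(i := a) \<in> A" and xb: "x(i := b) \<in> A" using cube_upd[OF x i] ab by auto
  have sa: "s * g (x(i := a)) < s * g x" using g_mono[OF xa, of "x i"] xp \<epsilon> by (simp add: a_def)
  have sb: "s * g x < s * g (x(i := b))" using g_mono[OF x, of b] ab \<epsilon> by (simp add: b_def)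
  have gc: "continuous_on U g" by (rule smooth_fun_continuous[OF g])
  \<comment> \<open>Half the smaller gap: it is spent once on moving the point and once on moving
    the target value from \<open>g x\<close> to \<open>y i\<close>.\<close>
  define \<eta> where "\<eta> = min (s * g x - s * g (x(i := a))) (s * g (x(i := b)) - s * g x) / 2"
  have \<eta>: "\<eta> > 0" "2 * \<eta> \<le> s * g x - s * g (x(i := a))" "2 * \<eta> \<le> s * g (x(i := b)) - s * g x"
    using sa sb by (auto simp: \<eta>_def)
  obtain da where da: "da > 0" "\<And>y. y \<in> cube n (x(i := a)) da \<Longrightarrow> \<bar>g y - g (x(i := a))\<bar> < \<eta>"
    using continuous_on_Rn_cube[OF gc U subsetD[OF sub xa] \<eta>(1)] by metis
  obtain db where db: "db > 0" "\<And>y. y \<in> cube n (x(i := b)) db \<Longrightarrow> \<bar>g y - g (x(i := b))\<bar> < \<eta>"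
    using continuous_on_Rn_cube[OF gc U subsetD[OF sub xb] \<eta>(1)] by metis
  obtain dc where dc: "dc > 0" "cube n x dc \<subseteq> A" using open_Rn_contains_cube[OF open_Rn_cube x] by blast
  define \<delta> where "\<delta> = min (min da db) (min dc \<eta>)"
  have \<delta>: "\<delta> > 0" "\<delta> \<le> da" "\<delta> \<le> db" "\<delta> \<le> dc" "\<delta> \<le> \<eta>" using da db dc \<eta> by (auto simp: \<delta>_def)
  have s1: "\<bar>s\<bar> \<le> 1" by (simp add: s_def abs_sgn_eq)
  have smul: "\<bar>s * u\<bar> \<le> \<bar>u\<bar>" for u using mult_right_mono[OF s1, of "\<bar>u\<bar>"] by (simp add: abs_mult)
  have "y \<in> \<Phi> ` A \<and> \<bar>h y - x i\<bar> < e" if y: "y \<in> cube n (\<Phi> x) \<delta>" for y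
  proof -
    have yR: "y \<in> Rn n" and yj: "\<And>j. j < n \<Longrightarrow> j \<noteq> i \<Longrightarrow> \<bar>y j - x j\<bar> < \<delta>" and yi: "\<bar>y i - g x\<bar> < \<delta>"
      using y i by (auto simp: cube_def \<Phi>_def split: if_splits)
    have yt: "y(i := t) \<in> cube n (x(i := t)) D" if "\<delta> \<le> D" for t D
      using yR yj i that \<delta>(1) by (auto simp: cube_def Rn_iff intro: less_le_trans)
    have ytA: "y(i := t) \<in> A" if "a \<le> t" "t \<le> b" for t
    proof -
      have "\<bar>t - p i\<bar> < d" using that ab by linarith
      moreover have "y(i := x i) \<in> A"
        using yt[OF \<delta>(4), of "x i"] dc(2) by auto
      ultimately show ?thesis using cube_upd[OF _ i, of "y(i := x i)" p d t] by simp
    qed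
    define f where "f t = s * (g (y(i := t)) - y i)" for t
    have c1: "continuous_on {a..b} (\<lambda>t. y(i := t))"
    proof (rule continuous_on_coordinatewise_then_product)
      show "continuous_on {a..b} (\<lambda>t. (y(i := t)) j)" for j
        by (cases "j = i") (simp_all add: continuous_on_id)
    qed
    have "continuous_on {a..b} (\<lambda>t. g (y(i := t)))"
      by (rule continuous_on_compose2[OF gc c1]) (use ytA sub in auto)
    then have "continuous_on {a..b} f" unfolding f_def by (intro continuous_intros)
    moreover have "f a \<le> 0"
    proof -
      have "\<bar>g (y(i := a)) - g (x(i := a))\<bar> < \<eta>" by (rule da(2)[OF yt[OF \<delta>(2)]])
      then have "s * g (y(i := a)) - s * g (x(i := a)) \<le> \<eta>"
        using smul[of "g (y(i := a)) - g (x(i := a))"] by (simp add: algebra_simps)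
      moreover have "s * g x - s * y i \<le> \<eta>"
        using smul[of "g x - y i"] yi \<delta>(5) by (simp add: algebra_simps)
      ultimately show ?thesis using \<eta>(2) by (simp add: f_def algebra_simps)
    qed
    moreover have "0 \<le> f b"
    proof -
      have "\<bar>g (y(i := b)) - g (x(i := b))\<bar> < \<eta>" by (rule db(2)[OF yt[OF \<delta>(3)]])
      then have "s * g (x(i := b)) - s * g (y(i := b)) \<le> \<eta>"
        using smul[of "g (x(i := b)) - g (y(i := b))"] by (simp add: algebra_simps)
      moreover have "s * y i - s * g x \<le> \<eta>"
        using smul[of "y i - g x"] yi \<delta>(5) by (simp add: algebra_simps)
      ultimately show ?thesis using \<eta>(3) by (simp add: f_def algebra_simps)
    qed
    ultimately obtain t where t: "a \<le> t" "t \<le> b" "f t = 0"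
      using IVT'[of f a 0 b] \<epsilon>(1) unfolding a_def b_def by force
    have "s \<noteq> 0" using sg[OF x] by (auto simp: s_def)
    then have gt: "g (y(i := t)) = y i" using t(3) by (simp add: f_def)
    then have "h y = t" by (rule h_eq[OF ytA[OF t(1,2)]])
    moreover have "y = \<Phi> (y(i := t))" unfolding \<Phi>_def gt by simp
    ultimately show ?thesis using ytA[OF t(1,2)] t \<epsilon> by (auto simp: a_def b_def)
  qed
  with \<delta>(1) show ?thesis by (rule that)
qed

private lemma A_Rn: "x \<in> A \<Longrightarrow> x \<in> Rn n"
  using cube_subset_Rn by blast

private lemma B_open: "open_Rn n (\<Phi> ` A)"
  unfolding open_Rn_iff
proof (intro conjI ballI)
  show "\<Phi> ` A \<subseteq> Rn n" using A_Rn Rn_upd[OF _ i] by (auto simp: \<Phi>_def)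
  fix y assume "y \<in> \<Phi> ` A"
  then obtain x where x: "x \<in> A" "y = \<Phi> x" by blast
  obtain \<delta> where "\<delta> > 0" "\<And>y. y \<in> cube n (\<Phi> x) \<delta> \<Longrightarrow> y \<in> \<Phi> ` A \<and> \<bar>h y - x i\<bar> < 1"
    using near[OF x(1) zero_less_one] by blast
  then show "\<exists>e>0. cube n y e \<subseteq> \<Phi> ` A" using x(2) by blast
qed

private lemma \<Psi>_in: "y \<in> \<Phi> ` A \<Longrightarrow> y(i := h y) \<in> A" "y \<in> \<Phi> ` A \<Longrightarrow> \<Phi> (y(i := h y)) = y"
  using h_\<Phi>(2) by auto

private lemma h_tendsto:
  assumes y: "y \<in> \<Phi> ` A" and j: "j < n"
  shows "((\<lambda>t. h (\<lambda>l. y l + t * unit_vec j l)) \<longlongrightarrow> h y) (nhds 0)"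
proof (rule tendstoI)
  fix e :: real assume e: "e > 0"
  obtain x where x: "x \<in> A" "y = \<Phi> x" using y by blast
  obtain \<delta> where \<delta>: "\<delta> > 0" "\<And>y. y \<in> cube n (\<Phi> x) \<delta> \<Longrightarrow> y \<in> \<Phi> ` A \<and> \<bar>h y - x i\<bar> < e"
    using near[OF x(1) e] by blast
  have yR: "y \<in> Rn n" using y open_Rn_subset[OF B_open] by blast
  have hy: "h y = x i" using h_\<Phi>(1)[OF x(1)] x(2) by simp
  have "\<forall>\<^sub>F t in nhds 0. (\<lambda>l. y l + t * unit_vec j l) \<in> cube n (\<Phi> x) \<delta>"
    by (rule eventually_line_in[OF open_Rn_cube _ unit_vec_Rn[OF j]])
      (use center_in_cube[OF yR \<delta>(1)] x(2) in simp)
  then show "\<forall>\<^sub>F t in nhds 0. dist (h (\<lambda>l. y l + t * unit_vec j l)) (h y) < e"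
    by eventually_elim (use \<delta>(2) hy in \<open>simp add: dist_real_def\<close>)
qed

private lemma h_derivative:
  assumes y: "y \<in> \<Phi> ` A" and j: "j < n"
  defines "x \<equiv> y(i := h y)"
  shows "((\<lambda>t. h (\<lambda>l. y l + t * unit_vec j l)) has_real_derivative
    (if j = i then 1 else - pd j g x) / pd i g x) (at 0)"
proof -
  \<comment> \<open>Moving \<open>y\<close> along \<open>unit_vec j\<close> changes \<open>g\<close>
    by 0 if \<open>j \<noteq> i\<close>, where its linearization is
    \<open>pd i g x * \<Delta> + pd j g x * t\<close>; it changes \<open>g\<close> by
    \<open>t\<close> if \<open>j = i\<close>, where only the term with \<open>\<Delta>\<close>
    occurs. Solving for \<open>\<Delta>\<close> gives \<open>r * t / pd i g x\<close>.\<close>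
  define r where "r = (if j = i then 1 else - pd j g x)"
  define Y where "Y t = (\<lambda>l. y l + t * unit_vec j l)" for t
  define X where "X t = (Y t)(i := h (Y t))" for t
  define \<Delta> where "\<Delta> t = h (Y t) - h y" for t
  have xA: "x \<in> A" and \<Phi>x: "\<Phi> x = y" unfolding x_def using \<Psi>_in[OF y] by auto
  have xU: "x \<in> U" using xA sub by blast
  have a: "pd i g x \<noteq> 0" using sg[OF xA] by auto
  have ht: "((\<lambda>t. h (Y t)) \<longlongrightarrow> h y) (nhds 0)" unfolding Y_def by (rule h_tendsto[OF y j])
  have YB: "\<forall>\<^sub>F t in nhds 0. Y t \<in> \<Phi> ` A"
    unfolding Y_def by (rule eventually_line_in[OF B_open y unit_vec_Rn[OF j]])
  have est: "\<forall>\<^sub>F t in at 0. \<bar>pd i g x * \<Delta> t - r * t\<bar> \<le> e * (\<bar>t\<bar> + \<bar>\<Delta> t\<bar>)" if e: "e > 0" for e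
  proof -
    obtain D where D: "D > 0" "cube n x D \<subseteq> U" "\<forall>u\<in>cube n x D. \<forall>z\<in>cube n x D.
       \<bar>g u - g z - (\<Sum>l<n. pd l g x * (u l - z l))\<bar> \<le> e * (\<Sum>l<n. \<bar>u l - z l\<bar>)"
      by (rule C1_estimate[OF smooth_fun_C1[OF g] U xU e])
    have xD: "x \<in> cube n x D" by (rule center_in_cube[OF A_Rn[OF xA] D(1)])
    have "\<forall>\<^sub>F t in nhds 0. X t \<in> cube n x D"
    proof (rule eventually_curve_in[OF open_Rn_cube xD])
      show "((\<lambda>t. X t l) \<longlongrightarrow> x l) (nhds 0)" for l
      proof (cases "l = i")
        case True then show ?thesis using ht by (simp add: X_def x_def)
      next
        case False
        have "((\<lambda>t. y l + t * unit_vec j l) \<longlongrightarrow> y l + 0 * unit_vec j l) (nhds 0)"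
          by (intro tendsto_intros filterlim_ident)
        then show ?thesis using False by (simp add: X_def x_def Y_def)
      qed
      show "\<forall>\<^sub>F t in nhds 0. X t \<in> Rn n" using YB
        by eventually_elim (use \<Psi>_in(1) A_Rn in \<open>auto simp: X_def\<close>)
    qed
    with YB have "\<forall>\<^sub>F t in nhds 0. \<bar>pd i g x * \<Delta> t - r * t\<bar> \<le> e * (\<bar>t\<bar> + \<bar>\<Delta> t\<bar>)"
    proof eventually_elim
      case (elim t)
      have "\<Phi> (X t) = Y t" unfolding X_def by (rule \<Psi>_in(2)[OF elim(1)])
      then have gX: "g (X t) = Y t i" by (metis \<Phi>_def fun_upd_same)
      have gx: "g x = y i" using \<Phi>x by (metis \<Phi>_def fun_upd_same)
      have gd: "g (X t) - g x = (if j = i then t else 0)" by (simp add: gX gx Y_def unit_vec_def)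
      have comp: "X t l - x l = (if l = i then \<Delta> t else if l = j then t else 0)" for l
        by (simp add: X_def x_def \<Delta>_def Y_def unit_vec_def)
      have S1: "(\<Sum>l<n. pd l g x * (X t l - x l)) = pd i g x * \<Delta> t + (if j = i then 0 else pd j g x * t)"
      proof -
        have "(\<Sum>l<n. pd l g x * (X t l - x l)) =
           (\<Sum>l<n. (if l = i then pd i g x * \<Delta> t else 0) + (if l = j then (if j = i then 0 else pd j g x * t) else 0))"
          by (intro sum.cong refl) (simp add: comp)
        then show ?thesis using i j by (simp add: sum.distrib)
      qed
      have S2: "(\<Sum>l<n. \<bar>X t l - x l\<bar>) \<le> \<bar>t\<bar> + \<bar>\<Delta> t\<bar>"
      proof -
        have "(\<Sum>l<n. \<bar>X t l - x l\<bar>) = (\<Sum>l<n. (if l = i then \<bar>\<Delta> t\<bar> else 0) + (if l = j then (if j = i then 0 else \<bar>t\<bar>) else 0))"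
          by (intro sum.cong refl) (simp add: comp)
        then show ?thesis using i j by (simp add: sum.distrib)
      qed
      have "\<bar>g (X t) - g x - (\<Sum>l<n. pd l g x * (X t l - x l))\<bar> \<le> e * (\<Sum>l<n. \<bar>X t l - x l\<bar>)"
        using D(3) elim(2) xD by blast
      also have "\<dots> \<le> e * (\<bar>t\<bar> + \<bar>\<Delta> t\<bar>)" using S2 e by simp
      also have "g (X t) - g x - (\<Sum>l<n. pd l g x * (X t l - x l)) = - (pd i g x * \<Delta> t - r * t)"
        unfolding gd S1 by (simp add: r_def)
      finally show ?case by simp
    qed
    then show ?thesis by (simp add: eventually_at_filter eventually_mono)
  qed
  have "((\<lambda>t. \<Delta> t / t) \<longlongrightarrow> r / pd i g x) (at 0)" by (rule difference_quotient_limit[OF a est])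
  moreover have "Y 0 = y" by (simp add: Y_def)
  ultimately show ?thesis
    unfolding has_field_derivative_iff by (simp add: \<Delta>_def Y_def r_def)
qed

private lemma h_continuous: "continuous_on (\<Phi> ` A) h"
  unfolding continuous_on_eq_continuous_within
proof
  fix y assume y: "y \<in> \<Phi> ` A"
  have "\<exists>T. open T \<and> y \<in> T \<and> (\<forall>z\<in>\<Phi> ` A \<inter> T. \<bar>h z - h y\<bar> < e)" if e: "e > 0" for e
  proof -
    obtain x where x: "x \<in> A" "y = \<Phi> x" using y by blast
    obtain \<delta> where \<delta>: "\<delta> > 0" "\<And>y. y \<in> cube n (\<Phi> x) \<delta> \<Longrightarrow> y \<in> \<Phi> ` A \<and> \<bar>h y - x i\<bar> < e"
      using near[OF x(1) e] by blast
    have hy: "h y = x i" using h_\<Phi>(1)[OF x(1)] x(2) by simp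
    have "y \<in> Rn n" using y open_Rn_subset[OF B_open] by blast
    then have yc: "y \<in> cube n y \<delta>" by (rule center_in_cube[OF _ \<delta>(1)])
    obtain T where T: "open T" "cube n y \<delta> = T \<inter> Rn n" using open_Rn_cube[of n y \<delta>] unfolding open_Rn_iff_open by blast
    have "\<bar>h z - h y\<bar> < e" if "z \<in> \<Phi> ` A \<inter> T" for z
    proof -
      have "z \<in> T \<inter> Rn n" using that open_Rn_subset[OF B_open] by blast
      then show ?thesis using \<delta>(2)[of z] T(2) x(2) hy by simp
    qed
    then show ?thesis using T yc by blast
  qed
  then have "\<forall>\<^sub>F z in at y within \<Phi> ` A. dist (h z) (h y) < e" if "e > 0" for e
    unfolding eventually_at_topological dist_real_def using that by (metis IntI)
  then show "continuous (at y within \<Phi> ` A) h"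
    unfolding continuous_within tendsto_iff by simp
qed

text \<open>Bootstrapping: the derivatives of \<open>h\<close> are rational expressions in partial
  derivatives of \<open>g\<close> at \<open>y(i := h y)\<close>, so every order of differentiability
  of \<open>h\<close> yields the next one.\<close>

private lemma h_Ck: "Ck_on n k (\<Phi> ` A) h"
proof (induction k)
  case 0
  then show ?case using h_continuous by simp
next
  case (Suc k)
  let ?\<Psi> = "\<lambda>y. y(i := h y)"
  define f' where "f' j y = (if j = i then 1 else - pd j g (?\<Psi> y)) / pd i g (?\<Psi> y)" for j y
  have \<Psi>k: "Ck_on n k (\<Phi> ` A) (\<lambda>y. ?\<Psi> y l)" for l
    using Suc Ck_on_proj[OF B_open] by (cases "l = i") auto
  have comp: "Ck_on n k (\<Phi> ` A) (\<lambda>y. pd j g (?\<Psi> y))" if "j < n" for j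
  proof (rule Ck_on_compose[of n A n "\<Phi> ` A" ?\<Psi>, OF open_Rn_cube B_open \<Psi>_in(1)])
    show "Ck_on n k A (pd j g)"
      using smooth_fun_pd[OF smooth_fun_subset[OF g sub] that] by (simp add: smooth_fun_def)
  qed (auto intro: \<Psi>k simp del: fun_upd_apply)
  show ?case
  proof (rule Ck_on_SucI'[OF B_open h_continuous, where f' = f'])
    show "((\<lambda>t. h (\<lambda>l. y l + t * unit_vec j l)) has_real_derivative f' j y) (at 0)" if "j < n" "y \<in> \<Phi> ` A" for j y
      unfolding f'_def by (rule h_derivative[OF that(2,1)])
    fix j assume j: "j < n"
    have 1: "Ck_on n k (\<Phi> ` A) (\<lambda>y. inverse (pd i g (?\<Psi> y)))"
      by (rule Ck_on_inverse[OF B_open comp[OF i]]) (use sg[OF \<Psi>_in(1)] in force)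
    have 2: "Ck_on n k (\<Phi> ` A) (\<lambda>y. if j = i then 1 else - pd j g (?\<Psi> y))"
      using Ck_on_mult[OF B_open Ck_on_const[OF B_open, of k "-1"] comp[OF j]] Ck_on_const[OF B_open]
      by (cases "j = i") simp_all
    have "f' j = (\<lambda>y. (if j = i then 1 else - pd j g (?\<Psi> y)) * inverse (pd i g (?\<Psi> y)))"
      by (simp add: f'_def divide_inverse fun_eq_iff)
    with Ck_on_mult[OF B_open 2 1] show "Ck_on n k (\<Phi> ` A) (f' j)" by simp
  qed
qed

lemma elementary_diffeo:
  obtains B \<Psi> where "diffeo_on n (cube n p d) B (\<lambda>x. x(i := g x)) \<Psi>"
proof -
  have "smooth_map n A n (\<Phi> ` A) \<Phi>"
  proof (rule smooth_mapI)
    show "smooth_fun n A (\<lambda>x. \<Phi> x j)" for j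
      using smooth_fun_proj[OF open_Rn_cube] smooth_fun_subset[OF g sub] by (cases "j = i") (auto simp: \<Phi>_def)
  qed auto
  moreover have "smooth_map n (\<Phi> ` A) n A (\<lambda>y. y(i := h y))"
  proof (rule smooth_mapI[OF \<Psi>_in(1)])
    show "smooth_fun n (\<Phi> ` A) (\<lambda>y. (y(i := h y)) j)" for j
      using smooth_fun_proj[OF B_open] h_Ck by (cases "j = i") (auto simp: smooth_fun_def)
  qed
  ultimately have "diffeo_on n A (\<Phi> ` A) \<Phi> (\<lambda>y. y(i := h y))"
    unfolding diffeo_on_def using open_Rn_cube B_open h_\<Phi>(2) \<Psi>_in(2) by blast
  then show ?thesis using that unfolding \<Phi>_def[abs_def] by blast
qed

end

text \<open>The cube is taken so small that \<open>pd i g\<close> varies by less than its modulus at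
  \<open>p\<close> and therefore keeps its sign.\<close>

lemma elementary_inverse:
  assumes g: "smooth_fun n U g" and U: "open_Rn n U" and i: "i < n" and p: "p \<in> U" and nz: "pd i g p \<noteq> 0"
  obtains A B \<Psi> where "p \<in> A" "A \<subseteq> U" "diffeo_on n A B (\<lambda>x. x(i := g x)) \<Psi>"
proof -
  have pR: "p \<in> Rn n" using p open_Rn_subset[OF U] by blast
  obtain d where d: "d > 0" "cube n p d \<subseteq> U" "\<And>y. y \<in> cube n p d \<Longrightarrow> \<bar>pd i g y - pd i g p\<bar> < \<bar>pd i g p\<bar>"
    using continuous_on_Rn_cube[OF smooth_fun_continuous[OF smooth_fun_pd[OF g i]] U p] nz
    by (metis zero_less_abs_iff)
  have sg: "sgn (pd i g p) * pd i g x > 0" if "x \<in> cube n p d" for x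
    using d(3)[OF that] nz by (auto simp: sgn_real_def split: if_splits)
  obtain B \<Psi> where "diffeo_on n (cube n p d) B (\<lambda>x. x(i := g x)) \<Psi>"
    using elementary_diffeo[OF g U i d(1,2) pR sg] by blast
  then show ?thesis using that[OF center_in_cube[OF pR d(1)] d(2)] by blast
qed

section \<open>Straightening a submersion\<close>

definition swap_coords :: "nat \<Rightarrow> nat \<Rightarrow> (nat \<Rightarrow> real) \<Rightarrow> nat \<Rightarrow> real" where
  "swap_coords a b x = (\<lambda>j. if j = a then x b else if j = b then x a else x j)"

lemma swap_coords_swap [simp]: "swap_coords a b (swap_coords a b x) = x"
  by (auto simp: swap_coords_def fun_eq_iff)

lemma swap_coords_Rn: "a < n \<Longrightarrow> b < n \<Longrightarrow> x \<in> Rn n \<Longrightarrow> swap_coords a b x \<in> Rn n"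
  by (auto simp: swap_coords_def Rn_iff)

lemma smooth_swap_coords:
  assumes "open_Rn n U" "\<And>x. x \<in> U \<Longrightarrow> swap_coords a b x \<in> V"
  shows "smooth_map n U n V (swap_coords a b)"
proof (rule smooth_mapI)
  show "smooth_fun n U (\<lambda>x. swap_coords a b x j)" for j
    using smooth_fun_proj[OF assms(1), of b] smooth_fun_proj[OF assms(1), of a] smooth_fun_proj[OF assms(1), of j]
    by (cases "j = a"; cases "j = b") (simp_all add: swap_coords_def)
qed (rule assms(2))

lemma diffeo_swap_coords:
  assumes B: "open_Rn n B" and ab: "a < n" "b < n"
  shows "diffeo_on n B {x \<in> Rn n. swap_coords a b x \<in> B} (swap_coords a b) (swap_coords a b)"
proof -
  have R: "open_Rn n (Rn n)" by simp
  have s: "smooth_map n (Rn n) n (Rn n) (swap_coords a b)"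
    by (rule smooth_swap_coords[OF R swap_coords_Rn[OF ab]])
  have o: "open_Rn n {x \<in> Rn n. swap_coords a b x \<in> B}"
    by (rule smooth_map_preimage_open[OF s R order_refl B])
  have "smooth_map n B n {x \<in> Rn n. swap_coords a b x \<in> B} (swap_coords a b)"
    by (rule smooth_swap_coords[OF B]) (use open_Rn_subset[OF B] swap_coords_Rn[OF ab] in auto)
  moreover have "smooth_map n {x \<in> Rn n. swap_coords a b x \<in> B} n B (swap_coords a b)"
    by (rule smooth_swap_coords[OF o]) simp
  ultimately show ?thesis unfolding diffeo_on_def using B o by simp
qed

text \<open>Coordinates are replaced by components of \<open>f\<close> one at a time. After
  \<open>r\<close> replacements the next component still depends on some coordinate from
  \<open>r\<close> on, because the tangent map of \<open>f\<close> is onto; this coordinate is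
  swapped to place \<open>r\<close> and replaced with the help of
  \<open>elementary_inverse\<close>.\<close>

lemma submersion_straighten:
  assumes f: "smooth_map n U q (Rn q) f" and U: "open_Rn n U" and p: "p \<in> U"
    and sub: "tangent_map f p ` Rn n = Rn q"
  shows "r \<le> q \<Longrightarrow> \<exists>A B \<kappa> \<mu>. diffeo_on n A B \<kappa> \<mu> \<and> p \<in> A \<and> A \<subseteq> U \<and> r \<le> n \<and> (\<forall>x\<in>A. \<forall>j<r. \<kappa> x j = f x j)"
proof (induction r)
  case 0
  have "diffeo_on n U U (\<lambda>x. x) (\<lambda>x. x)" using smooth_map_id[OF U] U by (simp add: diffeo_on_def)
  then show ?case using p by blast
next
  case (Suc r)
  then obtain A B \<kappa> \<mu> where d: "diffeo_on n A B \<kappa> \<mu>" and pA: "p \<in> A" and AU: "A \<subseteq> U"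
    and \<kappa>: "\<And>x j. x \<in> A \<Longrightarrow> j < r \<Longrightarrow> \<kappa> x j = f x j" by auto
  note D = diffeo_onD[OF d]
  have rq: "r < q" using Suc.prems by simp
  define G where "G y = f (\<mu> y) r" for y
  have G: "smooth_fun n B G"
    unfolding G_def
    by (rule smooth_fun_compose[OF D(4,2,1) smooth_fun_subset[OF smooth_map_comp[OF f rq] AU]])
  define y where "y = \<kappa> p"
  have y: "y \<in> B" unfolding y_def by (rule smooth_map_in[OF D(3) pA])
  have "\<exists>i. r \<le> i \<and> i < n \<and> pd i G y \<noteq> 0"
  proof (rule ccontr)
    assume no: "\<not> ?thesis"
    \<comment> \<open>A vector along which the first \<open>r\<close> components of \<open>f\<close>
      have derivative 0 and the next one has derivative 1. In the coordinates
      \<open>\<kappa>\<close> its first \<open>r\<close> entries vanish, so \<open>G\<close> must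
      have a nonzero partial derivative from \<open>r\<close> on.\<close>
    have "unit_vec r \<in> tangent_map f p ` Rn n" unfolding sub by (rule unit_vec_Rn[OF rq])
    then obtain u where u: "u \<in> Rn n" "tangent_map f p u = unit_vec r" by auto
    define v where "v = tangent_map \<kappa> p u"
    have v: "v \<in> Rn n" unfolding v_def by (rule tangent_map_Rn[OF D(3,1) open_Rn_subset[OF D(2)] pA u(1)])
    have v0: "v j = 0" if "j < r" for j
    proof -
      have "v j = dir_deriv (\<lambda>x. f x j) p u"
        unfolding v_def tangent_map_def by (rule dir_deriv_cong[OF D(1) pA u(1) \<kappa>[OF _ that]])
      also have "\<dots> = tangent_map f p u j" by (simp add: tangent_map_def)
      finally show ?thesis using that by (simp add: u(2) unit_vec_def)
    qed
    have "1 = dir_deriv (\<lambda>x. f x r) p u"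
      using fun_cong[OF u(2), of r] by (simp add: tangent_map_def unit_vec_def)
    also have "\<dots> = dir_deriv (\<lambda>x. G (\<kappa> x)) p u"
      by (rule dir_deriv_cong[OF D(1) pA u(1)]) (simp add: G_def D(5))
    also have "\<dots> = dir_deriv G y v"
      unfolding y_def v_def by (rule dir_deriv_compose[OF D(3,1,2) G pA u(1)])
    also have "\<dots> = (\<Sum>i<n. pd i G y * v i)" by (rule dir_deriv_smooth_eq_sum[OF G D(2) y v])
    also have "\<dots> = 0"
    proof (intro sum.neutral ballI)
      fix i assume "i \<in> {..<n}"
      then show "pd i G y * v i = 0" using no v0[of i] by (cases "i < r") auto
    qed
    finally show False by simp
  qed
  then obtain i where i: "r \<le> i" "i < n" "pd i G y \<noteq> 0" by blast
  then have rn: "r < n" by simp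
  let ?s = "swap_coords r i"
  define B1 where "B1 = {x \<in> Rn n. ?s x \<in> B}"
  have d1: "diffeo_on n B B1 ?s ?s" unfolding B1_def by (rule diffeo_swap_coords[OF D(2) rn i(2)])
  note D1 = diffeo_onD[OF d1]
  define G1 where "G1 = (\<lambda>x. G (?s x))"
  have G1: "smooth_fun n B1 G1" unfolding G1_def by (rule smooth_fun_compose[OF D1(4,2,1) G])
  have sline: "?s (\<lambda>j. ?s y j + t * unit_vec r j) = (\<lambda>j. y j + t * unit_vec i j)" for t
    by (auto simp: swap_coords_def unit_vec_def fun_eq_iff)
  have "pd r G1 (?s y) \<noteq> 0"
    using i(3) unfolding G1_def dir_deriv_def sline .
  then obtain A2 B2 \<Psi> where A2: "?s y \<in> A2" "A2 \<subseteq> B1" "diffeo_on n A2 B2 (\<lambda>x. x(r := G1 x)) \<Psi>"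
    by (rule elementary_inverse[OF G1 D1(2) rn smooth_map_in[OF D1(3) y]])
  have d2: "diffeo_on n {x \<in> A. ?s (\<kappa> x) \<in> A2} A2 (\<lambda>x. ?s (\<kappa> x)) (\<lambda>z. \<mu> (?s z))"
    by (rule diffeo_on_restrict[OF diffeo_on_compose[OF d d1] diffeo_onD(1)[OF A2(3)] A2(2)])
  have d3: "diffeo_on n {x \<in> A. ?s (\<kappa> x) \<in> A2} B2 (\<lambda>x. (?s (\<kappa> x))(r := G1 (?s (\<kappa> x)))) (\<lambda>z. \<mu> (?s (\<Psi> z)))"
    by (rule diffeo_on_compose[OF d2 A2(3)])
  define A3 \<kappa>3 \<mu>3 where "A3 = {x \<in> A. ?s (\<kappa> x) \<in> A2}"
    and "\<kappa>3 = (\<lambda>x. (?s (\<kappa> x))(r := G1 (?s (\<kappa> x))))" and "\<mu>3 = (\<lambda>z. \<mu> (?s (\<Psi> z)))"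
  have "\<kappa>3 x j = f x j" if "x \<in> A3" "j < Suc r" for x j
  proof (cases "j = r")
    case True
    then show ?thesis using D(5) that(1) by (simp add: A3_def \<kappa>3_def G1_def G_def)
  next
    case False
    then have "j < r" "j \<noteq> i" using that(2) i(1) by auto
    then show ?thesis using \<kappa> that(1) by (simp add: A3_def \<kappa>3_def swap_coords_def)
  qed
  moreover have "p \<in> A3" "A3 \<subseteq> U" using pA A2(1) AU by (auto simp: A3_def y_def)
  moreover have "diffeo_on n A3 B2 \<kappa>3 \<mu>3" unfolding A3_def \<kappa>3_def \<mu>3_def by (rule d3)
  moreover have "Suc r \<le> n" using rn by simp
  ultimately show ?case by blast
qed

theorem submersion_normal_form:
  assumes f: "smooth_map n U q (Rn q) f" and U: "open_Rn n U" and p: "p \<in> U"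
    and sub: "tangent_map f p ` Rn n = Rn q"
  obtains A c e \<kappa> \<mu> where "diffeo_on n A (cube n c e) \<kappa> \<mu>" "p \<in> A" "A \<subseteq> U" "e > 0" "c \<in> Rn n" "q \<le> n"
    "\<And>x j. x \<in> A \<Longrightarrow> j < q \<Longrightarrow> \<kappa> x j = f x j"
proof -
  obtain A B \<kappa> \<mu> where d: "diffeo_on n A B \<kappa> \<mu>" and A: "p \<in> A" "A \<subseteq> U" "q \<le> n"
    and \<kappa>: "\<forall>x\<in>A. \<forall>j<q. \<kappa> x j = f x j"
    using submersion_straighten[OF assms order_refl] by blast
  note D = diffeo_onD[OF d]
  have \<kappa>p: "\<kappa> p \<in> B" by (rule smooth_map_in[OF D(3) A(1)])
  obtain e where e: "e > 0" "cube n (\<kappa> p) e \<subseteq> B" by (rule open_Rn_contains_cube[OF D(2) \<kappa>p])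
  have cR: "\<kappa> p \<in> Rn n" using \<kappa>p open_Rn_subset[OF D(2)] by blast
  show ?thesis
  proof (rule that[OF diffeo_on_restrict[OF d open_Rn_cube e(2)] _ _ e(1) cR A(3)])
    show "p \<in> {x \<in> A. \<kappa> x \<in> cube n (\<kappa> p) e}" using A(1) center_in_cube[OF cR e(1)] by simp
  qed (use A(2) \<kappa> in auto)
qed

section \<open>Foliated charts\<close>

lemma cube_segment:
  assumes y: "y \<in> cube n c e" and z: "z \<in> cube n c e" and t: "0 \<le> t" "t \<le> 1"
  shows "(\<lambda>j. y j + t * (z j - y j)) \<in> cube n c e"
proof -
  have "\<bar>y j + t * (z j - y j) - c j\<bar> < e" if "j < n" for j
  proof -
    have b: "\<bar>y j - c j\<bar> < e" "\<bar>z j - c j\<bar> < e" using y z that by (auto simp: cube_def)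
    have "y j + t * (z j - y j) - c j = (1 - t) * (y j - c j) + t * (z j - c j)" by (simp add: algebra_simps)
    also have "\<bar>\<dots>\<bar> \<le> (1 - t) * \<bar>y j - c j\<bar> + t * \<bar>z j - c j\<bar>"
      using t abs_triangle_ineq[of "(1 - t) * (y j - c j)" "t * (z j - c j)"] by (simp add: abs_mult)
    also have "\<dots> < e"
    proof (cases "t = 0")
      case False
      then have "t * \<bar>z j - c j\<bar> < t * e" using b t by simp
      moreover have "(1 - t) * \<bar>y j - c j\<bar> \<le> (1 - t) * e" using b t by (intro mult_left_mono) auto
      ultimately show ?thesis by (simp add: algebra_simps)
    qed (use b in simp)
    finally show ?thesis .
  qed
  moreover have "(\<lambda>j. y j + t * (z j - y j)) \<in> Rn n"
    using y z cube_subset_Rn by (auto simp: Rn_iff cube_def)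
  ultimately show ?thesis by (simp add: cube_def)
qed

text \<open>The segment from \<open>y\<close> to \<open>z\<close> stays in the cube, and
  \<open>f\<close> is constant along it.\<close>

lemma zero_derivative_imp_eq:
  assumes f: "smooth_fun n U f" and U: "open_Rn n U" and sub: "cube n c e \<subseteq> U"
    and y: "y \<in> cube n c e" and z: "z \<in> cube n c e"
    and der: "\<And>x. x \<in> cube n c e \<Longrightarrow> dir_deriv f x (\<lambda>j. z j - y j) = 0"
  shows "f y = f z"
proof -
  let ?v = "\<lambda>j. z j - y j"
  have v: "?v \<in> Rn n" using y z by (simp add: cube_def Rn_iff)
  have "((\<lambda>t. f (\<lambda>j. y j + t * ?v j)) has_real_derivative 0) (at t)" if "0 \<le> t" "t \<le> 1" for t
  proof -
    have c: "(\<lambda>j. y j + t * ?v j) \<in> cube n c e" by (rule cube_segment[OF y z that])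
    show ?thesis
      using smooth_fun_line_derivative_at[OF f U subsetD[OF sub c] v] unfolding der[OF c] .
  qed
  then obtain t where "f (\<lambda>j. y j + 1 * ?v j) - f (\<lambda>j. y j + 0 * ?v j) = (1 - 0) * (0 :: real)"
    using MVT2[of 0 1 "\<lambda>t. f (\<lambda>j. y j + t * ?v j)" "\<lambda>t. 0"] by auto
  then show ?thesis by simp
qed

locale foliated = mfd M for M :: "'a mfd" +
  fixes q :: nat and F :: "('a set \<times> ('a \<Rightarrow> nat \<Rightarrow> real)) set"
  assumes cocycle: "foliation_cocycle M q F"
begin

lemma F_submersion: "(W, f) \<in> F \<Longrightarrow> submersion_on M q W f"
  using cocycle unfolding foliation_cocycle_def by blast

lemma F_open: "(W, f) \<in> F \<Longrightarrow> openin (mtop M) W"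
  using F_submersion by (auto simp: submersion_on_def)

lemma F_chart:
  assumes "(W, f) \<in> F" "(U, \<phi>) \<in> atlas M"
  shows "smooth_map m (\<phi> ` (U \<inter> W)) q (Rn q) (in_chart (U, \<phi>) f)"
    and "p \<in> U \<Longrightarrow> p \<in> W \<Longrightarrow> tangent_map (in_chart (U, \<phi>) f) (\<phi> p) ` Rn m = Rn q"
proof -
  have "\<forall>(U, \<phi>)\<in>atlas M. smooth_map m (\<phi> ` (U \<inter> W)) q (Rn q) (in_chart (U, \<phi>) f) \<and>
        (\<forall>p\<in>U \<inter> W. tangent_map (in_chart (U, \<phi>) f) (\<phi> p) ` Rn m = Rn q)"
    using F_submersion[OF assms(1)] unfolding submersion_on_def by (elim conjE)
  from bspec[OF this assms(2)] show "smooth_map m (\<phi> ` (U \<inter> W)) q (Rn q) (in_chart (U, \<phi>) f)"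
    and "p \<in> U \<Longrightarrow> p \<in> W \<Longrightarrow> tangent_map (in_chart (U, \<phi>) f) (\<phi> p) ` Rn m = Rn q" by simp_all
qed

lemma F_cover: "p \<in> pts M \<Longrightarrow> \<exists>W f. (W, f) \<in> F \<and> p \<in> W"
  using cocycle unfolding foliation_cocycle_def by blast

lemma F_in:
  assumes "(W, f) \<in> F" "p \<in> W"
  shows "f p \<in> Rn q"
proof -
  have "p \<in> pts M" using openin_subset[OF F_open[OF assms(1)]] assms(2) by blast
  then obtain U \<phi> where c: "(U, \<phi>) \<in> atlas M" "p \<in> U" using chart_at by blast
  have "in_chart (U, \<phi>) f (\<phi> p) \<in> Rn q"
    by (rule smooth_map_in[OF F_chart(1)[OF assms(1) c(1)]]) (use c assms in simp)
  then show ?thesis using c by (simp add: in_chart_def)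
qed

lemma F_compat:
  assumes i: "(W, f) \<in> F" and j: "(W', f') \<in> F" and p: "p \<in> W" "p \<in> W'"
  obtains \<theta> A N where "open_Rn q A" "f p \<in> A" "smooth_map q A q (Rn q) \<theta>"
    "openin (mtop M) N" "p \<in> N" "N \<subseteq> W \<inter> W'" "\<forall>x\<in>N. f' x = \<theta> (f x)"
proof -
  from cocycle obtain \<Theta> where "\<forall>i\<in>F. \<forall>j\<in>F. \<forall>x\<in>fst i \<inter> fst j.
              local_diffeo_at q (snd i x) (\<Theta> j i x) \<and>
              (\<exists>W. openin (mtop M) W \<and> x \<in> W \<and> W \<subseteq> fst i \<inter> fst j \<and>
                   (\<forall>y\<in>W. snd j y = \<Theta> j i x (snd i y)))"
    unfolding foliation_cocycle_def by (elim conjE exE)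
  from bspec[OF bspec[OF bspec[OF this i] j], of p] p
  have d: "local_diffeo_at q (f p) (\<Theta> (W', f') (W, f) p)"
    and N: "\<exists>N. openin (mtop M) N \<and> p \<in> N \<and> N \<subseteq> W \<inter> W' \<and> (\<forall>y\<in>N. f' y = \<Theta> (W', f') (W, f) p (f y))"
    by simp_all
  from d obtain A B where AB: "open_Rn q A" "open_Rn q B" "f p \<in> A" "smooth_map q A q B (\<Theta> (W', f') (W, f) p)"
    unfolding local_diffeo_at_def by blast
  have s: "smooth_map q A q (Rn q) (\<Theta> (W', f') (W, f) p)"
    by (rule smooth_map_subset[OF AB(4) order_refl open_Rn_subset[OF AB(2)]])
  from N obtain N where "openin (mtop M) N" "p \<in> N" "N \<subseteq> W \<inter> W'" "\<forall>y\<in>N. f' y = \<Theta> (W', f') (W, f) p (f y)" by blast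
  with AB(1,3) s show ?thesis by (rule that)
qed

text \<open>Near \<open>p\<close> the submersion \<open>f'\<close> factors through \<open>f\<close>
  by a smooth map, and the chain rule carries the kernel over.\<close>

lemma tangent_kernel_mono:
  assumes i: "(W, f) \<in> F" and j: "(W', f') \<in> F" and p: "p \<in> W" "p \<in> W'" and c: "(U, \<phi>) \<in> atlas M" "p \<in> U"
    and v: "v \<in> Rn m" and z: "tangent_map (in_chart (U, \<phi>) f) (\<phi> p) v = (\<lambda>j. 0)"
  shows "tangent_map (in_chart (U, \<phi>) f') (\<phi> p) v = (\<lambda>j. 0)"
proof -
  obtain \<theta> A N where N: "open_Rn q A" "f p \<in> A" "smooth_map q A q (Rn q) \<theta>"
    "openin (mtop M) N" "p \<in> N" "N \<subseteq> W \<inter> W'" "\<forall>x\<in>N. f' x = \<theta> (f x)"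
    by (rule F_compat[OF i j p])
  let ?g = "in_chart (U, \<phi>) f"
  let ?O = "\<phi> ` (U \<inter> N)"
  have O: "open_Rn m ?O" by (rule chart_image_Int_open[OF c(1) N(4)])
  have g: "smooth_map m ?O q (Rn q) ?g"
    by (rule smooth_map_subset[OF F_chart(1)[OF i c(1)] _ order_refl]) (use N(6) in blast)
  let ?O' = "{x \<in> ?O. ?g x \<in> A}"
  have O': "open_Rn m ?O'" by (rule smooth_map_preimage_open[OF g O order_refl N(1)])
  have g': "smooth_map m ?O' q A ?g"
    by (rule smooth_map_into[OF smooth_map_subset[OF g _ order_refl]]) auto
  have p': "\<phi> p \<in> ?O'" using c N(2,5) by (simp add: in_chart_def)
  have "tangent_map (in_chart (U, \<phi>) f') (\<phi> p) v = tangent_map (\<lambda>x. \<theta> (?g x)) (\<phi> p) v"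
    by (rule tangent_map_cong[OF O' p' v]) (use c N(7) in \<open>auto simp: in_chart_def\<close>)
  also have "\<dots> = tangent_map \<theta> (?g (\<phi> p)) (tangent_map ?g (\<phi> p) v)"
    by (rule tangent_map_compose[OF g' O' N(1,3) order_refl p' v])
  finally show ?thesis unfolding z tangent_map_zero .
qed

text \<open>The intersection over all submersions in \<open>foliation_tangent\<close> collapses to
  the kernel of any one of them.\<close>

lemma foliation_tangent_eq:
  assumes i: "(W, f) \<in> F" "p \<in> W" and c: "(U, \<phi>) \<in> atlas M" "p \<in> U"
  shows "foliation_tangent M F (U, \<phi>) p = {v \<in> Rn m. tangent_map (in_chart (U, \<phi>) f) (\<phi> p) v = (\<lambda>j. 0)}"
proof -
  have "v \<in> Rn m \<Longrightarrow> tangent_map (in_chart (U, \<phi>) f) (\<phi> p) v = (\<lambda>j. 0) \<Longrightarrow>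
      \<forall>(W', f')\<in>F. p \<in> W' \<longrightarrow> tangent_map (in_chart (U, \<phi>) f') (\<phi> p) v = (\<lambda>j. 0)" for v
    using tangent_kernel_mono[OF i(1) _ i(2) _ c] by blast
  then show ?thesis
    using i unfolding foliation_tangent_def zero_fun_def by auto
qed

text \<open>A chart \<open>K\<close> of \<open>S\<close> onto a cube, with inverse \<open>J\<close>,
  whose first \<open>q\<close> coordinates are a submersion of the cocycle. The pair
  \<open>(S, K)\<close> need not belong to \<open>atlas M\<close>, so its smoothness is expressed by
  plots: \<open>J\<close> is a plot, and \<open>K\<close> turns plots into smooth maps.\<close>

definition fol_chart :: "'a set \<Rightarrow> ('a \<Rightarrow> nat \<Rightarrow> real) \<Rightarrow> ((nat \<Rightarrow> real) \<Rightarrow> 'a) \<Rightarrow> (nat \<Rightarrow> real) \<Rightarrow> real \<Rightarrow> bool" where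
  "fol_chart S K J c e \<longleftrightarrow> openin (mtop M) S \<and> e > 0 \<and> c \<in> Rn m \<and> q \<le> m \<and>
     (\<forall>p\<in>S. K p \<in> cube m c e \<and> J (K p) = p) \<and> (\<forall>x\<in>cube m c e. J x \<in> S \<and> K (J x) = x) \<and>
     (m, cube m c e, restrict J (cube m c e)) \<in> MD \<and>
     (\<forall>n A \<alpha>. (n, A, \<alpha>) \<in> MD \<longrightarrow> smooth_map n {x \<in> A. \<alpha> x \<in> S} m (cube m c e) (\<lambda>x. K (\<alpha> x))) \<and>
     (\<exists>W f. (W, f) \<in> F \<and> S \<subseteq> W \<and> (\<forall>p\<in>S. \<forall>j<q. K p j = f p j))"

lemma fol_chart_exists:
  assumes "p \<in> pts M"
  obtains S K J c e where "fol_chart S K J c e" "p \<in> S"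
proof -
  obtain W f where W: "(W, f) \<in> F" "p \<in> W" using F_cover[OF assms] by blast
  obtain U \<phi> where c: "(U, \<phi>) \<in> atlas M" "p \<in> U" using chart_at[OF assms] by blast
  let ?g = "in_chart (U, \<phi>) f"
  have O: "open_Rn m (\<phi> ` (U \<inter> W))" by (rule chart_image_Int_open[OF c(1) F_open[OF W(1)]])
  have \<phi>p: "\<phi> p \<in> \<phi> ` (U \<inter> W)" using c W by blast
  obtain A c0 e \<kappa> \<mu> where d: "diffeo_on m A (cube m c0 e) \<kappa> \<mu>" and A: "\<phi> p \<in> A" "A \<subseteq> \<phi> ` (U \<inter> W)"
    and e: "e > 0" "c0 \<in> Rn m" "q \<le> m" and \<kappa>: "\<And>x j. x \<in> A \<Longrightarrow> j < q \<Longrightarrow> \<kappa> x j = ?g x j"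
    using submersion_normal_form[OF F_chart(1)[OF W(1) c(1)] O \<phi>p F_chart(2)[OF W(1) c(1) c(2) W(2)]] by metis
  note D = diffeo_onD[OF d]
  define S where "S = {x \<in> U. \<phi> x \<in> A}"
  define K where "K x = \<kappa> (\<phi> x)" for x
  define J where "J y = inv_into U \<phi> (\<mu> y)" for y
  have S: "openin (mtop M) S" unfolding S_def by (rule chart_preimage_open[OF c(1) D(1)])
  have AU: "A \<subseteq> \<phi> ` U" using A(2) by blast
  have 1: "K x \<in> cube m c0 e \<and> J (K x) = x" if "x \<in> S" for x
    using that smooth_map_in[OF D(3)] D(5) c by (simp add: S_def K_def J_def)
  have 2: "J y \<in> S \<and> K (J y) = y" if y: "y \<in> cube m c0 e" for y
  proof -
    have \<mu>y: "\<mu> y \<in> A" by (rule smooth_map_in[OF D(4) y])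
    then have "\<mu> y \<in> \<phi> ` U" using AU by blast
    then have "J y \<in> U" "\<phi> (J y) = \<mu> y" unfolding J_def by (simp_all add: chart_inv_in chart_f_inv)
    then show ?thesis using \<mu>y D(6)[OF y] by (simp add: S_def K_def)
  qed
  have 3: "(m, cube m c0 e, restrict J (cube m c0 e)) \<in> MD"
    unfolding J_def
    by (rule chart_inverse_plot[OF c(1) open_Rn_cube smooth_map_subset[OF D(4) order_refl open_Rn_subset[OF D(1)]]])
      (use smooth_map_in[OF D(4)] AU in blast)
  have 4: "smooth_map n {x \<in> B. \<alpha> x \<in> S} m (cube m c0 e) (\<lambda>x. K (\<alpha> x))" if P: "(n, B, \<alpha>) \<in> MD" for n B \<alpha>
  proof -
    have "smooth_map n {x \<in> B. \<alpha> x \<in> S} m A (\<lambda>x. \<phi> (\<alpha> x))"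
      by (rule smooth_map_into[OF smooth_map_subset[OF plot_smooth[OF P c(1)] _ order_refl]]) (auto simp: S_def)
    then show ?thesis
      unfolding K_def by (rule smooth_map_compose[OF _ plot_preimage_open[OF P S] D(1,3)])
  qed
  have 6: "K x j = f x j" if "x \<in> S" "j < q" for x j
    using that \<kappa> c by (auto simp: S_def K_def in_chart_def)
  have 5: "S \<subseteq> W"
  proof
    fix x assume "x \<in> S"
    then have x: "x \<in> U" "\<phi> x \<in> \<phi> ` (U \<inter> W)" using A(2) by (auto simp: S_def)
    then obtain y where "y \<in> U \<inter> W" "\<phi> x = \<phi> y" by blast
    then show "x \<in> W" using inj_onD[OF chart_inj[OF c(1)], of x y] x(1) by simp
  qed
  have "fol_chart S K J c0 e"
    unfolding fol_chart_def using S e 1 2 3 4 5 6 W(1) by blast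
  moreover have "p \<in> S" using c A(1) by (simp add: S_def)
  ultimately show ?thesis by (rule that)
qed

lemma fol_chartD:
  assumes "fol_chart S K J c e"
  shows "openin (mtop M) S" "e > 0" "c \<in> Rn m" "q \<le> m"
    "p \<in> S \<Longrightarrow> K p \<in> cube m c e" "p \<in> S \<Longrightarrow> J (K p) = p"
    "x \<in> cube m c e \<Longrightarrow> J x \<in> S" "x \<in> cube m c e \<Longrightarrow> K (J x) = x"
    "(m, cube m c e, restrict J (cube m c e)) \<in> MD"
    "(n, A, \<alpha>) \<in> MD \<Longrightarrow> smooth_map n {x \<in> A. \<alpha> x \<in> S} m (cube m c e) (\<lambda>x. K (\<alpha> x))"
    "\<exists>W f. (W, f) \<in> F \<and> S \<subseteq> W \<and> (\<forall>p\<in>S. \<forall>j<q. K p j = f p j)"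
  using assms unfolding fol_chart_def by (elim conjE; simp)+

lemma fol_chart_pts: "fol_chart S K J c e \<Longrightarrow> p \<in> S \<Longrightarrow> p \<in> pts M"
  using openin_subset[OF fol_chartD(1)] by blast

text \<open>Two points of a foliated chart lie on the same plaque iff their first \<open>q\<close> coordinates agree.\<close>

definition eqq :: "(nat \<Rightarrow> real) \<Rightarrow> (nat \<Rightarrow> real) \<Rightarrow> bool" where
  "eqq x y \<longleftrightarrow> (\<forall>j<q. x j = y j)"

lemma eqq_refl [simp]: "eqq x x" and eqq_sym: "eqq x y \<Longrightarrow> eqq y x" and eqq_trans: "eqq x y \<Longrightarrow> eqq y z \<Longrightarrow> eqq x z"
  by (simp_all add: eqq_def)

text \<open>Near \<open>p\<close> the second submersion is a function of the first. The
  neighbourhood \<open>N\<close> may be smaller than the overlap, where a plaque of one chart can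
  meet several plaques of the other.\<close>

lemma fol_chart_compat:
  assumes a: "fol_chart S K J c e" and b: "fol_chart S' K' J' c' e'" and p: "p \<in> S" "p \<in> S'"
  obtains N where "openin (mtop M) N" "p \<in> N" "N \<subseteq> S \<inter> S'"
    "\<And>x y. x \<in> N \<Longrightarrow> y \<in> N \<Longrightarrow> eqq (K x) (K y) \<Longrightarrow> eqq (K' x) (K' y)"
proof -
  obtain W f where W: "(W, f) \<in> F" "S \<subseteq> W" "\<forall>p\<in>S. \<forall>j<q. K p j = f p j" using fol_chartD(11)[OF a] by blast
  obtain W' f' where W': "(W', f') \<in> F" "S' \<subseteq> W'" "\<forall>p\<in>S'. \<forall>j<q. K' p j = f' p j" using fol_chartD(11)[OF b] by blast
  have pW: "p \<in> W" "p \<in> W'" using p W(2) W'(2) by auto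
  obtain \<theta> A N where N: "openin (mtop M) N" "p \<in> N" "N \<subseteq> W \<inter> W'" "\<forall>x\<in>N. f' x = \<theta> (f x)"
    using F_compat[OF W(1) W'(1) pW] by metis
  have "openin (mtop M) (N \<inter> (S \<inter> S'))" by (intro openin_Int N(1) fol_chartD(1)[OF a] fol_chartD(1)[OF b])
  moreover have "p \<in> N \<inter> (S \<inter> S')" using N(2) p by simp
  moreover have "eqq (K' x) (K' y)" if x: "x \<in> N \<inter> (S \<inter> S')" and y: "y \<in> N \<inter> (S \<inter> S')" and e: "eqq (K x) (K y)" for x y
  proof -
    \<comment> \<open>Agreement of the first \<open>q\<close> coordinates is full equality, because
      \<open>f x\<close> and \<open>f y\<close> vanish from \<open>q\<close> on; only then can the
      factorization of \<open>f'\<close> be used.\<close>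
    have "f x j = f y j" for j
    proof (cases "j < q")
      case True then show ?thesis using e x y W(3) by (simp add: eqq_def)
    next
      case False
      have "f x \<in> Rn q" "f y \<in> Rn q" using F_in[OF W(1)] x y N(3) by auto
      then show ?thesis using False by (simp add: Rn_iff)
    qed
    then have "f x = f y" by blast
    then have "f' x = f' y" using N(4) x y by simp
    then show ?thesis using W'(3) x y by (simp add: eqq_def)
  qed
  ultimately show ?thesis by (intro that[of "N \<inter> (S \<inter> S')"]) auto
qed

context
  fixes S K J c e U \<phi>
  assumes fc: "fol_chart S K J c e" and ch: "(U, \<phi>) \<in> atlas M"
begin

lemma fc_chart_smooth: "smooth_map m (\<phi> ` (U \<inter> S)) m (cube m c e) (in_chart (U, \<phi>) K)"
proof -
  let ?\<alpha> = "restrict (inv_into U \<phi>) (\<phi> ` U)"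
  have o: "open_Rn m (\<phi> ` (U \<inter> S))" by (rule chart_image_Int_open[OF ch fol_chartD(1)[OF fc]])
  have sub: "\<phi> ` (U \<inter> S) \<subseteq> {x \<in> \<phi> ` U. ?\<alpha> x \<in> S}"
  proof (rule image_subsetI)
    show "\<phi> p \<in> {x \<in> \<phi> ` U. ?\<alpha> x \<in> S}" if "p \<in> U \<inter> S" for p
      using that chart_inv[OF ch, of p] by simp
  qed
  have "smooth_map m (\<phi> ` (U \<inter> S)) m (cube m c e) (\<lambda>x. K (?\<alpha> x))"
    by (rule smooth_map_subset[OF fol_chartD(10)[OF fc chart_plot_MD[OF ch]] sub order_refl])
  then show ?thesis
    by (rule smooth_map_cong[OF o]) (auto simp: in_chart_def)
qed

lemma fc_J_open: "open_Rn m {x \<in> cube m c e. J x \<in> U}"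
proof -
  have "{x \<in> cube m c e. restrict J (cube m c e) x \<in> U} = {x \<in> cube m c e. J x \<in> U}" by auto
  with plot_preimage_open[OF fol_chartD(9)[OF fc] chart(1)[OF ch]] show ?thesis by simp
qed

lemma fc_J_smooth: "smooth_map m {x \<in> cube m c e. J x \<in> U} m (\<phi> ` (U \<inter> S)) (\<lambda>x. \<phi> (J x))"
proof -
  have e: "{x \<in> cube m c e. restrict J (cube m c e) x \<in> U} = {x \<in> cube m c e. J x \<in> U}" by auto
  have "smooth_map m {x \<in> cube m c e. J x \<in> U} m (Rn m) (\<lambda>x. \<phi> (restrict J (cube m c e) x))"
    using plot_smooth[OF fol_chartD(9)[OF fc] ch] unfolding e .
  then have "smooth_map m {x \<in> cube m c e. J x \<in> U} m (Rn m) (\<lambda>x. \<phi> (J x))"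
    by (rule smooth_map_cong[OF fc_J_open]) simp
  then show ?thesis by (rule smooth_map_into) (use fol_chartD(7)[OF fc] in auto)
qed

lemma fc_tangent_inverse:
  assumes p: "p \<in> U" "p \<in> S" and v: "v \<in> Rn m"
  shows "tangent_map (in_chart (U, \<phi>) K) (\<phi> p) (tangent_map (\<lambda>x. \<phi> (J x)) (K p) v) = v"
    and "tangent_map (\<lambda>x. \<phi> (J x)) (K p) (tangent_map (in_chart (U, \<phi>) K) (\<phi> p) v) = v"
proof -
  have o: "open_Rn m (\<phi> ` (U \<inter> S))" by (rule chart_image_Int_open[OF ch fol_chartD(1)[OF fc]])
  note sub = cube_subset_Rn[of m c e]
  have KpO: "K p \<in> {x \<in> cube m c e. J x \<in> U}" using p fol_chartD(5,6)[OF fc] by simp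
  have \<phi>p: "\<phi> p \<in> \<phi> ` (U \<inter> S)" using p by simp
  have e1: "\<phi> (J (K p)) = \<phi> p" using fol_chartD(6)[OF fc p(2)] by simp
  have e2: "in_chart (U, \<phi>) K (\<phi> p) = K p" using p ch by (simp add: in_chart_def)
  have "tangent_map (\<lambda>x. in_chart (U, \<phi>) K (\<phi> (J x))) (K p) v =
      tangent_map (in_chart (U, \<phi>) K) (\<phi> (J (K p))) (tangent_map (\<lambda>x. \<phi> (J x)) (K p) v)"
    by (rule tangent_map_compose[OF fc_J_smooth fc_J_open o fc_chart_smooth sub KpO v])
  moreover have "tangent_map (\<lambda>x. in_chart (U, \<phi>) K (\<phi> (J x))) (K p) v = tangent_map (\<lambda>x. x) (K p) v"
    by (rule tangent_map_cong[OF fc_J_open KpO v]) (use ch fol_chartD(8)[OF fc] in \<open>simp add: in_chart_def\<close>)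
  ultimately show "tangent_map (in_chart (U, \<phi>) K) (\<phi> p) (tangent_map (\<lambda>x. \<phi> (J x)) (K p) v) = v"
    by (simp add: e1 tangent_map_id)
  have into: "smooth_map m (\<phi> ` (U \<inter> S)) m {x \<in> cube m c e. J x \<in> U} (in_chart (U, \<phi>) K)"
    by (rule smooth_map_into[OF fc_chart_smooth]) (use ch fol_chartD(5,6)[OF fc] in \<open>auto simp: in_chart_def\<close>)
  have sub': "\<phi> ` (U \<inter> S) \<subseteq> Rn m" by (rule open_Rn_subset[OF o])
  have "tangent_map (\<lambda>x. \<phi> (J (in_chart (U, \<phi>) K x))) (\<phi> p) v =
      tangent_map (\<lambda>x. \<phi> (J x)) (in_chart (U, \<phi>) K (\<phi> p)) (tangent_map (in_chart (U, \<phi>) K) (\<phi> p) v)"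
    by (rule tangent_map_compose[OF into o fc_J_open fc_J_smooth sub' \<phi>p v])
  moreover have "tangent_map (\<lambda>x. \<phi> (J (in_chart (U, \<phi>) K x))) (\<phi> p) v = tangent_map (\<lambda>x. x) (\<phi> p) v"
    by (rule tangent_map_cong[OF o \<phi>p v]) (use ch fol_chartD(6)[OF fc] in \<open>auto simp: in_chart_def\<close>)
  ultimately show "tangent_map (\<lambda>x. \<phi> (J x)) (K p) (tangent_map (in_chart (U, \<phi>) K) (\<phi> p) v) = v"
    by (simp add: e2 tangent_map_id)
qed

lemma fc_foliation_tangent:
  assumes p: "p \<in> U" "p \<in> S" and v: "v \<in> Rn m"
  shows "v \<in> foliation_tangent M F (U, \<phi>) p \<longleftrightarrow> (\<forall>j<q. tangent_map (in_chart (U, \<phi>) K) (\<phi> p) v j = 0)"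
proof -
  obtain W f where W: "(W, f) \<in> F" "S \<subseteq> W" "\<forall>p\<in>S. \<forall>j<q. K p j = f p j" using fol_chartD(11)[OF fc] by blast
  have o: "open_Rn m (\<phi> ` (U \<inter> S))" by (rule chart_image_Int_open[OF ch fol_chartD(1)[OF fc]])
  have o': "open_Rn m (\<phi> ` (U \<inter> W))" by (rule chart_image_Int_open[OF ch F_open[OF W(1)]])
  have \<phi>p: "\<phi> p \<in> \<phi> ` (U \<inter> S)" "\<phi> p \<in> \<phi> ` (U \<inter> W)" using p W(2) by auto
  have e: "tangent_map (in_chart (U, \<phi>) K) (\<phi> p) v j = tangent_map (in_chart (U, \<phi>) f) (\<phi> p) v j" if "j < q" for j
    unfolding tangent_map_def
    by (rule dir_deriv_cong[OF o \<phi>p(1) v]) (use ch W(3) that in \<open>auto simp: in_chart_def\<close>)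
  have "tangent_map (in_chart (U, \<phi>) f) (\<phi> p) v \<in> Rn q"
    by (rule tangent_map_Rn[OF F_chart(1)[OF W(1) ch] o' order_refl \<phi>p(2) v])
  then have "tangent_map (in_chart (U, \<phi>) f) (\<phi> p) v = (\<lambda>j. 0) \<longleftrightarrow> (\<forall>j<q. tangent_map (in_chart (U, \<phi>) f) (\<phi> p) v j = 0)"
    unfolding fun_eq_iff Rn_iff by (metis not_le)
  then show ?thesis
    using foliation_tangent_eq[OF W(1) _ ch p(1)] p(2) W(2) v e by auto
qed

end

end

section \<open>Leaves\<close>

type_synonym 'a fchart = "'a set \<times> ('a \<Rightarrow> nat \<Rightarrow> real) \<times> ((nat \<Rightarrow> real) \<Rightarrow> 'a) \<times> (nat \<Rightarrow> real) \<times> real"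

text \<open>The leafwise coordinates, renumbered from 0.\<close>

definition shift :: "nat \<Rightarrow> (nat \<Rightarrow> real) \<Rightarrow> nat \<Rightarrow> real" where
  "shift q x = (\<lambda>i. x (i + q))"

text \<open>Puts the transverse coordinates of \<open>x\<close> in front of \<open>y\<close>: for
  fixed \<open>x\<close> this parametrizes a plaque in the coordinates of a foliated chart.\<close>

definition unshift :: "nat \<Rightarrow> (nat \<Rightarrow> real) \<Rightarrow> (nat \<Rightarrow> real) \<Rightarrow> nat \<Rightarrow> real" where
  "unshift q x y = (\<lambda>i. if i < q then x i else y (i - q))"

lemma shift_unshift [simp]: "shift q (unshift q x y) = y"
  by (simp add: shift_def unshift_def)

lemma shift_Rn: "x \<in> Rn n \<Longrightarrow> shift q x \<in> Rn (n - q)"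
  by (auto simp: shift_def Rn_iff)

lemma unshift_Rn: "y \<in> Rn (n - q) \<Longrightarrow> q \<le> n \<Longrightarrow> unshift q x y \<in> Rn n"
  by (auto simp: unshift_def Rn_iff)

lemma shift_cube: "x \<in> cube n c e \<Longrightarrow> shift q x \<in> cube (n - q) (shift q c) e"
  unfolding cube_def using shift_Rn[of x n q] by (auto simp: shift_def)

lemma unshift_cube:
  assumes "x \<in> cube n c e" "y \<in> cube (n - q) (shift q c) e" "q \<le> n"
  shows "unshift q x y \<in> cube n c e"
proof -
  have "\<bar>unshift q x y i - c i\<bar> < e" if i: "i < n" for i
  proof (cases "i < q")
    case True
    then show ?thesis using assms(1) i by (simp add: unshift_def cube_def)
  next
    case False
    then have "\<bar>y (i - q) - shift q c (i - q)\<bar> < e" using assms(2) i by (simp add: cube_def)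
    then show ?thesis using False by (simp add: unshift_def shift_def)
  qed
  then show ?thesis using unshift_Rn[OF subsetD[OF cube_subset_Rn assms(2)] assms(3)] by (simp add: cube_def)
qed

lemma unshift_cube_near:
  assumes "y' \<in> cube (n - q) y d" "q \<le> n" "d > 0"
  shows "unshift q x y' \<in> cube n (unshift q x y) d"
proof -
  have "\<bar>unshift q x y' i - unshift q x y i\<bar> < d" if "i < n" for i
    using assms that by (auto simp: unshift_def cube_def)
  then show ?thesis using unshift_Rn[OF subsetD[OF cube_subset_Rn assms(1)] assms(2)] by (simp add: cube_def)
qed

lemma smooth_unshift:
  assumes "open_Rn k U" "\<And>y. y \<in> U \<Longrightarrow> unshift q x y \<in> V"
  shows "smooth_map k U n V (unshift q x)"
proof (rule smooth_mapI[OF assms(2)])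
  show "smooth_fun k U (\<lambda>y. unshift q x y j)" for j
    using smooth_fun_const[OF assms(1), of "x j"] smooth_fun_proj[OF assms(1), of "j - q"]
    by (cases "j < q") (simp_all add: unshift_def)
qed

lemma tangent_unshift: "tangent_map (unshift q x) y v = unshift q (\<lambda>i. 0) v"
proof
  fix i
  show "tangent_map (unshift q x) y v i = unshift q (\<lambda>i. 0) v i"
    by (cases "i < q") (simp_all add: tangent_map_def unshift_def dir_deriv_proj)
qed

lemma smooth_shift:
  assumes "smooth_map k U n V h" "open_Rn k U" "V \<subseteq> Rn n" "\<And>x. x \<in> U \<Longrightarrow> shift q (h x) \<in> V'"
  shows "smooth_map k U p V' (\<lambda>x. shift q (h x))"
  by (rule smooth_mapI[OF assms(4)]) (simp_all add: shift_def smooth_map_coord[OF assms(1,3,2)])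

lemma connected_cube: "connected (cube n c e)"
proof -
  have "connected_component (cube n c e) y z" if y: "y \<in> cube n c e" and z: "z \<in> cube n c e" for y z
  proof -
    let ?g = "\<lambda>t j. y j + t * (z j - y j)"
    have "continuous_on {0..1} ?g"
      by (rule continuous_on_coordinatewise_then_product) (intro continuous_intros)
    then have "connected (?g ` {0..1})" by (rule connected_continuous_image) simp
    moreover have "?g ` {0..1} \<subseteq> cube n c e" using cube_segment[OF y z] by auto
    moreover have "y \<in> ?g ` {0..1}" by (rule image_eqI[of _ _ 0]) simp_all
    moreover have "z \<in> ?g ` {0..1}" by (rule image_eqI[of _ _ 1]) simp_all
    ultimately show ?thesis unfolding connected_component_def by blast
  qed
  then show ?thesis by (simp add: connected_iff_connected_component)
qed

lemma connectedin_cube: "connectedin (Euclidean_space n) (cube n c e)"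
proof -
  have "Euclidean_space n = subtopology euclidean (Rn n)"
    unfolding topspace_Euclidean_space by (simp add: Euclidean_space_def euclidean_product_topology)
  then show ?thesis
    by (metis connected_cube connectedin_iff_connected connectedin_subtopology cube_subset_Rn)
qed

section \<open>Chains of plaques\<close>

locale foliated_cover = foliated M q F for M :: "'a mfd" and q F +
  fixes CC :: "'a fchart set"
  assumes fc: "(S, K, J, c, e) \<in> CC \<Longrightarrow> fol_chart S K J c e"
    and cover: "p \<in> pts M \<Longrightarrow> \<exists>S K J c e. (S, K, J, c, e) \<in> CC \<and> p \<in> S"
begin

text \<open>One step of a chain. On \<open>M\<close> the reflexive transitive closure turns out to
  be membership in a common leaf, see \<open>leaf_proj_eq_iff\<close>.\<close>

definition plaque_rel :: "'a \<Rightarrow> 'a \<Rightarrow> bool" where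
  "plaque_rel x y \<longleftrightarrow> (\<exists>S K J c e. (S, K, J, c, e) \<in> CC \<and> x \<in> S \<and> y \<in> S \<and> eqq (K x) (K y))"

definition leaf_class :: "'a \<Rightarrow> 'a set" where
  "leaf_class x = {y. plaque_rel\<^sup>*\<^sup>* x y}"

lemma plaque_rel_pts: "plaque_rel x y \<Longrightarrow> y \<in> pts M"
  unfolding plaque_rel_def using fol_chart_pts[OF fc] by blast

lemma plaque_rel_sym: "plaque_rel x y \<Longrightarrow> plaque_rel y x"
  unfolding plaque_rel_def using eqq_sym by blast

lemma plaque_rel_rtrancl_sym: "plaque_rel\<^sup>*\<^sup>* x y \<Longrightarrow> plaque_rel\<^sup>*\<^sup>* y x"
  by (induction rule: rtranclp_induct) (auto intro: converse_rtranclp_into_rtranclp plaque_rel_sym)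

lemma leaf_class_self: "x \<in> leaf_class x"
  by (simp add: leaf_class_def)

lemma leaf_class_eq: "y \<in> leaf_class x \<Longrightarrow> leaf_class y = leaf_class x"
  unfolding leaf_class_def using plaque_rel_rtrancl_sym by (auto intro: rtranclp_trans)

lemma leaf_class_pts:
  assumes "x \<in> pts M"
  shows "leaf_class x \<subseteq> pts M"
proof
  fix y assume "y \<in> leaf_class x"
  then have "plaque_rel\<^sup>*\<^sup>* x y" by (simp add: leaf_class_def)
  then show "y \<in> pts M" by (induction rule: rtranclp_induct) (use assms plaque_rel_pts in auto)
qed

lemma leaf_class_step: "y \<in> leaf_class x \<Longrightarrow> plaque_rel y z \<Longrightarrow> z \<in> leaf_class x"
  unfolding leaf_class_def by (auto intro: rtranclp.rtrancl_into_rtrancl)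

section \<open>The leaf topology and the leaf atlas\<close>

lemma KJ_open:
  assumes a: "fol_chart S K J c e" and b: "fol_chart S' K' J' c' e'"
  shows "open_Rn m {w \<in> cube m c' e'. J' w \<in> S}"
    and "smooth_map m {w \<in> cube m c' e'. J' w \<in> S} m (cube m c e) (\<lambda>w. K (J' w))"
proof -
  have e: "{w \<in> cube m c' e'. restrict J' (cube m c' e') w \<in> S} = {w \<in> cube m c' e'. J' w \<in> S}" by auto
  show o: "open_Rn m {w \<in> cube m c' e'. J' w \<in> S}"
    using plot_preimage_open[OF fol_chartD(9)[OF b] fol_chartD(1)[OF a]] unfolding e .
  show "smooth_map m {w \<in> cube m c' e'. J' w \<in> S} m (cube m c e) (\<lambda>w. K (J' w))"
    by (rule smooth_map_cong[OF o fol_chartD(10)[OF a fol_chartD(9)[OF b], unfolded e]]) simp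
qed

lemma fol_chart_preimage_open:
  assumes a: "fol_chart S K J c e" and N: "openin (mtop M) N"
  shows "open_Rn m {w \<in> cube m c e. J w \<in> N}"
proof -
  have "{w \<in> cube m c e. restrict J (cube m c e) w \<in> N} = {w \<in> cube m c e. J w \<in> N}" by auto
  with plot_preimage_open[OF fol_chartD(9)[OF a] N] show ?thesis by simp
qed

text \<open>The leaf topology: a point is tested only against nearby points on the same plaque,
  expressed by \<open>eqq z x\<close>. On saturated sets it is finer than the subspace topology, by
  \<open>plaque_open_Int\<close>.\<close>

definition plaque_open :: "'a set \<Rightarrow> 'a set \<Rightarrow> bool" where
  "plaque_open L T \<longleftrightarrow> T \<subseteq> L \<and> (\<forall>S K J c e x. (S, K, J, c, e) \<in> CC \<longrightarrow> x \<in> cube m c e \<longrightarrow> J x \<in> T \<longrightarrow>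
     (\<exists>d>0. \<forall>z\<in>cube m c e. z \<in> cube m x d \<longrightarrow> eqq z x \<longrightarrow> J z \<in> T))"

lemma plaque_openI:
  assumes "T \<subseteq> L"
    and "\<And>S K J c e x. (S, K, J, c, e) \<in> CC \<Longrightarrow> x \<in> cube m c e \<Longrightarrow> J x \<in> T \<Longrightarrow>
      \<exists>d>0. \<forall>z\<in>cube m c e. z \<in> cube m x d \<longrightarrow> eqq z x \<longrightarrow> J z \<in> T"
  shows "plaque_open L T"
  unfolding plaque_open_def using assms by blast

lemma plaque_openD:
  assumes "plaque_open L T" "(S, K, J, c, e) \<in> CC" "x \<in> cube m c e" "J x \<in> T"
  obtains d where "d > 0" "\<And>z. z \<in> cube m c e \<Longrightarrow> z \<in> cube m x d \<Longrightarrow> eqq z x \<Longrightarrow> J z \<in> T"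
  using assms unfolding plaque_open_def by blast

lemma istopology_plaque_open: "istopology (plaque_open L)"
  unfolding istopology_def
proof (intro conjI allI impI)
  fix T T' assume T: "plaque_open L T" and T': "plaque_open L T'"
  show "plaque_open L (T \<inter> T')"
  proof (rule plaque_openI)
    show "T \<inter> T' \<subseteq> L" using T by (auto simp: plaque_open_def)
    fix S K J c e x assume a: "(S, K, J, c, e) \<in> CC" "x \<in> cube m c e" "J x \<in> T \<inter> T'"
    obtain d where d: "d > 0" "\<And>z. z \<in> cube m c e \<Longrightarrow> z \<in> cube m x d \<Longrightarrow> eqq z x \<Longrightarrow> J z \<in> T"
      using plaque_openD[OF T a(1,2)] a(3) by blast
    obtain d' where d': "d' > 0" "\<And>z. z \<in> cube m c e \<Longrightarrow> z \<in> cube m x d' \<Longrightarrow> eqq z x \<Longrightarrow> J z \<in> T'"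
      using plaque_openD[OF T' a(1,2)] a(3) by blast
    have "\<forall>z\<in>cube m c e. z \<in> cube m x (min d d') \<longrightarrow> eqq z x \<longrightarrow> J z \<in> T \<inter> T'"
      using d(2) d'(2) cube_mono[of "min d d'" d m x] cube_mono[of "min d d'" d' m x] by auto
    moreover have "min d d' > 0" using d(1) d'(1) by simp
    ultimately show "\<exists>d>0. \<forall>z\<in>cube m c e. z \<in> cube m x d \<longrightarrow> eqq z x \<longrightarrow> J z \<in> T \<inter> T'" by blast
  qed
next
  fix \<T> assume T: "\<forall>T\<in>\<T>. plaque_open L T"
  show "plaque_open L (\<Union>\<T>)"
  proof (rule plaque_openI)
    show "\<Union>\<T> \<subseteq> L" using T by (auto simp: plaque_open_def)
    fix S K J c e x assume a: "(S, K, J, c, e) \<in> CC" "x \<in> cube m c e" "J x \<in> \<Union>\<T>"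
    then obtain T where "T \<in> \<T>" "J x \<in> T" by blast
    then obtain d where "d > 0" "\<And>z. z \<in> cube m c e \<Longrightarrow> z \<in> cube m x d \<Longrightarrow> eqq z x \<Longrightarrow> J z \<in> T"
      using plaque_openD[OF _ a(1,2)] T by metis
    then show "\<exists>d>0. \<forall>z\<in>cube m c e. z \<in> cube m x d \<longrightarrow> eqq z x \<longrightarrow> J z \<in> \<Union>\<T>"
      using \<open>T \<in> \<T>\<close> by blast
  qed
qed

definition leaf_top :: "'a set \<Rightarrow> 'a topology" where
  "leaf_top L = topology (plaque_open L)"

lemma openin_leaf_top [simp]: "openin (leaf_top L) = plaque_open L"
  unfolding leaf_top_def by (rule topology_inverse'[OF istopology_plaque_open])

definition leaf_atlas :: "'a set \<Rightarrow> 'a chart set" where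
  "leaf_atlas L = {(P, \<psi>). \<exists>S K J c e x. (S, K, J, c, e) \<in> CC \<and> x \<in> cube m c e \<and> J x \<in> L \<and>
     P = {p \<in> S. eqq (K p) x} \<and> \<psi> = (\<lambda>p. shift q (K p))}"

definition leaf_mfd :: "'a set \<Rightarrow> 'a mfd" where
  "leaf_mfd L = \<lparr>mtop = leaf_top L, mdim = m - q, atlas = leaf_atlas L\<rparr>"

lemma leaf_mfd_simps [simp]: "mtop (leaf_mfd L) = leaf_top L" "mdim (leaf_mfd L) = m - q" "atlas (leaf_mfd L) = leaf_atlas L"
  by (simp_all add: leaf_mfd_def)

context
  fixes L :: "'a set"
  assumes Lp: "L \<subseteq> pts M" and sat: "\<And>x y. x \<in> L \<Longrightarrow> plaque_rel x y \<Longrightarrow> y \<in> L"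
begin

lemma plaque_open_Int:
  assumes N: "openin (mtop M) N"
  shows "plaque_open L (N \<inter> L)"
proof (rule plaque_openI)
  fix S K J c e x assume a: "(S, K, J, c, e) \<in> CC" "x \<in> cube m c e" "J x \<in> N \<inter> L"
  note f = fc[OF a(1)]
  obtain d where d: "d > 0" "cube m x d \<subseteq> {w \<in> cube m c e. J w \<in> N}"
    by (rule open_Rn_contains_cube[OF fol_chart_preimage_open[OF f N], of x]) (use a in auto)
  have "J z \<in> N \<inter> L" if z: "z \<in> cube m c e" "z \<in> cube m x d" "eqq z x" for z
  proof -
    have "plaque_rel (J x) (J z)"
      unfolding plaque_rel_def using a fol_chartD(7,8)[OF f] z eqq_sym
      by (intro exI[of _ S] exI[of _ K] exI[of _ J] exI[of _ c] exI[of _ e]) simp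
    then show ?thesis using sat a(3) d(2) z(2) by blast
  qed
  with d(1) show "\<exists>d>0. \<forall>z\<in>cube m c e. z \<in> cube m x d \<longrightarrow> eqq z x \<longrightarrow> J z \<in> N \<inter> L" by blast
qed simp

lemma topspace_leaf_top: "topspace (leaf_top L) = L"
proof -
  have "plaque_open L L" using plaque_open_Int[OF openin_topspace[of "mtop M"]] Lp by (simp add: Int_absorb1)
  then show ?thesis
    unfolding topspace_def by (auto simp: plaque_open_def)
qed

context
  fixes S K J c e x
  assumes CC: "(S, K, J, c, e) \<in> CC" and x: "x \<in> cube m c e" and JL: "J x \<in> L"
begin

private abbreviation "P \<equiv> {p \<in> S. eqq (K p) x}"
private abbreviation "\<psi> \<equiv> (\<lambda>p. shift q (K p))"
private abbreviation "Q \<equiv> cube (m - q) (shift q c) e"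
private abbreviation "\<rho> \<equiv> (\<lambda>y. J (unshift q x y))"

private lemma f: "fol_chart S K J c e"
  by (rule fc[OF CC])

private lemma qm: "q \<le> m"
  by (rule fol_chartD(4)[OF f])

lemma plaque_subset: "P \<subseteq> L"
proof
  fix p assume "p \<in> P"
  then have "plaque_rel (J x) p"
    unfolding plaque_rel_def using CC fol_chartD(7,8)[OF f x] eqq_sym
    by (intro exI[of _ S] exI[of _ K] exI[of _ J] exI[of _ c] exI[of _ e]) simp
  then show "p \<in> L" using sat JL by blast
qed

private lemma eqq_unshift: "eqq (unshift q x y) x"
  by (simp add: eqq_def unshift_def)

private lemma unshift_shift: "eqq z x \<Longrightarrow> unshift q x (shift q z) = z"
  by (auto simp: eqq_def unshift_def shift_def fun_eq_iff)

lemma leaf_chart_in: "p \<in> P \<Longrightarrow> \<psi> p \<in> Q"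
  using shift_cube fol_chartD(5)[OF f] by blast

lemma leaf_chart_inverse: "p \<in> P \<Longrightarrow> \<rho> (\<psi> p) = p"
  using fol_chartD(6)[OF f] by (simp add: unshift_shift)

lemma unshift_in: "y \<in> Q \<Longrightarrow> unshift q x y \<in> cube m c e"
  by (rule unshift_cube[OF x _ qm])

lemma leaf_chart_inv_in: "y \<in> Q \<Longrightarrow> \<rho> y \<in> P"
  and leaf_chart_f_inv: "y \<in> Q \<Longrightarrow> \<psi> (\<rho> y) = y"
  using fol_chartD(7,8)[OF f unshift_in] eqq_unshift by simp_all

lemma leaf_chart_inj: "inj_on \<psi> P"
  by (rule inj_on_inverseI[of _ \<rho>]) (rule leaf_chart_inverse)

lemma leaf_chart_image: "T \<subseteq> P \<Longrightarrow> \<psi> ` T = {y \<in> Q. \<rho> y \<in> T}"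
proof -
  assume T: "T \<subseteq> P"
  show ?thesis
  proof (rule subset_antisym; rule subsetI)
    fix y assume "y \<in> \<psi> ` T"
    then obtain p where "p \<in> T" "y = \<psi> p" by blast
    then show "y \<in> {y \<in> Q. \<rho> y \<in> T}" using T leaf_chart_in[of p] leaf_chart_inverse[of p] by auto
  next
    fix y assume "y \<in> {y \<in> Q. \<rho> y \<in> T}"
    then have "y = \<psi> (\<rho> y)" "\<rho> y \<in> T" using leaf_chart_f_inv by simp_all
    then show "y \<in> \<psi> ` T" by (rule image_eqI)
  qed
qed

lemma leaf_chart_image_all: "\<psi> ` P = Q"
  using leaf_chart_image[of P] leaf_chart_inv_in by blast

lemma leaf_chart_inv_into: "y \<in> Q \<Longrightarrow> inv_into P \<psi> y = \<rho> y"
  using inv_into_f_f[OF leaf_chart_inj leaf_chart_inv_in, of y] leaf_chart_f_inv[of y] by simp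

text \<open>Seen in another foliated chart, a plaque contains all nearby points of the plaque of
  that chart, by \<open>fol_chart_compat\<close>.\<close>

lemma plaque_plaque_open: "plaque_open L P"
proof (rule plaque_openI[OF plaque_subset])
  fix S' K' J' c' e' z assume b: "(S', K', J', c', e') \<in> CC" "z \<in> cube m c' e'" "J' z \<in> P"
  note g = fc[OF b(1)]
  have zS: "J' z \<in> S'" "J' z \<in> S" using fol_chartD(7)[OF g b(2)] b(3) by simp_all
  obtain N where N: "openin (mtop M) N" "J' z \<in> N" "N \<subseteq> S' \<inter> S"
    "\<And>x y. x \<in> N \<Longrightarrow> y \<in> N \<Longrightarrow> eqq (K' x) (K' y) \<Longrightarrow> eqq (K x) (K y)"
    using fol_chart_compat[OF g f zS] by metis
  obtain d where d: "d > 0" "cube m z d \<subseteq> {w \<in> cube m c' e'. J' w \<in> N}"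
    by (rule open_Rn_contains_cube[OF fol_chart_preimage_open[OF g N(1)], of z]) (use b N in auto)
  have "J' w \<in> P" if w: "w \<in> cube m c' e'" "w \<in> cube m z d" "eqq w z" for w
  proof -
    have wN: "J' w \<in> N" using d(2) w(2) by blast
    have "eqq (K' (J' w)) (K' (J' z))" using fol_chartD(8)[OF g] w b(2) by simp
    then have "eqq (K (J' w)) (K (J' z))" by (rule N(4)[OF wN N(2)])
    then show ?thesis using b(3) wN N(3) eqq_trans by blast
  qed
  with d(1) show "\<exists>d>0. \<forall>w\<in>cube m c' e'. w \<in> cube m z d \<longrightarrow> eqq w z \<longrightarrow> J' w \<in> P" by blast
qed

text \<open>Identifies the leaf topology on a plaque with the Euclidean one. For the converse
  direction the test takes place in an arbitrary chart of \<open>CC\<close>: there the plaque is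
  itself plaque open, and its leafwise coordinates depend continuously on those of the other
  chart.\<close>

lemma plaque_open_iff:
  assumes T: "T \<subseteq> P"
  shows "plaque_open L T \<longleftrightarrow> open_Rn (m - q) (\<psi> ` T)"
proof
  assume po: "plaque_open L T"
  show "open_Rn (m - q) (\<psi> ` T)"
    unfolding open_Rn_iff leaf_chart_image[OF T]
  proof (intro conjI ballI)
    show "{y \<in> Q. \<rho> y \<in> T} \<subseteq> Rn (m - q)" using cube_subset_Rn by blast
    fix y assume y: "y \<in> {y \<in> Q. \<rho> y \<in> T}"
    obtain d where d: "d > 0" "\<And>z. z \<in> cube m c e \<Longrightarrow> z \<in> cube m (unshift q x y) d \<Longrightarrow> eqq z (unshift q x y) \<Longrightarrow> J z \<in> T"
      using plaque_openD[OF po CC, of "unshift q x y"] unshift_in y by blast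
    obtain d' where d': "d' > 0" "cube (m - q) y d' \<subseteq> Q"
      using open_Rn_contains_cube[OF open_Rn_cube, of y] y by blast
    have "cube (m - q) y (min d d') \<subseteq> {y \<in> Q. \<rho> y \<in> T}"
    proof
      fix y' assume y': "y' \<in> cube (m - q) y (min d d')"
      then have 1: "y' \<in> Q" and 2: "y' \<in> cube (m - q) y d"
        using d'(2) cube_mono[of "min d d'" d' "m - q" y] cube_mono[of "min d d'" d "m - q" y] by auto
      have "\<rho> y' \<in> T"
        by (rule d(2)[OF unshift_in[OF 1] unshift_cube_near[OF 2 qm d(1)]]) (simp add: eqq_def unshift_def)
      with 1 show "y' \<in> {y \<in> Q. \<rho> y \<in> T}" by simp
    qed
    moreover have "min d d' > 0" using d(1) d'(1) by simp
    ultimately show "\<exists>e>0. cube (m - q) y e \<subseteq> {y \<in> Q. \<rho> y \<in> T}" by blast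
  qed
next
  assume op: "open_Rn (m - q) (\<psi> ` T)"
  show "plaque_open L T"
  proof (rule plaque_openI)
    show "T \<subseteq> L" using T plaque_subset by blast
    fix S' K' J' c' e' z assume b: "(S', K', J', c', e') \<in> CC" "z \<in> cube m c' e'" "J' z \<in> T"
    note g = fc[OF b(1)]
    have zP: "J' z \<in> P" using b(3) T by blast
    obtain d1 where d1: "d1 > 0" "\<And>w. w \<in> cube m c' e' \<Longrightarrow> w \<in> cube m z d1 \<Longrightarrow> eqq w z \<Longrightarrow> J' w \<in> P"
      using plaque_openD[OF plaque_plaque_open b(1,2) zP] by blast
    let ?O = "{w \<in> cube m c' e'. J' w \<in> S}"
    have s: "smooth_map m ?O (m - q) (Rn (m - q)) (\<lambda>w. shift q (K (J' w)))"
      by (rule smooth_shift[OF KJ_open(2)[OF f g] KJ_open(1)[OF f g] cube_subset_Rn])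
        (use shift_Rn fol_chartD(5)[OF f] cube_subset_Rn in blast)
    have "open_Rn m {w \<in> ?O. shift q (K (J' w)) \<in> \<psi> ` T}"
      by (rule smooth_map_preimage_open[OF s KJ_open(1)[OF f g] order_refl op])
    then obtain d2 where d2: "d2 > 0" "cube m z d2 \<subseteq> {w \<in> ?O. shift q (K (J' w)) \<in> \<psi> ` T}"
      by (rule open_Rn_contains_cube[of _ _ z]) (use b zP in auto)
    have "J' w \<in> T" if w: "w \<in> cube m c' e'" "w \<in> cube m z (min d1 d2)" "eqq w z" for w
    proof -
      have "w \<in> cube m z d1" "w \<in> cube m z d2"
        using w(2) cube_mono[of "min d1 d2" d1 m z] cube_mono[of "min d1 d2" d2 m z] by auto
      then have "J' w \<in> P" "\<psi> (J' w) \<in> \<psi> ` T" using d1(2)[OF w(1) _ w(3)] d2(2) by auto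
      then show ?thesis using inj_on_image_mem_iff[OF leaf_chart_inj _ T] by blast
    qed
    moreover have "min d1 d2 > 0" using d1(1) d2(1) by simp
    ultimately show "\<exists>d>0. \<forall>w\<in>cube m c' e'. w \<in> cube m z d \<longrightarrow> eqq w z \<longrightarrow> J' w \<in> T" by blast
  qed
qed

text \<open>\<open>plaque_open_iff\<close>, read for preimages, says that the chart is a quotient
  map; being injective, it is a homeomorphism.\<close>

lemma leaf_chart_homeomorphic:
  "homeomorphic_map (subtopology (leaf_top L) P) (subtopology (Euclidean_space (m - q)) (\<psi> ` P)) \<psi>"
proof -
  have oQ: "open_Rn (m - q) Q" by (rule open_Rn_cube)
  have oP: "openin (leaf_top L) P" using plaque_plaque_open by simp
  have tP: "topspace (subtopology (leaf_top L) P) = P" using plaque_subset by (auto simp: topspace_leaf_top)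
  have tQ: "topspace (subtopology (Euclidean_space (m - q)) Q) = Q" using cube_subset_Rn by auto
  have "quotient_map (subtopology (leaf_top L) P) (subtopology (Euclidean_space (m - q)) Q) \<psi>"
    unfolding quotient_map_def tP tQ
  proof (intro conjI allI impI)
    show "\<psi> ` P = Q" by (rule leaf_chart_image_all)
    fix V assume V: "V \<subseteq> Q"
    define T where "T = {p \<in> P. \<psi> p \<in> V}"
    have T: "T \<subseteq> P" by (auto simp: T_def)
    have im: "\<psi> ` T = V"
      unfolding leaf_chart_image[OF T] using V leaf_chart_inv_in leaf_chart_f_inv by (auto simp: T_def)
    show "openin (subtopology (leaf_top L) P) {p \<in> P. \<psi> p \<in> V} \<longleftrightarrow> openin (subtopology (Euclidean_space (m - q)) Q) V"
      unfolding T_def[symmetric] openin_open_subtopology[OF oP] openin_open_subtopology[OF oQ]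
      using T V plaque_open_iff[OF T] im by simp
  qed
  then show ?thesis
    unfolding leaf_chart_image_all using leaf_chart_inj tP by (simp add: homeomorphic_map_def)
qed

lemma smooth_unshift_leaf:
  assumes U: "openin (mtop M) U"
  shows "open_Rn (m - q) {y \<in> Q. \<rho> y \<in> U}"
    and "smooth_map (m - q) {y \<in> Q. \<rho> y \<in> U} m {w \<in> cube m c e. J w \<in> U} (unshift q x)"
    and "\<psi> ` (P \<inter> U) = {y \<in> Q. \<rho> y \<in> U}"
proof -
  show 3: "\<psi> ` (P \<inter> U) = {y \<in> Q. \<rho> y \<in> U}"
    using leaf_chart_image[of "P \<inter> U"] leaf_chart_inv_in by auto
  have "plaque_open L (P \<inter> (U \<inter> L))"
    using istopology_plaque_open[of L] plaque_plaque_open plaque_open_Int[OF U] unfolding istopology_def by blast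
  moreover have "P \<inter> (U \<inter> L) = P \<inter> U" using plaque_subset by blast
  ultimately show 1: "open_Rn (m - q) {y \<in> Q. \<rho> y \<in> U}"
    using plaque_open_iff[of "P \<inter> U"] unfolding 3 by simp
  show "smooth_map (m - q) {y \<in> Q. \<rho> y \<in> U} m {w \<in> cube m c e. J w \<in> U} (unshift q x)"
    by (rule smooth_unshift[OF 1]) (use unshift_in in auto)
qed

lemma leaf_chart_connected:
  assumes "p \<in> P" "p' \<in> P"
  shows "connected_component_of (leaf_top L) p p'"
proof -
  obtain \<sigma> where \<sigma>: "homeomorphic_maps (subtopology (leaf_top L) P) (subtopology (Euclidean_space (m - q)) (\<psi> ` P)) \<psi> \<sigma>"
    using leaf_chart_homeomorphic unfolding homeomorphic_map_maps by blast
  then have c: "continuous_map (subtopology (Euclidean_space (m - q)) Q) (leaf_top L) \<sigma>"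
    unfolding homeomorphic_maps_def leaf_chart_image_all continuous_map_in_subtopology by blast
  have tP: "topspace (subtopology (leaf_top L) P) = P" using plaque_subset by (auto simp: topspace_leaf_top)
  have inv: "\<sigma> (\<psi> r) = r" if "r \<in> P" for r using \<sigma> that tP unfolding homeomorphic_maps_def by blast
  have "connectedin (subtopology (Euclidean_space (m - q)) Q) Q"
    using connectedin_cube by (simp add: connectedin_subtopology)
  then have "connectedin (leaf_top L) (\<sigma> ` Q)" by (rule connectedin_continuous_map_image[OF c])
  moreover have "p \<in> \<sigma> ` Q" "p' \<in> \<sigma> ` Q"
    using inv[OF assms(1)] inv[OF assms(2)] leaf_chart_in[OF assms(1)] leaf_chart_in[OF assms(2)] by (metis imageI)+
  ultimately show ?thesis unfolding connected_component_of_def by blast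
qed

lemma leaf_chart_tangent:
  assumes ch: "(U, \<phi>) \<in> atlas M" and p: "p \<in> P" "p \<in> U"
  shows "inj_on (tangent_map (in_chart (P, \<psi>) \<phi>) (\<psi> p)) (Rn (m - q))"
    and "tangent_map (in_chart (P, \<psi>) \<phi>) (\<psi> p) ` Rn (m - q) = foliation_tangent M F (U, \<phi>) p"
proof -
  note su = smooth_unshift_leaf[OF chart(1)[OF ch]]
  \<comment> \<open>\<open>A\<close> and \<open>B\<close> are the mutually inverse differentials of
    the coordinate change between the foliated chart and \<open>\<phi>\<close>. In the foliated
    chart the differential of the plaque is \<open>emb\<close>, with transverse part 0.\<close>
  define A where "A = tangent_map (\<lambda>x. \<phi> (J x)) (K p)"
  define B where "B = tangent_map (in_chart (U, \<phi>) K) (\<phi> p)"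
  define emb where "emb = unshift q (\<lambda>i. 0)"
  have pS: "p \<in> S" using p by simp
  have BA: "B (A v) = v" and AB: "A (B v) = v" if "v \<in> Rn m" for v
    using fc_tangent_inverse[OF f ch p(2) pS that] by (simp_all add: A_def B_def)
  have embR: "emb v \<in> Rn m" if "v \<in> Rn (m - q)" for v unfolding emb_def by (rule unshift_Rn[OF that qm])
  have us: "unshift q x (\<psi> p) = K p" using p by (intro unshift_shift) simp
  have yp: "\<psi> p \<in> {y \<in> Q. \<rho> y \<in> U}" using leaf_chart_in[OF p(1)] leaf_chart_inverse[OF p(1)] p(2) by simp
  have sub: "\<phi> ` (U \<inter> S) \<subseteq> Rn m" using open_Rn_subset[OF chart(2)[OF ch]] by blast
  have T: "tangent_map (in_chart (P, \<psi>) \<phi>) (\<psi> p) v = A (emb v)" if v: "v \<in> Rn (m - q)" for v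
  proof -
    have "tangent_map (in_chart (P, \<psi>) \<phi>) (\<psi> p) v = tangent_map (\<lambda>y. \<phi> (J (unshift q x y))) (\<psi> p) v"
      by (rule tangent_map_cong[OF su(1) yp v]) (simp add: in_chart_def leaf_chart_inv_into)
    also have "\<dots> = tangent_map (\<lambda>x. \<phi> (J x)) (unshift q x (\<psi> p)) (tangent_map (unshift q x) (\<psi> p) v)"
      by (rule tangent_map_compose[OF su(2,1) fc_J_open[OF f ch] fc_J_smooth[OF f ch] sub yp v])
    finally show ?thesis by (simp add: us tangent_unshift A_def emb_def)
  qed
  have o: "open_Rn m (\<phi> ` (U \<inter> S))" by (rule chart_image_Int_open[OF ch fol_chartD(1)[OF f]])
  have AR: "A v \<in> Rn m" if "v \<in> Rn m" for v
    unfolding A_def by (rule tangent_map_Rn[OF fc_J_smooth[OF f ch] fc_J_open[OF f ch] sub _ that])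
      (use pS p(2) fol_chartD(5,6)[OF f] in simp)
  have BR: "B v \<in> Rn m" if "v \<in> Rn m" for v
    unfolding B_def by (rule tangent_map_Rn[OF fc_chart_smooth[OF f ch] o cube_subset_Rn _ that]) (use pS p(2) in simp)
  show "inj_on (tangent_map (in_chart (P, \<psi>) \<phi>) (\<psi> p)) (Rn (m - q))"
  proof (rule inj_onI)
    fix v w assume vw: "v \<in> Rn (m - q)" "w \<in> Rn (m - q)"
      "tangent_map (in_chart (P, \<psi>) \<phi>) (\<psi> p) v = tangent_map (in_chart (P, \<psi>) \<phi>) (\<psi> p) w"
    then have "A (emb v) = A (emb w)" using T by simp
    then have "emb v = emb w" using BA[OF embR] vw by metis
    then show "v = w" unfolding emb_def by (metis shift_unshift)
  qed
  show "tangent_map (in_chart (P, \<psi>) \<phi>) (\<psi> p) ` Rn (m - q) = foliation_tangent M F (U, \<phi>) p"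
  proof (rule subset_antisym; rule subsetI)
    fix u assume "u \<in> tangent_map (in_chart (P, \<psi>) \<phi>) (\<psi> p) ` Rn (m - q)"
    then obtain v where v: "v \<in> Rn (m - q)" "u = A (emb v)" using T by auto
    have uR: "u \<in> Rn m" unfolding v(2) by (rule AR[OF embR[OF v(1)]])
    have "B u = emb v" unfolding v(2) by (rule BA[OF embR[OF v(1)]])
    then have "\<forall>j<q. B u j = 0" by (simp add: emb_def unshift_def)
    then show "u \<in> foliation_tangent M F (U, \<phi>) p"
      using fc_foliation_tangent[OF f ch p(2) pS uR] by (simp add: B_def)
  next
    fix u assume u: "u \<in> foliation_tangent M F (U, \<phi>) p"
    then have uR: "u \<in> Rn m" by (simp add: foliation_tangent_def)
    have z: "\<forall>j<q. B u j = 0" using fc_foliation_tangent[OF f ch p(2) pS uR] u by (simp add: B_def)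
    have "emb (shift q (B u)) = B u" using z by (auto simp: emb_def unshift_def shift_def fun_eq_iff)
    then have 1: "u = A (emb (shift q (B u)))" using AB[OF uR] by simp
    have 2: "shift q (B u) \<in> Rn (m - q)" by (rule shift_Rn[OF BR[OF uR]])
    show "u \<in> tangent_map (in_chart (P, \<psi>) \<phi>) (\<psi> p) ` Rn (m - q)"
      by (rule image_eqI[OF _ 2]) (unfold T[OF 2], rule 1)
  qed
qed

end

lemma leaf_atlasE:
  assumes "(P, \<psi>) \<in> leaf_atlas L"
  obtains S K J c e x where "(S, K, J, c, e) \<in> CC" "x \<in> cube m c e" "J x \<in> L"
    "P = {p \<in> S. eqq (K p) x}" "\<psi> = (\<lambda>p. shift q (K p))"
  using assms unfolding leaf_atlas_def by blast

lemma leaf_atlasI: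
  assumes "(S, K, J, c, e) \<in> CC" "x \<in> cube m c e" "J x \<in> L"
  shows "({p \<in> S. eqq (K p) x}, \<lambda>p. shift q (K p)) \<in> leaf_atlas L"
  unfolding leaf_atlas_def mem_Collect_eq prod.case using assms by (intro exI conjI) (assumption | rule refl)+

lemma leaf_atlas_cover:
  assumes "p \<in> L"
  obtains P \<psi> where "(P, \<psi>) \<in> leaf_atlas L" "p \<in> P"
proof -
  obtain S K J c e where a: "(S, K, J, c, e) \<in> CC" "p \<in> S" using cover assms Lp by blast
  note f = fc[OF a(1)]
  have "({r \<in> S. eqq (K r) (K p)}, \<lambda>p. shift q (K p)) \<in> leaf_atlas L"
    by (rule leaf_atlasI[OF a(1) fol_chartD(5)[OF f a(2)]]) (simp add: fol_chartD(6)[OF f a(2)] assms)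
  then show ?thesis by (rule that) (use a(2) in simp)
qed

text \<open>Disjoint neighbourhoods are inherited because open sets of \<open>M\<close> trace open
  sets of the leaf topology; the transition maps are those of the foliated charts, restricted to
  plaques.\<close>

lemma leaf_mfd_smooth: "smooth_manifold (leaf_mfd L)"
  unfolding smooth_manifold_def leaf_mfd_simps
proof (intro conjI ballI)
  show "Hausdorff_space (leaf_top L)"
    unfolding Hausdorff_space_def topspace_leaf_top
  proof (intro allI impI)
    fix x y assume xy: "x \<in> L \<and> y \<in> L \<and> x \<noteq> y"
    then have "x \<in> pts M \<and> y \<in> pts M \<and> x \<noteq> y" using Lp by blast
    then have "\<exists>U V. openin (mtop M) U \<and> openin (mtop M) V \<and> x \<in> U \<and> y \<in> V \<and> disjnt U V"
      using Hausdorff unfolding Hausdorff_space_def by simp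
    then obtain U V where "openin (mtop M) U" "openin (mtop M) V" "x \<in> U" "y \<in> V" "disjnt U V"
      by blast
    then have "openin (leaf_top L) (U \<inter> L) \<and> openin (leaf_top L) (V \<inter> L) \<and> x \<in> U \<inter> L \<and> y \<in> V \<inter> L \<and> disjnt (U \<inter> L) (V \<inter> L)"
      using plaque_open_Int xy by (auto simp: disjnt_def)
    then show "\<exists>U V. openin (leaf_top L) U \<and> openin (leaf_top L) V \<and> x \<in> U \<and> y \<in> V \<and> disjnt U V" by blast
  qed
  fix ch assume "ch \<in> leaf_atlas L"
  then obtain P \<psi> where ch: "ch = (P, \<psi>)" "(P, \<psi>) \<in> leaf_atlas L" by (cases ch) auto
  from ch(2) obtain S K J c e x where a: "(S, K, J, c, e) \<in> CC" "x \<in> cube m c e" "J x \<in> L"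
    "P = {p \<in> S. eqq (K p) x}" "\<psi> = (\<lambda>p. shift q (K p))" by (rule leaf_atlasE)
  note f = fc[OF a(1)]
  show "case ch of (U, \<phi>) \<Rightarrow> openin (leaf_top L) U \<and> open_Rn (m - q) (\<phi> ` U) \<and>
      homeomorphic_map (subtopology (leaf_top L) U) (subtopology (Euclidean_space (m - q)) (\<phi> ` U)) \<phi>"
    unfolding ch(1) a(4,5) prod.case
    using leaf_chart_homeomorphic[OF a(1-3)] plaque_plaque_open[OF a(1-3)] leaf_chart_image_all[OF a(1-3)] open_Rn_cube
    by simp
  show "case ch of (U, \<phi>) \<Rightarrow> \<forall>(V, \<psi>)\<in>leaf_atlas L. smooth_map (m - q) (\<phi> ` (U \<inter> V)) (m - q) (Rn (m - q)) (in_chart (U, \<phi>) \<psi>)"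
    unfolding ch(1) prod.case
  proof (rule ballI)
    fix ch' assume "ch' \<in> leaf_atlas L"
    then obtain P' \<psi>' where ch': "ch' = (P', \<psi>')" "(P', \<psi>') \<in> leaf_atlas L" by (cases ch') auto
    from ch'(2) obtain S' K' J' c' e' x' where b: "(S', K', J', c', e') \<in> CC" "x' \<in> cube m c' e'" "J' x' \<in> L"
      "P' = {p \<in> S'. eqq (K' p) x'}" "\<psi>' = (\<lambda>p. shift q (K' p))" by (rule leaf_atlasE)
    note g = fc[OF b(1)]
    let ?Q = "cube (m - q) (shift q c) e" and ?\<rho> = "\<lambda>y. J (unshift q x y)"
    note su = smooth_unshift_leaf[OF a(1-3) fol_chartD(1)[OF g]]
    have "plaque_open L (P \<inter> P')"
      using istopology_plaque_open[of L] plaque_plaque_open[OF a(1-3)] plaque_plaque_open[OF b(1-3)]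
      unfolding istopology_def a(4) b(4) by blast
    then have o: "open_Rn (m - q) (\<psi> ` (P \<inter> P'))"
      using plaque_open_iff[OF a(1-3), of "P \<inter> P'"] unfolding a(4,5) by blast
    have sub: "\<psi> ` (P \<inter> P') \<subseteq> {y \<in> ?Q. ?\<rho> y \<in> S'}"
      using su(3) unfolding a(4,5) b(4) by blast
    have s: "smooth_map (m - q) {y \<in> ?Q. ?\<rho> y \<in> S'} (m - q) (Rn (m - q)) (\<lambda>y. shift q (K' (J (unshift q x y))))"
      by (rule smooth_shift[OF smooth_map_compose[OF su(2,1) KJ_open[OF g f]] su(1) cube_subset_Rn])
        (use shift_Rn fol_chartD(5)[OF g] cube_subset_Rn in blast)
    have "smooth_map (m - q) (\<psi> ` (P \<inter> P')) (m - q) (Rn (m - q)) (in_chart (P, \<psi>) \<psi>')"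
    proof (rule smooth_map_cong[OF o smooth_map_subset[OF s sub order_refl]])
      fix y assume "y \<in> \<psi> ` (P \<inter> P')"
      then have "y \<in> ?Q" using sub by blast
      from leaf_chart_inv_into[OF a(1-3) this]
      show "shift q (K' (J (unshift q x y))) = in_chart (P, \<psi>) \<psi>' y"
        unfolding in_chart_def a(4,5) b(5) by simp
    qed
    then show "case ch' of (V, \<psi>') \<Rightarrow> smooth_map (m - q) (\<psi> ` (P \<inter> V)) (m - q) (Rn (m - q)) (in_chart (P, \<psi>) \<psi>')"
      unfolding ch'(1) by simp
  qed
next
  have "P \<subseteq> L" if "(P, \<psi>) \<in> leaf_atlas L" for P \<psi>
    using that by (rule leaf_atlasE) (use plaque_subset in blast)
  then show "(\<Union>(U, \<phi>)\<in>leaf_atlas L. U) = topspace (leaf_top L)"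
  proof (intro subset_antisym subsetI)
    fix p assume "p \<in> topspace (leaf_top L)"
    then have "p \<in> L" by (simp add: topspace_leaf_top)
    then obtain P \<psi> where "(P, \<psi>) \<in> leaf_atlas L" "p \<in> P" by (rule leaf_atlas_cover)
    then show "p \<in> (\<Union>(U, \<phi>)\<in>leaf_atlas L. U)" by force
  qed (auto simp: topspace_leaf_top)
qed

lemma leaf_mfd_integral: "integral_submanifold M F (leaf_mfd L)"
  unfolding integral_submanifold_def leaf_mfd_simps topspace_leaf_top
proof (intro conjI)
  show "smooth_manifold (leaf_mfd L)" by (rule leaf_mfd_smooth)
  show "L \<subseteq> pts M" by (rule Lp)
  show "msmooth (leaf_mfd L) M (\<lambda>x. x)"
    unfolding msmooth_def leaf_mfd_simps
  proof (intro conjI ballI)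
    have "{x \<in> L. x \<in> U} = U \<inter> L" for U by blast
    then show "continuous_map (leaf_top L) (mtop M) (\<lambda>x. x)"
      unfolding continuous_map_def topspace_leaf_top using Lp plaque_open_Int by auto
    fix ch assume "ch \<in> leaf_atlas L"
    then obtain P \<psi> where ch: "ch = (P, \<psi>)" "(P, \<psi>) \<in> leaf_atlas L" by (cases ch) auto
    from ch(2) obtain S K J c e x where a: "(S, K, J, c, e) \<in> CC" "x \<in> cube m c e" "J x \<in> L"
      "P = {p \<in> S. eqq (K p) x}" "\<psi> = (\<lambda>p. shift q (K p))" by (rule leaf_atlasE)
    note f = fc[OF a(1)]
    have "smooth_map (m - q) (\<psi> ` (P \<inter> U)) m (Rn m) (in_chart (P, \<psi>) \<phi>)" if c: "(U, \<phi>) \<in> atlas M" for U \<phi>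
    proof -
      note su = smooth_unshift_leaf[OF a(1-3) chart(1)[OF c]]
      have sub: "\<phi> ` (U \<inter> S) \<subseteq> Rn m" using open_Rn_subset[OF chart(2)[OF c]] by blast
      have s: "smooth_map (m - q) (\<psi> ` (P \<inter> U)) m (Rn m) (\<lambda>y. \<phi> (J (unshift q x y)))"
        unfolding a(4,5) su(3)
        by (rule smooth_map_subset[OF smooth_map_compose[OF su(2,1) fc_J_open[OF f c] fc_J_smooth[OF f c]] order_refl sub])
      have o: "open_Rn (m - q) (\<psi> ` (P \<inter> U))" unfolding a(4,5) su(3) by (rule su(1))
      have "\<phi> (J (unshift q x y)) = in_chart (P, \<psi>) \<phi> y" if "y \<in> \<psi> ` (P \<inter> U)" for y
      proof -
        have "y \<in> cube (m - q) (shift q c) e" using that unfolding a(4,5) su(3) by blast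
        from leaf_chart_inv_into[OF a(1-3) this] show ?thesis unfolding in_chart_def a(4,5) by simp
      qed
      then show ?thesis by (rule smooth_map_cong[OF o s])
    qed
    then show "case ch of (U, \<phi>) \<Rightarrow> \<forall>(V, \<psi>)\<in>atlas M.
        smooth_map (m - q) (\<phi> ` (U \<inter> (\<lambda>x. x) -` V)) m (Rn m) (in_chart (U, \<phi>) (\<psi> \<circ> (\<lambda>x. x)))"
      unfolding ch(1) by (auto simp: comp_def)
  qed
  show "\<forall>(V, \<psi>)\<in>leaf_atlas L. \<forall>(U, \<phi>)\<in>atlas M. \<forall>p\<in>V \<inter> U.
      inj_on (tangent_map (in_chart (V, \<psi>) \<phi>) (\<psi> p)) (Rn (m - q)) \<and>
      tangent_map (in_chart (V, \<psi>) \<phi>) (\<psi> p) ` Rn (m - q) = foliation_tangent M F (U, \<phi>) p"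
  proof (intro ballI, clarify)
    fix P \<psi> U \<phi> p assume ch: "(P, \<psi>) \<in> leaf_atlas L" and c: "(U, \<phi>) \<in> atlas M" and p: "p \<in> P" "p \<in> U"
    from ch obtain S K J c e x where a: "(S, K, J, c, e) \<in> CC" "x \<in> cube m c e" "J x \<in> L"
      "P = {p \<in> S. eqq (K p) x}" "\<psi> = (\<lambda>p. shift q (K p))" by (rule leaf_atlasE)
    show "inj_on (tangent_map (in_chart (P, \<psi>) \<phi>) (\<psi> p)) (Rn (m - q)) \<and>
      tangent_map (in_chart (P, \<psi>) \<phi>) (\<psi> p) ` Rn (m - q) = foliation_tangent M F (U, \<phi>) p"
      using leaf_chart_tangent[OF a(1-3) c, of p] p unfolding a(4,5) by blast
  qed
qed

end

text \<open>Each plaque is the continuous image of a cube, hence connected, and two points of the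
  class are joined by finitely many plaques.\<close>

lemma leaf_class_connected:
  assumes p: "p \<in> pts M"
  shows "connected_space (leaf_top (leaf_class p))"
proof -
  let ?L = "leaf_class p"
  note Lp = leaf_class_pts[OF p]
  have top: "topspace (leaf_top ?L) = ?L" by (rule topspace_leaf_top[OF Lp leaf_class_step])
  have stp: "connected_component_of (leaf_top ?L) x y" if x: "x \<in> ?L" and r: "plaque_rel x y" for x y
  proof -
    obtain S K J c e where a: "(S, K, J, c, e) \<in> CC" "x \<in> S" "y \<in> S" "eqq (K x) (K y)"
      using r unfolding plaque_rel_def by blast
    note f = fc[OF a(1)]
    show ?thesis
      by (rule leaf_chart_connected[OF Lp leaf_class_step a(1) fol_chartD(5)[OF f a(2)]])
        (use a x fol_chartD(6)[OF f a(2)] eqq_sym in auto)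
  qed
  have conn: "connected_component_of (leaf_top ?L) p y" if "plaque_rel\<^sup>*\<^sup>* p y" for y
    using that
  proof (induction rule: rtranclp_induct)
    case base
    then show ?case using leaf_class_self top by (simp add: connected_component_of_refl)
  next
    case (step y z)
    then have "y \<in> ?L" by (simp add: leaf_class_def)
    from stp[OF this step.hyps(2)] show ?case by (rule connected_component_of_trans[OF step.IH])
  qed
  then have "connected_component_of (leaf_top ?L) x y" if "x \<in> ?L" "y \<in> ?L" for x y
    using that connected_component_of_trans connected_component_of_sym unfolding leaf_class_def by (metis mem_Collect_eq)
  then show ?thesis unfolding connected_space_iff_connected_component top by simp
qed

end

section \<open>Leaves are the classes of plaque chains\<close>

context foliated_cover
begin

lemma integral_submanifold_chart:
  assumes N: "integral_submanifold M F N" and V: "(V, \<psi>) \<in> atlas N" and U: "(U, \<phi>) \<in> atlas M" and p: "p \<in> V" "p \<in> U"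
  shows "tangent_map (in_chart (V, \<psi>) \<phi>) (\<psi> p) ` Rn (mdim N) = foliation_tangent M F (U, \<phi>) p"
proof -
  have "\<forall>(V, \<psi>)\<in>atlas N. \<forall>(U, \<phi>)\<in>atlas M. \<forall>p\<in>V \<inter> U.
        inj_on (tangent_map (in_chart (V, \<psi>) \<phi>) (\<psi> p)) (Rn (mdim N)) \<and>
        tangent_map (in_chart (V, \<psi>) \<phi>) (\<psi> p) ` Rn (mdim N) = foliation_tangent M F (U, \<phi>) p"
    using N unfolding integral_submanifold_def by (elim conjE)
  from bspec[OF this V] have "\<forall>(U, \<phi>)\<in>atlas M. \<forall>p\<in>V \<inter> U.
        inj_on (tangent_map (in_chart (V, \<psi>) \<phi>) (\<psi> p)) (Rn (mdim N)) \<and>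
        tangent_map (in_chart (V, \<psi>) \<phi>) (\<psi> p) ` Rn (mdim N) = foliation_tangent M F (U, \<phi>) p" by simp
  from bspec[OF this U] p show ?thesis by simp
qed

text \<open>In a foliated chart the first \<open>q\<close> coordinates of the inclusion have
  derivative 0, since the tangent spaces of \<open>N\<close> are those of the distribution; on a
  cube in a chart of \<open>N\<close> they are therefore constant.\<close>

lemma integral_submanifold_locally_in_plaque:
  assumes N: "integral_submanifold M F N" and p: "p \<in> pts N"
  shows "\<exists>T. openin (mtop N) T \<and> p \<in> T \<and> (\<forall>r\<in>T. plaque_rel p r)"
proof -
  have Nm: "smooth_manifold N" and NM: "pts N \<subseteq> pts M" and incl: "msmooth N M (\<lambda>x. x)"
    using N by (simp_all add: integral_submanifold_def)
  interpret N: mfd N by unfold_locales (rule Nm)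
  note ds = msmooth_dsmooth[OF Nm M incl]
  obtain V \<psi> where V: "(V, \<psi>) \<in> atlas N" "p \<in> V" using N.chart_at[OF p] by blast
  \<comment> \<open>The inverse chart of \<open>N\<close>, regarded as a plot of \<open>M\<close>
    through the inclusion.\<close>
  define \<alpha> where "\<alpha> = compose (\<psi> ` V) (\<lambda>x. x) (restrict (inv_into V \<psi>) (\<psi> ` V))"
  have P: "(N.m, \<psi> ` V, \<alpha>) \<in> MD"
    using ds N.chart_plot_MD[OF V(1)] unfolding \<alpha>_def dsmooth_def by blast
  have \<alpha>: "\<alpha> y = inv_into V \<psi> y" if "y \<in> \<psi> ` V" for y using that by (simp add: \<alpha>_def compose_def)
  have \<alpha>\<psi>: "\<alpha> (\<psi> r) = r" if "r \<in> V" for r using that V(1) \<alpha> by simp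
  obtain S K J c e where a: "(S, K, J, c, e) \<in> CC" "p \<in> S" using cover NM p by blast
  note f = fc[OF a(1)]
  let ?Y = "{y \<in> \<psi> ` V. \<alpha> y \<in> S}"
  have Y: "open_Rn N.m ?Y" by (rule plot_preimage_open[OF P fol_chartD(1)[OF f]])
  have Ks: "smooth_map N.m ?Y m (cube m c e) (\<lambda>y. K (\<alpha> y))" by (rule fol_chartD(10)[OF f P])
  have pY: "\<psi> p \<in> ?Y" using V(2) a(2) \<alpha>\<psi> by simp
  obtain d where d: "d > 0" "cube N.m (\<psi> p) d \<subseteq> ?Y" by (rule open_Rn_contains_cube[OF Y pY])
  have der: "dir_deriv (\<lambda>y. K (\<alpha> y) j) y u = 0" if y: "y \<in> ?Y" and u: "u \<in> Rn N.m" and j: "j < q" for y u j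
  proof -
    have yV: "y \<in> \<psi> ` V" and rS: "\<alpha> y \<in> S" using y by auto
    have rV: "\<alpha> y \<in> V" using \<alpha>[OF yV] N.chart_inv_in[OF yV] by simp
    have \<psi>r: "\<psi> (\<alpha> y) = y" using \<alpha>[OF yV] N.chart_f_inv[OF yV] by simp
    obtain U \<phi> where U: "(U, \<phi>) \<in> atlas M" "\<alpha> y \<in> U" using chart_at[OF plot_in[OF P yV]] by blast
    let ?Z = "{y \<in> \<psi> ` V. \<alpha> y \<in> U \<inter> S}"
    have Z: "open_Rn N.m ?Z" by (rule plot_preimage_open[OF P openin_Int[OF chart(1)[OF U(1)] fol_chartD(1)[OF f]]])
    have yZ: "y \<in> ?Z" using yV rS U(2) by simp
    have h: "smooth_map N.m ?Z m (\<phi> ` (U \<inter> S)) (\<lambda>y. \<phi> (\<alpha> y))"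
      by (rule smooth_map_into[OF smooth_map_subset[OF plot_smooth[OF P U(1)] _ order_refl]]) auto
    have o: "open_Rn m (\<phi> ` (U \<inter> S))" by (rule chart_image_Int_open[OF U(1) fol_chartD(1)[OF f]])
    let ?w = "tangent_map (\<lambda>y. \<phi> (\<alpha> y)) y u"
    have w: "?w \<in> Rn m" by (rule tangent_map_Rn[OF h Z open_Rn_subset[OF o] yZ u])
    have "?w = tangent_map (in_chart (V, \<psi>) \<phi>) (\<psi> (\<alpha> y)) u"
      unfolding \<psi>r by (rule tangent_map_cong[OF N.chart(2)[OF V(1)] yV u]) (simp add: in_chart_def \<alpha>)
    then have "?w \<in> foliation_tangent M F (U, \<phi>) (\<alpha> y)"
      using integral_submanifold_chart[OF N V(1) U(1) rV U(2)] u by blast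
    then have z: "tangent_map (in_chart (U, \<phi>) K) (\<phi> (\<alpha> y)) ?w j = 0"
      using fc_foliation_tangent[OF f U(1) U(2) rS w] j by blast
    have "dir_deriv (\<lambda>y. K (\<alpha> y) j) y u = dir_deriv (\<lambda>y. in_chart (U, \<phi>) K (\<phi> (\<alpha> y)) j) y u"
      by (rule dir_deriv_cong[OF Z yZ u]) (use U(1) in \<open>simp add: in_chart_def\<close>)
    also have "\<dots> = tangent_map (\<lambda>y. in_chart (U, \<phi>) K (\<phi> (\<alpha> y))) y u j" by (simp add: tangent_map_def)
    also have "\<dots> = tangent_map (in_chart (U, \<phi>) K) (\<phi> (\<alpha> y)) ?w j"
      by (rule fun_cong[OF tangent_map_compose[OF h Z o fc_chart_smooth[OF f U(1)] cube_subset_Rn yZ u]])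
    finally show ?thesis using z by simp
  qed
  define T where "T = {r \<in> V. \<psi> r \<in> cube N.m (\<psi> p) d}"
  have pc: "\<psi> p \<in> cube N.m (\<psi> p) d" by (rule center_in_cube[OF N.chart_Rn[OF V] d(1)])
  show ?thesis
  proof (intro exI[of _ T] conjI ballI)
    show "openin (mtop N) T" unfolding T_def by (rule N.chart_preimage_open[OF V(1) open_Rn_cube])
    show "p \<in> T" using V(2) pc by (simp add: T_def)
    fix r assume r: "r \<in> T"
    have rc: "\<psi> r \<in> cube N.m (\<psi> p) d" and rV: "r \<in> V" using r by (simp_all add: T_def)
    have rS: "r \<in> S" using d(2) rc \<alpha>\<psi>[OF rV] by auto
    have "K (\<alpha> (\<psi> p)) j = K (\<alpha> (\<psi> r)) j" if j: "j < q" for j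
    proof (rule zero_derivative_imp_eq[OF _ Y d(2) pc rc])
      show "smooth_fun N.m ?Y (\<lambda>y. K (\<alpha> y) j)" by (rule smooth_map_coord[OF Ks cube_subset_Rn Y])
      have "(\<lambda>j. \<psi> r j - \<psi> p j) \<in> Rn N.m"
        using N.chart_Rn[OF V] N.chart_Rn[OF V(1) rV] by (simp add: Rn_iff)
      then show "dir_deriv (\<lambda>y. K (\<alpha> y) j) y (\<lambda>j. \<psi> r j - \<psi> p j) = 0" if "y \<in> cube N.m (\<psi> p) d" for y
        using der[OF _ _ j] d(2) that by blast
    qed
    then have "eqq (K p) (K r)" using \<alpha>\<psi>[OF rV] \<alpha>\<psi>[OF V(2)] by (simp add: eqq_def)
    then show "plaque_rel p r" unfolding plaque_rel_def using a rS by blast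
  qed
qed

text \<open>The class and its complement are both open in \<open>N\<close>, because near each of its
  points \<open>N\<close> runs inside one plaque.\<close>

lemma connected_integral_submanifold_subset:
  assumes N: "integral_submanifold M F N" and conn: "connected_space (mtop N)" and p: "p \<in> pts N"
  shows "pts N \<subseteq> leaf_class p"
proof (rule ccontr)
  assume no: "\<not> pts N \<subseteq> leaf_class p"
  have op: "openin (mtop N) {r \<in> pts N. (r \<in> leaf_class p) = b}" for b
  proof (subst openin_subopen, rule ballI)
    fix r assume r: "r \<in> {r \<in> pts N. (r \<in> leaf_class p) = b}"
    then have "r \<in> pts N" by simp
    from integral_submanifold_locally_in_plaque[OF N this]
    obtain T where T: "openin (mtop N) T" "r \<in> T" "\<forall>s\<in>T. plaque_rel r s" by blast
    have "(s \<in> leaf_class p) = (r \<in> leaf_class p)" if "s \<in> T" for s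
      using leaf_class_step bspec[OF T(3) that] plaque_rel_sym by blast
    then have "T \<subseteq> {r \<in> pts N. (r \<in> leaf_class p) = b}" using r openin_subset[OF T(1)] by blast
    with T show "\<exists>T. openin (mtop N) T \<and> r \<in> T \<and> T \<subseteq> {r \<in> pts N. (r \<in> leaf_class p) = b}" by blast
  qed
  define A where "A b = {r \<in> pts N. (r \<in> leaf_class p) = b}" for b
  have "p \<in> A True" "A False \<noteq> {}" "A True \<inter> A False = {}" "pts N \<subseteq> A True \<union> A False"
    using p leaf_class_self no by (auto simp: A_def)
  moreover have "openin (mtop N) (A True)" "openin (mtop N) (A False)" using op by (simp_all only: A_def)
  ultimately show False using conn unfolding connected_space_def by blast
qed

lemma leaf_class_integral:
  assumes "p \<in> pts M"
  shows "integral_submanifold M F (leaf_mfd (leaf_class p))" "connected_space (mtop (leaf_mfd (leaf_class p)))"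
    "pts (leaf_mfd (leaf_class p)) = leaf_class p"
  using leaf_mfd_integral[OF leaf_class_pts[OF assms] leaf_class_step] leaf_class_connected[OF assms]
    topspace_leaf_top[OF leaf_class_pts[OF assms] leaf_class_step] by simp_all

text \<open>A class is a connected integral submanifold and contains every such submanifold that
  meets it, so it is maximal. Conversely a leaf lies in the class of any of its points and equals it
  by its own maximality.\<close>

theorem leaves_eq: "leaves M F = leaf_class ` pts M"
proof (rule subset_antisym; rule subsetI)
  fix L assume "L \<in> leaf_class ` pts M"
  then obtain p where p: "p \<in> pts M" "L = leaf_class p" by blast
  note li = leaf_class_integral[OF p(1)]
  have "pts N = L" if N: "integral_submanifold M F N" "connected_space (mtop N)" "L \<subseteq> pts N" for N
  proof -
    have "p \<in> pts N" using N(3) p(2) leaf_class_self by blast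
    then show ?thesis using connected_integral_submanifold_subset[OF N(1,2)] N(3) p(2) by blast
  qed
  moreover have "L \<noteq> {}" using p leaf_class_self by blast
  ultimately show "L \<in> leaves M F" unfolding leaves_def using li p(2) by blast
next
  fix L assume L: "L \<in> leaves M F"
  then obtain N p where N: "integral_submanifold M F N" "connected_space (mtop N)" "pts N = L" "p \<in> L"
    unfolding leaves_def by blast
  have p: "p \<in> pts M" using N by (auto simp: integral_submanifold_def)
  note li = leaf_class_integral[OF p]
  have "L \<subseteq> pts (leaf_mfd (leaf_class p))"
    using connected_integral_submanifold_subset[OF N(1,2)] N(3,4) li(3) by blast
  then have "pts (leaf_mfd (leaf_class p)) = L" using L li(1,2) unfolding leaves_def by blast
  then show "L \<in> leaf_class ` pts M" using li(3) p by blast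
qed

theorem leaf_proj_eq:
  assumes "x \<in> pts M"
  shows "leaf_proj M F x = leaf_class x"
  unfolding leaf_proj_def
proof (rule the_equality)
  show "leaf_class x \<in> leaves M F \<and> x \<in> leaf_class x" using assms leaf_class_self leaves_eq by blast
  fix L assume "L \<in> leaves M F \<and> x \<in> L"
  then show "L = leaf_class x" using leaves_eq leaf_class_eq by auto
qed

lemma leaf_proj_surj: "leaf_proj M F ` pts M = leaves M F"
  using leaf_proj_eq leaves_eq by (simp cong: image_cong)

lemma leaf_proj_eq_iff:
  assumes "x \<in> pts M" "y \<in> pts M"
  shows "leaf_proj M F x = leaf_proj M F y \<longleftrightarrow> plaque_rel\<^sup>*\<^sup>* x y"
proof
  assume "leaf_proj M F x = leaf_proj M F y"
  then have "y \<in> leaf_class x" using assms leaf_class_self[of y] by (simp add: leaf_proj_eq)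
  then show "plaque_rel\<^sup>*\<^sup>* x y" by (simp add: leaf_class_def)
next
  assume "plaque_rel\<^sup>*\<^sup>* x y"
  then have "y \<in> leaf_class x" by (simp add: leaf_class_def)
  then show "leaf_proj M F x = leaf_proj M F y" using leaf_class_eq assms by (simp add: leaf_proj_eq)
qed

lemma leaf_proj_in: "x \<in> pts M \<Longrightarrow> x \<in> leaf_proj M F x"
  using leaf_proj_eq leaf_class_self by simp

lemma leaf_proj_of_mem:
  assumes "L \<in> leaves M F" "x \<in> L"
  shows "leaf_proj M F x = L"
proof -
  obtain p where p: "p \<in> pts M" "L = leaf_class p" using assms(1) unfolding leaves_eq by blast
  then have "x \<in> pts M" using leaf_class_pts assms(2) by blast
  then show ?thesis using leaf_proj_eq leaf_class_eq assms(2) p(2) by simp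
qed

end

section \<open>Forms invariant under slides along plaques\<close>

text \<open>Baire's theorem in the locally compact Hausdorff space \<open>B\<close>, applied to the
  closures of the sets \<open>S i\<close> in \<open>B\<close>. Local closedness is what allows the
  passage from an interior point of the closure to an open part of \<open>S i\<close>
  itself.\<close>

lemma Baire_locally_closed:
  assumes B: "open_Rn n B" "B \<noteq> {}" and I: "countable I" and cov: "B \<subseteq> (\<Union>i\<in>I. S i)"
    and lc: "\<And>i. i \<in> I \<Longrightarrow> \<exists>A. open_Rn n A \<and> S i \<subseteq> A \<and> open_Rn n (A - S i)"
  shows "\<exists>i\<in>I. \<exists>G. open_Rn n G \<and> G \<noteq> {} \<and> G \<subseteq> S i \<inter> B"
proof (rule ccontr)
  assume no: "\<not> (\<exists>i\<in>I. \<exists>G. open_Rn n G \<and> G \<noteq> {} \<and> G \<subseteq> S i \<inter> B)"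
  define X where "X = subtopology (Euclidean_space n) B"
  have tX: "topspace X = B" using open_Rn_subset[OF B(1)] by (auto simp: X_def)
  have oX: "openin X T \<longleftrightarrow> open_Rn n T \<and> T \<subseteq> B" for T
    unfolding X_def by (rule openin_open_subtopology[OF B(1)])
  have lcX: "locally_compact_space X"
    unfolding X_def
    by (rule locally_compact_space_open_subset)
      (use B(1) Hausdorff_Euclidean_space locally_compact_Euclidean_space in auto)
  have hX: "Hausdorff_space X"
    unfolding X_def by (rule Hausdorff_space_subtopology[OF Hausdorff_Euclidean_space])
  have reg: "regular_space X" by (rule locally_compact_Hausdorff_imp_regular_space[OF lcX hX])
  have "X interior_of \<Union>((\<lambda>i. X closure_of (S i \<inter> B)) ` I) = {}"
  proof (rule Baire_category_alt)
    show "completely_metrizable_space X \<or> locally_compact_space X \<and> regular_space X" using lcX reg by simp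
    show "countable ((\<lambda>i. X closure_of (S i \<inter> B)) ` I)" using I by simp
    fix T assume "T \<in> (\<lambda>i. X closure_of (S i \<inter> B)) ` I"
    then obtain i where i: "i \<in> I" "T = X closure_of (S i \<inter> B)" by blast
    obtain A where A: "open_Rn n A" "S i \<subseteq> A" "open_Rn n (A - S i)" using lc[OF i(1)] by blast
    have "G = {}" if G: "openin X G" "G \<subseteq> T" for G
    proof (rule ccontr)
      assume "G \<noteq> {}"
      then obtain x where x: "x \<in> G" by blast
      then have "x \<in> X closure_of (S i \<inter> B)" using G(2) i(2) by blast
      \<comment> \<open>\<open>G\<close> lies in the closure of \<open>S i\<close> and meets
        \<open>S i\<close>. Inside \<open>G \<inter> A\<close> the complement of \<open>S i\<close>
        is open and misses \<open>S i\<close>, so it is empty; thus \<open>G \<inter> A\<close> is a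
        nonempty open part of \<open>S i\<close>.\<close>
      then obtain y where y: "y \<in> S i \<inter> B" "y \<in> G" using G(1) x unfolding in_closure_of by blast
      have GA: "open_Rn n (G \<inter> A)" using G(1) A(1) oX by (intro openin_Int) simp_all
      have "G \<inter> A \<subseteq> S i"
      proof
        fix z assume z: "z \<in> G \<inter> A"
        show "z \<in> S i"
        proof (rule ccontr)
          assume "z \<notin> S i"
          have 1: "openin X (G \<inter> (A - S i))" unfolding oX using G(1) A(3) oX by (intro conjI openin_Int) auto
          have 2: "\<forall>T. z \<in> T \<and> openin X T \<longrightarrow> (\<exists>u. u \<in> S i \<inter> B \<and> u \<in> T)"
          proof -
            have "z \<in> X closure_of (S i \<inter> B)" using z G(2) i(2) by blast
            then show ?thesis unfolding in_closure_of by (rule conjunct2)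
          qed
          have "\<exists>u. u \<in> S i \<inter> B \<and> u \<in> G \<inter> (A - S i)"
            by (rule mp[OF spec[OF 2]]) (use 1 z \<open>z \<notin> S i\<close> in simp)
          then show False by blast
        qed
      qed
      moreover have "G \<inter> A \<subseteq> B" using G(1) oX by blast
      moreover have "G \<inter> A \<noteq> {}" using y A(2) by blast
      ultimately show False using no i(1) GA by blast
    qed
    then show "closedin X T \<and> X interior_of T = {}"
      unfolding i(2) by (intro conjI closedin_closure_of) (simp add: openin_interior_of interior_of_subset)
  qed
  moreover have "B \<subseteq> \<Union>((\<lambda>i. X closure_of (S i \<inter> B)) ` I)"
  proof
    fix x assume x: "x \<in> B"
    then obtain i where "i \<in> I" "x \<in> S i \<inter> B" using cov by blast
    moreover have "S i \<inter> B \<subseteq> X closure_of (S i \<inter> B)" by (rule closure_of_subset) (simp add: tX)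
    ultimately show "x \<in> \<Union>((\<lambda>i. X closure_of (S i \<inter> B)) ` I)" by blast
  qed
  then have "B \<subseteq> X interior_of \<Union>((\<lambda>i. X closure_of (S i \<inter> B)) ` I)"
    by (rule interior_of_maximal) (simp add: oX B(1))
  ultimately show False using B(2) by blast
qed

lemma smooth_fun_nonzero_open:
  assumes "open_Rn n U" "smooth_fun n U f"
  shows "open_Rn n {x \<in> U. f x \<noteq> 0}"
proof -
  have "openin (top_of_set U) (U \<inter> f -` (- {0}))"
    by (rule continuous_openin_preimage_gen[OF smooth_fun_continuous[OF assms(2)]]) auto
  then obtain T where T: "open T" "U \<inter> f -` (- {0}) = U \<inter> T" unfolding openin_open by blast
  obtain T' where T': "open T'" "U = T' \<inter> Rn n" using assms(1) unfolding open_Rn_iff_open by blast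
  have "{x \<in> U. f x \<noteq> 0} = (T' \<inter> T) \<inter> Rn n" using T(2) T'(2) by auto
  then show ?thesis unfolding open_Rn_iff_open using open_Int[OF T'(1) T(1)] by blast
qed

text \<open>Lists of all lengths occur, and entries beyond the end of a short list are unspecified;
  this harms neither countability nor density.\<close>

definition rational_points :: "nat \<Rightarrow> (nat \<Rightarrow> real) set" where
  "rational_points n = (\<lambda>l i. if i < n then l ! i else 0) ` lists \<rat>"

lemma countable_rational_points: "countable (rational_points n)"
  unfolding rational_points_def by (intro countable_image countable_lists countable_rat)

lemma rational_point_near:
  assumes "d > 0"
  obtains z where "z \<in> rational_points n" "z \<in> cube n x d"
proof -
  have "\<forall>i. \<exists>r\<in>\<rat>. \<bar>r - x i\<bar> < d"
  proof
    fix i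
    obtain r where "r \<in> \<rat>" "x i < r" "r < x i + d" using Rats_dense_in_real[of "x i" "x i + d"] assms by auto
    then show "\<exists>r\<in>\<rat>. \<bar>r - x i\<bar> < d" by (intro bexI[of _ r]) auto
  qed
  then obtain r where r: "\<And>i. r i \<in> \<rat>" "\<And>i. \<bar>r i - x i\<bar> < d" by metis
  let ?z = "\<lambda>i. if i < n then map r [0..<n] ! i else 0"
  have "?z \<in> rational_points n"
    unfolding rational_points_def by (intro imageI) (use r(1) in auto)
  moreover have "?z \<in> cube n x d" using r(2) by (auto simp: cube_def Rn_iff)
  ultimately show ?thesis by (rule that)
qed

section \<open>Slides in a foliated chart\<close>

context foliated
begin

definition slide :: "(nat \<Rightarrow> real) \<Rightarrow> (nat \<Rightarrow> real) \<Rightarrow> nat \<Rightarrow> real" where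
  "slide z x = (\<lambda>i. if i < q then x i else z i)"

lemma eqq_slide: "eqq (slide z x) x"
  by (simp add: slide_def eqq_def)

text \<open>The reason for using slides: plots that run on common plaques become literally equal
  after sliding.\<close>

lemma slide_eqq: "eqq x y \<Longrightarrow> slide z x = slide z y"
  by (auto simp: slide_def eqq_def)

lemma slide_cube: "z \<in> cube m c e \<Longrightarrow> x \<in> cube m c e \<Longrightarrow> slide z x \<in> cube m c e"
  by (auto simp: slide_def cube_def Rn_iff)

lemma slide_near: "z \<in> cube m x d \<Longrightarrow> x \<in> Rn m \<Longrightarrow> d > 0 \<Longrightarrow> slide z x \<in> cube m x d"
  by (auto simp: slide_def cube_def Rn_iff)

lemma smooth_slide: "z \<in> cube m c e \<Longrightarrow> smooth_map m (cube m c e) m (cube m c e) (slide z)"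
proof (rule smooth_mapI[OF slide_cube], assumption, assumption)
  show "smooth_fun m (cube m c e) (\<lambda>x. slide z x j)" for j
    by (cases "j < q") (simp_all add: slide_def smooth_fun_const[OF open_Rn_cube] smooth_fun_proj[OF open_Rn_cube])
qed

lemma tangent_slide: "tangent_map (slide z) x v = slide (\<lambda>i. 0) v"
proof
  fix i
  show "tangent_map (slide z) x v i = slide (\<lambda>i. 0) v i"
    by (cases "i < q") (simp_all add: tangent_map_def slide_def dir_deriv_proj)
qed

end

context foliated_cover
begin

text \<open>Phrased for the plots \<open>J\<close> of the foliated charts alone;
  \<open>slide_form\<close> extends it by naturality to every plot inside a chart.\<close>

definition slide_invariant :: "'a param form_family \<Rightarrow> bool" where
  "slide_invariant \<beta> \<longleftrightarrow> (\<forall>S K J c e z. (S, K, J, c, e) \<in> CC \<longrightarrow> z \<in> cube m c e \<longrightarrow>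
     form_pullback m (cube m c e) (slide z) (\<beta> (m, cube m c e, restrict J (cube m c e))) =
     \<beta> (m, cube m c e, restrict J (cube m c e)))"

lemma slide_invariantD:
  "slide_invariant \<beta> \<Longrightarrow> (S, K, J, c, e) \<in> CC \<Longrightarrow> z \<in> cube m c e \<Longrightarrow>
     form_pullback m (cube m c e) (slide z) (\<beta> (m, cube m c e, restrict J (cube m c e))) =
     \<beta> (m, cube m c e, restrict J (cube m c e))"
  unfolding slide_invariant_def by blast

lemma plot_via_fol_chart:
  assumes f: "fol_chart S K J c e" and P: "(n, A, \<alpha>) \<in> MD" and sub: "\<alpha> ` A \<subseteq> S"
  shows "smooth_map n A m (cube m c e) (\<lambda>x. K (\<alpha> x))"
    and "compose A (restrict J (cube m c e)) (\<lambda>x. K (\<alpha> x)) = \<alpha>"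
proof -
  have "{x \<in> A. \<alpha> x \<in> S} = A" and sub': "\<And>x. x \<in> A \<Longrightarrow> \<alpha> x \<in> S" using sub by auto
  with fol_chartD(10)[OF f P] show "smooth_map n A m (cube m c e) (\<lambda>x. K (\<alpha> x))" by simp
  have "\<alpha> \<in> extensional A" using plot_ext[OF P] by (simp add: PiE_iff)
  then show "compose A (restrict J (cube m c e)) (\<lambda>x. K (\<alpha> x)) = \<alpha>"
    by (auto simp: compose_def restrict_def fun_eq_iff extensional_def sub' fol_chartD(5,6)[OF f])
qed

context
  fixes S K J c e z n A \<alpha>
  assumes CC: "(S, K, J, c, e) \<in> CC" and z: "z \<in> cube m c e" and P: "(n, A, \<alpha>) \<in> MD"
    and sub: "\<alpha> ` A \<subseteq> S"
begin

private lemma slide_fc: "fol_chart S K J c e"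
  by (rule fc[OF CC])

private lemma slide_sm: "smooth_map n A m (cube m c e) (\<lambda>x. slide z (K (\<alpha> x)))"
  by (rule smooth_map_compose[OF plot_via_fol_chart(1)[OF slide_fc P sub] plot_open[OF P] open_Rn_cube smooth_slide[OF z]])

private lemma slide_eq: "compose A (restrict J (cube m c e)) (\<lambda>x. slide z (K (\<alpha> x))) = (\<lambda>x\<in>A. J (slide z (K (\<alpha> x))))"
  using slide_cube[OF z] fol_chartD(5)[OF slide_fc] sub by (auto simp: compose_def restrict_def fun_eq_iff image_subset_iff)

lemma slide_plot: "(n, A, \<lambda>x\<in>A. J (slide z (K (\<alpha> x)))) \<in> MD"
  using diffeology_compose[OF diffeology_MD fol_chartD(9)[OF slide_fc] plot_open[OF P] slide_sm] unfolding slide_eq .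

lemma slide_form:
  assumes b: "\<beta> \<in> dforms MD k" and i: "slide_invariant \<beta>"
  shows "\<beta> (n, A, \<lambda>x\<in>A. J (slide z (K (\<alpha> x)))) = \<beta> (n, A, \<alpha>)"
proof -
  let ?\<eta> = "\<beta> (m, cube m c e, restrict J (cube m c e))"
  note K = plot_via_fol_chart[OF slide_fc P sub]
  have \<eta>: "?\<eta> \<in> forms m k (cube m c e)" by (rule dforms_in[OF b fol_chartD(9)[OF slide_fc]])
  have "\<beta> (n, A, \<lambda>x\<in>A. J (slide z (K (\<alpha> x)))) = form_pullback n A (\<lambda>x. slide z (K (\<alpha> x))) ?\<eta>"
    using dforms_natural[OF b fol_chartD(9)[OF slide_fc] plot_open[OF P] slide_sm] unfolding slide_eq .
  also have "\<dots> = form_pullback n A (\<lambda>x. K (\<alpha> x)) (form_pullback m (cube m c e) (slide z) ?\<eta>)"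
    by (rule form_pullback_compose[OF \<eta> open_Rn_cube open_Rn_cube plot_open[OF P] smooth_slide[OF z] K(1), symmetric])
  also have "\<dots> = form_pullback n A (\<lambda>x. K (\<alpha> x)) ?\<eta>" by (simp add: slide_invariantD[OF i CC z])
  also have "\<dots> = \<beta> (n, A, compose A (restrict J (cube m c e)) (\<lambda>x. K (\<alpha> x)))"
    by (rule dforms_natural[OF b fol_chartD(9)[OF slide_fc] plot_open[OF P] K(1), symmetric])
  finally show ?thesis unfolding K(2) .
qed

end

text \<open>Both plots have the same image under the slide to the centre of the cube.\<close>

lemma plaque_equal_plots:
  assumes CC: "(S, K, J, c, e) \<in> CC" and P: "(n, A, \<alpha>) \<in> MD" "(n, A, \<alpha>') \<in> MD"
    and sub: "\<alpha> ` A \<subseteq> S" "\<alpha>' ` A \<subseteq> S"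
    and eq: "\<And>x. x \<in> A \<Longrightarrow> eqq (K (\<alpha> x)) (K (\<alpha>' x))"
    and b: "\<beta> \<in> dforms MD k" and i: "slide_invariant \<beta>"
  shows "\<beta> (n, A, \<alpha>) = \<beta> (n, A, \<alpha>')"
proof -
  have c: "c \<in> cube m c e" by (rule center_in_cube[OF fol_chartD(3,2)[OF fc[OF CC]]])
  have "(\<lambda>x\<in>A. J (slide c (K (\<alpha> x)))) = (\<lambda>x\<in>A. J (slide c (K (\<alpha>' x))))"
    by (rule restrict_ext) (simp add: slide_eqq[OF eq])
  then show ?thesis
    using slide_form[OF CC c P(1) sub(1) b i] slide_form[OF CC c P(2) sub(2) b i] by simp
qed

text \<open>Words of slides act partially: a letter applies only where the point reached so far lies
  in its chart. Outside \<open>slide_dom\<close> the value of \<open>slide_act\<close> carries no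
  meaning.\<close>

fun slide_dom :: "('a fchart \<times> (nat \<Rightarrow> real)) list \<Rightarrow> 'a \<Rightarrow> bool" where
  "slide_dom [] p = True"
| "slide_dom (((S, K, J, c, e), z) # w) p = (p \<in> S \<and> slide_dom w (J (slide z (K p))))"

fun slide_act :: "('a fchart \<times> (nat \<Rightarrow> real)) list \<Rightarrow> 'a \<Rightarrow> 'a" where
  "slide_act [] p = p"
| "slide_act (((S, K, J, c, e), z) # w) p = slide_act w (J (slide z (K p)))"

lemma slide_dom_append: "slide_dom (v @ w) p \<longleftrightarrow> slide_dom v p \<and> slide_dom w (slide_act v p)"
  by (induction v p rule: slide_act.induct) auto

lemma slide_act_append: "slide_act (v @ w) p = slide_act w (slide_act v p)"
  by (induction v p rule: slide_act.induct) auto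

definition slides :: "('a fchart \<times> (nat \<Rightarrow> real)) set" where
  "slides = {((S, K, J, c, e), z) |S K J c e z. (S, K, J, c, e) \<in> CC \<and> z \<in> rational_points m \<and> z \<in> cube m c e}"

lemma slidesE:
  assumes "s \<in> slides"
  obtains S K J c e z where "s = ((S, K, J, c, e), z)" "(S, K, J, c, e) \<in> CC" "z \<in> cube m c e"
  using assms unfolding slides_def by blast

text \<open>Rational targets are in general different from \<open>y\<close>, so a word brings
  \<open>x\<close> only onto the plaque of \<open>y\<close>; the last comparison is therefore kept
  as an \<open>eqq\<close> condition in one more chart.\<close>

lemma slides_reach:
  assumes "plaque_rel\<^sup>*\<^sup>* x y" "x \<in> pts M"
  shows "\<exists>w S K J c e. w \<in> lists slides \<and> (S, K, J, c, e) \<in> CC \<and> slide_dom w x \<and> slide_act w x \<in> S \<and> y \<in> S \<and>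
    eqq (K (slide_act w x)) (K y)"
  using assms
proof (induction rule: rtranclp_induct)
  case base
  obtain S K J c e where "(S, K, J, c, e) \<in> CC" "x \<in> S" using cover[OF base] by blast
  then show ?case
    by (intro exI[of _ "[]"] exI[of _ S] exI[of _ K] exI[of _ J] exI[of _ c] exI[of _ e]) simp
next
  case (step y y')
  obtain w S K J c e where w: "w \<in> lists slides" "(S, K, J, c, e) \<in> CC" "slide_dom w x" "slide_act w x \<in> S" "y \<in> S"
    "eqq (K (slide_act w x)) (K y)" using step.IH[OF step.prems] by (elim exE conjE)
  obtain S' K' J' c' e' where b: "(S', K', J', c', e') \<in> CC" "y \<in> S'" "y' \<in> S'" "eqq (K' y) (K' y')"
    using step.hyps(2) unfolding plaque_rel_def by (elim exE conjE)
  note f = fc[OF w(2)] and g = fc[OF b(1)]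
  obtain N where N: "openin (mtop M) N" "y \<in> N" "N \<subseteq> S \<inter> S'"
    "\<And>x y. x \<in> N \<Longrightarrow> y \<in> N \<Longrightarrow> eqq (K x) (K y) \<Longrightarrow> eqq (K' x) (K' y)"
    using fol_chart_compat[OF f g w(5) b(2)] by metis
  have Ky: "K y \<in> cube m c e" "K y \<in> Rn m" using fol_chartD(5)[OF f w(5)] cube_subset_Rn by blast+
  \<comment> \<open>The target is taken close to \<open>K y\<close>, so that the slid point lies in
    \<open>N\<close>, where lying on a common plaque of the old chart implies the same for the next
    chart.\<close>
  obtain d where d: "d > 0" "cube m (K y) d \<subseteq> {u \<in> cube m c e. J u \<in> N}"
    by (rule open_Rn_contains_cube[OF fol_chart_preimage_open[OF f N(1)], of "K y"])
      (use Ky N(2) fol_chartD(6)[OF f w(5)] in simp)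
  obtain z where z: "z \<in> rational_points m" "z \<in> cube m (K y) d" by (rule rational_point_near[OF d(1)])
  have zc: "z \<in> cube m c e" using z(2) d(2) by blast
  let ?u = "slide z (K y)"
  have u: "?u \<in> cube m c e" "J ?u \<in> N" using slide_near[OF z(2) Ky(2) d(1)] d(2) by blast+
  have "eqq (K (J ?u)) (K y)" using fol_chartD(8)[OF f u(1)] eqq_slide by simp
  then have "eqq (K' (J ?u)) (K' y')" by (rule eqq_trans[OF N(4)[OF u(2) N(2)] b(4)])
  moreover have "slide z (K (slide_act w x)) = ?u" by (rule slide_eqq[OF w(6)])
  moreover have "((S, K, J, c, e), z) \<in> slides" unfolding slides_def using w(2) z(1) zc by blast
  ultimately show ?case
    using w b u(2) N(3)
    by (intro exI[of _ "w @ [((S, K, J, c, e), z)]"] exI[of _ S'] exI[of _ K'] exI[of _ J'] exI[of _ c'] exI[of _ e'])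
      (auto simp: slide_dom_append slide_act_append)
qed

text \<open>Slide invariance is applied letter by letter; before each letter the plot is restricted
  to the open set where its values lie in the chart of that letter.\<close>

lemma slides_plot:
  assumes "w \<in> lists slides" "(n, A, \<alpha>) \<in> MD"
  defines "W \<equiv> {x \<in> A. slide_dom w (\<alpha> x)}"
  shows "open_Rn n W \<and> (n, W, \<lambda>x\<in>W. slide_act w (\<alpha> x)) \<in> MD \<and>
    (\<forall>k \<beta>. \<beta> \<in> dforms MD k \<longrightarrow> slide_invariant \<beta> \<longrightarrow>
      \<beta> (n, W, \<lambda>x\<in>W. slide_act w (\<alpha> x)) = \<beta> (n, W, restrict \<alpha> W))"
  using assms(1,2) unfolding W_def
proof (induction w arbitrary: A \<alpha> rule: list.induct)
  case Nil
  have "(\<lambda>x\<in>A. \<alpha> x) = \<alpha>"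
    using plot_ext[OF Nil(2)] unfolding PiE_iff by (simp add: extensional_restrict)
  then show ?case using plot_open[OF Nil(2)] Nil(2) by simp
next
  case (Cons s w)
  obtain S K J c e z where s: "s = ((S, K, J, c, e), z)" "(S, K, J, c, e) \<in> CC" "z \<in> cube m c e"
    using Cons.prems(1) by (auto elim: slidesE)
  have w: "w \<in> lists slides" using Cons.prems(1) by simp
  let ?A = "{x \<in> A. \<alpha> x \<in> S}"
  have oA: "open_Rn n ?A" by (rule plot_preimage_open[OF Cons.prems(2) fol_chartD(1)[OF fc[OF s(2)]]])
  have P: "(n, ?A, restrict \<alpha> ?A) \<in> MD"
    by (rule diffeology_restrict[OF diffeology_MD Cons.prems(2) oA]) blast
  have sub: "restrict \<alpha> ?A ` ?A \<subseteq> S" by auto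
  let ?\<alpha> = "\<lambda>x\<in>?A. J (slide z (K (\<alpha> x)))"
  have e: "(\<lambda>x\<in>?A. J (slide z (K (restrict \<alpha> ?A x)))) = ?\<alpha>" by (rule restrict_ext) simp
  have P': "(n, ?A, ?\<alpha>) \<in> MD" using slide_plot[OF s(2,3) P sub] unfolding e .
  let ?W = "{x \<in> A. slide_dom (s # w) (\<alpha> x)}"
  have W: "{x \<in> ?A. slide_dom w (?\<alpha> x)} = ?W" by (auto simp: s(1))
  have r: "(\<lambda>x\<in>?W. slide_act w (?\<alpha> x)) = (\<lambda>x\<in>?W. slide_act (s # w) (\<alpha> x))"
    by (rule restrict_ext) (auto simp: s(1))
  note IH = Cons.IH[OF w P', unfolded W r]
  have OA: "?W \<subseteq> ?A" by (auto simp: s(1))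
  have "\<beta> (n, ?W, \<lambda>x\<in>?W. slide_act (s # w) (\<alpha> x)) = \<beta> (n, ?W, restrict \<alpha> ?W)"
    if b: "\<beta> \<in> dforms MD k" and i: "slide_invariant \<beta>" for \<beta> k
  proof -
    have IO: "open_Rn n ?W" using IH by simp
    have "\<beta> (n, ?W, \<lambda>x\<in>?W. slide_act (s # w) (\<alpha> x)) = \<beta> (n, ?W, restrict ?\<alpha> ?W)"
      using IH b i by blast
    also have "\<dots> = \<beta> (n, ?W, restrict (restrict \<alpha> ?A) ?W)"
    proof
      fix x
      have f: "\<beta> (n, ?A, ?\<alpha>) = \<beta> (n, ?A, restrict \<alpha> ?A)"
        using slide_form[OF s(2,3) P sub b i] unfolding e .
      show "\<beta> (n, ?W, restrict ?\<alpha> ?W) x = \<beta> (n, ?W, restrict (restrict \<alpha> ?A) ?W) x"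
      proof (cases "x \<in> ?W")
        case True
        show ?thesis
          unfolding dform_restrict[OF b P' IO OA True] dform_restrict[OF b P IO OA True] f ..
      next
        case False
        have "\<beta> (n, ?W, restrict ?\<alpha> ?W) \<in> forms n k ?W" "\<beta> (n, ?W, restrict (restrict \<alpha> ?A) ?W) \<in> forms n k ?W"
          using dforms_in[OF b] diffeology_restrict[OF diffeology_MD P' IO OA] diffeology_restrict[OF diffeology_MD P IO OA]
          by blast+
        then show ?thesis using False by (intro ext) (simp add: forms_zero)
      qed
    qed
    also have "restrict (restrict \<alpha> ?A) ?W = restrict \<alpha> ?W"
      by (rule restrict_ext) (use OA in auto)
    finally show ?thesis .
  qed
  then show ?case using IH by blast
qed

text \<open>Density and continuity enter through a contradiction: \<open>B\<close> is the open set
  where the values on the fixed vectors \<open>v\<close> differ, whereas on an open part of some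
  \<open>S i\<close> they agree.\<close>

theorem slide_invariant_plots:
  assumes CCc: "countable CC" and b: "\<beta> \<in> dforms MD k" and i: "slide_invariant \<beta>"
    and P: "(n, V, \<alpha>) \<in> MD" "(n, V, \<alpha>') \<in> MD" and eq: "\<And>y. y \<in> V \<Longrightarrow> plaque_rel\<^sup>*\<^sup>* (\<alpha> y) (\<alpha>' y)"
  shows "\<beta> (n, V, \<alpha>) = \<beta> (n, V, \<alpha>')"
proof (intro ext, rule ccontr)
  fix x v assume ne: "\<beta> (n, V, \<alpha>) x v \<noteq> \<beta> (n, V, \<alpha>') x v"
  have V: "open_Rn n V" by (rule plot_open[OF P(1)])
  note F = dforms_in[OF b P(1)] and F' = dforms_in[OF b P(2)]
  have v: "v \<in> tuples n k" and xV: "x \<in> V" using ne forms_zero[OF F] forms_zero[OF F'] by metis+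
  define g where "g y = \<beta> (n, V, \<alpha>) y v - \<beta> (n, V, \<alpha>') y v" for y
  define B where "B = {y \<in> V. g y \<noteq> 0}"
  have "smooth_fun n V g"
    unfolding g_def by (rule smooth_fun_diff[OF V forms_smooth[OF F v] forms_smooth[OF F' v]])
  then have B: "open_Rn n B"
    unfolding B_def by (rule smooth_fun_nonzero_open[OF V])
  have xB: "x \<in> B" using ne xV by (simp add: B_def g_def)
  define S :: "('a fchart \<times> (nat \<Rightarrow> real)) list \<times> 'a fchart \<Rightarrow> (nat \<Rightarrow> real) set" where
    "S = (\<lambda>(w, S, K, J, c, e). {y \<in> V. slide_dom w (\<alpha> y) \<and> slide_act w (\<alpha> y) \<in> S \<and> \<alpha>' y \<in> S \<and>
      eqq (K (slide_act w (\<alpha> y))) (K (\<alpha>' y))})"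
  have "countable slides"
  proof -
    have "slides \<subseteq> CC \<times> rational_points m" unfolding slides_def by blast
    then show ?thesis
      by (rule countable_subset) (intro countable_SIGMA CCc countable_rational_points)
  qed
  then have I: "countable (lists slides \<times> CC)" by (intro countable_SIGMA countable_lists CCc)
  have cov: "B \<subseteq> (\<Union>i\<in>lists slides \<times> CC. S i)"
  proof
    fix y assume "y \<in> B"
    then have y: "y \<in> V" by (simp add: B_def)
    obtain w S' K J c e where w: "w \<in> lists slides" "(S', K, J, c, e) \<in> CC" "slide_dom w (\<alpha> y)" "slide_act w (\<alpha> y) \<in> S'"
      "\<alpha>' y \<in> S'" "eqq (K (slide_act w (\<alpha> y))) (K (\<alpha>' y))"
      using slides_reach[OF eq[OF y] plot_in[OF P(1) y]] by (elim exE conjE)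
    have "y \<in> S (w, S', K, J, c, e)" unfolding S_def using y w by simp
    moreover have "(w, S', K, J, c, e) \<in> lists slides \<times> CC" using w by simp
    ultimately show "y \<in> (\<Union>i\<in>lists slides \<times> CC. S i)" by (rule UN_I[rotated])
  qed
  have local_str: "\<exists>A. open_Rn n A \<and> S (w, S', K, J, c, e) \<subseteq> A \<and> open_Rn n (A - S (w, S', K, J, c, e)) \<and>
      (\<forall>G. open_Rn n G \<longrightarrow> G \<subseteq> S (w, S', K, J, c, e) \<longrightarrow> (\<forall>y\<in>G. g y = 0))"
    if w: "w \<in> lists slides" and c: "(S', K, J, c, e) \<in> CC" for w S' K J c e
  proof -
    note f = fc[OF c]
    define W where "W = {y \<in> V. slide_dom w (\<alpha> y)}"
    define \<alpha>w where "\<alpha>w = (\<lambda>y\<in>W. slide_act w (\<alpha> y))"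
    have W: "open_Rn n W" "(n, W, \<alpha>w) \<in> MD" "\<beta> (n, W, \<alpha>w) = \<beta> (n, W, restrict \<alpha> W)"
      using slides_plot[OF w P(1)] b i unfolding W_def \<alpha>w_def by blast+
    have WV: "W \<subseteq> V" by (auto simp: W_def)
    define A where "A = {y \<in> W. \<alpha>w y \<in> S'} \<inter> {y \<in> V. \<alpha>' y \<in> S'}"
    have oS: "openin (mtop M) S'" by (rule fol_chartD(1)[OF f])
    have A: "open_Rn n A"
      unfolding A_def by (intro openin_Int plot_preimage_open[OF W(2) oS] plot_preimage_open[OF P(2) oS])
    have AW: "A \<subseteq> W" "A \<subseteq> V" by (auto simp: A_def W_def)
    have RW: "(n, A, restrict \<alpha>w A) \<in> MD" by (rule diffeology_restrict[OF diffeology_MD W(2) A AW(1)])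
    have R': "(n, A, restrict \<alpha>' A) \<in> MD" by (rule diffeology_restrict[OF diffeology_MD P(2) A AW(2)])
    have RS: "restrict \<alpha>w A ` A \<subseteq> S'" "restrict \<alpha>' A ` A \<subseteq> S'" by (auto simp: A_def)
    have SA: "S (w, S', K, J, c, e) = {y \<in> A. eqq (K (\<alpha>w y)) (K (\<alpha>' y))}"
      unfolding S_def A_def W_def \<alpha>w_def by auto
    have s1: "smooth_fun n A (\<lambda>y. K (restrict \<alpha>w A y) j)" for j
      by (rule smooth_map_coord[OF plot_via_fol_chart(1)[OF f RW RS(1)] cube_subset_Rn A])
    have s2: "smooth_fun n A (\<lambda>y. K (restrict \<alpha>' A y) j)" for j
      by (rule smooth_map_coord[OF plot_via_fol_chart(1)[OF f R' RS(2)] cube_subset_Rn A])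
    \<comment> \<open>Inside the open set \<open>A\<close> the set is the common zero set of
      \<open>q\<close> smooth functions; this gives local closedness.\<close>
    have "A - S (w, S', K, J, c, e) = (\<Union>j\<in>{..<q}. {y \<in> A. K (restrict \<alpha>w A y) j - K (restrict \<alpha>' A y) j \<noteq> 0})"
      unfolding SA eqq_def by auto
    moreover have "open_Rn n \<dots>"
    proof (rule openin_Union)
      fix T assume "T \<in> (\<lambda>j. {y \<in> A. K (restrict \<alpha>w A y) j - K (restrict \<alpha>' A y) j \<noteq> 0}) ` {..<q}"
      then obtain j where "T = {y \<in> A. K (restrict \<alpha>w A y) j - K (restrict \<alpha>' A y) j \<noteq> 0}" by blast
      then show "open_Rn n T" using smooth_fun_nonzero_open[OF A smooth_fun_diff[OF A s1 s2]] by simp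
    qed
    ultimately have o: "open_Rn n (A - S (w, S', K, J, c, e))" by simp
    have z: "g y = 0" if G: "open_Rn n G" "G \<subseteq> S (w, S', K, J, c, e)" and y: "y \<in> G" for G y
    proof -
      have GA: "G \<subseteq> A" and ge: "\<And>y. y \<in> G \<Longrightarrow> eqq (K (\<alpha>w y)) (K (\<alpha>' y))" using G(2) SA by auto
      have GW: "G \<subseteq> W" "G \<subseteq> V" using GA AW by auto
      have "\<beta> (n, G, restrict \<alpha>w G) = \<beta> (n, G, restrict \<alpha>' G)"
        by (rule plaque_equal_plots[OF c diffeology_restrict[OF diffeology_MD W(2) G(1) GW(1)]
            diffeology_restrict[OF diffeology_MD P(2) G(1) GW(2)] _ _ _ b i])
          (use GA ge in \<open>auto simp: A_def\<close>)
      then have "\<beta> (n, W, \<alpha>w) y = \<beta> (n, V, \<alpha>') y"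
        using dform_restrict[OF b W(2) G(1) GW(1) y] dform_restrict[OF b P(2) G(1) GW(2) y] by simp
      moreover have "\<beta> (n, W, \<alpha>w) y = \<beta> (n, V, \<alpha>) y"
        unfolding W(3) by (rule dform_restrict[OF b P(1) W(1) WV]) (use GW y in blast)
      ultimately show ?thesis by (simp add: g_def)
    qed
    show ?thesis by (intro exI[of _ A] conjI allI impI ballI A o z) (auto simp: SA)
  qed
  have "\<exists>i\<in>lists slides \<times> CC. \<exists>G. open_Rn n G \<and> G \<noteq> {} \<and> G \<subseteq> S i \<inter> B"
  proof (rule Baire_locally_closed[OF B _ I cov])
    show "B \<noteq> {}" using xB by blast
    fix i assume "i \<in> lists slides \<times> CC"
    then obtain w S' K J c e where "i = (w, S', K, J, c, e)" "w \<in> lists slides" "(S', K, J, c, e) \<in> CC"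
      by (cases i) auto
    then show "\<exists>A. open_Rn n A \<and> S i \<subseteq> A \<and> open_Rn n (A - S i)" using local_str[of w S' K J c e] by metis
  qed
  then obtain i G where i: "i \<in> lists slides \<times> CC" and G: "open_Rn n G" "G \<noteq> {}" "G \<subseteq> S i \<inter> B" by (elim bexE exE conjE)
  obtain w S' K J c e where w: "i = (w, S', K, J, c, e)" "w \<in> lists slides" "(S', K, J, c, e) \<in> CC"
    using i by (cases i) auto
  obtain y where y: "y \<in> G" using G(2) by blast
  have "G \<subseteq> S (w, S', K, J, c, e)" using G(3) w(1) by blast
  then have "g y = 0" using local_str[OF w(2,3)] G(1) y by blast
  moreover have "y \<in> B" using y G(3) by blast
  ultimately show False by (simp add: B_def)
qed

end

section \<open>Bump functions and vector fields tangent to the foliation\<close>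

text \<open>The function \<open>exp (- (1 / t))\<close> extended by 0, with a polynomial factor that
  makes the family closed under differentiation.\<close>

definition flat :: "real poly \<Rightarrow> real \<Rightarrow> real" where
  "flat p t = (if t > 0 then poly p (1 / t) * exp (- (1 / t)) else 0)"

lemma flat_tendsto_0: "(flat p \<longlongrightarrow> 0) (at 0)"
proof (rule filterlim_split_at)
  have "\<forall>\<^sub>F t :: real in at_left 0. t < 0" by (rule eventually_at_left_field[THEN iffD2]) (rule exI[of _ "-1"], auto)
  then have "\<forall>\<^sub>F t in at_left 0. 0 = flat p t" by (rule eventually_mono) (simp add: flat_def)
  then show "(flat p \<longlongrightarrow> 0) (at_left 0)" by (rule Lim_transform_eventually[OF tendsto_const])
next
  have "((\<lambda>s. \<Sum>i\<le>degree p. coeff p i * (s ^ i / exp s)) \<longlongrightarrow> (\<Sum>i\<le>degree p. coeff p i * 0)) at_top"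
    by (intro tendsto_intros tendsto_power_div_exp_0)
  moreover have "(\<lambda>s :: real. \<Sum>i\<le>degree p. coeff p i * (s ^ i / exp s)) = (\<lambda>s. poly p s * exp (- s))"
    by (simp add: poly_altdef sum_distrib_right exp_minus divide_inverse mult.assoc)
  ultimately have "((\<lambda>s. poly p s * exp (- s)) \<longlongrightarrow> 0) at_top" by simp
  then have l: "((\<lambda>t. poly p (inverse t) * exp (- inverse t)) \<longlongrightarrow> 0) (at_right 0)"
    by (rule filterlim_compose[OF _ filterlim_inverse_at_top_right])
  have "\<forall>\<^sub>F t :: real in at_right 0. t > 0" by (rule eventually_at_right_less)
  then have "\<forall>\<^sub>F t in at_right 0. poly p (inverse t) * exp (- inverse t) = flat p t"
    by (rule eventually_mono) (simp add: flat_def divide_inverse)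
  with l show "(flat p \<longlongrightarrow> 0) (at_right 0)" by (rule Lim_transform_eventually)
qed

text \<open>With \<open>s = 1 / t\<close> the derivative in \<open>t\<close> of
  \<open>p(s) exp(-s)\<close> is \<open>s^2 (p(s) - p'(s)) exp(-s)\<close>, which explains the
  polynomial.\<close>

lemma flat_derivative: "(flat p has_real_derivative flat ([:0, 0, 1:] * (p - pderiv p)) t) (at t)"
proof -
  consider "t > 0" | "t < 0" | "t = 0" by linarith
  then show ?thesis
  proof cases
    case 1
    have "((\<lambda>t. poly p (1 / t) * exp (- (1 / t))) has_real_derivative flat ([:0, 0, 1:] * (p - pderiv p)) t) (at t)"
      using 1 by (auto intro!: derivative_eq_intros poly_DERIV[THEN DERIV_chain2] simp: flat_def field_simps power2_eq_square)
    moreover have "\<forall>\<^sub>F s in nhds t. poly p (1 / s) * exp (- (1 / s)) = flat p s"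
      using eventually_gt_at_top[of 0] eventually_nhds_in_open[of "{0<..}" t] 1
      by (auto simp: flat_def elim: eventually_mono)
    ultimately show ?thesis by (rule DERIV_cong_ev[OF refl _ refl, THEN iffD1, rotated])
  next
    case 2
    have "((\<lambda>t. 0) has_real_derivative flat ([:0, 0, 1:] * (p - pderiv p)) t) (at t)"
      using 2 by (simp add: flat_def)
    moreover have "\<forall>\<^sub>F s in nhds t. 0 = flat p s"
      using eventually_nhds_in_open[of "{..<0}" t] 2 by (auto simp: flat_def elim: eventually_mono)
    ultimately show ?thesis by (rule DERIV_cong_ev[OF refl _ refl, THEN iffD1, rotated])
  next
    case 3
    \<comment> \<open>Dividing by \<open>h\<close> multiplies the polynomial by its variable, so the
      difference quotient at 0 belongs to the family again and tends to 0.\<close>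
    have "(\<lambda>h. (flat p (0 + h) - flat p 0) / h) = flat (pCons 0 p)"
      by (auto simp: flat_def fun_eq_iff)
    then show ?thesis using flat_tendsto_0[of "pCons 0 p"] 3 by (simp add: DERIV_def flat_def)
  qed
qed

text \<open>The induction runs over all polynomials at once, since differentiation changes
  \<open>p\<close>.\<close>

lemma Ck_on_flat:
  assumes U: "open_Rn n U" and f: "smooth_fun n U f"
  shows "Ck_on n k U (\<lambda>x. flat p (f x))"
proof (induction k arbitrary: p)
  have c: "continuous_on U (\<lambda>x. flat p (f x))" for p
    by (rule continuous_on_compose2[OF _ smooth_fun_continuous[OF f] subset_UNIV])
      (meson DERIV_continuous_on flat_derivative has_field_derivative_at_within)
  {
    case 0
    show ?case using c by simp
  next
    case (Suc k)
    let ?q = "[:0, 0, 1:] * (p - pderiv p)"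
    show ?case
    proof (rule Ck_on_SucI'[OF U c, where f' = "\<lambda>i x. flat ?q (f x) * pd i f x"])
      fix i x assume i: "i < n" and x: "x \<in> U"
      have "((\<lambda>t. f (\<lambda>j. x j + t * unit_vec i j)) has_real_derivative pd i f x) (at 0)"
        by (rule smooth_fun_line_derivative[OF f U x unit_vec_Rn[OF i]])
      from DERIV_chain2[OF flat_derivative[of p] this]
      show "((\<lambda>t. flat p (f (\<lambda>j. x j + t * unit_vec i j))) has_real_derivative flat ?q (f x) * pd i f x) (at 0)"
        by simp
    next
      fix i assume i: "i < n"
      show "Ck_on n k U (\<lambda>x. flat ?q (f x) * pd i f x)"
        using Ck_on_mult[OF U Suc.IH] smooth_fun_pd[OF f i] by (simp add: smooth_fun_def)
    qed
  }
qed

lemma bump_function: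
  assumes "\<delta> > 0"
  obtains b where "smooth_fun n (Rn n) b" "b x \<noteq> 0" "\<forall>y. b y \<noteq> 0 \<longrightarrow> (\<forall>i<n. \<bar>y i - x i\<bar> \<le> \<delta>)"
proof -
  \<comment> \<open>Positive at \<open>x\<close> and nonpositive outside the open Euclidean ball of
    radius \<open>\<delta>\<close>, where \<open>flat 1\<close> makes the function vanish.\<close>
  define s where "s y = \<delta>\<^sup>2 - (\<Sum>i<n. (y i - x i) * (y i - x i))" for y
  have o: "open_Rn n (Rn n)" by simp
  have s: "smooth_fun n (Rn n) s"
    unfolding s_def
    by (intro smooth_fun_diff[OF o] smooth_fun_sum[OF o] smooth_fun_mult[OF o] smooth_fun_const[OF o] smooth_fun_proj[OF o])
  have "smooth_fun n (Rn n) (\<lambda>y. flat 1 (s y))" unfolding smooth_fun_def using Ck_on_flat[OF o s] by blast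
  moreover have "flat 1 (s x) \<noteq> 0" using assms by (simp add: flat_def s_def)
  moreover have "\<forall>y. flat 1 (s y) \<noteq> 0 \<longrightarrow> (\<forall>i<n. \<bar>y i - x i\<bar> \<le> \<delta>)"
  proof (intro allI impI)
    fix y i assume that: "flat 1 (s y) \<noteq> 0" and i: "i < n"
    have "(y i - x i) * (y i - x i) \<le> (\<Sum>i<n. (y i - x i) * (y i - x i))"
      by (rule member_le_sum) (use i in auto)
    also have "\<dots> \<le> \<delta>\<^sup>2" using that by (auto simp: flat_def s_def split: if_splits)
    finally show "\<bar>y i - x i\<bar> \<le> \<delta>" using assms abs_le_square_iff[of "y i - x i" \<delta>] by (simp add: power2_eq_square)
  qed
  ultimately show ?thesis by (rule that)
qed

text \<open>Needed in \<open>bump_field_smooth\<close>, where compactness makes the image of the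
  closed cube closed in \<open>M\<close>.\<close>

lemma compactin_closed_cube: "compactin (Euclidean_space n) {y \<in> Rn n. \<forall>i<n. \<bar>y i - x i\<bar> \<le> d}"
proof -
  define S where "S i = (if i < n then {x i - d..x i + d} else {0})" for i
  have "y \<in> Rn n \<and> (\<forall>i<n. \<bar>y i - x i\<bar> \<le> d) \<longleftrightarrow> (\<forall>i. y i \<in> S i)" for y
  proof (intro iffI allI)
    show "y i \<in> S i" if "y \<in> Rn n \<and> (\<forall>i<n. \<bar>y i - x i\<bar> \<le> d)" for i
      using that by (cases "i < n") (auto simp: S_def Rn_iff abs_le_iff algebra_simps)
  next
    assume a: "\<forall>i. y i \<in> S i"
    have "y i = 0" if "n \<le> i" for i using spec[OF a, of i] that by (simp add: S_def)
    moreover have "\<bar>y i - x i\<bar> \<le> d" if "i < n" for i using spec[OF a, of i] that by (simp add: S_def abs_le_iff)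
    ultimately show "y \<in> Rn n \<and> (\<forall>i<n. \<bar>y i - x i\<bar> \<le> d)" by (simp add: Rn_iff)
  qed
  then have e: "{y \<in> Rn n. \<forall>i<n. \<bar>y i - x i\<bar> \<le> d} = Pi\<^sub>E UNIV S"
    by (auto simp: PiE_iff)
  have 1: "compactin (powertop_real UNIV) (Pi\<^sub>E UNIV S)"
    by (rule compactin_PiE[THEN iffD2]) (auto simp: S_def)
  have 2: "Pi\<^sub>E UNIV S \<subseteq> {y. \<forall>i\<ge>n. y i = 0}"
    unfolding e[symmetric] by (auto simp: Rn_iff)
  have "compactin (Euclidean_space n) (Pi\<^sub>E UNIV S)"
    unfolding Euclidean_space_def compactin_subtopology by (rule conjI[OF 1 2])
  then show ?thesis unfolding e .
qed

section \<open>Tangent vector fields supported in a foliated chart\<close>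

context foliated
begin

context
  fixes S K J c e b u x \<delta>
  assumes fc: "fol_chart S K J c e" and b: "smooth_fun m (Rn m) b" and u: "u \<in> Rn m" "\<forall>j<q. u j = 0"
    and supp: "\<forall>y. b y \<noteq> 0 \<longrightarrow> (\<forall>i<m. \<bar>y i - x i\<bar> \<le> \<delta>)"
    and sub: "{y \<in> Rn m. \<forall>i<m. \<bar>y i - x i\<bar> \<le> \<delta>} \<subseteq> cube m c e"
begin

text \<open>The vertical field \<open>b * u\<close> of the foliated chart, carried to
  \<open>M\<close> by the differential of \<open>J\<close> and extended by 0 outside
  \<open>S\<close>.\<close>

definition bump_field :: "'a chart \<Rightarrow> (nat \<Rightarrow> real) \<Rightarrow> nat \<Rightarrow> real" where
  "bump_field = (\<lambda>(V, \<psi>) y. if inv_into V \<psi> y \<in> S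
     then tangent_map (\<lambda>w. \<psi> (J w)) (K (inv_into V \<psi> y)) (\<lambda>i. b (K (inv_into V \<psi> y)) * u i) else (\<lambda>i. 0))"

private abbreviation "CQ \<equiv> {y \<in> Rn m. \<forall>i<m. \<bar>y i - x i\<bar> \<le> \<delta>}"

lemma bu_Rn: "(\<lambda>i. r * u i) \<in> Rn m"
  using u(1) by (simp add: Rn_iff)

lemma bump_field_at:
  assumes "(V, \<psi>) \<in> atlas M" "p \<in> V"
  shows "bump_field (V, \<psi>) (\<psi> p) = (if p \<in> S then tangent_map (\<lambda>w. \<psi> (J w)) (K p) (\<lambda>i. b (K p) * u i) else (\<lambda>i. 0))"
  using assms by (simp add: bump_field_def)

lemma fc_tangent_J_Rn:
  assumes ch: "(V, \<psi>) \<in> atlas M" and p: "p \<in> V" "p \<in> S" and w: "w \<in> Rn m"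
  shows "tangent_map (\<lambda>w. \<psi> (J w)) (K p) w \<in> Rn m"
proof (rule tangent_map_Rn[OF fc_J_smooth[OF fc ch] fc_J_open[OF fc ch] _ _ w])
  show "\<psi> ` (V \<inter> S) \<subseteq> Rn m" using open_Rn_subset[OF chart(2)[OF ch]] by blast
  show "K p \<in> {x \<in> cube m c e. J x \<in> V}" using p fol_chartD(5,6)[OF fc] by simp
qed

text \<open>At points outside \<open>S\<close> a neighbourhood is needed on which the field
  vanishes. The image of the closed cube \<open>CQ\<close> is compact, hence closed in the Hausdorff
  space \<open>M\<close>, and the field is 0 on its complement.\<close>

lemma bump_field_smooth:
  assumes ch: "(V, \<psi>) \<in> atlas M"
  shows "smooth_map m (\<psi> ` V) m (Rn m) (bump_field (V, \<psi>))"
proof (rule smooth_map_local[OF chart(2)[OF ch]])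
  fix y assume "y \<in> \<psi> ` V"
  then obtain p where p: "p \<in> V" "y = \<psi> p" by blast
  let ?C = "J ` CQ"
  have "compactin (mtop M) ?C"
  proof -
    have c: "continuous_map (subtopology (Euclidean_space m) (cube m c e)) (mtop M) (restrict J (cube m c e))"
      using fol_chartD(9)[OF fc] by (simp add: manifold_diffeology_def)
    have "compactin (subtopology (Euclidean_space m) (cube m c e)) CQ"
      using compactin_closed_cube sub by (simp add: compactin_subtopology)
    from image_compactin[OF this c] have "compactin (mtop M) (restrict J (cube m c e) ` CQ)" .
    moreover have "restrict J (cube m c e) ` CQ = J ` CQ" using sub by (intro image_cong) auto
    ultimately show ?thesis by simp
  qed
  then have cl: "closedin (mtop M) ?C"
    using M by (intro compactin_imp_closedin) (simp_all add: smooth_manifold_def)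
  show "\<exists>A. open_Rn m A \<and> y \<in> A \<and> A \<subseteq> \<psi> ` V \<and> smooth_map m A m (Rn m) (bump_field (V, \<psi>))"
  proof (cases "p \<in> S")
    case True
    let ?A = "\<psi> ` (V \<inter> S)"
    let ?k = "in_chart (V, \<psi>) K"
    let ?O = "{x \<in> cube m c e. J x \<in> V}"
    have A: "open_Rn m ?A" by (rule chart_image_Int_open[OF ch fol_chartD(1)[OF fc]])
    have k: "smooth_map m ?A m ?O ?k"
      by (rule smooth_map_into[OF fc_chart_smooth[OF fc ch]])
        (use ch fol_chartD(5,6)[OF fc] in \<open>auto simp: in_chart_def\<close>)
    note O = fc_J_open[OF fc ch] and JO = fc_J_smooth[OF fc ch]
    have AR: "?A \<subseteq> Rn m" by (rule open_Rn_subset[OF A])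
    have "smooth_map m ?O m (Rn m) (\<lambda>w. tangent_map (\<lambda>w. \<psi> (J w)) w (\<lambda>i. b w * u i))"
    proof (rule smooth_mapI)
      show "tangent_map (\<lambda>w. \<psi> (J w)) w (\<lambda>i. b w * u i) \<in> Rn m" if "w \<in> ?O" for w
        by (rule tangent_map_Rn[OF JO O AR that bu_Rn])
      show "smooth_fun m ?O (\<lambda>w. tangent_map (\<lambda>w. \<psi> (J w)) w (\<lambda>i. b w * u i) j)" for j
        unfolding tangent_map_def
      proof (rule smooth_fun_dir_deriv[OF smooth_map_coord[OF JO AR O] O])
        show "smooth_fun m ?O (\<lambda>w. b w * u j)" for j
          by (intro smooth_fun_mult[OF O] smooth_fun_const[OF O] smooth_fun_subset[OF b] open_Rn_subset[OF O])
      qed (rule bu_Rn)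
    qed
    then have "smooth_map m ?A m (Rn m) (\<lambda>y. tangent_map (\<lambda>w. \<psi> (J w)) (?k y) (\<lambda>i. b (?k y) * u i))"
      by (rule smooth_map_compose[OF k A O])
    then have "smooth_map m ?A m (Rn m) (bump_field (V, \<psi>))"
      by (rule smooth_map_cong[OF A]) (use ch in \<open>auto simp: bump_field_def in_chart_def\<close>)
    then show ?thesis using A True p by blast
  next
    case False
    let ?A = "\<psi> ` (V \<inter> (pts M - ?C))"
    have A: "open_Rn m ?A"
      by (rule chart_image_Int_open[OF ch]) (use cl in \<open>simp add: closedin_def\<close>)
    have "p \<notin> ?C" using False fol_chartD(7)[OF fc] sub by blast
    then have "y \<in> ?A" using p chart_subset[OF ch] by blast
    moreover have "smooth_map m ?A m (Rn m) (bump_field (V, \<psi>))"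
    proof (rule smooth_map_cong[OF A smooth_map_const[OF A Rn_zero]])
      fix z assume "z \<in> ?A"
      then obtain r where r: "r \<in> V" "r \<notin> ?C" "z = \<psi> r" by blast
      have "b (K r) = 0" if "r \<in> S"
      proof (rule ccontr)
        assume "b (K r) \<noteq> 0"
        then have "K r \<in> CQ" using supp fol_chartD(5)[OF fc that] cube_subset_Rn by blast
        then have "J (K r) \<in> ?C" by (rule imageI)
        then show False using r(2) fol_chartD(6)[OF fc that] by simp
      qed
      then show "(\<lambda>i. 0) = bump_field (V, \<psi>) z"
        unfolding r(3) bump_field_at[OF ch r(1)] by (simp add: tangent_map_zero)
    qed
    ultimately show ?thesis using A by blast
  qed
qed

lemma bump_field_tangent: "bump_field \<in> tangent_fields M F"
proof -
  have 1: "\<forall>(U, \<phi>)\<in>atlas M. smooth_map m (\<phi> ` U) m (Rn m) (bump_field (U, \<phi>))"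
    using bump_field_smooth by blast
  have "bump_field (V, \<psi>) (\<psi> p) = tangent_map (in_chart (U, \<phi>) \<psi>) (\<phi> p) (bump_field (U, \<phi>) (\<phi> p))"
    if c: "(U, \<phi>) \<in> atlas M" "(V, \<psi>) \<in> atlas M" and p: "p \<in> U" "p \<in> V" for U \<phi> V \<psi> p
  proof (cases "p \<in> S")
    case True
    let ?w = "\<lambda>i. b (K p) * u i"
    let ?O = "{x \<in> cube m c e. J x \<in> U \<inter> V}"
    have oUV: "openin (mtop M) (U \<inter> V)" by (intro openin_Int chart(1)[OF c(1)] chart(1)[OF c(2)])
    have "{x \<in> cube m c e. restrict J (cube m c e) x \<in> U \<inter> V} = ?O" by auto
    with plot_preimage_open[OF fol_chartD(9)[OF fc] oUV] have O: "open_Rn m ?O" by simp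
    have "?O \<subseteq> {x \<in> cube m c e. J x \<in> U}" by auto
    from smooth_map_subset[OF fc_J_smooth[OF fc c(1)] this order_refl]
    have s: "smooth_map m ?O m (\<phi> ` (U \<inter> V)) (\<lambda>x. \<phi> (J x))" by (rule smooth_map_into) blast
    have KO: "K p \<in> ?O" using p True fol_chartD(5,6)[OF fc] by simp
    have "tangent_map (\<lambda>w. \<psi> (J w)) (K p) ?w = tangent_map (\<lambda>w. in_chart (U, \<phi>) \<psi> (\<phi> (J w))) (K p) ?w"
      by (rule tangent_map_cong[OF O KO bu_Rn]) (use c in \<open>simp add: in_chart_def\<close>)
    also have "\<dots> = tangent_map (in_chart (U, \<phi>) \<psi>) (\<phi> (J (K p))) (tangent_map (\<lambda>w. \<phi> (J w)) (K p) ?w)"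
      by (rule tangent_map_compose[OF s O chart_image_Int_open[OF c(1) chart(1)[OF c(2)]] transition[OF c] order_refl KO bu_Rn])
    finally show ?thesis
      unfolding bump_field_at[OF c(1) p(1)] bump_field_at[OF c(2) p(2)] using True fol_chartD(6)[OF fc True] by simp
  next
    case False
    then show ?thesis
      unfolding bump_field_at[OF c(1) p(1)] bump_field_at[OF c(2) p(2)] by (simp add: tangent_map_zero)
  qed
  then have 2: "\<forall>(U, \<phi>)\<in>atlas M. \<forall>(V, \<psi>)\<in>atlas M. \<forall>p\<in>U \<inter> V.
        bump_field (V, \<psi>) (\<psi> p) = tangent_map (in_chart (U, \<phi>) \<psi>) (\<phi> p) (bump_field (U, \<phi>) (\<phi> p))"
    by blast
  have "bump_field (U, \<phi>) (\<phi> p) \<in> foliation_tangent M F (U, \<phi>) p" if c: "(U, \<phi>) \<in> atlas M" "p \<in> U" for U \<phi> p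
  proof (cases "p \<in> S")
    case True
    have t: "tangent_map (in_chart (U, \<phi>) K) (\<phi> p) (tangent_map (\<lambda>w. \<phi> (J w)) (K p) (\<lambda>i. b (K p) * u i)) = (\<lambda>i. b (K p) * u i)"
      by (rule fc_tangent_inverse(1)[OF fc c True bu_Rn])
    show ?thesis
      unfolding bump_field_at[OF c] if_P[OF True]
        fc_foliation_tangent[OF fc c True fc_tangent_J_Rn[OF c True bu_Rn]] t
      using u(2) by simp
  next
    case False
    obtain W f where W: "(W, f) \<in> F" "p \<in> W" using F_cover chart_subset[OF c(1)] c(2) by blast
    show ?thesis
      unfolding bump_field_at[OF c] if_not_P[OF False] foliation_tangent_eq[OF W c]
      using Rn_zero by (simp add: tangent_map_zero)
  qed
  then have 3: "\<forall>(U, \<phi>)\<in>atlas M. \<forall>p\<in>U. bump_field (U, \<phi>) (\<phi> p) \<in> foliation_tangent M F (U, \<phi>) p" by blast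
  show ?thesis unfolding tangent_fields_def vector_fields_def using 1 2 3 by simp
qed

end

end

section \<open>Basic forms\<close>

lemma ext_deriv_zero_form: "ext_deriv n U (\<lambda>y w. 0) = (\<lambda>y w. 0)"
  by (simp add: ext_deriv_def fun_eq_iff)

context mfd
begin

lemma vector_field_smooth:
  "X \<in> vector_fields M \<Longrightarrow> (U, \<phi>) \<in> atlas M \<Longrightarrow> smooth_map m (\<phi> ` U) m (Rn m) (X (U, \<phi>))"
  unfolding vector_fields_def by blast

text \<open>Cartan's formula, in which the derivative of the contraction drops out. Outside the
  chart, or for a wrong number of vectors, both sides are 0 by convention.\<close>

lemma lie_deriv_contraction_zero:
  assumes \<omega>: "\<omega> \<in> mforms M k" and X: "X \<in> vector_fields M" and c0: "contraction X \<omega> = 0"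
  shows "lie_deriv M X \<omega> = contraction X (mform_d M \<omega>)"
proof (intro ext)
  fix c :: "'a chart" and x v
  obtain U \<phi> where c: "c = (U, \<phi>)" by (cases c)
  show "lie_deriv M X \<omega> c x v = contraction X (mform_d M \<omega>) c x v"
  proof (cases "c \<in> atlas M")
    case False
    have "\<omega> c = (\<lambda>y w. 0)" using mformsD(1)[OF \<omega> False] by (simp add: zero_fun_def)
    then have "mform_d M \<omega> c = (\<lambda>y w. 0)" by (simp add: mform_d_def c ext_deriv_zero_form)
    then show ?thesis using False by (simp add: lie_deriv_def contraction_def c)
  next
    case True
    then have a: "(U, \<phi>) \<in> atlas M" by (simp add: c)
    note \<omega>f = mformsD(2)[OF \<omega> a] and U = chart(2)[OF a]
    show ?thesis
    proof (cases "x \<in> \<phi> ` U \<and> v \<in> tuples m k")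
      case True
      have "(\<lambda>y w. \<omega> (U, \<phi>) y (X (U, \<phi>) y # w)) = (\<lambda>y w. 0)"
        using c0 by (simp add: contraction_def fun_eq_iff)
      then have "ext_deriv m (\<phi> ` U) (\<lambda>y w. \<omega> (U, \<phi>) y (X (U, \<phi>) y # w)) x v = 0"
        by (simp add: ext_deriv_zero_form)
      then show ?thesis
        using cartan_formula[OF \<omega>f U vector_field_smooth[OF X a], of x v] True a
        by (simp add: lie_deriv_def contraction_def c mform_d_def tuples_def)
    next
      case False
      have r: "contraction X (mform_d M \<omega>) c x v = 0"
        using ext_deriv_zero[OF \<omega>f, of x "X (U, \<phi>) x # v"] False
        by (auto simp: contraction_def mform_d_def c tuples_def)
      have z: "\<omega> (U, \<phi>) y w = 0" if "x \<notin> \<phi> ` U \<or> length w \<noteq> k" "y = x \<or> length w \<noteq> k" for y w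
        using forms_zero[OF \<omega>f] that by (auto simp: tuples_def)
      have "lie_deriv M X \<omega> c x v = 0"
      proof (cases "x \<in> \<phi> ` U \<and> set v \<subseteq> Rn m")
        case True
        then have len: "length v \<noteq> k" using False by (auto simp: tuples_def)
        then have "(\<lambda>y. \<omega> (U, \<phi>) y v) = (\<lambda>y. 0)" using z by auto
        then show ?thesis using z len by (simp add: lie_deriv_def c)
      qed (auto simp: lie_deriv_def c)
      with r show ?thesis by simp
    qed
  qed
qed

end

section \<open>Slide invariance in terms of vertical vectors\<close>

context foliated
begin

text \<open>Slide from \<open>x\<close> to \<open>x\<close> itself: the point stays where it is, and
  the tangent map of the slide kills the vertical vector \<open>u\<close>.\<close>

lemma vertical_contraction:
  assumes \<eta>: "\<eta> \<in> forms m k (cube m c e)"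
    and inv: "\<And>z. z \<in> cube m c e \<Longrightarrow> form_pullback m (cube m c e) (slide z) \<eta> = \<eta>"
    and x: "x \<in> cube m c e" and u: "\<And>j. j < q \<Longrightarrow> u j = 0"
  shows "\<eta> x (u # w) = 0"
proof (cases "u # w \<in> tuples m k")
  case True
  have "\<eta> x (u # w) = \<eta> (slide x x) (map (tangent_map (slide x) x) (u # w))"
    using form_pullback_apply[OF x True, of "slide x" \<eta>] inv[OF x] by simp
  also have "map (tangent_map (slide x) x) (u # w) = (map (tangent_map (slide x) x) (u # w))[0 := (\<lambda>j. 0)]"
    using u by (auto simp: tangent_slide slide_def)
  also have "\<eta> (slide x x) \<dots> = 0"
  proof (rule alternating_zero)
    show "alternating m k (\<eta> (slide x x))" by (rule forms_alternating[OF \<eta> slide_cube[OF x x]])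
    show "map (tangent_map (slide x) x) (u # w) \<in> tuples m k"
      by (rule map_tangent_tuples[OF smooth_slide[OF x] open_Rn_cube cube_subset_Rn x True])
    show "0 < k" using True by (auto simp: tuples_def)
  qed
  finally show ?thesis .
qed (rule forms_zero[OF \<eta> disjI2])

text \<open>The pullback changes both the vectors and the base point. Removing the vertical parts of
  the vectors is harmless by \<open>v0\<close>. Moving the point along its plaque is harmless
  because, given \<open>v0\<close>, the derivative of a coefficient in a vertical direction is a
  value of the exterior derivative on that direction.\<close>

lemma vertical_contraction_converse:
  assumes \<eta>: "\<eta> \<in> forms m k (cube m c e)" and z: "z \<in> cube m c e"
    and v0: "\<And>y u w. y \<in> cube m c e \<Longrightarrow> u \<in> Rn m \<Longrightarrow> (\<And>j. j < q \<Longrightarrow> u j = 0) \<Longrightarrow> \<eta> y (u # w) = 0"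
    and d0: "\<And>y u w. y \<in> cube m c e \<Longrightarrow> u \<in> Rn m \<Longrightarrow> (\<And>j. j < q \<Longrightarrow> u j = 0) \<Longrightarrow>
      ext_deriv m (cube m c e) \<eta> y (u # w) = 0"
  shows "form_pullback m (cube m c e) (slide z) \<eta> = \<eta>"
proof (intro ext)
  fix x v
  let ?C = "cube m c e"
  show "form_pullback m ?C (slide z) \<eta> x v = \<eta> x v"
  proof (cases "x \<in> ?C \<and> v \<in> tuples m k")
    case False
    then show ?thesis using form_pullback_zero[OF \<eta>, of x ?C v m] forms_zero[OF \<eta>, of x v] by simp
  next
    case True
    then have x: "x \<in> ?C" and v: "v \<in> tuples m k" by auto
    have len: "length v = k" using v by (simp add: tuples_def)
    let ?s = "slide (\<lambda>i. 0)"
    have sR: "?s u \<in> Rn m" if "u \<in> Rn m" for u using that by (auto simp: slide_def Rn_iff)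
    have y: "slide z x \<in> ?C" by (rule slide_cube[OF z x])
    have alt: "alternating m k (\<eta> (slide z x))" by (rule forms_alternating[OF \<eta> y])
    \<comment> \<open>The vectors are replaced by their transverse parts one after the other; each
      replacement changes one entry by a vertical vector.\<close>
    have "\<eta> (slide z x) (map ?s (take i v) @ drop i v) = \<eta> (slide z x) v" if "i \<le> k" for i
      using that
    proof (induction i)
      case (Suc i)
      then have i: "i < k" by simp
      define L where "L = map ?s (take i v) @ drop i v"
      have L: "L \<in> tuples m k"
        using v i sR by (auto simp: L_def tuples_def dest: in_set_takeD in_set_dropD)
      have vi: "v ! i \<in> Rn m" by (rule tuples_nth[OF v i])
      have e1: "L = L[i := v ! i]" and e2: "map ?s (take (Suc i) v) @ drop (Suc i) v = L[i := ?s (v ! i)]"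
        using i len by (auto simp: L_def take_Suc_conv_app_nth list_update_append Cons_nth_drop_Suc[symmetric] nth_append)
      let ?d = "\<lambda>j. 1 * (v ! i) j + (-1) * ?s (v ! i) j"
      have dR: "?d \<in> Rn m" using vi sR[OF vi] by (simp add: Rn_iff)
      have dq: "?d j = 0" if "j < q" for j using that by (simp add: slide_def)
      have "\<eta> (slide z x) (L[i := ?d]) = 0"
        unfolding alternating_update_move[OF alt L i dR] using v0[OF y dR dq] by simp
      then have "\<eta> (slide z x) (L[i := v ! i]) = \<eta> (slide z x) (L[i := ?s (v ! i)])"
        using alternating_lin[OF alt L i vi sR[OF vi], of 1 "-1"] by simp
      then show ?case unfolding e2 using e1 Suc L_def by simp
    qed simp
    from this[of k] have 1: "\<eta> (slide z x) (map ?s v) = \<eta> (slide z x) v" by (simp add: len)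
    let ?d = "\<lambda>j. slide z x j - x j"
    have dR: "?d \<in> Rn m" using subsetD[OF cube_subset_Rn x] subsetD[OF cube_subset_Rn y] by (simp add: Rn_iff)
    have dq: "?d j = 0" if "j < q" for j using that by (simp add: slide_def)
    have "\<eta> x v = \<eta> (slide z x) v"
    proof (rule zero_derivative_imp_eq[OF forms_smooth[OF \<eta> v] open_Rn_cube order_refl x y])
      fix w assume w: "w \<in> ?C"
      have dv: "?d # v \<in> tuples m (Suc k)" using v dR by (simp add: tuples_def)
      \<comment> \<open>In the exterior derivative on the list that starts with the vertical
        \<open>?d\<close>, all summands but the first still contain \<open>?d\<close> and vanish by
        \<open>v0\<close>.\<close>
      have "dir_deriv (\<lambda>y. \<eta> y (del (Suc i) (?d # v))) w (v ! i) = 0" if i: "i < k" for i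
      proof -
        have "dir_deriv (\<lambda>y. \<eta> y (del (Suc i) (?d # v))) w (v ! i) = dir_deriv (\<lambda>y. 0) w (v ! i)"
          by (rule dir_deriv_cong[OF open_Rn_cube w tuples_nth[OF v i]]) (simp add: del_def v0[OF _ dR dq])
        then show ?thesis by simp
      qed
      then show "dir_deriv (\<lambda>y. \<eta> y v) w ?d = 0"
        using d0[OF w dR dq, of v] unfolding ext_deriv_apply[OF w dv] sum.lessThan_Suc_shift by (simp add: del_def)
    qed
    then show ?thesis
      unfolding form_pullback_apply[OF x v] using 1 by (simp add: tangent_slide[abs_def])
  qed
qed

context
  fixes S K J c e \<beta> k
  assumes fc: "fol_chart S K J c e" and \<beta>: "\<beta> \<in> dforms MD k"
begin

private abbreviation "\<eta> \<equiv> \<beta> (m, cube m c e, restrict J (cube m c e))"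

lemma fol_chart_form:
  assumes ch: "(V, \<psi>) \<in> atlas M" and p: "p \<in> V" "p \<in> S" and v: "v \<in> tuples m k"
  shows "\<eta> (K p) v = mform_of_dform M \<beta> (V, \<psi>) (\<psi> p) (map (tangent_map (\<lambda>w. \<psi> (J w)) (K p)) v)"
proof -
  let ?J = "restrict J (cube m c e)"
  have Kp: "K p \<in> cube m c e" and JK: "J (K p) = p" using fol_chartD(5,6)[OF fc p(2)] by simp_all
  have "\<eta> (K p) v = mform_of_dform M \<beta> (V, \<psi>) (\<psi> (?J (K p))) (map (tangent_map (\<lambda>y. \<psi> (?J y)) (K p)) v)"
    unfolding mform_of_dform_chart[OF ch]
    by (rule plot_form_in_chart[OF \<beta> fol_chartD(9)[OF fc] ch Kp _ v]) (simp add: Kp JK p(1))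
  also have "map (tangent_map (\<lambda>y. \<psi> (?J y)) (K p)) v = map (tangent_map (\<lambda>w. \<psi> (J w)) (K p)) v"
  proof (rule map_cong[OF refl])
    fix u assume "u \<in> set v"
    then have "u \<in> Rn m" using v by (auto simp: tuples_def)
    then show "tangent_map (\<lambda>y. \<psi> (?J y)) (K p) u = tangent_map (\<lambda>w. \<psi> (J w)) (K p) u"
      by (rule tangent_map_cong[OF open_Rn_cube Kp]) simp
  qed
  also have "\<psi> (?J (K p)) = \<psi> p" by (simp add: Kp JK)
  finally show ?thesis .
qed

text \<open>In the foliated chart the value of a tangent field is a vertical vector, so
  \<open>vertical_contraction\<close> applies there.\<close>

lemma contraction_zero_at:
  assumes inv: "\<And>z. z \<in> cube m c e \<Longrightarrow> form_pullback m (cube m c e) (slide z) \<eta> = \<eta>"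
    and X: "X \<in> tangent_fields M F" and ch: "(V, \<psi>) \<in> atlas M" and p: "p \<in> V" "p \<in> S"
  shows "contraction X (mform_of_dform M \<beta>) (V, \<psi>) (\<psi> p) v = 0"
proof (cases "X (V, \<psi>) (\<psi> p) # v \<in> tuples m k")
  case False
  then show ?thesis
    using forms_zero[OF mformsD(2)[OF mform_of_dform_mforms[OF \<beta>] ch]] by (simp add: contraction_def)
next
  case True
  let ?X = "X (V, \<psi>) (\<psi> p)"
  let ?B = "tangent_map (in_chart (V, \<psi>) K) (\<psi> p)" and ?A = "tangent_map (\<lambda>w. \<psi> (J w)) (K p)"
  have vR: "u \<in> Rn m" if "u \<in> set (?X # v)" for u using True that by (auto simp: tuples_def)
  have o: "open_Rn m (\<psi> ` (V \<inter> S))" by (rule chart_image_Int_open[OF ch fol_chartD(1)[OF fc]])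
  have \<psi>p: "\<psi> p \<in> \<psi> ` (V \<inter> S)" using p by simp
  have B: "map ?B (?X # v) \<in> tuples m k"
    by (rule map_tangent_tuples[OF fc_chart_smooth[OF fc ch] o cube_subset_Rn \<psi>p True])
  have AB: "?A (?B u) = u" if "u \<in> set (?X # v)" for u
    by (rule fc_tangent_inverse(2)[OF fc ch p vR[OF that]])
  have "map ?A (map ?B (?X # v)) = ?X # v"
    unfolding map_map by (rule map_idI) (simp only: comp_apply AB)
  then have "mform_of_dform M \<beta> (V, \<psi>) (\<psi> p) (?X # v) = \<eta> (K p) (map ?B (?X # v))"
    using fol_chart_form[OF ch p B] by simp
  also have "\<dots> = \<eta> (K p) (?B ?X # map ?B v)" by simp
  also have "\<dots> = 0"
  proof (rule vertical_contraction[OF dforms_in[OF \<beta> fol_chartD(9)[OF fc]] inv fol_chartD(5)[OF fc p(2)]])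
    have "?X \<in> foliation_tangent M F (V, \<psi>) p"
      using X ch p(1) unfolding tangent_fields_def by blast
    then show "?B ?X j = 0" if "j < q" for j
      using fc_foliation_tangent[OF fc ch p vR[of ?X]] that by simp
  qed
  finally show ?thesis by (simp add: contraction_def)
qed

text \<open>Up to the nonzero factor \<open>b y\<close>, every vertical vector at a point is the
  value of a global tangent field. A condition on global fields thus becomes a pointwise
  one.\<close>

lemma contraction_zero_vertical:
  assumes z: "\<And>X. X \<in> tangent_fields M F \<Longrightarrow> contraction X (mform_of_dform M \<beta>) = 0"
    and y: "y \<in> cube m c e" and u: "u \<in> Rn m" "\<And>j. j < q \<Longrightarrow> u j = 0"
  shows "\<eta> y (u # w) = 0"
proof (cases "u # w \<in> tuples m k")
  case True
  let ?p = "J y"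
  have p: "?p \<in> S" and Kp: "K ?p = y" using fol_chartD(7,8)[OF fc y] by simp_all
  obtain V \<psi> where ch: "(V, \<psi>) \<in> atlas M" "?p \<in> V" using chart_at[OF fol_chart_pts[OF fc p]] by blast
  obtain d where d: "d > 0" "cube m y d \<subseteq> cube m c e" by (rule open_Rn_contains_cube[OF open_Rn_cube y])
  \<comment> \<open>Half the radius keeps the closed cube that carries \<open>b\<close> inside the
    open one.\<close>
  obtain b where b: "smooth_fun m (Rn m) b" "b y \<noteq> 0" "\<forall>x. b x \<noteq> 0 \<longrightarrow> (\<forall>i<m. \<bar>x i - y i\<bar> \<le> d / 2)"
    by (rule bump_function[of "d / 2" m y]) (use d in auto)
  have sub: "{x \<in> Rn m. \<forall>i<m. \<bar>x i - y i\<bar> \<le> d / 2} \<subseteq> cube m c e"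
    using d by (intro order_trans[OF _ d(2)]) (force simp: cube_def)
  have u': "\<forall>j<q. u j = 0" using u(2) by blast
  let ?X = "bump_field S K J b u"
  let ?A = "tangent_map (\<lambda>w. \<psi> (J w)) (K ?p)"
  have X: "?X \<in> tangent_fields M F" by (rule bump_field_tangent[OF fc b(1) u(1) u' b(3) sub])
  have Xp: "?X (V, \<psi>) (\<psi> ?p) = ?A (\<lambda>i. b y * u i)"
    unfolding bump_field_at[OF fc b(1) u(1) u' b(3) sub ch] using p Kp by simp
  have bu: "(\<lambda>i. b y * u i) # w \<in> tuples m k" using True by (auto simp: tuples_def Rn_iff)
  have "contraction ?X (mform_of_dform M \<beta>) (V, \<psi>) (\<psi> ?p) (map ?A w) = 0"
    unfolding z[OF X] by simp
  then have "\<eta> (K ?p) ((\<lambda>i. b y * u i) # w) = 0"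
    unfolding fol_chart_form[OF ch p bu] by (simp add: contraction_def Xp)
  moreover have "\<eta> y ((\<lambda>i. b y * u i) # w) = b y * \<eta> y (u # w)"
    using alternating_lin[OF forms_alternating[OF dforms_in[OF \<beta> fol_chartD(9)[OF fc]] y] True _ u(1) u(1), of 0 "b y" 0]
      True by (simp add: tuples_def)
  ultimately show ?thesis using b(2) Kp by simp
qed (rule forms_zero[OF dforms_in[OF \<beta> fol_chartD(9)[OF fc]] disjI2])

end

end

context foliated_cover
begin

lemma slide_invariant_d:
  assumes b: "\<beta> \<in> dforms MD k" and i: "slide_invariant \<beta>"
  shows "slide_invariant (dform_d \<beta>)"
  unfolding slide_invariant_def
proof (intro allI impI)
  fix S K J c e z assume c: "(S, K, J, c, e) \<in> CC" "z \<in> cube m c e"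
  note f = fc[OF c(1)]
  show "form_pullback m (cube m c e) (slide z) (dform_d \<beta> (m, cube m c e, restrict J (cube m c e))) =
     dform_d \<beta> (m, cube m c e, restrict J (cube m c e))"
    using ext_deriv_pullback[OF dforms_in[OF b fol_chartD(9)[OF f]] open_Rn_cube open_Rn_cube smooth_slide[OF c(2)]]
    by (simp add: dform_d_def slide_invariantD[OF i c])
qed

lemma slide_invariant_contraction:
  assumes b: "\<beta> \<in> dforms MD k" and i: "slide_invariant \<beta>" and X: "X \<in> tangent_fields M F"
  shows "contraction X (mform_of_dform M \<beta>) = 0"
proof (intro ext)
  fix c :: "'a chart" and x v
  obtain U \<phi> where c: "c = (U, \<phi>)" by (cases c)
  note \<omega> = mform_of_dform_mforms[OF b]
  consider "c \<notin> atlas M" | "c \<in> atlas M" "x \<notin> \<phi> ` U" | p where "c \<in> atlas M" "p \<in> U" "x = \<phi> p" by blast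
  then show "contraction X (mform_of_dform M \<beta>) c x v = 0 c x v"
  proof cases
    case 1
    then show ?thesis using mformsD(1)[OF \<omega>] by (simp add: contraction_def)
  next
    case 2
    then show ?thesis using forms_zero[OF mformsD(2)[OF \<omega>]] by (simp add: contraction_def c)
  next
    case 3
    then have a: "(U, \<phi>) \<in> atlas M" by (simp add: c)
    then have "p \<in> pts M" using chart_subset 3 by blast
    then obtain S K J c' e where d: "(S, K, J, c', e) \<in> CC" "p \<in> S" using cover by blast
    show ?thesis
      using contraction_zero_at[OF fc[OF d(1)] b slide_invariantD[OF i d(1)] X a 3(2) d(2)] by (simp add: c 3(3))
  qed
qed

text \<open>By \<open>lie_deriv_contraction_zero\<close>, basic means that tangent fields contract
  both the form and its derivative to 0. In foliated charts this pair of conditions is slide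
  invariance, which passes to the derivative by \<open>slide_invariant_d\<close>.\<close>

theorem basic_iff_slide_invariant:
  assumes b: "\<beta> \<in> dforms MD k"
  shows "mform_of_dform M \<beta> \<in> basic_forms M F k \<longleftrightarrow> slide_invariant \<beta>"
proof
  let ?\<omega> = "mform_of_dform M \<beta>"
  have b': "dform_d \<beta> \<in> dforms MD (Suc k)"
    by (rule dform_d_dforms[OF diffeology_params[OF diffeology_MD] b])
  note \<omega> = mform_of_dform_mforms[OF b]
  have lie: "lie_deriv M X ?\<omega> = contraction X (mform_of_dform M (dform_d \<beta>))"
    if "X \<in> tangent_fields M F" "contraction X ?\<omega> = 0" for X
    using lie_deriv_contraction_zero[OF \<omega> _ that(2)] that(1) by (simp add: mform_d_of_dform tangent_fields_def)
  {
    assume i: "slide_invariant \<beta>"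
    have "contraction X ?\<omega> = 0 \<and> lie_deriv M X ?\<omega> = 0" if X: "X \<in> tangent_fields M F" for X
      using lie[OF X] slide_invariant_contraction[OF b i X] slide_invariant_contraction[OF b' slide_invariant_d[OF b i] X]
      by simp
    then show "?\<omega> \<in> basic_forms M F k" using \<omega> by (simp add: basic_forms_def)
  next
    assume ba: "?\<omega> \<in> basic_forms M F k"
    have 1: "contraction X ?\<omega> = 0" if "X \<in> tangent_fields M F" for X using ba that by (simp add: basic_forms_def)
    have 2: "contraction X (mform_of_dform M (dform_d \<beta>)) = 0" if X: "X \<in> tangent_fields M F" for X
      using ba X lie[OF X 1[OF X]] by (simp add: basic_forms_def)
    show "slide_invariant \<beta>"
      unfolding slide_invariant_def
    proof (intro allI impI)
      fix S K J c e z assume c: "(S, K, J, c, e) \<in> CC" "z \<in> cube m c e"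
      note f = fc[OF c(1)]
      show "form_pullback m (cube m c e) (slide z) (\<beta> (m, cube m c e, restrict J (cube m c e))) =
        \<beta> (m, cube m c e, restrict J (cube m c e))"
      proof (rule vertical_contraction_converse[OF dforms_in[OF b fol_chartD(9)[OF f]] c(2)])
        fix y u w assume y: "y \<in> cube m c e" "u \<in> Rn m" "\<And>j. j < q \<Longrightarrow> u j = 0"
        show "\<beta> (m, cube m c e, restrict J (cube m c e)) y (u # w) = 0"
          by (rule contraction_zero_vertical[OF f b 1 y])
        show "ext_deriv m (cube m c e) (\<beta> (m, cube m c e, restrict J (cube m c e))) y (u # w) = 0"
          using contraction_zero_vertical[OF f b' 2 y] by (simp add: dform_d_def)
      qed
    qed
  }
qed

end

section \<open>The leaf space\<close>

text \<open>Lets the basic forms inherit the structure of a complex along the bijection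
  \<open>f\<close>, so that no direct check is made that the exterior derivative preserves
  them.\<close>

lemma cochain_iso_transport:
  assumes C: "cochain_complex C d"
    and bij: "\<And>k. bij_betw f (C k) (C' k)" and lin: "\<And>k. family_linear (C k) f"
    and d: "\<And>k a. a \<in> C k \<Longrightarrow> f (d a) = d' (f a)"
  shows "cochain_iso C d C' d' f"
proof -
  note CD = cochain_complexD[OF C]
  have im: "f ` C k = C' k" for k using bij[of k] by (simp add: bij_betw_def)
  have add: "f (a + b) = f a + f b" and scale: "f (fscale r a) = fscale r (f a)" if "a \<in> C k" "b \<in> C k" for a b r k
    using lin[of k] that by (simp_all add: family_linear_def)
  have dadd: "d (a + b) = d a + d b" and dscale: "d (fscale r a) = fscale r (d a)" if "a \<in> C k" "b \<in> C k" for a b r k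
    using CD(2)[of k] that by (simp_all add: family_linear_def)
  have f0: "f 0 = 0" using family_linear_zero[OF lin CD(1)] .
  have Cadd: "a + b \<in> C k" and Cscale: "fscale r a \<in> C k" and C0: "0 \<in> C k" if "a \<in> C k" "b \<in> C k" for a b r k
    using CD(1)[of k] that by (simp_all add: family_subspace_def)
  have "cochain_complex C' d'"
    unfolding cochain_complex_def
  proof (intro allI conjI)
    fix k
    have "0 \<in> f ` C k" using f0 CD(1)[of k] by (metis family_subspace_def imageI)
    then show "family_subspace (C' k)"
      unfolding family_subspace_def im[symmetric]
      by (auto simp: add[symmetric] scale[symmetric] Cadd Cscale)
    show "family_linear (C' k) d'"
      unfolding family_linear_def im[symmetric]
    proof (intro conjI allI ballI; elim imageE; hypsubst)
      fix a b assume a: "a \<in> C k" and b: "b \<in> C k"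
      have "d' (f a + f b) = f (d (a + b))" unfolding add[OF a b, symmetric] by (rule d[OF Cadd[OF a b], symmetric])
      also have "\<dots> = d' (f a) + d' (f b)"
        unfolding dadd[OF a b] add[OF CD(3)[OF a] CD(3)[OF b]] d[OF a] d[OF b] ..
      finally show "d' (f a + f b) = d' (f a) + d' (f b)" .
    next
      fix r a assume a: "a \<in> C k"
      have "d' (fscale r (f a)) = f (d (fscale r a))" unfolding scale[OF a a, symmetric] by (rule d[OF Cscale[OF a a], symmetric])
      also have "\<dots> = fscale r (d' (f a))"
        unfolding dscale[OF a a] scale[OF CD(3)[OF a] CD(3)[OF a]] d[OF a] ..
      finally show "d' (fscale r (f a)) = fscale r (d' (f a))" .
    qed
    show "d' ` C' k \<subseteq> C' (Suc k)"
      unfolding im[symmetric] using d CD(3) by (auto simp: d[symmetric])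
    show "\<forall>a\<in>C' k. d' (d' a) = 0"
      unfolding im[symmetric]
    proof (intro ballI; elim imageE; hypsubst)
      fix a assume a: "a \<in> C k"
      have "d' (d' (f a)) = f (d (d a))" unfolding d[OF a, symmetric] d[OF CD(3)[OF a], symmetric] ..
      then show "d' (d' (f a)) = 0" by (simp add: CD(4)[OF a] f0)
    qed
  qed
  then show ?thesis using C bij lin d by (simp add: cochain_iso_def)
qed

context foliated
begin

text \<open>Second countability enters through the Lindelof property: countably many domains of
  foliated charts cover \<open>M\<close>, and a countable set of charts has these domains.\<close>

lemma countable_foliated_cover:
  assumes "second_countable (mtop M)"
  obtains CC where "countable CC" "foliated_cover M q F CC"
proof -
  define A where "A = {(S, K, J, c, e). fol_chart S K J c e}"
  have "\<forall>T\<in>fst ` A. openin (mtop M) T" using fol_chartD(1) by (auto simp: A_def)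
  moreover have U: "\<Union>(fst ` A) = topspace (mtop M)"
  proof
    show "\<Union>(fst ` A) \<subseteq> pts M" using fol_chart_pts by (force simp: A_def)
    show "pts M \<subseteq> \<Union>(fst ` A)"
    proof
      fix p assume "p \<in> pts M"
      then obtain S K J c e where s: "fol_chart S K J c e" "p \<in> S" by (rule fol_chart_exists)
      then have "(S, K, J, c, e) \<in> A" by (simp add: A_def)
      from imageI[OF this, of fst] s(2) show "p \<in> \<Union>(fst ` A)" by auto
    qed
  qed
  ultimately obtain \<V> where V: "countable \<V>" "\<V> \<subseteq> fst ` A" "\<Union>\<V> = topspace (mtop M)"
    using second_countable_imp_Lindelof_space[OF assms] unfolding Lindelof_space_def by (metis (no_types, lifting))
  obtain CC where CC: "CC \<subseteq> A" "countable CC" "\<V> = fst ` CC"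
    using countable_subset_image[of \<V> fst A] V(1,2) by blast
  have "foliated_cover M q F CC"
  proof unfold_locales
    show "fol_chart S K J c e" if "(S, K, J, c, e) \<in> CC" for S K J c e using that CC(1) by (auto simp: A_def)
    show "\<exists>S K J c e. (S, K, J, c, e) \<in> CC \<and> p \<in> S" if p: "p \<in> pts M" for p
    proof -
      obtain T where T: "T \<in> \<V>" "p \<in> T" using p V(3) by blast
      then obtain x where x: "x \<in> CC" "T = fst x" using CC(3) by blast
      obtain S K J c e where "x = (S, K, J, c, e)" by (cases x)
      then have "(S, K, J, c, e) \<in> CC \<and> p \<in> S" using x T(2) by simp
      then show ?thesis by (intro exI)
    qed
  qed
  with CC(2) show ?thesis by (rule that)
qed

end

context foliated_cover
begin

sublocale leaf_space: diffeological_quotient "pts M" MD "leaves M F" "leaf_proj M F"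
  by unfold_locales (rule diffeology_MD, rule leaf_proj_surj)

lemma leavesE:
  assumes "L \<in> leaves M F"
  obtains x where "x \<in> pts M" "L = leaf_proj M F x"
  using assms unfolding leaf_proj_surj[symmetric] by (elim imageE)

text \<open>Forwards, the plot \<open>J\<close> of a chart and its slide have equal projections,
  since slides stay on plaques. The converse is \<open>slide_invariant_plots\<close>.\<close>

lemma descending_iff_slide_invariant:
  assumes "countable CC" and b: "\<beta> \<in> dforms MD k"
  shows "\<beta> \<in> leaf_space.descending k \<longleftrightarrow> slide_invariant \<beta>"
proof
  assume d: "\<beta> \<in> leaf_space.descending k"
  show "slide_invariant \<beta>"
    unfolding slide_invariant_def
  proof (intro allI impI)
    fix S K J c e z assume c: "(S, K, J, c, e) \<in> CC" and z: "z \<in> cube m c e"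
    note f = fc[OF c]
    let ?C = "cube m c e"
    let ?\<alpha> = "compose ?C (restrict J ?C) (slide z)"
    have P: "(m, ?C, ?\<alpha>) \<in> MD"
      by (rule diffeology_compose[OF diffeology_MD fol_chartD(9)[OF f] open_Rn_cube smooth_slide[OF z]])
    have eq: "\<forall>y\<in>?C. leaf_proj M F (?\<alpha> y) = leaf_proj M F (restrict J ?C y)"
    proof
      fix y assume y: "y \<in> ?C"
      have s: "slide z y \<in> ?C" by (rule slide_cube[OF z y])
      have "plaque_rel (J (slide z y)) (J y)"
        unfolding plaque_rel_def using c fol_chartD(7,8)[OF f y] fol_chartD(7,8)[OF f s] eqq_slide
        by (intro exI[of _ S] exI[of _ K] exI[of _ J] exI[of _ c] exI[of _ e]) simp
      then have "leaf_proj M F (J (slide z y)) = leaf_proj M F (J y)"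
        using leaf_proj_eq_iff[OF fol_chart_pts[OF f fol_chartD(7)[OF f s]] fol_chart_pts[OF f fol_chartD(7)[OF f y]]] by blast
      then show "leaf_proj M F (?\<alpha> y) = leaf_proj M F (restrict J ?C y)" using y s by (simp add: compose_def)
    qed
    have "\<beta> (m, ?C, ?\<alpha>) = \<beta> (m, ?C, restrict J ?C)"
      using d P fol_chartD(9)[OF f] eq unfolding leaf_space.descending_def by blast
    then show "form_pullback m ?C (slide z) (\<beta> (m, ?C, restrict J ?C)) = \<beta> (m, ?C, restrict J ?C)"
      unfolding dforms_natural[OF b fol_chartD(9)[OF f] open_Rn_cube smooth_slide[OF z]] .
  qed
next
  assume i: "slide_invariant \<beta>"
  have "\<beta> (n, V, \<alpha>) = \<beta> (n, V, \<alpha>')"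
    if P: "(n, V, \<alpha>) \<in> MD" "(n, V, \<alpha>') \<in> MD" and e: "\<forall>y\<in>V. leaf_proj M F (\<alpha> y) = leaf_proj M F (\<alpha>' y)" for n V \<alpha> \<alpha>'
  proof (rule slide_invariant_plots[OF assms(1) b i P])
    fix y assume y: "y \<in> V"
    show "plaque_rel\<^sup>*\<^sup>* (\<alpha> y) (\<alpha>' y)"
      using leaf_proj_eq_iff[OF plot_in[OF P(1) y] plot_in[OF P(2) y]] e y by blast
  qed
  then show "\<beta> \<in> leaf_space.descending k" using b unfolding leaf_space.descending_def by blast
qed

lemma leaf_pullback_eq: "leaf_pullback M F = mform_of_dform M \<circ> dform_pullback MD (leaf_proj M F)"
  by (simp add: leaf_pullback_def fun_eq_iff)

lemma bij_betw_leaf_pullback: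
  assumes "countable CC"
  shows "bij_betw (leaf_pullback M F) (dforms (leaf_diffeology M F) k) (basic_forms M F k)"
  unfolding leaf_pullback_eq leaf_diffeology_def
proof (rule bij_betw_trans[OF leaf_space.bij_betw_quotient_pullback])
  have sub: "leaf_space.descending k \<subseteq> dforms MD k" by (auto simp: leaf_space.descending_def)
  have "mform_of_dform M ` leaf_space.descending k = basic_forms M F k"
  proof (rule subset_antisym; rule subsetI)
    fix \<omega> assume "\<omega> \<in> mform_of_dform M ` leaf_space.descending k"
    then obtain \<beta> where b: "\<beta> \<in> leaf_space.descending k" "\<omega> = mform_of_dform M \<beta>" by blast
    have "\<beta> \<in> dforms MD k" using b(1) sub by blast
    then show "\<omega> \<in> basic_forms M F k"
      using b descending_iff_slide_invariant[OF assms] basic_iff_slide_invariant by simp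
  next
    fix \<omega> assume w: "\<omega> \<in> basic_forms M F k"
    then have "\<omega> \<in> mforms M k" by (simp add: basic_forms_def)
    then obtain \<beta> where b: "\<beta> \<in> dforms MD k" "\<omega> = mform_of_dform M \<beta>"
      using bij_betw_mform_of_dform[of k] by (auto simp: bij_betw_def)
    then have "\<beta> \<in> leaf_space.descending k"
      using w descending_iff_slide_invariant[OF assms b(1)] basic_iff_slide_invariant[OF b(1)] by simp
    with b(2) show "\<omega> \<in> mform_of_dform M ` leaf_space.descending k" by (rule image_eqI)
  qed
  then show "bij_betw (mform_of_dform M) (leaf_space.descending k) (basic_forms M F k)"
    using inj_on_subset[OF inj_on_mform_of_dform sub] by (simp add: bij_betw_def)
qed

lemma diffeology_leaf: "diffeology (leaves M F) (leaf_diffeology M F)"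
  using leaf_space.diffeology_quotient by (simp add: leaf_diffeology_def)

lemma cochain_iso_leaf_pullback:
  assumes "countable CC"
  shows "cochain_iso (dforms (leaf_diffeology M F)) dform_d (basic_forms M F) (mform_d M) (leaf_pullback M F)"
proof (rule cochain_iso_transport[OF _ bij_betw_leaf_pullback[OF assms]])
  show "cochain_complex (dforms (leaf_diffeology M F)) dform_d"
    by (rule dforms_cochain_complex[OF diffeology_params[OF diffeology_leaf]])
  show "family_linear (dforms (leaf_diffeology M F) k) (leaf_pullback M F)" for k
    using family_linear_dform_pullback[of "dforms (leaf_diffeology M F) k" MD "leaf_proj M F"]
      family_linear_mform_of_dform[of UNIV]
    by (simp add: leaf_pullback_def family_linear_def)
  show "leaf_pullback M F (dform_d a) = mform_d M (leaf_pullback M F a)" for a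
    by (simp add: leaf_pullback_def mform_d_of_dform dform_d_pullback)
qed

section \<open>Automorphisms acting on the leaf space\<close>

context
  fixes g assumes g: "foliation_automorphism M F g"
begin

lemma automorphism_dsmooth: "dsmooth (pts M) MD (pts M) MD g"
  using g msmooth_dsmooth[OF M M] by (simp add: foliation_automorphism_def mdiffeomorphism_def)

lemma automorphism_in: "x \<in> pts M \<Longrightarrow> g x \<in> pts M"
  using automorphism_dsmooth by (auto simp: dsmooth_def)

lemma leaf_proj_automorphism:
  assumes "x \<in> pts M"
  shows "leaf_proj M F (g x) = g ` leaf_proj M F x"
proof (rule leaf_proj_of_mem)
  have "leaf_proj M F x \<in> leaves M F" using leaf_proj_surj assms by blast
  then show "g ` leaf_proj M F x \<in> leaves M F" using g by (simp add: foliation_automorphism_def)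
  show "g x \<in> g ` leaf_proj M F x" using leaf_proj_in[OF assms] by (rule imageI)
qed

text \<open>The induced map takes direct images of leaves. Uniqueness uses that every leaf is the
  projection of a point and that \<open>descends_to\<close> makes the map extensional outside the
  leaves.\<close>

lemma descends_to_ex1: "\<exists>!r. descends_to M F g r"
proof (rule ex1I)
  show "descends_to M F g (restrict ((`) g) (leaves M F))"
    unfolding descends_to_def
  proof (intro conjI ballI)
    show "restrict ((`) g) (leaves M F) \<in> leaves M F \<rightarrow>\<^sub>E leaves M F"
      using g by (auto simp: foliation_automorphism_def)
    fix x assume x: "x \<in> pts M"
    then have "leaf_proj M F x \<in> leaves M F" using leaf_proj_surj by blast
    then show "leaf_proj M F (g x) = restrict ((`) g) (leaves M F) (leaf_proj M F x)"
      by (simp add: leaf_proj_automorphism[OF x])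
  qed
  fix r assume r: "descends_to M F g r"
  show "r = restrict ((`) g) (leaves M F)"
  proof
    fix L
    show "r L = restrict ((`) g) (leaves M F) L"
    proof (cases "L \<in> leaves M F")
      case True
      then obtain x where x: "x \<in> pts M" "L = leaf_proj M F x" by (rule leavesE)
      then show ?thesis using r leaf_proj_automorphism[OF x(1)] True by (simp add: descends_to_def)
    next
      case False
      have "r \<in> extensional (leaves M F)" using r by (simp add: descends_to_def PiE_iff)
      then show ?thesis using False by (simp add: extensional_def)
    qed
  qed
qed

lemma descends_to_leaf_map: "descends_to M F g (leaf_map M F g)"
  unfolding leaf_map_def by (rule theI'[OF descends_to_ex1])

lemma leaf_map_funcset: "leaf_map M F g \<in> leaves M F \<rightarrow> leaves M F"
  and leaf_map_proj: "x \<in> pts M \<Longrightarrow> leaf_map M F g (leaf_proj M F x) = leaf_proj M F (g x)"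
  using descends_to_leaf_map by (simp_all add: descends_to_def PiE_iff Pi_iff)

lemma dsmooth_leaf_map:
  "dsmooth (leaves M F) (leaf_diffeology M F) (leaves M F) (leaf_diffeology M F) (leaf_map M F g)"
  unfolding leaf_diffeology_def
  by (rule leaf_space.dsmooth_induced[OF automorphism_dsmooth leaf_map_funcset leaf_map_proj[symmetric]])

lemma leaf_pullback_equivariant:
  assumes a: "\<alpha> \<in> dforms (leaf_diffeology M F) k"
  shows "mform_pullback M M g (leaf_pullback M F \<alpha>) =
    leaf_pullback M F (dform_pullback (leaf_diffeology M F) (leaf_map M F g) \<alpha>)"
proof -
  have ps: "dsmooth (pts M) MD (leaves M F) (leaf_diffeology M F) (leaf_proj M F)"
    using leaf_space.dsmooth_quotient by (simp add: leaf_diffeology_def)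
  have ms: "msmooth M M g" using g by (simp add: foliation_automorphism_def mdiffeomorphism_def)
  have "dform_pullback MD g (dform_pullback MD (leaf_proj M F) \<alpha>) (n, U, \<sigma>) =
      dform_pullback MD (leaf_proj M F) (dform_pullback (leaf_diffeology M F) (leaf_map M F g) \<alpha>) (n, U, \<sigma>)" for n U \<sigma>
  proof (cases "(n, U, \<sigma>) \<in> MD")
    case True
    have 1: "(n, U, compose U g \<sigma>) \<in> MD" using automorphism_dsmooth True by (auto simp: dsmooth_def)
    have 2: "(n, U, compose U (leaf_proj M F) \<sigma>) \<in> leaf_diffeology M F" using ps True by (auto simp: dsmooth_def)
    have "compose U (leaf_proj M F) (compose U g \<sigma>) = compose U (leaf_map M F g) (compose U (leaf_proj M F) \<sigma>)"
      using leaf_map_proj[OF plot_in[OF True]] by (auto simp: compose_def restrict_def fun_eq_iff)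
    then show ?thesis by (simp add: dform_pullback_apply[OF True] dform_pullback_apply[OF 1] dform_pullback_apply[OF 2])
  qed (simp add: dform_pullback_def)
  then have "dform_pullback MD g (dform_pullback MD (leaf_proj M F) \<alpha>) =
      dform_pullback MD (leaf_proj M F) (dform_pullback (leaf_diffeology M F) (leaf_map M F g) \<alpha>)"
    by (intro ext) (metis prod_cases3)
  then show ?thesis
    using mform_pullback_of_dform[OF ms dform_pullback_dforms[OF ps a]] by (simp add: leaf_pullback_def)
qed

lemma cochain_map_leaf_map:
  "cochain_map (dforms (leaf_diffeology M F)) dform_d (dforms (leaf_diffeology M F)) dform_d
    (dform_pullback (leaf_diffeology M F) (leaf_map M F g))"
  unfolding cochain_map_def
proof (intro conjI allI ballI)
  show "cochain_complex (dforms (leaf_diffeology M F)) dform_d"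
    by (rule dforms_cochain_complex[OF diffeology_params[OF diffeology_leaf]])
  then show "cochain_complex (dforms (leaf_diffeology M F)) dform_d" .
  show "dform_pullback (leaf_diffeology M F) (leaf_map M F g) ` dforms (leaf_diffeology M F) k \<subseteq> dforms (leaf_diffeology M F) k" for k
    by (rule image_subsetI) (rule dform_pullback_dforms[OF dsmooth_leaf_map])
qed (rule family_linear_dform_pullback dform_d_pullback[symmetric])+

end

text \<open>On leaves \<open>inv_into\<close> agrees with the map induced by \<open>g'\<close>, so
  it too is covered by a smooth map of \<open>M\<close> and \<open>dsmooth_induced\<close>
  applies.\<close>

lemma ddiffeomorphism_leaf_map:
  assumes g: "foliation_automorphism M F g" "foliation_automorphism M F g'"
    and inv: "\<And>x. x \<in> pts M \<Longrightarrow> g' (g x) = x" "\<And>x. x \<in> pts M \<Longrightarrow> g (g' x) = x"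
  shows "ddiffeomorphism (leaves M F) (leaf_diffeology M F) (leaves M F) (leaf_diffeology M F) (leaf_map M F g)"
proof -
  let ?r = "leaf_map M F g" and ?r' = "leaf_map M F g'"
  have l: "?r' (?r L) = L" "?r (?r' L) = L" if L: "L \<in> leaves M F" for L
  proof -
    obtain x where x: "x \<in> pts M" "L = leaf_proj M F x" using L by (rule leavesE)
    show "?r' (?r L) = L"
      unfolding x(2) leaf_map_proj[OF g(1) x(1)] leaf_map_proj[OF g(2) automorphism_in[OF g(1) x(1)]] inv(1)[OF x(1)] ..
    show "?r (?r' L) = L"
      unfolding x(2) leaf_map_proj[OF g(2) x(1)] leaf_map_proj[OF g(1) automorphism_in[OF g(2) x(1)]] inv(2)[OF x(1)] ..
  qed
  have bij: "bij_betw ?r (leaves M F) (leaves M F)"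
    by (rule bij_betwI[OF leaf_map_funcset[OF g(1)] leaf_map_funcset[OF g(2)]]) (simp_all add: l)
  have ii: "inv_into (leaves M F) ?r L = ?r' L" if L: "L \<in> leaves M F" for L
    by (rule inv_into_f_eq[OF bij_betw_imp_inj_on[OF bij] funcset_mem[OF leaf_map_funcset[OF g(2)] L] l(2)[OF L]])
  have "dsmooth (leaves M F) (leaf_diffeology M F) (leaves M F) (leaf_diffeology M F) (inv_into (leaves M F) ?r)"
    unfolding leaf_diffeology_def
  proof (rule leaf_space.dsmooth_induced[OF automorphism_dsmooth[OF g(2)]])
    show "inv_into (leaves M F) ?r \<in> leaves M F \<rightarrow> leaves M F"
      using ii leaf_map_funcset[OF g(2)] by (simp add: Pi_iff)
    fix x assume x: "x \<in> pts M"
    then have "leaf_proj M F x \<in> leaves M F" using leaf_proj_surj by blast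
    from ii[OF this] show "leaf_proj M F (g' x) = inv_into (leaves M F) ?r (leaf_proj M F x)"
      unfolding leaf_map_proj[OF g(2) x] by (rule sym)
  qed
  with bij dsmooth_leaf_map[OF g(1)] show ?thesis by (simp add: ddiffeomorphism_def)
qed

lemma right_action_leaf_map:
  fixes H (structure)
  assumes H: "group H" and R: "right_action H (pts M) R" and aut: "\<forall>h\<in>carrier H. foliation_automorphism M F (R h)"
  shows "right_action H (leaves M F) (\<lambda>h. leaf_map M F (R h))"
    and "h \<in> carrier H \<Longrightarrow>
      ddiffeomorphism (leaves M F) (leaf_diffeology M F) (leaves M F) (leaf_diffeology M F) (leaf_map M F (R h))"
proof -
  interpret group H by (rule H)
  note a = bspec[OF aut]
  have R1: "R \<one> x = x" if "x \<in> pts M" for x using R that by (simp add: right_action_def)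
  have Rm: "R (g \<otimes> h) x = R h (R g x)" if "g \<in> carrier H" "h \<in> carrier H" "x \<in> pts M" for g h x
    using R that by (simp add: right_action_def)
  show "right_action H (leaves M F) (\<lambda>h. leaf_map M F (R h))"
    unfolding right_action_def
  proof (intro conjI ballI)
    show "leaf_map M F (R h) \<in> leaves M F \<rightarrow> leaves M F" if "h \<in> carrier H" for h
      by (rule leaf_map_funcset[OF a[OF that]])
    show "leaf_map M F (R \<one>) L = L" if L: "L \<in> leaves M F" for L
    proof -
      obtain x where x: "x \<in> pts M" "L = leaf_proj M F x" using L by (rule leavesE)
      show ?thesis unfolding x(2) leaf_map_proj[OF a[OF one_closed] x(1)] R1[OF x(1)] ..
    qed
    show "leaf_map M F (R (g \<otimes> h)) L = leaf_map M F (R h) (leaf_map M F (R g) L)"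
      if g: "g \<in> carrier H" and h: "h \<in> carrier H" and "L \<in> leaves M F" for g h L
    proof -
      obtain x where x: "x \<in> pts M" "L = leaf_proj M F x" using \<open>L \<in> leaves M F\<close> by (rule leavesE)
      show ?thesis
        unfolding x(2) leaf_map_proj[OF a[OF m_closed[OF g h]] x(1)] leaf_map_proj[OF a[OF g] x(1)]
          leaf_map_proj[OF a[OF h] automorphism_in[OF a[OF g] x(1)]] Rm[OF g h x(1)] ..
    qed
  qed
  assume h: "h \<in> carrier H"
  show "ddiffeomorphism (leaves M F) (leaf_diffeology M F) (leaves M F) (leaf_diffeology M F) (leaf_map M F (R h))"
  proof (rule ddiffeomorphism_leaf_map[OF a[OF h] a[OF inv_closed[OF h]]])
    fix x assume x: "x \<in> pts M"
    show "R (inv h) (R h x) = x" using Rm[OF h inv_closed[OF h] x] R1[OF x] r_inv[OF h] by simp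
    show "R h (R (inv h) x) = x" using Rm[OF inv_closed[OF h] h x] R1[OF x] l_inv[OF h] by simp
  qed
qed

end

theorem theorem2p13:
  fixes M :: "'a mfd"
    and q :: nat
    and F :: "('a set \<times> ('a \<Rightarrow> nat \<Rightarrow> real)) set"
    and H :: "('h, 'b) monoid_scheme"
    and R :: "'h \<Rightarrow> 'a \<Rightarrow> 'a"
  assumes "smooth_manifold M"
    and "second_countable (mtop M)"
    and "foliation M q F"
    and "group H"
    and "right_action H (pts M) R"
    and "\<forall>h\<in>carrier H. foliation_automorphism M F (R h)"
  shows
    "\<comment> \<open>(1)\<close>
     (\<forall>h\<in>carrier H. \<exists>!r. descends_to M F (R h) r) \<and>
     right_action H (leaves M F) (\<lambda>h. leaf_map M F (R h)) \<and>
     (\<forall>h\<in>carrier H. ddiffeomorphism (leaves M F) (leaf_diffeology M F)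
                       (leaves M F) (leaf_diffeology M F) (leaf_map M F (R h))) \<and>
     \<comment> \<open>(2)\<close>
     cochain_iso (dforms (leaf_diffeology M F)) dform_d (basic_forms M F) (mform_d M)
       (leaf_pullback M F) \<and>
     (\<forall>h\<in>carrier H. \<forall>k. \<forall>\<alpha>\<in>dforms (leaf_diffeology M F) k.
        mform_pullback M M (R h) (leaf_pullback M F \<alpha>) =
        leaf_pullback M F (dform_pullback (leaf_diffeology M F) (leaf_map M F (R h)) \<alpha>)) \<and>
     \<comment> \<open>(3)\<close>
     (\<forall>k. cohomology_iso (dforms (leaf_diffeology M F)) dform_d (basic_forms M F) (mform_d M) k
            (induced (basic_forms M F) (mform_d M) k (leaf_pullback M F)) \<and>
          (\<forall>h\<in>carrier H. \<forall>A\<in>cohomology (dforms (leaf_diffeology M F)) dform_d k.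
             induced (basic_forms M F) (mform_d M) k (mform_pullback M M (R h))
               (induced (basic_forms M F) (mform_d M) k (leaf_pullback M F) A) =
             induced (basic_forms M F) (mform_d M) k (leaf_pullback M F)
               (induced (dforms (leaf_diffeology M F)) dform_d k
                  (dform_pullback (leaf_diffeology M F) (leaf_map M F (R h))) A)))"
proof -
  have "foliation_cocycle M q F" using assms(3) by (simp add: foliation_def)
  with assms(1) interpret foliated M q F by unfold_locales
  \<comment> \<open>The cover is an auxiliary choice: none of the notions in the statement refers to
    it.\<close>
  obtain CC where CC: "countable CC" "foliated_cover M q F CC"
    by (rule countable_foliated_cover[OF assms(2)])
  interpret foliated_cover M q F CC by (rule CC(2))
  note a = bspec[OF assms(6)]
  note action = right_action_leaf_map[OF assms(4-6)]
  note iso = cochain_iso_leaf_pullback[OF CC(1)]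
  note equivariant = leaf_pullback_equivariant[OF a]
  have induced: "\<forall>k. cohomology_iso (dforms (leaf_diffeology M F)) dform_d (basic_forms M F) (mform_d M) k
        (induced (basic_forms M F) (mform_d M) k (leaf_pullback M F)) \<and>
      (\<forall>h\<in>carrier H. \<forall>A\<in>cohomology (dforms (leaf_diffeology M F)) dform_d k.
         induced (basic_forms M F) (mform_d M) k (mform_pullback M M (R h))
           (induced (basic_forms M F) (mform_d M) k (leaf_pullback M F) A) =
         induced (basic_forms M F) (mform_d M) k (leaf_pullback M F)
           (induced (dforms (leaf_diffeology M F)) dform_d k
              (dform_pullback (leaf_diffeology M F) (leaf_map M F (R h))) A))"
  proof (rule allI, rule conjI[OF cochain_iso_cohomology[OF iso]], rule ballI, rule ballI)
    fix k h A assume h: "h \<in> carrier H" and A: "A \<in> cohomology (dforms (leaf_diffeology M F)) dform_d k"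
    show "induced (basic_forms M F) (mform_d M) k (mform_pullback M M (R h))
        (induced (basic_forms M F) (mform_d M) k (leaf_pullback M F) A) =
      induced (basic_forms M F) (mform_d M) k (leaf_pullback M F)
        (induced (dforms (leaf_diffeology M F)) dform_d k
          (dform_pullback (leaf_diffeology M F) (leaf_map M F (R h))) A)"
    proof (rule cochain_iso_cohomology_equivariant[OF iso cochain_map_leaf_map[OF a[OF h]] _ A])
      fix \<alpha> assume "\<alpha> \<in> dforms (leaf_diffeology M F) k"
      then show "mform_pullback M M (R h) (leaf_pullback M F \<alpha>) =
          leaf_pullback M F (dform_pullback (leaf_diffeology M F) (leaf_map M F (R h)) \<alpha>)"
        by (rule equivariant[OF h])
    qed
  qed
  have descends: "\<forall>h\<in>carrier H. \<exists>!r. descends_to M F (R h) r"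
    by (rule ballI) (rule descends_to_ex1[OF a])
  have ddiffeo: "\<forall>h\<in>carrier H. ddiffeomorphism (leaves M F) (leaf_diffeology M F)
      (leaves M F) (leaf_diffeology M F) (leaf_map M F (R h))"
    by (rule ballI) (rule action(2))
  have pullback: "\<forall>h\<in>carrier H. \<forall>k. \<forall>\<alpha>\<in>dforms (leaf_diffeology M F) k.
      mform_pullback M M (R h) (leaf_pullback M F \<alpha>) =
      leaf_pullback M F (dform_pullback (leaf_diffeology M F) (leaf_map M F (R h)) \<alpha>)"
    by (rule ballI, rule allI, rule ballI) (rule equivariant)
  show ?thesis
    by (rule conjI[OF descends conjI[OF action(1) conjI[OF ddiffeo conjI[OF iso conjI[OF pullback induced]]]]])
qed

end
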